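(* Let $M$ be a smooth manifold of dimension $n>2$, let $a=a_{ij}\,\mathrm dx^i\mathrm dx^j$ be a (pseudo-)Riemannian metric on $M$, let $b=b_i\,\mathrm dx^i$ be a nowhere vanishing 1-form on $M$, and let $m$ be a real parameter. Put $\alpha=\sqrt{a_{ij}(x)y^iy^j}$ and $\beta=b_i(x)y^i$. Let $(M,F=\alpha^{1+m}\beta^{-m})$ be an $m$-Kropina space of Berwald type such that the 1-form is closed ($\mathrm db=0$) and null with respect to $a$ ($a_{ij}b^ib^j=0$). Let $\Gamma^k_{ij}(x)$ be the coefficients of its associated affine connection and let $\bar R_{ij}$ be its affine Ricci tensor. The following are equivalent: (i) The affine connection is locally metrizable by a (pseudo-)Riemannian metric. (ii) The affine Ricci tensor is symmetric, $\bar R_{ij}=\bar R_{ji}$. (iii) There exist (around each point of $M$) local coordinates $(u,v,x^3,\dots,x^n)$ such that $$a=-2\,\mathrm du\,\mathrm dv+\big[\tilde H(u,x)+\phi(u)\,v\big]\mathrm du^2+W_a(u,x)\,\mathrm du\,\mathrm dx^a+h_{ab}(u,x)\,\mathrm dx^a\mathrm dx^b,\qquad b=\mathrm du,$$ with $h$ some (pseudo-)Riemannian metric of dimension $n-2$. In this case the affine connection is metrizable, in the chart corresponding to the coordinates $(u,v,x^3,\dots,x^n)$, by the (pseudo-)Riemannian metric $$\tilde a=e^{\frac{m}{1-m}\int^u\phi(\tilde u)\,\mathrm d\tilde u}\,a.$$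
   Context: Indices $i,j,k,l,p$ run from $1$ to $n$; indices $a,b$ on $W_a$, $h_{ab}$, $x^a$ run from $3$ to $n$; repeated indices are summed; indices are raised and lowered with $a_{ij}$. In (iii), $x=(x^3,\dots,x^n)$, and $\tilde H,\phi,W_a,h_{ab}$ are functions of the indicated variables. Products of 1-forms are symmetrized tensor products: $\mathrm du\,\mathrm dv=\tfrac12(\mathrm du\otimes\mathrm dv+\mathrm dv\otimes\mathrm du)$, etc. $\int^u\phi(\tilde u)\,\mathrm d\tilde u$ denotes an antiderivative of $\phi$. Local coordinates $x^i$ on $M$ induce coordinates $(x^i,y^i)$ on $TM$; write $\partial_i=\partial/\partial x^i$, $\bar\partial_i=\partial/\partial y^i$. A conic subbundle is a non-empty open set $\mathcal A\subset TM\setminus\{0\}$ such that $(x,\lambda y)\in\mathcal A$ for all $(x,y)\in\mathcal A$ and $\lambda>0$. A Finsler space is a triple $(M,\mathcal A,F)$, where $M$ is a smooth manifold, $\mathcal A$ is a conic subbundle of $TM\setminus\{0\}$ with non-empty fibers, and $F:TM\setminus\{0\}\to\mathbb R$ is a continuous map, smooth on $\mathcal A$, such that $F(x,\lambda y)=\lambda F(x,y)$ for all $\lambda>0$ and such that the fundamental tensor $g_{ij}=\bar\partial_i\bar\partial_j(\tfrac12F^2)$ is non-degenerate on $\mathcal A$ (its signature may be arbitrary). An $m$-Kropina space is a Finsler space with Finsler metric of the form $F=\alpha^{1+m}\beta^{-m}$, with $\alpha,\beta,m$ as in the claim. For null $b$ the value $m=1$ is excluded by this definition, since the fundamental tensor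 is then degenerate. The Cartan non-linear connection has coefficients $N^i_j(x,y)=\tfrac14\bar\partial_j\big(g^{ik}(y^l\partial_l\bar\partial_kF^2-\partial_kF^2)\big)$. The Finsler space is of Berwald type if $N^i_j(x,y)=\Gamma^i_{jk}(x)y^k$ for a set of smooth functions $\Gamma^i_{jk}$ on $M$; these are then the coefficients of a torsion-free affine connection on $M$, called the (associated) affine connection. The affine curvature tensor and affine Ricci tensor are $$\bar R_l{}^i{}_{jk}=\partial_j\Gamma^i_{kl}-\partial_k\Gamma^i_{jl}+\Gamma^i_{pj}\Gamma^p_{kl}-\Gamma^i_{pk}\Gamma^p_{jl},\qquad \bar R_{lk}=\bar R_l{}^i{}_{ik}.$$ The affine connection is metrizable by a (pseudo-)Riemannian metric if it is the Levi-Civita connection of that metric; it is locally metrizable if this holds for some (pseudo-)Riemannian metric in a neighborhood of each point.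
   Formalization: The parameter m is assumed nonzero. For m = 0, F = α does not involve b and the claim fails: on flat R^{2,1} minus the axis r = 0 with b = d(t − r), (i) and (ii) hold but (iii) does not, since ∇b is not a multiple of b⊗b. *)

theory Defs
  imports "HOL-Analysis.Analysis"
begin

subsection \<open>Smooth functions and smooth manifolds\<close>

definition dird :: "'a::real_normed_vector \<Rightarrow> ('a \<Rightarrow> 'b::real_normed_vector) \<Rightarrow> 'a \<Rightarrow> 'b" where
  "dird v f = (\<lambda>x. frechet_derivative f (at x) v)"

text \<open>Meant for open \<open>S\<close> in a finite-dimensional space: all iterated directional derivatives
  exist and are Frechet differentiable (hence continuous), i.e. \<open>f\<close> is of class C-infinity.\<close>

definition smooth_on :: "'a::real_normed_vector set \<Rightarrow> ('a \<Rightarrow> 'b::real_normed_vector) \<Rightarrow> bool" where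
  "smooth_on S f \<longleftrightarrow> (\<forall>vs. \<forall>x\<in>S. foldr dird vs f differentiable (at x))"

text \<open>A chart is a domain together with a coordinate map; the values of the map outside the
  domain are irrelevant.\<close>

type_synonym ('p, 'n) chart = "'p set \<times> ('p \<Rightarrow> real ^ 'n)"

abbreviation cdom :: "('p, 'n) chart \<Rightarrow> 'p set" where
  "cdom c \<equiv> fst c"

abbreviation coord :: "('p, 'n) chart \<Rightarrow> 'p \<Rightarrow> real ^ 'n" where
  "coord c \<equiv> snd c"

abbreviation crange :: "('p, 'n) chart \<Rightarrow> (real ^ 'n) set" where
  "crange c \<equiv> coord c ` cdom c"

definition cinv :: "('p, 'n) chart \<Rightarrow> real ^ 'n \<Rightarrow> 'p" where
  "cinv c = inv_into (cdom c) (coord c)"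

definition transition :: "('p, 'n) chart \<Rightarrow> ('p, 'n) chart \<Rightarrow> real ^ 'n \<Rightarrow> real ^ 'n" where
  "transition c c' = coord c' \<circ> cinv c"

definition is_chart :: "'p topology \<Rightarrow> ('p, 'n::finite) chart \<Rightarrow> bool" where
  "is_chart X c \<longleftrightarrow> openin X (cdom c) \<and> open (crange c) \<and>
     homeomorphic_map (subtopology X (cdom c)) (top_of_set (crange c)) (coord c)"

definition compatible :: "('p, 'n::finite) chart \<Rightarrow> ('p, 'n) chart \<Rightarrow> bool" where
  "compatible c c' \<longleftrightarrow>
     smooth_on (coord c ` (cdom c \<inter> cdom c')) (transition c c') \<and>
     smooth_on (coord c' ` (cdom c \<inter> cdom c')) (transition c' c)"

text \<open>\<open>\<A>\<close> is a maximal atlas, so its members are all the local coordinate systems.\<close>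

definition smooth_manifold :: "'p topology \<Rightarrow> ('p, 'n::finite) chart set \<Rightarrow> bool" where
  "smooth_manifold X \<A> \<longleftrightarrow>
     Hausdorff_space X \<and> second_countable X \<and>
     (\<forall>c\<in>\<A>. is_chart X c) \<and> (\<Union>c\<in>\<A>. cdom c) = topspace X \<and>
     (\<forall>c\<in>\<A>. \<forall>c'\<in>\<A>. compatible c c') \<and>
     (\<forall>c. is_chart X c \<and> (\<forall>c'\<in>\<A>. compatible c c') \<longrightarrow> c \<in> \<A>)"


subsection \<open>The tangent bundle\<close>

text \<open>A tangent vector at \<open>p\<close> assigns to every chart around \<open>p\<close> a component vector, subject to the
  usual transformation law. It is 0 on all other arguments, so that equality of tangent vectors is
  equality of functions. The vector operations are pointwise.\<close>

type_synonym ('p, 'n) tvec = "('p, 'n) chart \<Rightarrow> real ^ 'n"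

definition tangent_space :: "('p, 'n::finite) chart set \<Rightarrow> 'p \<Rightarrow> ('p, 'n) tvec set" where
  "tangent_space \<A> p =
     {w. (\<forall>c\<in>\<A>. \<forall>c'\<in>\<A>. p \<in> cdom c \<and> p \<in> cdom c' \<longrightarrow>
            w c' = frechet_derivative (transition c c') (at (coord c p)) (w c)) \<and>
         (\<forall>c. \<not> (c \<in> \<A> \<and> p \<in> cdom c) \<longrightarrow> w c = 0)}"

definition slit_tangent_bundle ::
    "'p topology \<Rightarrow> ('p, 'n::finite) chart set \<Rightarrow> ('p \<times> ('p, 'n) tvec) set" where
  "slit_tangent_bundle X \<A> = {(p, w). p \<in> topspace X \<and> w \<in> tangent_space \<A> p \<and> w \<noteq> (\<lambda>_. 0)}"

text \<open>The tangent vector at \<open>p\<close> with components \<open>y\<close> in the chart \<open>c\<close>.\<close>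

definition tvec_of :: "('p, 'n::finite) chart set \<Rightarrow> ('p, 'n) chart \<Rightarrow> 'p \<Rightarrow> real ^ 'n \<Rightarrow> ('p, 'n) tvec" where
  "tvec_of \<A> c p y = (\<lambda>c'. if c' \<in> \<A> \<and> p \<in> cdom c'
       then frechet_derivative (transition c c') (at (coord c p)) y else 0)"

text \<open>The point of the tangent bundle with induced coordinates \<open>(x, y)\<close>.\<close>

definition tpoint :: "('p, 'n::finite) chart set \<Rightarrow> ('p, 'n) chart \<Rightarrow>
    (real ^ 'n) \<times> (real ^ 'n) \<Rightarrow> 'p \<times> ('p, 'n) tvec" where
  "tpoint \<A> c = (\<lambda>(x, y). (cinv c x, tvec_of \<A> c (cinv c x) y))"

definition tset_in :: "('p, 'n::finite) chart set \<Rightarrow> ('p \<times> ('p, 'n) tvec) set \<Rightarrow> ('p, 'n) chart \<Rightarrow>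
    ((real ^ 'n) \<times> (real ^ 'n)) set" where
  "tset_in \<A> K c = {(x, y). x \<in> crange c \<and> tpoint \<A> c (x, y) \<in> K}"

definition conic_subbundle ::
    "'p topology \<Rightarrow> ('p, 'n::finite) chart set \<Rightarrow> ('p \<times> ('p, 'n) tvec) set \<Rightarrow> bool" where
  "conic_subbundle X \<A> K \<longleftrightarrow>
     K \<noteq> {} \<and> K \<subseteq> slit_tangent_bundle X \<A> \<and> (\<forall>c\<in>\<A>. open (tset_in \<A> K c)) \<and>
     (\<forall>p w. \<forall>s>0. (p, w) \<in> K \<longrightarrow> (p, \<lambda>c. s *\<^sub>R w c) \<in> K)"


subsection \<open>Metrics and 1-forms\<close>

definition partial :: "'n \<Rightarrow> (real ^ 'n::finite \<Rightarrow> real) \<Rightarrow> real ^ 'n \<Rightarrow> real" where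
  "partial i f = dird (axis i 1) f"

type_synonym ('p, 'n) metric = "'p \<Rightarrow> ('p, 'n) tvec \<Rightarrow> ('p, 'n) tvec \<Rightarrow> real"
type_synonym ('p, 'n) form = "'p \<Rightarrow> ('p, 'n) tvec \<Rightarrow> real"

definition metric_comp :: "('p, 'n::finite) chart set \<Rightarrow> ('p, 'n) metric \<Rightarrow> ('p, 'n) chart \<Rightarrow>
    real ^ 'n \<Rightarrow> real ^ 'n ^ 'n" where
  "metric_comp \<A> g c x = (\<chi> i j. g (cinv c x)
      (tvec_of \<A> c (cinv c x) (axis i 1)) (tvec_of \<A> c (cinv c x) (axis j 1)))"

definition form_comp :: "('p, 'n::finite) chart set \<Rightarrow> ('p, 'n) form \<Rightarrow> ('p, 'n) chart \<Rightarrow>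
    real ^ 'n \<Rightarrow> real ^ 'n" where
  "form_comp \<A> b c x = (\<chi> i. b (cinv c x) (tvec_of \<A> c (cinv c x) (axis i 1)))"

text \<open>Meant for open \<open>U\<close>; the signature is arbitrary.\<close>

definition pseudo_riemannian_on :: "('p, 'n::finite) chart set \<Rightarrow> 'p set \<Rightarrow> ('p, 'n) metric \<Rightarrow> bool" where
  "pseudo_riemannian_on \<A> U g \<longleftrightarrow>
     (\<forall>p\<in>U. \<forall>w1\<in>tangent_space \<A> p. \<forall>w2\<in>tangent_space \<A> p.
        g p w1 w2 = g p w2 w1 \<and>
        (\<forall>w3\<in>tangent_space \<A> p. \<forall>r s. g p (\<lambda>c. r *\<^sub>R w1 c + s *\<^sub>R w2 c) w3 = r * g p w1 w3 + s * g p w2 w3)) \<and>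
     (\<forall>p\<in>U. \<forall>w1\<in>tangent_space \<A> p. (\<forall>w2\<in>tangent_space \<A> p. g p w1 w2 = 0) \<longrightarrow> w1 = (\<lambda>_. 0)) \<and>
     (\<forall>c\<in>\<A>. \<forall>i j. smooth_on (coord c ` (cdom c \<inter> U)) (\<lambda>x. metric_comp \<A> g c x $ i $ j))"

definition one_form :: "'p topology \<Rightarrow> ('p, 'n::finite) chart set \<Rightarrow> ('p, 'n) form \<Rightarrow> bool" where
  "one_form X \<A> b \<longleftrightarrow>
     (\<forall>p\<in>topspace X. \<forall>w1\<in>tangent_space \<A> p. \<forall>w2\<in>tangent_space \<A> p. \<forall>r s.
        b p (\<lambda>c. r *\<^sub>R w1 c + s *\<^sub>R w2 c) = r * b p w1 + s * b p w2) \<and>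
     (\<forall>c\<in>\<A>. \<forall>i. smooth_on (crange c) (\<lambda>x. form_comp \<A> b c x $ i))"

definition nowhere_vanishing :: "'p topology \<Rightarrow> ('p, 'n::finite) chart set \<Rightarrow> ('p, 'n) form \<Rightarrow> bool" where
  "nowhere_vanishing X \<A> b \<longleftrightarrow> (\<forall>p\<in>topspace X. \<exists>w\<in>tangent_space \<A> p. b p w \<noteq> 0)"

definition closed_form :: "('p, 'n::finite) chart set \<Rightarrow> ('p, 'n) form \<Rightarrow> bool" where
  "closed_form \<A> b \<longleftrightarrow> (\<forall>c\<in>\<A>. \<forall>x\<in>crange c. \<forall>i j.
     partial i (\<lambda>z. form_comp \<A> b c z $ j) x = partial j (\<lambda>z. form_comp \<A> b c z $ i) x)"

definition null_form :: "('p, 'n::finite) chart set \<Rightarrow> ('p, 'n) metric \<Rightarrow> ('p, 'n) form \<Rightarrow> bool" where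
  "null_form \<A> a b \<longleftrightarrow> (\<forall>c\<in>\<A>. \<forall>x\<in>crange c.
     let b' = matrix_inv (metric_comp \<A> a c x) *v form_comp \<A> b c x
     in (\<Sum>i\<in>UNIV. \<Sum>j\<in>UNIV. metric_comp \<A> a c x $ i $ j * b' $ i * b' $ j) = 0)"


subsection \<open>Finsler spaces\<close>

text \<open>Derivatives with respect to the induced coordinates \<open>(x, y)\<close> of the tangent bundle.\<close>

definition partial_x :: "'n \<Rightarrow> ((real ^ 'n::finite) \<times> (real ^ 'n) \<Rightarrow> real) \<Rightarrow> (real ^ 'n) \<times> (real ^ 'n) \<Rightarrow> real" where
  "partial_x i f = dird (axis i 1, 0) f"

definition partial_y :: "'n \<Rightarrow> ((real ^ 'n::finite) \<times> (real ^ 'n) \<Rightarrow> real) \<Rightarrow> (real ^ 'n) \<times> (real ^ 'n) \<Rightarrow> real" where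
  "partial_y i f = dird (0, axis i 1) f"

text \<open>In the following three definitions, \<open>f\<close> is the coordinate expression of \<open>F\<close>.\<close>

definition fundamental_tensor :: "((real ^ 'n::finite) \<times> (real ^ 'n) \<Rightarrow> real) \<Rightarrow>
    (real ^ 'n) \<times> (real ^ 'n) \<Rightarrow> real ^ 'n ^ 'n" where
  "fundamental_tensor f z = (\<chi> i j. partial_y i (partial_y j (\<lambda>z. 1/2 * (f z)\<^sup>2)) z)"

definition spray :: "((real ^ 'n::finite) \<times> (real ^ 'n) \<Rightarrow> real) \<Rightarrow> 'n \<Rightarrow>
    (real ^ 'n) \<times> (real ^ 'n) \<Rightarrow> real" where
  "spray f i z = (\<Sum>k\<in>UNIV. matrix_inv (fundamental_tensor f z) $ i $ k *
      ((\<Sum>l\<in>UNIV. snd z $ l * partial_x l (partial_y k (\<lambda>z. (f z)\<^sup>2)) z) - partial_x k (\<lambda>z. (f z)\<^sup>2) z))"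

definition cartan_N :: "((real ^ 'n::finite) \<times> (real ^ 'n) \<Rightarrow> real) \<Rightarrow> 'n \<Rightarrow> 'n \<Rightarrow>
    (real ^ 'n) \<times> (real ^ 'n) \<Rightarrow> real" where
  "cartan_N f i j z = 1/4 * partial_y j (spray f i) z"

definition finsler_space :: "'p topology \<Rightarrow> ('p, 'n::finite) chart set \<Rightarrow> ('p \<times> ('p, 'n) tvec) set \<Rightarrow>
    ('p \<times> ('p, 'n) tvec \<Rightarrow> real) \<Rightarrow> bool" where
  "finsler_space X \<A> K F \<longleftrightarrow>
     smooth_manifold X \<A> \<and>
     conic_subbundle X \<A> K \<and> (\<forall>p\<in>topspace X. \<exists>w. (p, w) \<in> K) \<and>
     (\<forall>c\<in>\<A>. continuous_on (crange c \<times> (UNIV - {0})) (F \<circ> tpoint \<A> c)) \<and>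
     (\<forall>c\<in>\<A>. smooth_on (tset_in \<A> K c) (F \<circ> tpoint \<A> c)) \<and>
     (\<forall>(p, w)\<in>slit_tangent_bundle X \<A>. \<forall>s>0. F (p, \<lambda>c. s *\<^sub>R w c) = s * F (p, w)) \<and>
     (\<forall>c\<in>\<A>. \<forall>z\<in>tset_in \<A> K c. invertible (fundamental_tensor (F \<circ> tpoint \<A> c) z))"

text \<open>Real powers of a real base: for integer exponents the base may be negative (which
  \<open>powr\<close> does not support), and 0 is admitted as a base for exponents \<open>\<ge> 0\<close>.\<close>

definition rpow_defined :: "real \<Rightarrow> real \<Rightarrow> bool" where
  "rpow_defined x r \<longleftrightarrow> (x < 0 \<longrightarrow> r \<in> \<int>) \<and> (x = 0 \<longrightarrow> 0 \<le> r)"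

definition rpow :: "real \<Rightarrow> real \<Rightarrow> real" where
  "rpow x r = (if r \<in> \<int> then x powi \<lfloor>r\<rfloor> else x powr r)"

text \<open>The formula for \<open>F\<close> is required on the conic subbundle, where it has to be well defined.
  It cannot be imposed on the whole slit tangent bundle, on which \<open>F\<close> is real-valued and continuous.
  There \<open>\<beta>\<close> vanishes somewhere, so \<open>\<beta> powr (-m)\<close> blows up if \<open>m > 0\<close>, and \<open>a p w w\<close> may be negative.\<close>

definition kropina_space :: "'p topology \<Rightarrow> ('p, 'n::finite) chart set \<Rightarrow> ('p, 'n) metric \<Rightarrow> ('p, 'n) form \<Rightarrow>
    real \<Rightarrow> ('p \<times> ('p, 'n) tvec) set \<Rightarrow> ('p \<times> ('p, 'n) tvec \<Rightarrow> real) \<Rightarrow> bool" where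
  "kropina_space X \<A> a b m K F \<longleftrightarrow>
     finsler_space X \<A> K F \<and>
     (\<forall>(p, w)\<in>K. let \<alpha> = sqrt (a p w w); \<beta> = b p w in
        0 \<le> a p w w \<and> rpow_defined \<alpha> (1 + m) \<and> rpow_defined \<beta> (- m) \<and>
        F (p, w) = rpow \<alpha> (1 + m) * rpow \<beta> (- m))"


subsection \<open>Affine connections\<close>

text \<open>A connection is given by its coefficients in all charts; \<open>\<Gamma> c x i j k\<close> is the coefficient with
  upper index \<open>i\<close> and lower indices \<open>j\<close>, \<open>k\<close> at the point with coordinates \<open>x\<close>.\<close>

type_synonym ('p, 'n) connection = "('p, 'n) chart \<Rightarrow> real ^ 'n \<Rightarrow> 'n \<Rightarrow> 'n \<Rightarrow> 'n \<Rightarrow> real"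

definition associated_connection :: "('p, 'n::finite) chart set \<Rightarrow> ('p \<times> ('p, 'n) tvec) set \<Rightarrow>
    ('p \<times> ('p, 'n) tvec \<Rightarrow> real) \<Rightarrow> ('p, 'n) connection \<Rightarrow> bool" where
  "associated_connection \<A> K F \<Gamma> \<longleftrightarrow>
     (\<forall>c\<in>\<A>. (\<forall>i j k. smooth_on (crange c) (\<lambda>x. \<Gamma> c x i j k)) \<and>
        (\<forall>(x, y)\<in>tset_in \<A> K c. \<forall>i j.
           cartan_N (F \<circ> tpoint \<A> c) i j (x, y) = (\<Sum>k\<in>UNIV. \<Gamma> c x i j k * y $ k)))"

definition berwald_type :: "('p, 'n::finite) chart set \<Rightarrow> ('p \<times> ('p, 'n) tvec) set \<Rightarrow>
    ('p \<times> ('p, 'n) tvec \<Rightarrow> real) \<Rightarrow> bool" where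
  "berwald_type \<A> K F \<longleftrightarrow> (\<exists>\<Gamma>. associated_connection \<A> K F \<Gamma>)"

text \<open>The following two are in a fixed chart; \<open>affine_curvature G x l i j k\<close> has upper index \<open>i\<close> and
  lower indices \<open>l\<close>, \<open>j\<close>, \<open>k\<close>.\<close>

definition affine_curvature :: "(real ^ 'n::finite \<Rightarrow> 'n \<Rightarrow> 'n \<Rightarrow> 'n \<Rightarrow> real) \<Rightarrow> real ^ 'n \<Rightarrow>
    'n \<Rightarrow> 'n \<Rightarrow> 'n \<Rightarrow> 'n \<Rightarrow> real" where
  "affine_curvature G x l i j k =
     partial j (\<lambda>z. G z i k l) x - partial k (\<lambda>z. G z i j l) x
     + (\<Sum>p\<in>UNIV. G x i p j * G x p k l) - (\<Sum>p\<in>UNIV. G x i p k * G x p j l)"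

definition affine_ricci :: "(real ^ 'n::finite \<Rightarrow> 'n \<Rightarrow> 'n \<Rightarrow> 'n \<Rightarrow> real) \<Rightarrow> real ^ 'n \<Rightarrow>
    'n \<Rightarrow> 'n \<Rightarrow> real" where
  "affine_ricci G x l k = (\<Sum>i\<in>UNIV. affine_curvature G x l i i k)"

definition levi_civita_on :: "('p, 'n::finite) chart set \<Rightarrow> 'p set \<Rightarrow> ('p, 'n) metric \<Rightarrow>
    ('p, 'n) connection \<Rightarrow> bool" where
  "levi_civita_on \<A> U g \<Gamma> \<longleftrightarrow>
     (\<forall>c\<in>\<A>. \<forall>x\<in>coord c ` (cdom c \<inter> U). \<forall>i j k.
        \<Gamma> c x i j k = 1/2 * (\<Sum>l\<in>UNIV. matrix_inv (metric_comp \<A> g c x) $ i $ l *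
          (partial j (\<lambda>z. metric_comp \<A> g c z $ l $ k) x
           + partial k (\<lambda>z. metric_comp \<A> g c z $ l $ j) x
           - partial l (\<lambda>z. metric_comp \<A> g c z $ j $ k) x)))"

definition metrizable_by_on :: "('p, 'n::finite) chart set \<Rightarrow> 'p set \<Rightarrow> ('p, 'n) metric \<Rightarrow>
    ('p, 'n) connection \<Rightarrow> bool" where
  "metrizable_by_on \<A> U g \<Gamma> \<longleftrightarrow> pseudo_riemannian_on \<A> U g \<and> levi_civita_on \<A> U g \<Gamma>"

definition locally_metrizable :: "'p topology \<Rightarrow> ('p, 'n::finite) chart set \<Rightarrow> ('p, 'n) connection \<Rightarrow> bool" where
  "locally_metrizable X \<A> \<Gamma> \<longleftrightarrow>
     (\<forall>p\<in>topspace X. \<exists>U g. openin X U \<and> p \<in> U \<and> metrizable_by_on \<A> U g \<Gamma>)"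

definition ricci_symmetric :: "('p, 'n::finite) chart set \<Rightarrow> ('p, 'n) connection \<Rightarrow> bool" where
  "ricci_symmetric \<A> \<Gamma> \<longleftrightarrow>
     (\<forall>c\<in>\<A>. \<forall>x\<in>crange c. \<forall>i j. affine_ricci (\<Gamma> c) x i j = affine_ricci (\<Gamma> c) x j i)"


subsection \<open>Adapted coordinates\<close>

definition sym_prod :: "real ^ 'n \<Rightarrow> real ^ 'n \<Rightarrow> real ^ 'n ^ 'n" where
  "sym_prod e f = (\<chi> i j. 1/2 * (e $ i * f $ j + f $ i * e $ j))"

definition independent_of :: "'n \<Rightarrow> (real ^ 'n) set \<Rightarrow> (real ^ 'n \<Rightarrow> 'b) \<Rightarrow> bool" where
  "independent_of v S f \<longleftrightarrow> (\<forall>x\<in>S. \<forall>x'\<in>S. (\<forall>i. i \<noteq> v \<longrightarrow> x $ i = x' $ i) \<longrightarrow> f x = f x')"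

text \<open>The distinct indices \<open>u\<close> and \<open>v\<close> label the first two coordinates, the indices in
  \<open>- {u, v}\<close> label the remaining \<open>n - 2\<close> ones. Functions of \<open>(u, x)\<close> are functions of all
  coordinates that are independent of the coordinate \<open>v\<close>.\<close>

definition adapted_chart :: "('p, 'n::finite) chart set \<Rightarrow> ('p, 'n) metric \<Rightarrow> ('p, 'n) form \<Rightarrow> 'n \<Rightarrow> 'n \<Rightarrow>
    ('p, 'n) chart \<Rightarrow> (real \<Rightarrow> real) \<Rightarrow> bool" where
  "adapted_chart \<A> a b u v c \<phi> \<longleftrightarrow>
     c \<in> \<A> \<and> smooth_on ((\<lambda>x. x $ u) ` crange c) \<phi> \<and>
     (\<exists>H W h.
        smooth_on (crange c) H \<and> independent_of v (crange c) H \<and>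
        (\<forall>i\<in>- {u, v}. smooth_on (crange c) (\<lambda>x. W x i) \<and> independent_of v (crange c) (\<lambda>x. W x i)) \<and>
        (\<forall>i\<in>- {u, v}. \<forall>j\<in>- {u, v}.
           smooth_on (crange c) (\<lambda>x. h x i j) \<and> independent_of v (crange c) (\<lambda>x. h x i j)) \<and>
        (\<forall>x\<in>crange c.
           (\<forall>i\<in>- {u, v}. \<forall>j\<in>- {u, v}. h x i j = h x j i) \<and>
           (\<forall>y :: 'n \<Rightarrow> real. (\<forall>i\<in>- {u, v}. (\<Sum>j\<in>- {u, v}. h x i j * y j) = 0) \<longrightarrow> (\<forall>j\<in>- {u, v}. y j = 0)) \<and>
           (let d = (\<lambda>i. axis i 1 :: real ^ 'n) in
              metric_comp \<A> a c x =
                (- 2) *\<^sub>R sym_prod (d u) (d v)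
                + (H x + \<phi> (x $ u) * x $ v) *\<^sub>R sym_prod (d u) (d u)
                + (\<Sum>i\<in>- {u, v}. W x i *\<^sub>R sym_prod (d u) (d i))
                + (\<Sum>i\<in>- {u, v}. \<Sum>j\<in>- {u, v}. h x i j *\<^sub>R sym_prod (d i) (d j)) \<and>
              form_comp \<A> b c x = d u)))"

end

theory Submission
  imports Defs
begin

text \<open>Write \<open>L = F\<^sup>2\<close>, \<open>A = a(y, y)\<close> and \<open>\<beta> = b(y)\<close>, and let \<open>\<nabla>\<close> be the affine connection of the
  Berwald space. Its parallel transport preserves \<open>F\<close>: horizontal derivatives of \<open>L\<close> vanish
  (\<open>berwald_horizontal\<close>). For \<open>L = A powr (1 + m) * (\<beta>\<^sup>2) powr (- m)\<close> this says that
  \<open>(1 + m) \<beta> (\<nabla>\<^sub>w a)(y, y) = 2 m A (\<nabla>\<^sub>w b)(y)\<close> on an open set of \<open>y\<close>, hence, as both sides are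
  cubic polynomials, for all \<open>y\<close>. Putting \<open>\<beta>(y) = 0\<close> shows that \<open>\<nabla>\<^sub>w b\<close> vanishes wherever \<open>b\<close>
  does, because \<open>A\<close> is not identically zero on the kernel of \<open>b\<close> if \<open>n > 2\<close>. So \<open>\<nabla>\<^sub>w b\<close> is a
  multiple of \<open>b\<close> and \<open>\<nabla>\<^sub>w a\<close> a multiple of \<open>a\<close> (\<open>proportional_of_cubic_identity\<close>), and since \<open>b\<close>
  is closed there is a function \<open>\<kappa>\<close> with \<open>\<nabla> b = \<kappa> b \<otimes> b\<close> and \<open>\<nabla> a = \<lambda> \<kappa> b \<otimes> a\<close>, where
  \<open>\<lambda> = 2 m / (1 + m)\<close> (\<open>kropina_chart\<close>). In other words \<open>\<nabla>\<close> is a Weyl connection of the conformal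
  class of \<open>a\<close>, with Weyl form \<open>\<lambda> \<kappa> b\<close>. The values \<open>m = 1\<close> and \<open>m = -1\<close> do not occur, since the
  fundamental tensor then has the vector \<open>b\<^sup>\<sharp> - (1 + m) (\<beta> / A) y\<close> in its kernel.

  The antisymmetric part of the Ricci tensor of a torsion-free connection is the exterior
  derivative of the trace \<open>\<Gamma>\<^sup>i\<^sub>i\<^sub>k\<close>. For a Weyl connection the trace is the derivative of
  \<open>ln (sqrt \<bar>det a\<bar>)\<close> minus \<open>n / 2\<close> times the Weyl form. Hence the Ricci tensor is symmetric if
  and only if the Weyl form is closed (\<open>weyl_ricci_symmetric_iff\<close>), that is, \<open>d \<kappa> \<and> b = 0\<close>.
  Applied to a metric with zero Weyl form, the same lemma shows that the Ricci tensor of a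
  metrizable connection is symmetric.

  Coordinates relate \<open>\<kappa>\<close> to \<open>a\<close>. Locally \<open>b = du\<close>, and as \<open>b\<close> is null, the vector field
  \<open>- b\<^sup>\<sharp>\<close> is tangent to the level sets of \<open>u\<close>; its flow gives coordinates in which it is \<open>\<partial>\<^sub>v\<close>
  (\<open>chart_along_flow\<close>). There \<open>a(\<partial>\<^sub>v, -) = - du\<close>, and the Levi-Civita Hessian of \<open>u\<close> is
  \<open>- 1/2 \<partial>\<^sub>v a\<close> (\<open>hessian_of_coordinate\<close>), while the Weyl property makes it \<open>(1 - \<lambda>) \<kappa> du\<^sup>2\<close>
  (\<open>hessian_of_weyl\<close>). So \<open>\<partial>\<^sub>v a = \<phi> du\<^sup>2\<close> with \<open>\<phi> = - 2 (1 - \<lambda>) \<kappa>\<close>. If the Ricci tensor is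
  symmetric, then \<open>d \<kappa> \<and> du = 0\<close>, so \<open>\<phi>\<close> depends on \<open>u\<close> only, and integrating in \<open>v\<close> gives
  exactly the adapted form of \<open>a\<close>.

  Conversely, in an adapted chart \<open>\<kappa> = - \<phi>(u) / (2 (1 - \<lambda>))\<close>, so the Weyl form is
  \<open>- m / (1 - m) \<phi>(u) du\<close>. Multiplying \<open>a\<close> by the exponential of \<open>m / (1 - m) \<integral> \<phi>\<close> adds the
  derivative of the exponent to the Weyl form and makes it zero, and a torsion-free connection
  with zero Weyl form is the Levi-Civita connection (\<open>adapted_metrizable\<close>).

  The construction of the coordinates needs a smooth flow (\<open>flow\<close>). It is obtained by Picard
  iteration over all initial values at once. The matrix \<open>Y\<close> of derivatives with respect to
  initial values solves a linear equation and is found as a limit of difference quotients; as the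
  derivatives of the flow and of \<open>Y\<close> can be expressed by the flow, \<open>Y\<close>, \<open>Y\<^sup>-\<^sup>1\<close> and integrals of
  these, smoothness follows by induction on the number of derivatives.\<close>

section \<open>Smooth functions and directional derivatives\<close>

lemma dird_has_derivative:
  assumes "(f has_derivative f') (at x)"
  shows "dird v f x = f' v"
  using frechet_derivative_at[OF assms] by (simp add: dird_def)

lemma differentiable_has_derivative_dird:
  assumes "f differentiable (at x)"
  shows "(f has_derivative (\<lambda>v. dird v f x)) (at x)"
  using assms by (simp add: dird_def frechet_derivative_works)

lemma dird_cong:
  assumes "open S" "x \<in> S" "\<And>y. y \<in> S \<Longrightarrow> f y = g y"
  shows "dird v f x = dird v g x"
proof -
  have "(f has_derivative D) (at x) \<longleftrightarrow> (g has_derivative D) (at x)" for D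
    using assms has_derivative_transform_within_open by (metis (no_types, lifting))
  then show ?thesis by (simp add: dird_def frechet_derivative_def)
qed

text \<open>The class \<open>C\<^sup>k\<close>. Smoothness is \<open>C\<^sup>k\<close> for all \<open>k\<close> (\<open>smooth_on_iff_ck\<close>), which makes it
  accessible to induction on the number of derivatives.\<close>

fun ck :: "nat \<Rightarrow> 'a::euclidean_space set \<Rightarrow> ('a \<Rightarrow> 'b::real_normed_vector) \<Rightarrow> bool" where
  "ck 0 S f \<longleftrightarrow> continuous_on S f"
| "ck (Suc k) S f \<longleftrightarrow> (\<forall>x\<in>S. f differentiable (at x)) \<and> (\<forall>v. ck k S (dird v f))"

lemma ck_continuous_on: "ck k S f \<Longrightarrow> continuous_on S f"
  by (cases k) (auto intro!: continuous_at_imp_continuous_on differentiable_imp_continuous_within)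

lemma ck_Suc_has_derivative:
  assumes "ck (Suc k) S f" "x \<in> S"
  shows "(f has_derivative (\<lambda>v. dird v f x)) (at x)"
  using assms by (auto intro: differentiable_has_derivative_dird)

lemma ck_mono_Suc: "ck (Suc k) S f \<Longrightarrow> ck k S f"
proof (induction k arbitrary: f)
  case 0
  then show ?case using ck_continuous_on by fastforce
next
  case (Suc k)
  then show ?case by (metis ck.simps(2))
qed

lemma ck_cong:
  assumes "open S" "\<And>x. x \<in> S \<Longrightarrow> f x = g x"
  shows "ck k S f \<longleftrightarrow> ck k S g"
  using assms(2)
proof (induction k arbitrary: f g)
  case 0
  then show ?case using continuous_on_cong by fastforce
next
  case (Suc k)
  have "f differentiable (at x) \<longleftrightarrow> g differentiable (at x)" if "x \<in> S" for x
    using that assms(1) Suc.prems has_derivative_transform_within_open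
    unfolding differentiable_def by (metis (no_types, lifting))
  moreover have "ck k S (dird v f) \<longleftrightarrow> ck k S (dird v g)" for v
    by (rule Suc.IH) (use dird_cong[OF assms(1)] Suc.prems in auto)
  ultimately show ?case by auto
qed

lemma ck_SucI:
  assumes "open S" "\<And>x. x \<in> S \<Longrightarrow> (f has_derivative f' x) (at x)"
    and "\<And>v. ck k S (\<lambda>x. f' x v)"
  shows "ck (Suc k) S f"
proof -
  have "ck k S (dird v f)" for v
    using assms(3)[of v] ck_cong[OF assms(1), of "dird v f" "\<lambda>x. f' x v"] dird_has_derivative[OF assms(2)]
    by auto
  then show ?thesis using assms(2) by (auto simp: differentiable_def)
qed

lemma smooth_on_iff_ck: "smooth_on S f \<longleftrightarrow> (\<forall>k. ck k S f)"
proof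
  assume "smooth_on S f"
  then have "ck k S f" for k
  proof (induction k arbitrary: f)
    case 0
    then have "\<forall>x\<in>S. foldr dird [] f differentiable (at x)" unfolding smooth_on_def by blast
    then show ?case by (auto intro!: continuous_at_imp_continuous_on differentiable_imp_continuous_within)
  next
    case (Suc k)
    have "smooth_on S (dird v f)" for v
      unfolding smooth_on_def
    proof (intro allI)
      fix vs
      show "\<forall>x\<in>S. foldr dird vs (dird v f) differentiable (at x)"
        using Suc.prems[unfolded smooth_on_def, rule_format, of _ "vs @ [v]"] by simp
    qed
    moreover have "\<forall>x\<in>S. foldr dird [] f differentiable (at x)"
      using Suc.prems unfolding smooth_on_def by blast
    ultimately show ?case using Suc.IH by simp
  qed
  then show "\<forall>k. ck k S f" ..
next
  assume "\<forall>k. ck k S f"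
  then have "\<forall>x\<in>S. foldr dird vs f differentiable (at x)" for vs
  proof (induction vs arbitrary: f rule: rev_induct)
    case Nil
    then show ?case using ck.simps(2)[of 0 S f] by auto
  next
    case (snoc v vs)
    have "\<forall>k. ck k S (dird v f)" using snoc.prems ck.simps(2) by blast
    then show ?case using snoc.IH by simp
  qed
  then show "smooth_on S f" by (simp add: smooth_on_def)
qed

lemma ck_const: "open S \<Longrightarrow> ck k S (\<lambda>x. c)"
proof (induction k arbitrary: c)
  case (Suc k)
  show ?case by (rule ck_SucI[where f'="\<lambda>_ _. 0"]) (use Suc in auto)
qed simp

lemma ck_linear_comp:
  assumes "bounded_linear L" "open S" "ck k S f"
  shows "ck k S (\<lambda>x. L (f x))"
  using assms(3)
proof (induction k arbitrary: f)
  case 0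
  then show ?case using bounded_linear.continuous_on[OF assms(1)] by auto
next
  case (Suc k)
  show ?case
    by (rule ck_SucI[OF assms(2) bounded_linear.has_derivative[OF assms(1) ck_Suc_has_derivative[OF Suc.prems]]])
       (use Suc in auto)
qed

lemma ck_bounded_linear:
  assumes "bounded_linear L" "open S" shows "ck k S L"
proof (cases k)
  case 0
  then show ?thesis using linear_continuous_on[OF assms(1)] by simp
next
  case (Suc j)
  show ?thesis unfolding Suc
    by (rule ck_SucI[OF assms(2) bounded_linear_imp_has_derivative[OF assms(1)]]) (rule ck_const[OF assms(2)])
qed

lemma ck_add: "open S \<Longrightarrow> ck k S f \<Longrightarrow> ck k S g \<Longrightarrow> ck k S (\<lambda>x. f x + g x)"
proof (induction k arbitrary: f g)
  case 0 then show ?case by (auto intro: continuous_on_add)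
next
  case (Suc k)
  show ?case
    by (rule ck_SucI[OF Suc.prems(1) has_derivative_add[OF ck_Suc_has_derivative[OF Suc.prems(2)] ck_Suc_has_derivative[OF Suc.prems(3)]]])
       (use Suc in auto)
qed

lemma ck_sum: "open S \<Longrightarrow> (\<And>i. i \<in> I \<Longrightarrow> ck k S (f i)) \<Longrightarrow> ck k S (\<lambda>x. \<Sum>i\<in>I. f i x)"
  by (induction I rule: infinite_finite_induct) (auto intro: ck_const ck_add)

lemma ck_bilinear:
  assumes "bounded_bilinear pr" "open S"
  shows "ck k S f \<Longrightarrow> ck k S g \<Longrightarrow> ck k S (\<lambda>x. pr (f x) (g x))"
proof (induction k arbitrary: f g)
  case 0 then show ?case using bounded_bilinear.continuous_on[OF assms(1)] by auto
next
  case (Suc k)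
  show ?case
  proof (rule ck_SucI[OF assms(2) bounded_bilinear.FDERIV[OF assms(1) ck_Suc_has_derivative[OF Suc.prems(1)] ck_Suc_has_derivative[OF Suc.prems(2)]]])
    fix v
    have "ck k S f" "ck k S g" "ck k S (dird v f)" "ck k S (dird v g)"
      using Suc.prems ck_mono_Suc by auto
    then show "ck k S (\<lambda>x. pr (f x) (dird v g x) + pr (dird v f x) (g x))"
      using Suc.IH assms(2) by (intro ck_add) auto
  qed
qed

lemmas ck_mult = ck_bilinear[OF bounded_bilinear_mult]
lemmas ck_scaleR = ck_bilinear[OF bounded_bilinear_scaleR]

text \<open>The chain rule writes a derivative of the composition as a finite sum over a basis of
  products of functions that are one class less regular, to which the induction hypothesis
  applies.\<close>

lemma ck_compose:
  fixes f :: "'b::euclidean_space \<Rightarrow> 'c::real_normed_vector" and g :: "'a::euclidean_space \<Rightarrow> 'b"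
  assumes "open S" "open T"
  shows "ck k T f \<Longrightarrow> ck k S g \<Longrightarrow> (\<And>x. x \<in> S \<Longrightarrow> g x \<in> T) \<Longrightarrow> ck k S (\<lambda>x. f (g x))"
proof (induction k arbitrary: f)
  case 0
  then show ?case using continuous_on_compose2[of T f S g] by auto
next
  case (Suc k)
  have d: "((\<lambda>x. f (g x)) has_derivative (\<lambda>v. dird (dird v g x) f (g x))) (at x)" if "x \<in> S" for x
    using has_derivative_compose[OF ck_Suc_has_derivative[OF Suc.prems(2) that] ck_Suc_has_derivative[OF Suc.prems(1) Suc.prems(3)[OF that]]] .
  show ?case
  proof (rule ck_SucI[OF assms(1) d])
    fix v
    have e: "dird (dird v g x) f (g x) = (\<Sum>b\<in>Basis. (dird v g x \<bullet> b) *\<^sub>R dird b f (g x))" if "x \<in> S" for x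
    proof -
      have l: "linear (\<lambda>w. dird w f (g x))"
        using ck_Suc_has_derivative[OF Suc.prems(1) Suc.prems(3)[OF that]] has_derivative_linear by blast
      show ?thesis
        using linear_sum[OF l, of "\<lambda>b. (dird v g x \<bullet> b) *\<^sub>R b" Basis] linear_cmul[OF l]
        by (simp add: euclidean_representation)
    qed
    have "ck k S (\<lambda>x. \<Sum>b\<in>Basis. (dird v g x \<bullet> b) *\<^sub>R dird b f (g x))"
    proof (intro ck_sum ck_scaleR assms(1))
      fix b :: 'b
      show "ck k S (\<lambda>x. dird v g x \<bullet> b)"
        using ck_linear_comp[OF bounded_linear_inner_left[of b] assms(1)] Suc.prems(2) by auto
      show "ck k S (\<lambda>x. dird b f (g x))"
        using Suc.IH[of "dird b f"] Suc.prems ck_mono_Suc by auto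
    qed
    then show "ck k S (\<lambda>x. dird (dird v g x) f (g x))"
      using ck_cong[OF assms(1), of "\<lambda>x. dird (dird v g x) f (g x)"] e by auto
  qed
qed

lemma ck_inverse: "ck k (- {0}) (inverse :: real \<Rightarrow> real)"
proof (induction k)
  case 0 then show ?case by (auto intro!: continuous_intros)
next
  case (Suc k)
  have o: "open (- {0::real})" by auto
  show ?case
  proof (rule ck_SucI[OF o has_derivative_inverse'])
    fix v :: real
    show "ck k (- {0}) (\<lambda>x::real. - (inverse x * v * inverse x))"
      using ck_mult[OF o ck_const[OF o, of k "-v"] ck_mult[OF o Suc Suc]] by (simp add: algebra_simps)
  qed auto
qed

lemma ck_exp: "ck k UNIV (exp :: real \<Rightarrow> real)"
proof (induction k)
  case 0 then show ?case by (auto intro!: continuous_intros)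
next
  case (Suc k)
  have "(exp has_derivative (\<lambda>v. v * exp x)) (at x)" for x :: real
    by (auto intro!: derivative_eq_intros)
  then show ?case
    by (rule ck_SucI[OF open_UNIV]) (rule ck_mult[OF open_UNIV ck_const[OF open_UNIV] Suc])
qed

lemma ck_vec:
  fixes f :: "'a::euclidean_space \<Rightarrow> ('b::euclidean_space) ^ 'n"
  assumes "open S" "\<And>i. ck k S (\<lambda>x. f x $ i)"
  shows "ck k S f"
proof -
  have "f x = (\<Sum>i\<in>UNIV. axis i (f x $ i))" for x
    by (simp add: vec_eq_iff axis_def)
  moreover have "linear (\<lambda>y::'b. axis i y :: 'b ^ 'n)" for i
    by (rule linearI) (simp_all add: vec_eq_iff axis_def)
  then have "bounded_linear (\<lambda>y::'b. axis i y :: 'b ^ 'n)" for i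
    by (simp only: linear_conv_bounded_linear)
  then have "ck k S (\<lambda>x. \<Sum>i\<in>UNIV. axis i (f x $ i))"
    by (intro ck_sum[OF assms(1)] ck_linear_comp[OF _ assms(1) assms(2)])
  ultimately show ?thesis by simp
qed

lemma ck_vec_nth: "open S \<Longrightarrow> ck k S f \<Longrightarrow> ck k S (\<lambda>x. f x $ i)"
  by (rule ck_linear_comp[OF bounded_linear_vec_nth])

lemma smooth_on_cong:
  fixes f :: "'a::euclidean_space \<Rightarrow> 'b::real_normed_vector"
  assumes "open S" "\<And>x. x \<in> S \<Longrightarrow> f x = g x"
  shows "smooth_on S f \<longleftrightarrow> smooth_on S g"
  by (simp add: smooth_on_iff_ck ck_cong[OF assms(1), of f g] assms(2))

lemma smooth_on_subset: "smooth_on S f \<Longrightarrow> T \<subseteq> S \<Longrightarrow> smooth_on T f"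
  unfolding smooth_on_def by blast

lemma smooth_on_differentiable:
  fixes f :: "'a::euclidean_space \<Rightarrow> 'b::real_normed_vector"
  shows "smooth_on S f \<Longrightarrow> x \<in> S \<Longrightarrow> f differentiable (at x)"
  using smooth_on_iff_ck[of S f] ck.simps(2) by blast

lemma smooth_on_has_derivative:
  fixes f :: "'a::euclidean_space \<Rightarrow> 'b::real_normed_vector"
  shows "smooth_on S f \<Longrightarrow> x \<in> S \<Longrightarrow> (f has_derivative (\<lambda>v. dird v f x)) (at x)"
  by (simp add: smooth_on_differentiable differentiable_has_derivative_dird)

lemma smooth_on_dird:
  fixes f :: "'a::euclidean_space \<Rightarrow> 'b::real_normed_vector"
  shows "smooth_on S f \<Longrightarrow> smooth_on S (dird v f)"
  by (meson ck.simps(2) smooth_on_iff_ck)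

lemma smooth_on_continuous_on:
  fixes f :: "'a::euclidean_space \<Rightarrow> 'b::real_normed_vector"
  shows "smooth_on S f \<Longrightarrow> continuous_on S f"
  using ck_continuous_on smooth_on_iff_ck by blast

lemma matrix_inv_mult:
  fixes A :: "real ^ 'n ^ 'n"
  assumes "invertible A"
  shows "A ** matrix_inv A = mat 1" "matrix_inv A ** A = mat 1"
proof -
  have "A ** matrix_inv A = mat 1 \<and> matrix_inv A ** A = mat 1"
    using assms unfolding matrix_inv_def invertible_def by (rule someI_ex)
  then show "A ** matrix_inv A = mat 1" "matrix_inv A ** A = mat 1" by auto
qed

context fixes S :: "'a::euclidean_space set" assumes S: "open S" begin

lemma smooth_on_const: "smooth_on S (\<lambda>x. c)"
  using S by (simp add: smooth_on_iff_ck ck_const)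

lemma smooth_on_add: "smooth_on S f \<Longrightarrow> smooth_on S g \<Longrightarrow> smooth_on S (\<lambda>x. f x + g x)"
  using S by (simp add: smooth_on_iff_ck ck_add)

lemma smooth_on_sum: "(\<And>i. i \<in> I \<Longrightarrow> smooth_on S (f i)) \<Longrightarrow> smooth_on S (\<lambda>x. \<Sum>i\<in>I. f i x)"
  using S by (simp add: smooth_on_iff_ck ck_sum)

lemma smooth_on_bilinear:
  "bounded_bilinear pr \<Longrightarrow> smooth_on S f \<Longrightarrow> smooth_on S g \<Longrightarrow> smooth_on S (\<lambda>x. pr (f x) (g x))"
  using S by (simp add: smooth_on_iff_ck ck_bilinear)

lemmas smooth_on_mult = smooth_on_bilinear[OF bounded_bilinear_mult]
lemmas smooth_on_inner = smooth_on_bilinear[OF bounded_bilinear_inner]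

lemma smooth_on_linear_comp: "bounded_linear L \<Longrightarrow> smooth_on S f \<Longrightarrow> smooth_on S (\<lambda>x. L (f x))"
  using S by (simp add: smooth_on_iff_ck ck_linear_comp)

lemma smooth_on_bounded_linear: "bounded_linear L \<Longrightarrow> smooth_on S L"
  using S by (simp add: smooth_on_iff_ck ck_bounded_linear)

lemma smooth_on_uminus: "smooth_on S f \<Longrightarrow> smooth_on S (\<lambda>x. - f x)"
  by (rule smooth_on_linear_comp[OF bounded_linear_minus[OF bounded_linear_ident]])

lemma smooth_on_diff: "smooth_on S f \<Longrightarrow> smooth_on S g \<Longrightarrow> smooth_on S (\<lambda>x. f x - g x)"
  using smooth_on_add[of f "\<lambda>x. - g x"] smooth_on_uminus[of g] by simp

lemma smooth_on_compose:
  assumes "open T" "smooth_on T f" "smooth_on S g" "\<And>x. x \<in> S \<Longrightarrow> g x \<in> T"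
  shows "smooth_on S (\<lambda>x. f ((g x) :: 'b::euclidean_space))"
  using assms(2-4) ck_compose[OF S assms(1), of _ f g] by (auto simp: smooth_on_iff_ck)

lemma smooth_on_exp: "smooth_on S g \<Longrightarrow> smooth_on S (\<lambda>x. exp (g x :: real))"
  using smooth_on_compose[of UNIV exp g] ck_exp by (auto simp: smooth_on_iff_ck)

lemma smooth_on_vec:
  fixes f :: "'a \<Rightarrow> ('b::euclidean_space) ^ 'n"
  shows "(\<And>i. smooth_on S (\<lambda>x. f x $ i)) \<Longrightarrow> smooth_on S f"
  using S by (simp add: smooth_on_iff_ck ck_vec)

lemma smooth_on_vec_nth: "smooth_on S f \<Longrightarrow> smooth_on S (\<lambda>x. f x $ i)"
  using S by (simp add: smooth_on_iff_ck ck_vec_nth)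

end

text \<open>Along \<open>z + s v\<close>, the derivative of \<open>f\<close> in direction \<open>w\<close> grows by the integral of
  \<open>\<partial>\<^sub>w \<partial>\<^sub>v f\<close>: this is differentiation under the integral sign of the fundamental theorem of
  calculus for \<open>f\<close>. Differentiating the growth at \<open>s = 0\<close> gives \<open>\<partial>\<^sub>v \<partial>\<^sub>w f = \<partial>\<^sub>w \<partial>\<^sub>v f\<close>.\<close>

lemma dird_dird_commute:
  fixes f :: "'a::euclidean_space \<Rightarrow> 'b::banach"
  assumes "open S" "ck 2 S f" "z \<in> S"
  shows "dird v (dird w f) z = dird w (dird v f) z"
proof -
  obtain r where r: "r > 0" "ball z r \<subseteq> S" using assms open_contains_ball by blast
  \<comment> \<open>This size keeps the parallelogram with sides \<open>d v\<close> and \<open>d w\<close> inside the ball.\<close>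
  define d where "d = r / (norm v + norm w + 1)"
  have d: "d > 0" using r by (simp add: d_def add_nonneg_pos)
  have inS: "z + s *\<^sub>R v + t *\<^sub>R w \<in> S" if "\<bar>s\<bar> < d" "\<bar>t\<bar> < d" for s t
  proof -
    have "norm (s *\<^sub>R v + t *\<^sub>R w) \<le> \<bar>s\<bar> * norm v + \<bar>t\<bar> * norm w"
      using norm_triangle_ineq[of "s *\<^sub>R v" "t *\<^sub>R w"] by simp
    also have "\<dots> \<le> d * norm v + d * norm w"
      using that by (intro add_mono mult_right_mono) auto
    also have "\<dots> < d * (norm v + norm w + 1)" using d by (simp add: algebra_simps)
    also have "\<dots> = r"
    proof -
      have "norm v + norm w + 1 > 0" by (simp add: add_nonneg_pos)
      then show ?thesis by (simp add: d_def)
    qed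
    finally have "norm (s *\<^sub>R v + t *\<^sub>R w) < r" .
    then have "z + (s *\<^sub>R v + t *\<^sub>R w) \<in> ball z r"
      by (metis add_diff_cancel_left' dist_commute dist_norm mem_ball)
    then have "z + (s *\<^sub>R v + t *\<^sub>R w) \<in> S" using r(2) by blast
    then show ?thesis by (simp only: add.assoc)
  qed
  have c2: "ck (Suc (Suc 0)) S f" using assms(2) by (simp add: numeral_2_eq_2)
  then have cv: "ck (Suc 0) S (dird v f)" and cw: "ck (Suc 0) S (dird w f)" by auto
  have cwv: "continuous_on S (dird w (dird v f))" using cv by simp
  have line: "((\<lambda>\<sigma>. z + \<sigma> *\<^sub>R v + t *\<^sub>R w) has_derivative (\<lambda>h. h *\<^sub>R v)) (at s)"
    "((\<lambda>\<sigma>. z + s *\<^sub>R v + \<sigma> *\<^sub>R w) has_derivative (\<lambda>h. h *\<^sub>R w)) (at t)" for s t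
    by (auto intro!: derivative_eq_intros)
  have sc: "dird (h *\<^sub>R u) g y = h *\<^sub>R dird u g y" if "ck (Suc 0) S g" "y \<in> S" for h u y and g :: "'a \<Rightarrow> 'b"
    using has_derivative_linear[OF ck_Suc_has_derivative[OF that]] linear_cmul by blast
  have dv: "((\<lambda>\<sigma>. g (z + \<sigma> *\<^sub>R v + t *\<^sub>R w)) has_vector_derivative dird v g (z + s *\<^sub>R v + t *\<^sub>R w)) (at s)"
    if "ck (Suc 0) S g" "\<bar>s\<bar> < d" "\<bar>t\<bar> < d" for s t and g :: "'a \<Rightarrow> 'b"
    using has_derivative_compose[OF line(1) ck_Suc_has_derivative[OF that(1) inS[OF that(2,3)]]] sc[OF that(1) inS[OF that(2,3)]]
    unfolding has_vector_derivative_def by simp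
  have dw: "((\<lambda>\<sigma>. g (z + s *\<^sub>R v + \<sigma> *\<^sub>R w)) has_vector_derivative dird w g (z + s *\<^sub>R v + t *\<^sub>R w)) (at t)"
    if "ck (Suc 0) S g" "\<bar>s\<bar> < d" "\<bar>t\<bar> < d" for s t and g :: "'a \<Rightarrow> 'b"
    using has_derivative_compose[OF line(2) ck_Suc_has_derivative[OF that(1) inS[OF that(2,3)]]] sc[OF that(1) inS[OF that(2,3)]]
    unfolding has_vector_derivative_def by simp
  have c1: "ck (Suc 0) S f" using c2 ck_mono_Suc by blast
  let ?U = "{-d<..<d}"
  have cont: "continuous_on (?U \<times> {0..s}) (\<lambda>(t, \<sigma>). dird w (dird v f) (z + \<sigma> *\<^sub>R v + t *\<^sub>R w))" if "s < d" for s
    unfolding split_beta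
  proof (rule continuous_on_compose2[OF cwv])
    show "(\<lambda>p. z + snd p *\<^sub>R v + fst p *\<^sub>R w) ` (?U \<times> {0..s}) \<subseteq> S" using that inS by fastforce
  qed (intro continuous_intros)
  have eq: "dird w f (z + s *\<^sub>R v) = dird w f z + integral {0..s} (\<lambda>\<sigma>. dird w (dird v f) (z + \<sigma> *\<^sub>R v))"
    if s: "0 \<le> s" "s < d" for s
  proof -
    have ftc: "((\<lambda>\<sigma>. dird v f (z + \<sigma> *\<^sub>R v + t *\<^sub>R w)) has_integral f (z + s *\<^sub>R v + t *\<^sub>R w) - f (z + t *\<^sub>R w)) {0..s}"
      if "\<bar>t\<bar> < d" for t
    proof -
      have "((\<lambda>\<sigma>. dird v f (z + \<sigma> *\<^sub>R v + t *\<^sub>R w)) has_integral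
          f (z + s *\<^sub>R v + t *\<^sub>R w) - f (z + 0 *\<^sub>R v + t *\<^sub>R w)) {0..s}"
      proof (rule fundamental_theorem_of_calculus[OF s(1)])
        fix \<sigma> assume "\<sigma> \<in> {0..s}"
        then have "\<bar>\<sigma>\<bar> < d" using s by simp
        from has_vector_derivative_at_within[OF dv[OF c1 this that]]
        show "((\<lambda>\<sigma>. f (z + \<sigma> *\<^sub>R v + t *\<^sub>R w)) has_vector_derivative dird v f (z + \<sigma> *\<^sub>R v + t *\<^sub>R w)) (at \<sigma> within {0..s})" .
      qed
      then show ?thesis by simp
    qed
    have "((\<lambda>t. integral (cbox 0 s) (\<lambda>\<sigma>. dird v f (z + \<sigma> *\<^sub>R v + t *\<^sub>R w))) has_vector_derivative
        integral (cbox 0 s) (\<lambda>\<sigma>. dird w (dird v f) (z + \<sigma> *\<^sub>R v + 0 *\<^sub>R w))) (at 0 within ?U)"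
    proof (rule leibniz_rule_vector_derivative)
      show "((\<lambda>t. dird v f (z + \<sigma> *\<^sub>R v + t *\<^sub>R w)) has_vector_derivative
          dird w (dird v f) (z + \<sigma> *\<^sub>R v + t *\<^sub>R w)) (at t within ?U)"
        if "t \<in> ?U" "\<sigma> \<in> cbox 0 s" for t \<sigma>
      proof (rule has_vector_derivative_at_within[OF dw[OF cv]])
        show "\<bar>\<sigma>\<bar> < d" "\<bar>t\<bar> < d" using that s by (auto simp: abs_less_iff)
      qed
      show "(\<lambda>\<sigma>. dird v f (z + \<sigma> *\<^sub>R v + t *\<^sub>R w)) integrable_on cbox 0 s" if "t \<in> ?U" for t
      proof -
        have "\<bar>t\<bar> < d" using that by (auto simp: abs_less_iff)
        from has_integral_integrable[OF ftc[OF this]] show ?thesis by simp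
      qed
    qed (use cont[OF s(2)] d in simp_all)
    then have "((\<lambda>t. integral (cbox 0 s) (\<lambda>\<sigma>. dird v f (z + \<sigma> *\<^sub>R v + t *\<^sub>R w))) has_vector_derivative
        integral (cbox 0 s) (\<lambda>\<sigma>. dird w (dird v f) (z + \<sigma> *\<^sub>R v + 0 *\<^sub>R w))) (at 0)"
      using d by (simp add: at_within_open[of 0 ?U])
    then have "((\<lambda>t. f (z + s *\<^sub>R v + t *\<^sub>R w) - f (z + t *\<^sub>R w)) has_vector_derivative
        integral (cbox 0 s) (\<lambda>\<sigma>. dird w (dird v f) (z + \<sigma> *\<^sub>R v + 0 *\<^sub>R w))) (at 0)"
    proof (rule has_vector_derivative_transform_within_open[where S = ?U])
      show "integral (cbox 0 s) (\<lambda>\<sigma>. dird v f (z + \<sigma> *\<^sub>R v + t *\<^sub>R w))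
          = f (z + s *\<^sub>R v + t *\<^sub>R w) - f (z + t *\<^sub>R w)" if "t \<in> ?U" for t
      proof -
        have "\<bar>t\<bar> < d" using that by (auto simp: abs_less_iff)
        from integral_unique[OF ftc[OF this]] show ?thesis by simp
      qed
    qed (use d in simp_all)
    moreover have "((\<lambda>t. f (z + s *\<^sub>R v + t *\<^sub>R w) - f (z + t *\<^sub>R w)) has_vector_derivative
       dird w f (z + s *\<^sub>R v) - dird w f z) (at 0)"
      using has_vector_derivative_diff[OF dw[OF c1, of s 0] dw[OF c1, of 0 0]] s d by simp
    ultimately have "integral (cbox 0 s) (\<lambda>\<sigma>. dird w (dird v f) (z + \<sigma> *\<^sub>R v + 0 *\<^sub>R w)) = dird w f (z + s *\<^sub>R v) - dird w f z"
      by (rule vector_derivative_unique_at)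
    then show ?thesis by simp
  qed
  have "continuous_on {0..d/2} (\<lambda>\<sigma>. dird w (dird v f) (z + \<sigma> *\<^sub>R v))"
  proof (rule continuous_on_compose2[OF cwv])
    show "(\<lambda>\<sigma>. z + \<sigma> *\<^sub>R v) ` {0..d/2} \<subseteq> S" using inS[of _ 0] d by fastforce
  qed (intro continuous_intros)
  from has_vector_derivative_add[OF has_vector_derivative_const[of "dird w f z"] integral_has_vector_derivative[OF this, of 0]] d
  have "((\<lambda>s. dird w f z + integral {0..s} (\<lambda>\<sigma>. dird w (dird v f) (z + \<sigma> *\<^sub>R v))) has_vector_derivative
      dird w (dird v f) z) (at 0 within {0..d/2})"
    by simp
  then have "((\<lambda>s. dird w f (z + s *\<^sub>R v)) has_vector_derivative dird w (dird v f) z) (at 0 within {0..d/2})"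
    by (rule has_vector_derivative_transform[rotated 2]) (use d in \<open>simp_all add: eq\<close>)
  moreover have "((\<lambda>s. dird w f (z + s *\<^sub>R v)) has_vector_derivative dird v (dird w f) z) (at 0 within {0..d/2})"
    using has_vector_derivative_at_within[OF dv[OF cw, of 0 0]] d by simp
  ultimately show ?thesis
    by (intro vector_derivative_unique_within_closed_interval[of 0 "d/2" 0 "\<lambda>s. dird w f (z + s *\<^sub>R v)"])
      (use d in simp_all)
qed

section \<open>Integrals along a coordinate direction\<close>

lemma has_derivative_integral_param:
  fixes f :: "'a::euclidean_space \<Rightarrow> real \<Rightarrow> 'c::banach"
  assumes S: "open S" "x0 \<in> S"
    and d: "\<And>x t. x \<in> S \<Longrightarrow> t \<in> {a..b} \<Longrightarrow> ((\<lambda>x. f x t) has_derivative f' x t) (at x)"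
    and cf: "continuous_on (S \<times> {a..b}) (\<lambda>(x, t). f x t)"
    and cf': "\<And>v. continuous_on (S \<times> {a..b}) (\<lambda>(x, t). f' x t v)"
  shows "((\<lambda>x. integral {a..b} (f x)) has_derivative (\<lambda>v. integral {a..b} (\<lambda>t. f' x0 t v))) (at x0)"
proof -
  obtain r where r: "r > 0" "ball x0 r \<subseteq> S" using S open_contains_ball by blast
  let ?U = "ball x0 r"
  define F where "F x t = Blinfun (f' x t)" for x t
  have F: "blinfun_apply (F x t) = f' x t" if "x \<in> S" "t \<in> {a..b}" for x t
    unfolding F_def by (rule bounded_linear_Blinfun_apply[OF has_derivative_bounded_linear[OF d[OF that]]])
  have cF: "continuous_on (?U \<times> {a..b}) (\<lambda>(x, t). F x t)"
    unfolding continuous_on_eq_continuous_within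
  proof
    fix p assume p: "p \<in> ?U \<times> {a..b}"
    show "continuous (at p within ?U \<times> {a..b}) (\<lambda>(x, t). F x t)"
    proof (rule continuous_blinfun_componentwiseI1)
      fix i :: 'a
      have "continuous_on (?U \<times> {a..b}) (\<lambda>(x, t). f' x t i)"
        by (rule continuous_on_subset[OF cf']) (use r in blast)
      then have "continuous_on (?U \<times> {a..b}) (\<lambda>q. blinfun_apply (case q of (x, t) \<Rightarrow> F x t) i)"
        by (rule continuous_on_eq) (use F r in auto)
      then show "continuous (at p within ?U \<times> {a..b}) (\<lambda>q. blinfun_apply (case q of (x, t) \<Rightarrow> F x t) i)"
        using p unfolding continuous_on_eq_continuous_within by (rule bspec)
    qed
  qed
  have sl: "continuous_on {a..b} (f x)" if "x \<in> ?U" for x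
  proof -
    have "continuous_on {a..b} (\<lambda>t. case (x, t) of (x, t) \<Rightarrow> f x t)"
    proof (rule continuous_on_compose2[OF cf])
      show "(\<lambda>t. (x, t)) ` {a..b} \<subseteq> S \<times> {a..b}" using that r by blast
    qed (intro continuous_intros)
    then show ?thesis by simp
  qed
  have sF: "continuous_on {a..b} (F x)" if "x \<in> ?U" for x
  proof -
    have "continuous_on {a..b} (\<lambda>t. case (x, t) of (x, t) \<Rightarrow> F x t)"
    proof (rule continuous_on_compose2[OF cF])
      show "(\<lambda>t. (x, t)) ` {a..b} \<subseteq> ?U \<times> {a..b}" using that by blast
    qed (intro continuous_intros)
    then show ?thesis by simp
  qed
  have "((\<lambda>x. integral (cbox a b) (f x)) has_derivative blinfun_apply (integral (cbox a b) (F x0))) (at x0 within ?U)"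
  proof (rule leibniz_rule)
    fix x t assume "x \<in> ?U" "t \<in> cbox a b"
    then have "x \<in> S" "t \<in> {a..b}" using r by auto
    then show "((\<lambda>x. f x t) has_derivative blinfun_apply (F x t)) (at x within ?U)"
      using has_derivative_at_withinI[OF d] by (simp add: F)
  qed (use r sl cF in \<open>auto intro!: integrable_continuous_interval\<close>)
  then have "((\<lambda>x. integral {a..b} (f x)) has_derivative blinfun_apply (integral {a..b} (F x0))) (at x0)"
    using r by (simp add: at_within_open[of x0 ?U])
  moreover have "blinfun_apply (integral {a..b} (F x0)) = (\<lambda>v. integral {a..b} (\<lambda>t. f' x0 t v))"
  proof
    fix v
    have "blinfun_apply (integral {a..b} (F x0)) v = integral {a..b} (\<lambda>t. blinfun_apply (F x0 t) v)"
      by (rule blinfun_apply_integral) (use sF r in \<open>auto intro!: integrable_continuous_interval\<close>)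
    also have "\<dots> = integral {a..b} (\<lambda>t. f' x0 t v)"
      by (rule integral_cong) (simp add: F S)
    finally show "blinfun_apply (integral {a..b} (F x0)) v = integral {a..b} (\<lambda>t. f' x0 t v)" .
  qed
  ultimately show ?thesis by (simp only:)
qed

text \<open>\<open>tslide e s\<close> multiplies the component along the unit vector \<open>e\<close> by \<open>s\<close> and keeps the
  orthogonal ones; \<open>e\<close> is the direction of time, the hyperplane orthogonal to \<open>e\<close> carries the
  initial values, and \<open>tslide e 0\<close> is the projection to it. With this scaling, \<open>tint e f z\<close> is
  the integral of \<open>f\<close> from the hyperplane to \<open>z\<close> along \<open>e\<close>, as an integral over a fixed interval,
  for both signs of the time.\<close>

definition tslide :: "'a::euclidean_space \<Rightarrow> real \<Rightarrow> 'a \<Rightarrow> 'a" where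
  "tslide e s z = z + ((s - 1) * (z \<bullet> e)) *\<^sub>R e"

definition tint :: "'a::euclidean_space \<Rightarrow> ('a \<Rightarrow> 'b::real_normed_vector) \<Rightarrow> 'a \<Rightarrow> 'b" where
  "tint e f z = (z \<bullet> e) *\<^sub>R integral {0..1} (\<lambda>s. f (tslide e s z))"

lemma bounded_linear_tslide: "bounded_linear (tslide e s)"
proof -
  have "linear (tslide e s)"
    by (rule linearI) (simp_all add: tslide_def algebra_simps inner_add_left)
  then show ?thesis by (simp only: linear_conv_bounded_linear)
qed

lemma tslide_inner: "e \<bullet> e = 1 \<Longrightarrow> tslide e s z \<bullet> e = s * (z \<bullet> e)"
  by (simp add: tslide_def inner_add_left algebra_simps)

lemma tslide_add: "tslide e s (z + w) = tslide e s z + tslide e s w"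
  by (simp add: tslide_def inner_add_left algebra_simps)

lemma tslide_orth: "w \<bullet> e = 0 \<Longrightarrow> tslide e s w = w"
  by (simp add: tslide_def)

lemma tslide_time: "e \<bullet> e = 1 \<Longrightarrow> tslide e s (t *\<^sub>R e) = (s * t) *\<^sub>R e"
  by (simp add: tslide_def algebra_simps)

lemma tslide_tslide: "e \<bullet> e = 1 \<Longrightarrow> tslide e s (tslide e t z) = tslide e (s * t) z"
  by (simp add: tslide_def inner_add_left algebra_simps)

lemma continuous_on_tslide: "continuous_on S (\<lambda>(z, s). tslide e s z)"
  unfolding tslide_def split_beta by (intro continuous_intros)

text \<open>The weight \<open>q\<close> makes the induction work: a derivative in direction \<open>v\<close> is an integral of
  the same kind of derivatives of \<open>f\<close> in the directions \<open>v\<close> and \<open>e\<close>, where the latter picks up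
  the factor \<open>s - 1\<close>.\<close>

lemma ck_tslide_integral:
  fixes f :: "'a::euclidean_space \<Rightarrow> 'b::banach"
  assumes S: "open S" "\<And>z s. z \<in> S \<Longrightarrow> s \<in> {0..1} \<Longrightarrow> tslide e s z \<in> S"
  shows "ck k S f \<Longrightarrow> continuous_on {0..1} q \<Longrightarrow> ck k S (\<lambda>z. integral {0..1} (\<lambda>s. q s *\<^sub>R f (tslide e s z)))"
proof (induction k arbitrary: f q)
  have c: "continuous_on (S \<times> {0..1}) (\<lambda>(z, s). q s *\<^sub>R f (tslide e s z))"
    if "continuous_on S f" "continuous_on {0..1} q" for f :: "'a \<Rightarrow> 'b" and q :: "real \<Rightarrow> real"
    unfolding split_beta
  proof (intro continuous_on_scaleR)
    show "continuous_on (S \<times> {0..1}) (\<lambda>p. q (snd p))"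
      by (rule continuous_on_compose2[OF that(2)]) (auto intro!: continuous_intros)
    show "continuous_on (S \<times> {0..1}) (\<lambda>p. f (tslide e (snd p) (fst p)))"
      by (rule continuous_on_compose2[OF that(1)])
        (use S continuous_on_tslide[of "S \<times> {0..1}" e] in \<open>auto simp: split_beta\<close>)
  qed
  {
    case 0
    then show ?case using integral_continuous_on_param[of S 0 1 "\<lambda>z s. q s *\<^sub>R f (tslide e s z)"] c by simp
  next
    case (Suc k)
    let ?q' = "\<lambda>s. q s * (s - 1)"
    have q': "continuous_on {0..1} ?q'" using Suc.prems(2) by (intro continuous_intros)
    have cd: "continuous_on S (dird v f)" for v
      using Suc.prems(1) ck_continuous_on[of k S "dird v f"] by simp
    have lin: "dird (tslide e s v) f y = dird v f y + ((s - 1) * (v \<bullet> e)) *\<^sub>R dird e f y" if "y \<in> S" for s v y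
    proof -
      have "linear (\<lambda>w. dird w f y)"
        using ck_Suc_has_derivative[OF Suc.prems(1) that] has_derivative_linear by blast
      from linear_add[OF this] linear_cmul[OF this] show ?thesis unfolding tslide_def by simp
    qed
    show ?case
    proof (rule ck_SucI[OF S(1) has_derivative_integral_param[OF S(1)]])
      fix x t assume x: "x \<in> S" "t \<in> {0..1::real}"
      have "((\<lambda>x. f (tslide e t x)) has_derivative (\<lambda>v. dird (tslide e t v) f (tslide e t x))) (at x)"
        by (rule has_derivative_compose[OF bounded_linear_imp_has_derivative[OF bounded_linear_tslide]
            ck_Suc_has_derivative[OF Suc.prems(1) S(2)[OF x]]])
      then show "((\<lambda>x. q t *\<^sub>R f (tslide e t x)) has_derivative (\<lambda>v. q t *\<^sub>R dird (tslide e t v) f (tslide e t x))) (at x)"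
        by (rule has_derivative_scaleR_right)
    next
      show "continuous_on (S \<times> {0..1}) (\<lambda>(x, t). q t *\<^sub>R f (tslide e t x))"
        using c Suc.prems ck_continuous_on by blast
    next
      fix v
      have "continuous_on (S \<times> {0..1}) (\<lambda>p. (\<lambda>(x, t). q t *\<^sub>R dird v f (tslide e t x)) p
          + (v \<bullet> e) *\<^sub>R (\<lambda>(x, t). ?q' t *\<^sub>R dird e f (tslide e t x)) p)"
        by (intro continuous_on_add continuous_on_scaleR continuous_on_const c cd q' Suc.prems)
      then show "continuous_on (S \<times> {0..1}) (\<lambda>(x, t). q t *\<^sub>R dird (tslide e t v) f (tslide e t x))"
        by (rule continuous_on_eq) (use S(2) in \<open>auto simp: lin algebra_simps\<close>)
    next
      fix v
      have eq: "integral {0..1} (\<lambda>t. q t *\<^sub>R dird (tslide e t v) f (tslide e t x))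
          = integral {0..1} (\<lambda>t. q t *\<^sub>R dird v f (tslide e t x))
            + (v \<bullet> e) *\<^sub>R integral {0..1} (\<lambda>t. ?q' t *\<^sub>R dird e f (tslide e t x))" if "x \<in> S" for x
      proof -
        have sl: "continuous_on {0..1} (\<lambda>t. q t *\<^sub>R g (tslide e t x))"
          if "continuous_on S g" "continuous_on {0..1} q" for g :: "'a \<Rightarrow> 'b" and q :: "real \<Rightarrow> real"
        proof -
          have "continuous_on {0..1} (\<lambda>t. case (x, t) of (z, s) \<Rightarrow> q s *\<^sub>R g (tslide e s z))"
          proof (rule continuous_on_compose2[OF c[OF that]])
            show "(\<lambda>t. (x, t)) ` {0..1} \<subseteq> S \<times> {0..1}" using \<open>x \<in> S\<close> by blast
          qed (intro continuous_intros)
          then show ?thesis by simp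
        qed
        have i: "(\<lambda>t. q t *\<^sub>R dird v f (tslide e t x)) integrable_on {0..1}"
          "(\<lambda>t. ?q' t *\<^sub>R dird e f (tslide e t x)) integrable_on {0..1}"
          by (rule integrable_continuous_interval[OF sl[OF cd Suc.prems(2)]])
             (rule integrable_continuous_interval[OF sl[OF cd q']])
        have "integral {0..1} (\<lambda>t. q t *\<^sub>R dird (tslide e t v) f (tslide e t x))
            = integral {0..1} (\<lambda>t. q t *\<^sub>R dird v f (tslide e t x) + (v \<bullet> e) *\<^sub>R (?q' t *\<^sub>R dird e f (tslide e t x)))"
          by (rule integral_cong) (use S(2) that in \<open>simp add: lin algebra_simps\<close>)
        also have "\<dots> = integral {0..1} (\<lambda>t. q t *\<^sub>R dird v f (tslide e t x))
            + (v \<bullet> e) *\<^sub>R integral {0..1} (\<lambda>t. ?q' t *\<^sub>R dird e f (tslide e t x))"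
          by (simp only: integral_add[OF i(1) integrable_cmul[OF i(2)]] integral_cmul)
        finally show ?thesis .
      qed
      have "ck k S (\<lambda>x. integral {0..1} (\<lambda>t. q t *\<^sub>R dird v f (tslide e t x))
            + (v \<bullet> e) *\<^sub>R integral {0..1} (\<lambda>t. ?q' t *\<^sub>R dird e f (tslide e t x)))"
        by (intro ck_add[OF S(1)] ck_scaleR[OF S(1)] ck_const[OF S(1)] Suc.IH q' Suc.prems(2))
           (use Suc.prems(1) in auto)
      then show "ck k S (\<lambda>x. integral {0..1} (\<lambda>t. q t *\<^sub>R dird (tslide e t v) f (tslide e t x)))"
        by (subst ck_cong[OF S(1) eq])
    qed
  }
qed

lemma ck_tint:
  fixes f :: "'a::euclidean_space \<Rightarrow> 'b::banach"
  assumes S: "open S" "\<And>z s. z \<in> S \<Longrightarrow> s \<in> {0..1} \<Longrightarrow> tslide e s z \<in> S" and "ck k S f"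
  shows "ck k S (tint e f)"
proof -
  have "ck k S (\<lambda>z. integral {0..1} (\<lambda>s. 1 *\<^sub>R f (tslide e s z)))"
    by (rule ck_tslide_integral[OF S assms(3)]) auto
  then have "ck k S (\<lambda>z. (z \<bullet> e) *\<^sub>R integral {0..1} (\<lambda>s. f (tslide e s z)))"
    using S(1) by (intro ck_scaleR) (simp_all add: ck_bounded_linear bounded_linear_inner_left)
  then show ?thesis by (simp add: tint_def[abs_def])
qed

lemma continuous_on_tint:
  fixes f :: "'a::euclidean_space \<Rightarrow> 'b::banach"
  assumes "\<And>z s. z \<in> S \<Longrightarrow> s \<in> {0..1} \<Longrightarrow> tslide e s z \<in> S" and f: "continuous_on S f"
  shows "continuous_on S (tint e f)"
proof -
  have "continuous_on (S \<times> {0..1}) (\<lambda>p. f (tslide e (snd p) (fst p)))"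
    by (rule continuous_on_compose2[OF f])
      (use assms continuous_on_tslide[of "S \<times> {0..1}" e] in \<open>auto simp: split_beta\<close>)
  then have "continuous_on S (\<lambda>z. integral (cbox 0 1) (\<lambda>s. f (tslide e s z)))"
    by (intro integral_continuous_on_param) (simp add: split_beta)
  then show ?thesis unfolding tint_def by (intro continuous_intros) simp_all
qed

text \<open>Substitution in an integral over a segment from 0 to \<open>x\<close>, where \<open>x\<close> may have either sign.\<close>

lemma scaled_integral_eq:
  fixes g :: "real \<Rightarrow> 'b::banach"
  assumes H: "\<And>x. x \<in> {a..b} \<Longrightarrow> (H has_vector_derivative g x) (at x within {a..b})"
    and "0 \<in> {a..b}" "x \<in> {a..b}"
  shows "x *\<^sub>R integral {0..1} (\<lambda>s. g (s * x)) = H x - H 0"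
proof -
  have img: "(\<lambda>s. s * x) ` {0..1} \<subseteq> {a..b}"
  proof (rule image_subsetI)
    fix s :: real assume "s \<in> {0..1}"
    then have "(1 - s) *\<^sub>R 0 + s *\<^sub>R x \<in> {a..b}"
      by (intro convexD_alt[of "{a..b}"]) (use assms in auto)
    then show "s * x \<in> {a..b}" by simp
  qed
  have cont: "continuous_on {a..b} H"
    using H by (meson continuous_on_vector_derivative)
  have "((\<lambda>s. x *\<^sub>R g (s * x)) has_integral H (1 * x) - H (0 * x)) {0..1}"
  proof (rule fundamental_theorem_of_calculus)
    fix s :: real assume s: "s \<in> {0..1}"
    have "((\<lambda>s. s * x) has_vector_derivative x) (at s within {0..1})"
      by (auto intro!: derivative_eq_intros simp: has_vector_derivative_def)
    moreover have "(H has_vector_derivative g (s * x)) (at (s * x) within (\<lambda>s. s * x) ` {0..1})"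
      using has_vector_derivative_within_subset[OF H img] img s by blast
    ultimately show "((\<lambda>s. H (s * x)) has_vector_derivative x *\<^sub>R g (s * x)) (at s within {0..1})"
      using vector_diff_chain_within[of "\<lambda>s. s * x" x s "{0..1}" H "g (s * x)"] by (simp add: o_def)
  qed simp
  from integral_unique[OF this] show ?thesis by simp
qed

lemma tint_line_derivative:
  fixes f :: "'a::euclidean_space \<Rightarrow> 'b::banach"
  assumes e: "e \<bullet> e = 1" and f: "continuous_on S f" and z: "z \<bullet> e = 0"
    and S: "\<And>t. \<bar>t\<bar> < T \<Longrightarrow> z + t *\<^sub>R e \<in> S" and t: "\<bar>t\<bar> < T"
  shows "((\<lambda>t. tint e f (z + t *\<^sub>R e)) has_vector_derivative f (z + t *\<^sub>R e)) (at t)"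
proof -
  define R where "R = (\<bar>t\<bar> + T) / 2"
  have R: "\<bar>t\<bar> < R" "R < T" "0 < R" using t by (auto simp: R_def)
  have "continuous_on {-R..R} (\<lambda>t. f (z + t *\<^sub>R e))"
  proof (rule continuous_on_compose2[OF f])
    show "(\<lambda>t. z + t *\<^sub>R e) ` {-R..R} \<subseteq> S" using S R by fastforce
  qed (intro continuous_intros)
  then obtain H where H: "\<And>x. x \<in> {-R..R} \<Longrightarrow> (H has_vector_derivative f (z + x *\<^sub>R e)) (at x within {-R..R})"
    using antiderivative_continuous by blast
  have eq: "H x - H 0 = tint e f (z + x *\<^sub>R e)" if "x \<in> {-R<..<R}" for x
  proof -
    have "H x - H 0 = x *\<^sub>R integral {0..1} (\<lambda>s. f (z + (s * x) *\<^sub>R e))"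
      by (rule scaled_integral_eq[OF H, symmetric]) (use that R in auto)
    then show ?thesis
      using e z by (simp add: tint_def inner_add_left tslide_add tslide_orth tslide_time)
  qed
  have ti: "t \<in> interior {-R..R}" using R by (auto simp: abs_less_iff)
  have "t \<in> {-R..R}" using R by (auto simp: abs_less_iff)
  from H[OF this] have "(H has_vector_derivative f (z + t *\<^sub>R e)) (at t)"
    unfolding at_within_interior[OF ti] .
  from has_vector_derivative_diff[OF this has_vector_derivative_const[of "H 0"]]
  have "((\<lambda>x. H x - H 0) has_vector_derivative f (z + t *\<^sub>R e)) (at t)" by simp
  then show ?thesis
  proof (rule has_vector_derivative_transform_within_open[of _ _ _ "{-R<..<R}"])
    show "t \<in> {-R<..<R}" using R by (auto simp: abs_less_iff)
  qed (simp_all only: eq open_greaterThanLessThan)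
qed

lemma line_increment:
  fixes f g :: "'a::euclidean_space \<Rightarrow> 'b::banach"
  assumes e: "e \<bullet> e = 1" and g: "continuous_on S g" and z: "z \<bullet> e = 0"
    and S: "\<And>t. \<bar>t\<bar> < T \<Longrightarrow> z + t *\<^sub>R e \<in> S" and t: "\<bar>t\<bar> < T"
    and d: "\<And>t. \<bar>t\<bar> < T \<Longrightarrow> ((\<lambda>t. f (z + t *\<^sub>R e)) has_vector_derivative g (z + t *\<^sub>R e)) (at t)"
  shows "f (z + t *\<^sub>R e) = f z + tint e g (z + t *\<^sub>R e)"
proof -
  let ?h = "\<lambda>t. f (z + t *\<^sub>R e) - tint e g (z + t *\<^sub>R e)"
  have "\<exists>c. \<forall>t\<in>{-T<..<T}. ?h t = c"
  proof (rule has_derivative_zero_constant)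
    fix x assume "x \<in> {-T<..<T}"
    then have x: "\<bar>x\<bar> < T" by auto
    have "(?h has_vector_derivative 0) (at x)"
      using has_vector_derivative_diff[OF d[OF x] tint_line_derivative[OF e g z S x]] by simp
    then show "(?h has_derivative (\<lambda>h. 0)) (at x within {-T<..<T})"
      by (simp add: has_vector_derivative_def has_derivative_at_withinI)
  qed simp
  then obtain c where c: "\<And>t. t \<in> {-T<..<T} \<Longrightarrow> ?h t = c" by blast
  have "?h t = ?h 0" using c[of t] c[of 0] t by (simp add: abs_less_iff)
  moreover have "tint e g z = 0" using z by (simp add: tint_def)
  ultimately show ?thesis by (simp add: algebra_simps)
qed

section \<open>Inverse matrices, local inverses and potentials\<close>

lemma ck_prod:
  fixes f :: "'i \<Rightarrow> 'a::euclidean_space \<Rightarrow> real"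
  assumes "open S"
  shows "(\<And>i. i \<in> I \<Longrightarrow> ck k S (f i)) \<Longrightarrow> ck k S (\<lambda>x. \<Prod>i\<in>I. f i x)"
  by (induction I rule: infinite_finite_induct) (simp_all add: ck_const ck_mult assms)

text \<open>By the rule of Cramer, the entries are quotients of determinants.\<close>

lemma ck_matrix_inv:
  fixes A :: "'a::euclidean_space \<Rightarrow> real ^ 'n ^ 'n"
  assumes S: "open S" and A: "ck k S A" "\<And>x. x \<in> S \<Longrightarrow> invertible (A x)"
  shows "ck k S (\<lambda>x. matrix_inv (A x))"
proof (intro ck_vec[OF S])
  fix i j
  let ?B = "\<lambda>x. \<chi> k l. if l = i then axis j 1 $ k else A x $ k $ l"
  have entry: "ck k S (\<lambda>x. A x $ p $ q)" for p q
    by (intro ck_vec_nth[OF S] A)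
  have det: "ck k S (\<lambda>x. det (M x))" if "\<And>p q. ck k S (\<lambda>x. M x $ p $ q)" for M :: "'a \<Rightarrow> real ^ 'n ^ 'n"
    unfolding det_def by (intro ck_sum[OF S] ck_mult[OF S] ck_const[OF S] ck_prod[OF S] that)
  have eq: "matrix_inv (A x) $ i $ j = det (?B x) * inverse (det (A x))" if "x \<in> S" for x
  proof -
    have inv: "invertible (A x)" and d: "det (A x) \<noteq> 0"
      using A(2)[OF that] by (auto simp: invertible_det_nz)
    have "A x *v (matrix_inv (A x) *v axis j 1) = axis j 1"
      using matrix_inv_mult(1)[OF inv] by (simp add: matrix_vector_mul_assoc)
    then have "(matrix_inv (A x) *v axis j 1) $ i = det (?B x) / det (A x)"
      using cramer[OF d] by auto
    then show ?thesis by (simp add: matrix_vector_mult_basis column_def divide_inverse)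
  qed
  have B: "ck k S (\<lambda>x. ?B x $ p $ q)" for p q
    by (cases "q = i") (simp_all add: ck_const[OF S] entry)
  have "ck k S (\<lambda>x. inverse (det (A x)))"
    by (rule ck_compose[OF S _ ck_inverse det[OF entry]]) (use A(2) in \<open>auto simp: invertible_det_nz\<close>)
  then have "ck k S (\<lambda>x. det (?B x) * inverse (det (A x)))"
    by (intro ck_mult[OF S] det B)
  then show "ck k S (\<lambda>x. matrix_inv (A x) $ i $ j)"
    by (subst ck_cong[OF S eq])
qed

lemma smooth_on_matrix_inv:
  fixes A :: "'a::euclidean_space \<Rightarrow> real ^ 'n ^ 'n"
  assumes "open S" "smooth_on S A" "\<And>x. x \<in> S \<Longrightarrow> invertible (A x)"
  shows "smooth_on S (\<lambda>x. matrix_inv (A x))"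
  using assms ck_matrix_inv[OF assms(1) _ assms(3)] by (simp add: smooth_on_iff_ck)

lemma bounded_bilinear_matrix_mult: "bounded_bilinear ((**) :: real ^ 'n ^ 'm \<Rightarrow> real ^ 'p ^ 'n \<Rightarrow> real ^ 'p ^ 'm)"
proof -
  have "bilinear ((**) :: real ^ 'n ^ 'm \<Rightarrow> real ^ 'p ^ 'n \<Rightarrow> real ^ 'p ^ 'm)"
    unfolding bilinear_def
    by (intro conjI allI linearI)
       (simp_all add: vec_eq_iff matrix_matrix_mult_def algebra_simps sum.distrib sum_distrib_left)
  then show ?thesis by (simp only: bilinear_conv_bounded_bilinear)
qed

lemma bounded_bilinear_matrix_vector_mult: "bounded_bilinear ((*v) :: real ^ 'n ^ 'm \<Rightarrow> real ^ 'n \<Rightarrow> real ^ 'm)"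
proof -
  have "bilinear ((*v) :: real ^ 'n ^ 'm \<Rightarrow> real ^ 'n \<Rightarrow> real ^ 'm)"
    unfolding bilinear_def
    by (intro conjI allI linearI)
       (simp_all add: vec_eq_iff matrix_vector_mult_def algebra_simps sum.distrib sum_distrib_left)
  then show ?thesis by (simp only: bilinear_conv_bounded_bilinear)
qed

definition jac :: "(real ^ 'n \<Rightarrow> real ^ 'm) \<Rightarrow> real ^ 'n \<Rightarrow> real ^ 'n ^ 'm" where
  "jac f x = (\<chi> i j. dird (axis j 1) f x $ i)"

lemma jac_mult:
  assumes "f differentiable (at x)"
  shows "jac f x *v w = dird w f x"
proof -
  have l: "linear (\<lambda>w. dird w f x)"
    using differentiable_has_derivative_dird[OF assms] has_derivative_linear by blast
  have "dird w f x = dird (\<Sum>j\<in>UNIV. (w $ j) *\<^sub>R axis j 1) f x"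
    by (subst basis_expansion[symmetric, of w]) (simp add: scalar_mult_eq_scaleR)
  also have "\<dots> = (\<Sum>j\<in>UNIV. (w $ j) *\<^sub>R dird (axis j 1) f x)"
    using linear_sum[OF l, of "\<lambda>j. (w $ j) *\<^sub>R axis j 1" UNIV] linear_cmul[OF l] by simp
  finally show ?thesis
    by (simp add: vec_eq_iff jac_def matrix_vector_mult_def mult.commute)
qed

lemma ck_jac:
  assumes "open S" "ck (Suc k) S f"
  shows "ck k S (jac f)"
  unfolding jac_def using assms by (intro ck_vec[OF assms(1)]) (simp add: ck_vec_nth)

text \<open>The inverse function theorem gives a differentiable inverse \<open>g\<close> with derivative
  \<open>jac f (g y)\<^sup>-\<^sup>1\<close>. If \<open>g\<close> is \<open>C\<^sup>k\<close> then so is this derivative, and \<open>g\<close> is \<open>C\<^sup>k\<^sup>+\<^sup>1\<close>.\<close>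

lemma smooth_local_inverse:
  fixes f :: "real ^ 'n \<Rightarrow> real ^ 'n"
  assumes S: "open S" "x0 \<in> S" and f: "smooth_on S f"
    and inj: "\<And>w. dird w f x0 = 0 \<Longrightarrow> w = 0"
  obtains U V g where "open U" "x0 \<in> U" "U \<subseteq> S" "open V" "f ` U = V"
    "\<And>x. x \<in> U \<Longrightarrow> g (f x) = x" "\<And>y. y \<in> V \<Longrightarrow> g y \<in> U \<and> f (g y) = y" "smooth_on V g"
proof -
  define F where "F x = Blinfun (\<lambda>v. dird v f x)" for x
  have F: "blinfun_apply (F x) = (\<lambda>v. dird v f x)" if "x \<in> S" for x
    unfolding F_def by (rule bounded_linear_Blinfun_apply[OF has_derivative_bounded_linear[OF smooth_on_has_derivative[OF f that]]])
  have cF: "continuous_on S F"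
    unfolding continuous_on_eq_continuous_within
  proof
    fix p assume p: "p \<in> S"
    show "continuous (at p within S) F"
    proof (rule continuous_blinfun_componentwiseI1)
      fix i :: "real ^ 'n"
      have "continuous_on S (dird i f)"
        by (rule smooth_on_continuous_on[OF smooth_on_dird[OF f]])
      then have "continuous_on S (\<lambda>x. blinfun_apply (F x) i)"
        by (rule continuous_on_eq) (use F in auto)
      then show "continuous (at p within S) (\<lambda>x. blinfun_apply (F x) i)"
        using p unfolding continuous_on_eq_continuous_within by (rule bspec)
    qed
  qed
  have "linear (blinfun_apply (F x0))" by (rule bounded_linear.linear[OF blinfun.bounded_linear_right])
  moreover have "inj (blinfun_apply (F x0))"
    using inj linear_injective_0[OF calculation] F[OF S(2)] by auto
  ultimately obtain h where h: "linear h" "h \<circ> blinfun_apply (F x0) = id"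
    using linear_injective_left_inverse by blast
  define invf where "invf = Blinfun h"
  have "blinfun_apply invf = h"
    using h(1) by (simp add: invf_def bounded_linear_Blinfun_apply linear_conv_bounded_linear)
  then have invf: "invf o\<^sub>L F x0 = id_blinfun"
    using h(2) by (intro blinfun_eqI) (simp add: fun_eq_iff)
  have D: "(f has_derivative blinfun_apply (F x)) (at x)" if "x \<in> S" for x
    using smooth_on_has_derivative[OF f that] by (simp only: F[OF that])
  obtain U V g g' where g: "open U" "U \<subseteq> S" "x0 \<in> U" "open V" "f x0 \<in> V" "homeomorphism U V f g"
    "\<And>y. y \<in> V \<Longrightarrow> (g has_derivative (g' y)) (at y)"
    "\<And>y. y \<in> V \<Longrightarrow> g' y = inv (blinfun_apply (F (g y)))"
    "\<And>y. y \<in> V \<Longrightarrow> bij (blinfun_apply (F (g y)))"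
    by (rule inverse_function_theorem[OF S(1) D cF S(2) invf]) (assumption | rule that)+
  have gU: "g y \<in> S" if "y \<in> V" for y using g(2,6) that by (auto simp: homeomorphism_def)
  have invg: "invertible (jac f (g y))" "g' y v = matrix_inv (jac f (g y)) *v v" if "y \<in> V" for y v
  proof -
    have J: "blinfun_apply (F (g y)) = (\<lambda>w. jac f (g y) *v w)"
      using F[OF gU[OF that]] jac_mult[OF smooth_on_differentiable[OF f gU[OF that]]] by (simp add: fun_eq_iff)
    have "inj ((*v) (jac f (g y)))" using g(9)[OF that] by (simp add: J bij_def)
    then show I: "invertible (jac f (g y))"
      using matrix_left_invertible_injective invertible_left_inverse by blast
    have "jac f (g y) *v g' y v = v"
      using g(8,9)[OF that] by (simp add: J[symmetric] bij_def surj_f_inv_f)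
    then have "matrix_inv (jac f (g y)) *v (jac f (g y) *v g' y v) = matrix_inv (jac f (g y)) *v v" by simp
    then show "g' y v = matrix_inv (jac f (g y)) *v v"
      by (simp add: matrix_vector_mul_assoc matrix_inv_mult(2)[OF I])
  qed
  have "ck k V g" for k
  proof (induction k)
    case 0
    then show ?case using g(6) by (simp add: homeomorphism_def)
  next
    case (Suc k)
    have "ck (Suc k) S f" using f unfolding smooth_on_iff_ck by blast
    from ck_jac[OF S(1) this] have "ck k S (jac f)" .
    then have "ck k V (\<lambda>y. jac f (g y))"
      by (rule ck_compose[OF g(4) S(1) _ Suc gU])
    then have "ck k V (\<lambda>y. matrix_inv (jac f (g y)))"
      by (rule ck_matrix_inv[OF g(4) _ invg(1)])
    then have c: "ck k V (\<lambda>y. matrix_inv (jac f (g y)) *v v)" for v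
      by (rule ck_bilinear[OF bounded_bilinear_matrix_vector_mult g(4) _ ck_const[OF g(4)]])
    show ?case
      by (rule ck_SucI[OF g(4) g(7)]) (use c ck_cong[OF g(4) invg(2)] in auto)
  qed
  then have "smooth_on V g" by (simp add: smooth_on_iff_ck)
  show ?thesis
    by (rule that[of U V g]) (use g(1-6) \<open>smooth_on V g\<close> in \<open>auto simp: homeomorphism_def\<close>)
qed

text \<open>The potential of the lemma of Poincare is the integral of \<open>b\<close> along the segments from the
  centre. Closedness turns the integrand of its derivative into the derivative of
  \<open>s b(x0 + s (x - x0))\<close> with respect to \<open>s\<close>.\<close>

lemma closed_form_potential:
  fixes b :: "real ^ 'n \<Rightarrow> real ^ 'n"
  assumes r: "r > 0" and b: "smooth_on (ball x0 r) b"
    and closed: "\<And>x v w. x \<in> ball x0 r \<Longrightarrow> dird v b x \<bullet> w = dird w b x \<bullet> v"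
  obtains U where "smooth_on (ball x0 r) U" "\<And>x v. x \<in> ball x0 r \<Longrightarrow> (U has_derivative (\<lambda>v. b x \<bullet> v)) (at x)"
proof -
  let ?S = "ball x0 r"
  define U where "U x = integral {0..1} (\<lambda>s. b (x0 + s *\<^sub>R (x - x0)) \<bullet> (x - x0))" for x
  have inS: "x0 + s *\<^sub>R (x - x0) \<in> ?S" if "x \<in> ?S" "s \<in> {0..1}" for x s
  proof -
    have "(1 - s) *\<^sub>R x0 + s *\<^sub>R x \<in> ?S"
      by (rule convexD_alt[OF convex_ball]) (use that r in auto)
    then show ?thesis by (simp add: algebra_simps)
  qed
  have cont: "continuous_on (?S \<times> {0..1}) (\<lambda>p. g (x0 + snd p *\<^sub>R (fst p - x0)))"
    if "continuous_on ?S g" for g :: "real ^ 'n \<Rightarrow> real ^ 'n"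
    by (rule continuous_on_compose2[OF that]) (use inS in \<open>auto intro!: continuous_intros simp del: mem_ball\<close>)
  have cb: "continuous_on ?S b" and cdb: "continuous_on ?S (dird v b)" for v
    using smooth_on_continuous_on[OF b] smooth_on_continuous_on[OF smooth_on_dird[OF b]] by auto
  have lin: "dird (s *\<^sub>R v) b y = s *\<^sub>R dird v b y" if "y \<in> ?S" for s v y
    using has_derivative_linear[OF smooth_on_has_derivative[OF b that]] linear_cmul by blast
  have U: "(U has_derivative (\<lambda>v. b x \<bullet> v)) (at x)" if x: "x \<in> ?S" for x
  proof -
    have "(U has_derivative (\<lambda>v. integral {0..1} (\<lambda>s. b (x0 + s *\<^sub>R (x - x0)) \<bullet> v
        + dird (s *\<^sub>R v) b (x0 + s *\<^sub>R (x - x0)) \<bullet> (x - x0)))) (at x)"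
      unfolding U_def[abs_def]
    proof (rule has_derivative_integral_param[OF open_ball x])
      fix y and s :: real assume y: "y \<in> ?S" "s \<in> {0..1}"
      have "((\<lambda>x. x0 + s *\<^sub>R (x - x0)) has_derivative (\<lambda>v. s *\<^sub>R v)) (at y)"
        by (auto intro!: derivative_eq_intros)
      from has_derivative_compose[OF this smooth_on_has_derivative[OF b inS[OF y]]]
      have 1: "((\<lambda>x. b (x0 + s *\<^sub>R (x - x0))) has_derivative (\<lambda>v. dird (s *\<^sub>R v) b (x0 + s *\<^sub>R (y - x0)))) (at y)" .
      have 2: "((\<lambda>x. x - x0) has_derivative (\<lambda>v. v)) (at y)"
        by (auto intro!: derivative_eq_intros)
      show "((\<lambda>x. b (x0 + s *\<^sub>R (x - x0)) \<bullet> (x - x0)) has_derivative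
          (\<lambda>v. b (x0 + s *\<^sub>R (y - x0)) \<bullet> v + dird (s *\<^sub>R v) b (x0 + s *\<^sub>R (y - x0)) \<bullet> (y - x0))) (at y)"
        by (rule has_derivative_inner[OF 1 2])
    next
      show "continuous_on (?S \<times> {0..1}) (\<lambda>(x, s). b (x0 + s *\<^sub>R (x - x0)) \<bullet> (x - x0))"
        unfolding split_beta by (intro continuous_intros cont[OF cb])
    next
      fix v
      have "continuous_on (?S \<times> {0..1}) (\<lambda>p. b (x0 + snd p *\<^sub>R (fst p - x0)) \<bullet> v
          + snd p * (dird v b (x0 + snd p *\<^sub>R (fst p - x0)) \<bullet> (fst p - x0)))"
        by (intro continuous_intros cont[OF cb] cont[OF cdb])
      then show "continuous_on (?S \<times> {0..1}) (\<lambda>(x, s). b (x0 + s *\<^sub>R (x - x0)) \<bullet> v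
        + dird (s *\<^sub>R v) b (x0 + s *\<^sub>R (x - x0)) \<bullet> (x - x0))"
        by (rule continuous_on_eq) (use inS lin in \<open>auto simp del: mem_ball\<close>)
    qed
    moreover have "integral {0..1} (\<lambda>s. b (x0 + s *\<^sub>R (x - x0)) \<bullet> v
        + dird (s *\<^sub>R v) b (x0 + s *\<^sub>R (x - x0)) \<bullet> (x - x0)) = b x \<bullet> v" for v
    proof -
      have "((\<lambda>s. b (x0 + s *\<^sub>R (x - x0)) \<bullet> v + dird (s *\<^sub>R v) b (x0 + s *\<^sub>R (x - x0)) \<bullet> (x - x0))
        has_integral 1 * (b (x0 + 1 *\<^sub>R (x - x0)) \<bullet> v) - 0 * (b (x0 + 0 *\<^sub>R (x - x0)) \<bullet> v)) {0..1}"
      proof (rule fundamental_theorem_of_calculus)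
        fix s :: real assume s: "s \<in> {0..1}"
        have 1: "((\<lambda>s. x0 + s *\<^sub>R (x - x0)) has_derivative (\<lambda>h. h *\<^sub>R (x - x0))) (at s)"
          by (auto intro!: derivative_eq_intros)
        from has_derivative_compose[OF this smooth_on_has_derivative[OF b inS[OF x s]]]
        have 2: "((\<lambda>s. b (x0 + s *\<^sub>R (x - x0))) has_derivative (\<lambda>h. dird (h *\<^sub>R (x - x0)) b (x0 + s *\<^sub>R (x - x0)))) (at s)" .
        have "((\<lambda>s. s * (b (x0 + s *\<^sub>R (x - x0)) \<bullet> v)) has_derivative
           (\<lambda>h. s * (dird (h *\<^sub>R (x - x0)) b (x0 + s *\<^sub>R (x - x0)) \<bullet> v) + h * (b (x0 + s *\<^sub>R (x - x0)) \<bullet> v))) (at s)"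
          by (rule has_derivative_mult[OF has_derivative_ident has_derivative_inner_left[OF 2]])
        then have "((\<lambda>s. s * (b (x0 + s *\<^sub>R (x - x0)) \<bullet> v)) has_vector_derivative
           b (x0 + s *\<^sub>R (x - x0)) \<bullet> v + dird (s *\<^sub>R v) b (x0 + s *\<^sub>R (x - x0)) \<bullet> (x - x0)) (at s)"
          unfolding has_vector_derivative_def
        proof (rule has_derivative_eq_rhs)
          define y where "y = x - x0"
          define Y where "Y = x0 + s *\<^sub>R y"
          have Y: "Y \<in> ?S" using inS[OF x s] by (simp only: Y_def y_def)
          show "(\<lambda>h. s * (dird (h *\<^sub>R (x - x0)) b (x0 + s *\<^sub>R (x - x0)) \<bullet> v) + h * (b (x0 + s *\<^sub>R (x - x0)) \<bullet> v))
            = (\<lambda>h. h *\<^sub>R (b (x0 + s *\<^sub>R (x - x0)) \<bullet> v + dird (s *\<^sub>R v) b (x0 + s *\<^sub>R (x - x0)) \<bullet> (x - x0)))"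
            unfolding y_def[symmetric] unfolding Y_def[symmetric] lin[OF Y] inner_scaleR_left closed[OF Y, of y v]
            by (simp add: algebra_simps)
        qed
        then show "((\<lambda>s. s * (b (x0 + s *\<^sub>R (x - x0)) \<bullet> v)) has_vector_derivative
           b (x0 + s *\<^sub>R (x - x0)) \<bullet> v + dird (s *\<^sub>R v) b (x0 + s *\<^sub>R (x - x0)) \<bullet> (x - x0)) (at s within {0..1})"
          by (rule has_vector_derivative_at_within)
      qed simp
      from integral_unique[OF this] show ?thesis by simp
    qed
    ultimately show ?thesis by simp
  qed
  have "ck k ?S U" for k
  proof (cases k)
    case 0
    then show ?thesis using U by (auto intro!: has_derivative_continuous continuous_at_imp_continuous_on)
  next
    case (Suc j)
    have "ck j ?S b" using b by (simp add: smooth_on_iff_ck)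
    then have c: "ck j ?S (\<lambda>x. b x \<bullet> v)" for v
      by (rule ck_linear_comp[OF bounded_linear_inner_left open_ball])
    show ?thesis unfolding Suc by (rule ck_SucI[OF open_ball U c])
  qed
  then have "smooth_on ?S U" by (simp add: smooth_on_iff_ck)
  then show ?thesis using U by (rule that)
qed

section \<open>Ordinary differential equations with parameters\<close>

lemma tint_bound:
  fixes f :: "'a::euclidean_space \<Rightarrow> 'b::banach"
  assumes f: "continuous_on UNIV f" and B: "\<And>x. norm (f x) \<le> B"
  shows "norm (tint e f z) \<le> \<bar>z \<bullet> e\<bar> * B"
proof -
  have "continuous_on {0..1} (\<lambda>s. f (tslide e s z))"
    by (rule continuous_on_compose2[OF f]) (auto intro!: continuous_intros simp: tslide_def)
  then have "norm (integral {0..1} (\<lambda>s. f (tslide e s z))) \<le> B * (1 - 0)"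
    using B by (intro integral_bound) simp_all
  then show ?thesis by (simp add: tint_def mult_left_mono)
qed

lemma tint_diff:
  fixes f g :: "'a::euclidean_space \<Rightarrow> 'b::banach"
  assumes f: "continuous_on UNIV f" and g: "continuous_on UNIV g"
  shows "tint e f z - tint e g z = tint e (\<lambda>x. f x - g x) z"
proof -
  have i: "(\<lambda>s. h (tslide e s z)) integrable_on {0..1}" if "continuous_on UNIV h" for h :: "'a \<Rightarrow> 'b"
    by (intro integrable_continuous_interval continuous_on_compose2[OF that])
       (auto intro!: continuous_intros simp: tslide_def)
  show ?thesis
    by (simp add: tint_def integral_diff[OF i[OF f] i[OF g]] scaleR_diff_right)
qed

text \<open>The Picard iteration takes place in the space of bounded continuous functions on the whole
  parameter space, so that the solution is jointly continuous. A point \<open>z\<close> encodes the time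
  \<open>z \<bullet> e\<close> and a parameter orthogonal to \<open>e\<close>.\<close>

lemma picard:
  fixes e :: "'p::euclidean_space" and f :: "'p \<Rightarrow> 'b::banach \<Rightarrow> 'b"
  assumes e: "e \<bullet> e = 1" and T: "0 < T" "0 \<le> B" "T * B \<le> 1/2"
    and cf: "continuous_on UNIV (\<lambda>(z, y). f z y)"
    and lip: "\<And>z y y'. norm (f z y - f z y') \<le> B * norm (y - y')"
    and bd: "\<And>z. norm (f z (P z)) \<le> M" and cP: "continuous_on UNIV P"
  obtains y where "continuous_on UNIV y"
    "\<And>z. \<bar>z \<bullet> e\<bar> \<le> T \<Longrightarrow> y z = P z + tint e (\<lambda>\<zeta>. f \<zeta> (y \<zeta>)) z"
proof -
  define cl where "cl z = z + (max (-T) (min T (z \<bullet> e)) - z \<bullet> e) *\<^sub>R e" for z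
  have cl: "\<bar>cl z \<bullet> e\<bar> \<le> T" for z using e T by (simp add: cl_def inner_add_left)
  have cl_id: "cl z = z" if "\<bar>z \<bullet> e\<bar> \<le> T" for z using that by (simp add: cl_def)
  have ccl: "continuous_on UNIV cl" unfolding cl_def[abs_def] by (intro continuous_intros)
  define op where "op W z = tint e (\<lambda>\<zeta>. f \<zeta> (P \<zeta> + apply_bcontfun W \<zeta>)) (cl z)" for W z
  have cfW: "continuous_on UNIV (\<lambda>\<zeta>. f \<zeta> (P \<zeta> + apply_bcontfun W \<zeta>))" for W
  proof -
    have "continuous_on UNIV (\<lambda>\<zeta>. case (\<zeta>, P \<zeta> + apply_bcontfun W \<zeta>) of (z, y) \<Rightarrow> f z y)"
      by (rule continuous_on_compose2[OF cf]) (intro continuous_intros cP continuous_on_apply_bcontfun subset_UNIV)+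
    then show ?thesis by simp
  qed
  have op: "op W \<in> bcontfun" for W
    unfolding bcontfun_def
  proof (intro CollectI conjI)
    show "continuous_on UNIV (op W)" unfolding op_def[abs_def]
      by (rule continuous_on_compose2[OF continuous_on_tint[OF _ cfW] ccl]) simp_all
    obtain N where N: "\<And>x. norm (apply_bcontfun W x) \<le> N"
      using bounded_apply_bcontfun[of W] unfolding bounded_iff by blast
    have b: "norm (f x (P x + apply_bcontfun W x)) \<le> M + B * N" for x
    proof -
      have "norm (f x (P x + apply_bcontfun W x)) \<le> norm (f x (P x)) + norm (f x (P x + apply_bcontfun W x) - f x (P x))"
        by (metis add.commute diff_add_cancel norm_triangle_ineq)
      also have "\<dots> \<le> M + B * norm (apply_bcontfun W x)" using bd[of x] lip[of x "P x + apply_bcontfun W x" "P x"] by simp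
      also have "\<dots> \<le> M + B * N" using N[of x] T by (simp add: mult_left_mono)
      finally show ?thesis .
    qed
    have nn: "0 \<le> M + B * N" using order_trans[OF norm_ge_zero b] .
    have "norm (op W x) \<le> T * (M + B * N)" for x
      using order_trans[OF tint_bound[OF cfW b] mult_right_mono[OF cl nn]] by (simp add: op_def)
    then show "bounded (range (op W))" unfolding bounded_iff by blast
  qed
  define Op where "Op W = Bcontfun (op W)" for W
  have Op: "apply_bcontfun (Op W) = op W" for W
    unfolding Op_def by (rule Bcontfun_inverse[OF op])
  have "dist (Op W) (Op W') \<le> 1/2 * dist W W'" for W W'
  proof (rule dist_bound)
    fix x
    have b: "norm (f \<zeta> (P \<zeta> + apply_bcontfun W \<zeta>) - f \<zeta> (P \<zeta> + apply_bcontfun W' \<zeta>)) \<le> B * dist W W'" for \<zeta>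
    proof -
      have "norm (f \<zeta> (P \<zeta> + apply_bcontfun W \<zeta>) - f \<zeta> (P \<zeta> + apply_bcontfun W' \<zeta>)) \<le> B * dist (apply_bcontfun W \<zeta>) (apply_bcontfun W' \<zeta>)"
        using lip[of \<zeta> "P \<zeta> + apply_bcontfun W \<zeta>" "P \<zeta> + apply_bcontfun W' \<zeta>"] by (simp add: dist_norm)
      also have "\<dots> \<le> B * dist W W'" using T by (intro mult_left_mono dist_bounded)
      finally show ?thesis .
    qed
    have "dist (apply_bcontfun (Op W) x) (apply_bcontfun (Op W') x) \<le> \<bar>cl x \<bullet> e\<bar> * (B * dist W W')"
      unfolding Op op_def dist_norm tint_diff[OF cfW cfW]
      by (rule tint_bound[OF _ b[unfolded dist_norm]]) (intro continuous_intros cfW)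
    also have "\<dots> \<le> T * (B * dist W W')" using T cl by (intro mult_right_mono mult_nonneg_nonneg) auto
    also have "\<dots> \<le> 1/2 * dist W W'"
      using mult_right_mono[OF T(3), of "dist W W'"] by (simp add: mult.assoc)
    finally show "dist (apply_bcontfun (Op W) x) (apply_bcontfun (Op W') x) \<le> 1/2 * dist W W'" .
  qed
  then obtain W where W: "Op W = W" using banach_fix_type[of "1/2" Op] by auto
  have W': "apply_bcontfun W z = tint e (\<lambda>\<zeta>. f \<zeta> (P \<zeta> + apply_bcontfun W \<zeta>)) z" if "\<bar>z \<bullet> e\<bar> \<le> T" for z
    using arg_cong[OF W, of "\<lambda>W. apply_bcontfun W z"] cl_id[OF that] by (simp add: Op op_def)
  show ?thesis
  proof (rule that[of "\<lambda>z. P z + apply_bcontfun W z"])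
    show "continuous_on UNIV (\<lambda>z. P z + apply_bcontfun W z)"
      by (intro continuous_intros cP continuous_on_apply_bcontfun)
  qed (use W' in simp)
qed

lemma fixpoint_line_derivative:
  fixes y g :: "'a::euclidean_space \<Rightarrow> 'b::banach"
  assumes e: "e \<bullet> e = 1" and y: "\<And>z. \<bar>z \<bullet> e\<bar> \<le> T \<Longrightarrow> y z = P (tslide e 0 z) + tint e g z"
    and g: "continuous_on UNIV g" and z: "z \<bullet> e = 0" and t: "\<bar>t\<bar> < T"
  shows "((\<lambda>t. y (z + t *\<^sub>R e)) has_vector_derivative g (z + t *\<^sub>R e)) (at t)"
proof -
  have d: "((\<lambda>t. P z + tint e g (z + t *\<^sub>R e)) has_vector_derivative 0 + g (z + t *\<^sub>R e)) (at t)"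
    by (intro has_vector_derivative_add has_vector_derivative_const tint_line_derivative[OF e g z _ t]) simp
  show ?thesis
  proof (rule has_vector_derivative_transform_within_open[of _ _ _ "{-T<..<T}"])
    show "((\<lambda>t. P z + tint e g (z + t *\<^sub>R e)) has_vector_derivative g (z + t *\<^sub>R e)) (at t)" using d by simp
    show "t \<in> {-T<..<T}" using t by (auto simp: abs_less_iff)
    show "P z + tint e g (z + s *\<^sub>R e) = y (z + s *\<^sub>R e)" if "s \<in> {-T<..<T}" for s
    proof -
      have "(z + s *\<^sub>R e) \<bullet> e = s" using e z by (simp add: inner_add_left)
      moreover have "tslide e 0 (z + s *\<^sub>R e) = z" using e z by (simp add: tslide_add tslide_orth tslide_time)
      ultimately show ?thesis using y[of "z + s *\<^sub>R e"] that by auto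
    qed
  qed simp
qed

text \<open>\<open>Y\<close> is the fundamental matrix and \<open>Z\<close> solves the adjoint equation, so that \<open>Z Y\<close> has
  derivative 0 and is the identity. Having the inverse as the solution of an equation of its own
  gives its continuity and the formula of variation of constants.\<close>

lemma linear_ode:
  fixes A :: "'p::euclidean_space \<Rightarrow> real ^ 'n ^ 'n"
  assumes e: "e \<bullet> e = 1" and cA: "continuous_on UNIV A" and bA: "\<And>z. norm (A z) \<le> B" and T0: "0 < T0"
  obtains T Y Z where "0 < T" "T \<le> T0" "continuous_on UNIV Y" "continuous_on UNIV Z"
    "\<And>z. z \<bullet> e = 0 \<Longrightarrow> Y z = mat 1 \<and> Z z = mat 1"
    "\<And>z t. z \<bullet> e = 0 \<Longrightarrow> \<bar>t\<bar> < T \<Longrightarrow>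
       ((\<lambda>t. Y (z + t *\<^sub>R e)) has_vector_derivative A (z + t *\<^sub>R e) ** Y (z + t *\<^sub>R e)) (at t)"
    "\<And>z t. z \<bullet> e = 0 \<Longrightarrow> \<bar>t\<bar> < T \<Longrightarrow>
       ((\<lambda>t. Z (z + t *\<^sub>R e)) has_vector_derivative - (Z (z + t *\<^sub>R e) ** A (z + t *\<^sub>R e))) (at t)"
    "\<And>z. \<bar>z \<bullet> e\<bar> < T \<Longrightarrow> Y z ** Z z = mat 1 \<and> Z z ** Y z = mat 1"
proof -
  note bb = bounded_bilinear_matrix_mult[where 'n='n and 'm='n and 'p='n]
  have "\<exists>K>0. \<forall>(X :: real ^ 'n ^ 'n) (Y :: real ^ 'n ^ 'n). norm (X ** Y) \<le> norm X * norm Y * K"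
    by (rule bounded_bilinear.pos_bounded[OF bb])
  then obtain K where K': "0 < K" "\<forall>(X :: real ^ 'n ^ 'n) (Y :: real ^ 'n ^ 'n). norm (X ** Y) \<le> norm X * norm Y * K"
    by (elim exE conjE)
  note K = K'(1) K'(2)[rule_format]
  have B0: "0 \<le> B" using order_trans[OF norm_ge_zero bA] .
  define T where "T = min T0 (1 / (2 * (B * K + 1)))"
  have p: "0 < B * K + 1" using B0 K by (simp add: add_nonneg_pos)
  have T: "0 < T" "T \<le> T0" using T0 p by (simp_all add: T_def)
  have half: "c / (2 * q) * q = c / 2" if "0 < q" for q c :: real using that by simp
  have "T * (B * K) \<le> 1 / (2 * (B * K + 1)) * (B * K + 1)"
    using B0 K p T by (intro mult_mono) (simp_all add: T_def)
  also have "\<dots> = 1/2" using half[OF p, of 1] .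
  finally have TB: "T * (B * K) \<le> 1/2" .
  have BK: "0 \<le> B * K" using B0 K by simp
  have lipY: "norm (A z ** y - A z ** y') \<le> B * K * norm (y - y')" for z and y y' :: "real ^ 'n ^ 'n"
  proof -
    have "norm (A z ** (y - y')) \<le> norm (A z) * norm (y - y') * K" by (rule K)
    also have "\<dots> \<le> B * norm (y - y') * K" using K bA by (intro mult_right_mono) auto
    finally show ?thesis by (simp add: bounded_bilinear.diff_right[OF bb] algebra_simps)
  qed
  have lipZ: "norm (- (y ** A z) - - (y' ** A z)) \<le> B * K * norm (y - y')" for z and y y' :: "real ^ 'n ^ 'n"
  proof -
    have "norm ((y - y') ** A z) \<le> norm (y - y') * norm (A z) * K" by (rule K)
    also have "\<dots> \<le> norm (y - y') * B * K" using K bA by (intro mult_right_mono mult_left_mono) auto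
    finally have "norm (y ** A z - y' ** A z) \<le> norm (y - y') * B * K"
      by (simp add: bounded_bilinear.diff_left[OF bb])
    then have "norm (y' ** A z - y ** A z) \<le> norm (y - y') * B * K" by (simp only: norm_minus_commute)
    then show ?thesis by (simp add: algebra_simps)
  qed
  have cA': "continuous_on UNIV (\<lambda>p. A (fst p))"
    by (rule continuous_on_compose2[OF cA]) (auto intro!: continuous_intros)
  note cs = continuous_on_snd[OF continuous_on_id]
  have cY: "continuous_on UNIV (\<lambda>(z, y :: real ^ 'n ^ 'n). A z ** y)"
    unfolding split_beta by (rule bounded_bilinear.continuous_on[OF bb cA' cs])
  have cZ: "continuous_on UNIV (\<lambda>(z, y :: real ^ 'n ^ 'n). - (y ** A z))"
    unfolding split_beta by (rule continuous_on_minus[OF bounded_bilinear.continuous_on[OF bb cs cA']])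
  obtain Y where Y: "continuous_on UNIV Y" "\<And>z. \<bar>z \<bullet> e\<bar> \<le> T \<Longrightarrow> Y z = mat 1 + tint e (\<lambda>\<zeta>. A \<zeta> ** Y \<zeta>) z"
    by (rule picard[OF e T(1) BK TB cY lipY, of "\<lambda>_. mat 1" B]) (use bA in simp_all)
  obtain Z where Z: "continuous_on UNIV Z" "\<And>z. \<bar>z \<bullet> e\<bar> \<le> T \<Longrightarrow> Z z = mat 1 + tint e (\<lambda>\<zeta>. - (Z \<zeta> ** A \<zeta>)) z"
    by (rule picard[OF e T(1) BK TB cZ lipZ, of "\<lambda>_. mat 1" B]) (use bA in simp_all)
  have z0: "Y z = mat 1 \<and> Z z = mat 1" if "z \<bullet> e = 0" for z
    using Y(2)[of z] Z(2)[of z] that T by (simp add: tint_def)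
  have dY: "((\<lambda>t. Y (z + t *\<^sub>R e)) has_vector_derivative A (z + t *\<^sub>R e) ** Y (z + t *\<^sub>R e)) (at t)"
    if "z \<bullet> e = 0" "\<bar>t\<bar> < T" for z t
    by (rule fixpoint_line_derivative[OF e Y(2) _ that])
       (assumption | intro bounded_bilinear.continuous_on[OF bb] cA Y(1))+
  have dZ: "((\<lambda>t. Z (z + t *\<^sub>R e)) has_vector_derivative - (Z (z + t *\<^sub>R e) ** A (z + t *\<^sub>R e))) (at t)"
    if "z \<bullet> e = 0" "\<bar>t\<bar> < T" for z t
    by (rule fixpoint_line_derivative[OF e Z(2) _ that])
       (assumption | intro continuous_on_minus bounded_bilinear.continuous_on[OF bb] cA Z(1))+
  have inv: "Z z ** Y z = mat 1" if zT: "\<bar>z \<bullet> e\<bar> < T" for z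
  proof -
    define \<zeta> where "\<zeta> = tslide e 0 z"
    have \<zeta>: "\<zeta> \<bullet> e = 0" "z = \<zeta> + (z \<bullet> e) *\<^sub>R e" using e by (simp_all add: \<zeta>_def tslide_inner) (simp add: tslide_def)
    have "\<exists>c. \<forall>t\<in>{-T<..<T}. Z (\<zeta> + t *\<^sub>R e) ** Y (\<zeta> + t *\<^sub>R e) = c"
    proof (rule has_derivative_zero_constant)
      fix t assume "t \<in> {-T<..<T}"
      then have t: "\<bar>t\<bar> < T" by auto
      have "((\<lambda>t. Z (\<zeta> + t *\<^sub>R e) ** Y (\<zeta> + t *\<^sub>R e)) has_vector_derivative
         Z (\<zeta> + t *\<^sub>R e) ** (A (\<zeta> + t *\<^sub>R e) ** Y (\<zeta> + t *\<^sub>R e))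
         + (- (Z (\<zeta> + t *\<^sub>R e) ** A (\<zeta> + t *\<^sub>R e))) ** Y (\<zeta> + t *\<^sub>R e)) (at t)"
        by (rule bounded_bilinear.has_vector_derivative[OF bb dZ[OF \<zeta>(1) t] dY[OF \<zeta>(1) t]])
      then have "((\<lambda>t. Z (\<zeta> + t *\<^sub>R e) ** Y (\<zeta> + t *\<^sub>R e)) has_vector_derivative 0) (at t)"
        by (simp add: bounded_bilinear.minus_left[OF bb] matrix_mul_assoc)
      then show "((\<lambda>t. Z (\<zeta> + t *\<^sub>R e) ** Y (\<zeta> + t *\<^sub>R e)) has_derivative (\<lambda>h. 0)) (at t within {-T<..<T})"
        by (simp add: has_vector_derivative_def has_derivative_at_withinI)
    qed simp
    then obtain c where c: "\<And>t. t \<in> {-T<..<T} \<Longrightarrow> Z (\<zeta> + t *\<^sub>R e) ** Y (\<zeta> + t *\<^sub>R e) = c" by blast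
    have "Z z ** Y z = c" using c[of "z \<bullet> e"] zT \<zeta>(2) by (simp add: abs_less_iff)
    also have "c = mat 1" using c[of 0] T z0[OF \<zeta>(1)] by simp
    finally show ?thesis .
  qed
  show ?thesis
    by (rule that[OF T Y(1) Z(1) z0 dY dZ]) (use inv matrix_left_right_inverse in blast)+
qed

text \<open>The increment of a function is the integral of its derivative over the segment.\<close>

lemma hadamard:
  fixes f :: "'a::euclidean_space \<Rightarrow> 'b::banach"
  assumes S: "convex S" and f: "\<And>x. x \<in> S \<Longrightarrow> f differentiable (at x)" and x: "x \<in> S" "x + w \<in> S"
  shows "((\<lambda>s. dird w f (x + s *\<^sub>R w)) has_integral f (x + w) - f x) {0..1}"
proof -
  have inS: "x + s *\<^sub>R w \<in> S" if "s \<in> {0..1}" for s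
  proof -
    have "(1 - s) *\<^sub>R x + s *\<^sub>R (x + w) \<in> S"
      by (rule convexD_alt[OF S x]) (use that in auto)
    then show ?thesis by (simp add: algebra_simps)
  qed
  have "((\<lambda>s. dird w f (x + s *\<^sub>R w)) has_integral f (x + 1 *\<^sub>R w) - f (x + 0 *\<^sub>R w)) {0..1}"
  proof (rule fundamental_theorem_of_calculus)
    fix s :: real assume s: "s \<in> {0..1}"
    have 1: "((\<lambda>s. x + s *\<^sub>R w) has_derivative (\<lambda>h. h *\<^sub>R w)) (at s within {0..1})"
      by (auto intro!: derivative_eq_intros)
    have D: "(f has_derivative (\<lambda>v. dird v f (x + s *\<^sub>R w))) (at (x + s *\<^sub>R w))"
      by (rule differentiable_has_derivative_dird[OF f[OF inS[OF s]]])
    have lin: "dird (h *\<^sub>R w) f (x + s *\<^sub>R w) = h *\<^sub>R dird w f (x + s *\<^sub>R w)" for h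
      using linear_cmul[OF has_derivative_linear[OF D]] .
    show "((\<lambda>s. f (x + s *\<^sub>R w)) has_vector_derivative dird w f (x + s *\<^sub>R w)) (at s within {0..1})"
      using has_derivative_compose[OF 1 D] by (simp add: has_vector_derivative_def lin)
  qed simp
  then show ?thesis by simp
qed

text \<open>A product of a continuous function with a linear one is differentiable at 0, although the
  first factor is not assumed to be differentiable. Thus a difference quotient that extends
  continuously to increment 0 yields the derivative.\<close>

lemma has_derivative_mult_cont:
  fixes c :: "'a::real_normed_vector \<Rightarrow> 'b::real_normed_vector" and l :: "'a \<Rightarrow> 'c::real_normed_vector"
    and pr :: "'b \<Rightarrow> 'c \<Rightarrow> 'd::real_normed_vector"
  assumes pr: "bounded_bilinear pr" and l: "bounded_linear l" and c: "isCont c 0"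
  shows "((\<lambda>w. pr (c w) (l w)) has_derivative (\<lambda>w. pr (c 0) (l w))) (at 0)"
proof -
  interpret bounded_bilinear pr by (rule pr)
  interpret l: bounded_linear l by (rule l)
  obtain K where K: "0 < K" "\<And>a b. norm (pr a b) \<le> norm a * norm b * K" using pos_bounded by blast
  obtain K' where K': "0 < K'" "\<And>a. norm (l a) \<le> norm a * K'" using l.pos_bounded by blast
  have bound: "norm (norm (pr (c y) (l y) - pr (c 0) (l y)) / norm y) \<le> norm (c y - c 0) * K' * K" for y
  proof (cases "y = 0")
    case True then show ?thesis using K K' by simp
  next
    case False
    have "norm (pr (c y - c 0) (l y)) \<le> norm (c y - c 0) * norm (l y) * K" by (rule K)
    also have "\<dots> \<le> norm (c y - c 0) * (norm y * K') * K"
      using K K' by (intro mult_right_mono mult_left_mono) auto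
    finally have "norm (pr (c y) (l y) - pr (c 0) (l y)) \<le> (norm (c y - c 0) * K' * K) * norm y"
      by (simp add: diff_left algebra_simps)
    then show ?thesis using False by (simp add: divide_le_eq)
  qed
  have "(\<lambda>y. norm (c y - c 0) * K' * K) \<midarrow>0\<rightarrow> norm (c 0 - c 0) * K' * K"
    using c unfolding isCont_def by (intro tendsto_intros)
  then have "(\<lambda>y. norm (c y - c 0) * K' * K) \<midarrow>0\<rightarrow> 0" by simp
  then have lim: "(\<lambda>y. norm (pr (c y) (l y) - pr (c 0) (l y)) / norm y) \<midarrow>0\<rightarrow> 0"
    by (rule Lim_null_comparison[rotated]) (use bound in \<open>simp add: eventually_at_topological\<close>)
  show ?thesis
    unfolding has_derivative_at
  proof
    show "bounded_linear (\<lambda>w. pr (c 0) (l w))"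
      using bounded_linear_compose[OF bounded_linear_right l] .
    show "(\<lambda>h. norm (pr (c (0 + h)) (l (0 + h)) - pr (c 0) (l 0) - pr (c 0) (l h)) / norm h) \<midarrow>0\<rightarrow> 0"
      using lim by (simp add: l.zero zero_right)
  qed
qed

lemma tslide_norm:
  assumes "e \<bullet> e = 1" "s \<in> {0..1}"
  shows "norm (tslide e s w) \<le> 2 * norm w"
proof -
  have ne: "norm e = 1" using assms(1) by (simp add: norm_eq_sqrt_inner)
  have "norm (tslide e s w) \<le> norm w + norm (((s - 1) * (w \<bullet> e)) *\<^sub>R e)"
    unfolding tslide_def by (rule norm_triangle_ineq)
  also have "\<dots> = norm w + \<bar>s - 1\<bar> * \<bar>w \<bullet> e\<bar>" by (simp add: ne abs_mult)
  also have "\<dots> \<le> norm w + 1 * norm w"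
    using Cauchy_Schwarz_ineq2[of w e] ne assms(2) by (intro add_left_mono mult_mono) auto
  finally show ?thesis by simp
qed

text \<open>A function with a continuous derivative in the direction of time is differentiable as soon
  as it is differentiable in the remaining directions.\<close>

lemma has_derivative_split:
  fixes f g :: "'a::euclidean_space \<Rightarrow> 'b::banach"
  assumes e: "e \<bullet> e = 1" and S: "open S" "z \<in> S" and g: "continuous_on S g"
    and line: "\<And>\<zeta>. \<zeta> \<in> S \<Longrightarrow> ((\<lambda>t. f (\<zeta> + t *\<^sub>R e)) has_vector_derivative g \<zeta>) (at 0)"
    and r: "((\<lambda>w. f (z + tslide e 0 w)) has_derivative r') (at 0)"
  shows "(f has_derivative (\<lambda>w. r' w + (w \<bullet> e) *\<^sub>R g z)) (at z)"
proof -
  have ne: "norm e = 1" using e by (simp add: norm_eq_sqrt_inner)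
  obtain d where d: "d > 0" "ball z d \<subseteq> S" using S open_contains_ball by blast
  let ?U = "ball 0 (d/3) :: 'a set"
  have small: "z + tslide e 0 w + t *\<^sub>R e \<in> S" if "w \<in> ?U" "\<bar>t\<bar> \<le> norm w" for w t
  proof -
    have "norm (tslide e 0 w + t *\<^sub>R e) \<le> norm (tslide e 0 w) + norm (t *\<^sub>R e)" by (rule norm_triangle_ineq)
    also have "\<dots> \<le> 2 * norm w + norm w" using tslide_norm[OF e, of 0 w] that ne by simp
    also have "\<dots> < d" using that by simp
    finally have "dist z (z + (tslide e 0 w + t *\<^sub>R e)) < d" by (metis add_diff_cancel_left' dist_commute dist_norm)
    then have "z + (tslide e 0 w + t *\<^sub>R e) \<in> S" using d by auto
    then show ?thesis by (simp only: add.assoc)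
  qed
  define c where "c w = integral {0..1} (\<lambda>s. g (z + tslide e 0 w + (s * (w \<bullet> e)) *\<^sub>R e))" for w
  have we: "\<bar>s * (w \<bullet> e)\<bar> \<le> norm w" if "s \<in> {0..1}" for s w
  proof -
    have "\<bar>s\<bar> * \<bar>w \<bullet> e\<bar> \<le> 1 * norm w"
      using Cauchy_Schwarz_ineq2[of w e] ne that by (intro mult_mono) auto
    then show ?thesis by (simp add: abs_mult)
  qed
  have "continuous_on ?U (\<lambda>w. integral (cbox 0 1) (\<lambda>s. g (z + tslide e 0 w + (s * (w \<bullet> e)) *\<^sub>R e)))"
    unfolding split_beta[symmetric]
  proof (rule integral_continuous_on_param)
    have "continuous_on (?U \<times> cbox 0 1) (\<lambda>p. g (z + tslide e 0 (fst p) + (snd p * (fst p \<bullet> e)) *\<^sub>R e))"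
    proof (rule continuous_on_compose2[OF g])
      show "continuous_on (?U \<times> cbox 0 1) (\<lambda>p. z + tslide e 0 (fst p) + (snd p * (fst p \<bullet> e)) *\<^sub>R e)"
        unfolding tslide_def by (intro continuous_intros)
      show "(\<lambda>p. z + tslide e 0 (fst p) + (snd p * (fst p \<bullet> e)) *\<^sub>R e) ` (?U \<times> cbox 0 1) \<subseteq> S"
        using small we by (auto simp del: mem_ball)
    qed
    then show "continuous_on (?U \<times> cbox 0 1) (\<lambda>(w, s). g (z + tslide e 0 w + (s * (w \<bullet> e)) *\<^sub>R e))"
      by (simp add: split_beta)
  qed
  then have "continuous_on ?U c" by (simp add: c_def[abs_def])
  then have cc: "isCont c 0" using d by (simp add: continuous_on_eq_continuous_at)
  have c0: "c 0 = g z" by (simp add: c_def tslide_def)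
  have inc: "f (z + w) = f (z + tslide e 0 w) + (w \<bullet> e) *\<^sub>R c w" if w: "w \<in> ?U" for w
  proof -
    let ?H = "\<lambda>t. f (z + tslide e 0 w + t *\<^sub>R e)"
    have "(w \<bullet> e) *\<^sub>R c w = ?H (w \<bullet> e) - ?H 0"
      unfolding c_def
    proof (rule scaled_integral_eq)
      show "w \<bullet> e \<in> {- norm w..norm w}" using we[of 1 w] by (auto simp: abs_le_iff)
      fix t assume t: "t \<in> {- norm w..norm w}"
      have "((\<lambda>s. s - t) has_vector_derivative 1) (at t)" by (auto intro!: derivative_eq_intros)
      moreover have "((\<lambda>s. f (z + tslide e 0 w + t *\<^sub>R e + s *\<^sub>R e)) has_vector_derivative g (z + tslide e 0 w + t *\<^sub>R e)) (at (t - t))"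
        using line[OF small[OF w, of t]] t by (simp add: abs_le_iff)
      ultimately have "((\<lambda>s. f (z + tslide e 0 w + t *\<^sub>R e + (s - t) *\<^sub>R e)) has_vector_derivative 1 *\<^sub>R g (z + tslide e 0 w + t *\<^sub>R e)) (at t)"
        using vector_diff_chain_at[of "\<lambda>s. s - t" 1 t] by (simp add: o_def)
      then show "(?H has_vector_derivative g (z + tslide e 0 w + t *\<^sub>R e)) (at t within {- norm w..norm w})"
        by (simp add: has_vector_derivative_at_within scaleR_diff_left)
    qed simp
    then show ?thesis by (simp add: tslide_def algebra_simps)
  qed
  have "((\<lambda>w. (w \<bullet> e) *\<^sub>R c w) has_derivative (\<lambda>w. (w \<bullet> e) *\<^sub>R c 0)) (at 0)"
    using has_derivative_mult_cont[OF bounded_bilinear.flip[OF bounded_bilinear_scaleR] bounded_linear_inner_left cc] .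
  from has_derivative_add[OF r this]
  have "((\<lambda>w. f (z + tslide e 0 w) + (w \<bullet> e) *\<^sub>R c w) has_derivative (\<lambda>w. r' w + (w \<bullet> e) *\<^sub>R g z)) (at 0)"
    by (simp only: c0)
  then have "((\<lambda>w. f (z + w)) has_derivative (\<lambda>w. r' w + (w \<bullet> e) *\<^sub>R g z)) (at 0)"
    by (rule has_derivative_transform_within_open[of _ _ _ _ ?U]) (use d inc in \<open>simp_all del: mem_ball add: centre_in_ball\<close>)
  then have h: "((\<lambda>w. f (z + w)) has_derivative (\<lambda>w. r' w + (w \<bullet> e) *\<^sub>R g z)) (at (z - z))" by simp
  have "((\<lambda>x. x - z) has_derivative (\<lambda>v. v)) (at z)" by (auto intro!: derivative_eq_intros)
  from has_derivative_compose[OF this h] show ?thesis by simp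
qed

section \<open>Smoothness of flows\<close>

text \<open>The initial value \<open>x0 + L z\<close> on the hyperplane orthogonal to \<open>e\<close> may be any linear image.
  For \<open>w\<close> orthogonal to \<open>e\<close>, the difference \<open>G (z + w) - G z\<close> solves the linear equation with the
  averaged Jacobian \<open>Jp (w, z)\<close>, hence equals \<open>Y2 (w, z)\<close> applied to \<open>L w\<close>, where \<open>Y2\<close> is
  continuous also at \<open>w = 0\<close>: this is the derivative of \<open>G\<close>. Variation of constants gives the
  derivative of \<open>Y = Y2 (0, -)\<close> in the same way. Both derivatives are built from \<open>G\<close> and \<open>Y\<close> by
  smooth operations and integrals, which yields all higher derivatives by induction.\<close>

lemma flow:
  fixes \<xi> :: "real ^ 'n \<Rightarrow> real ^ 'n" and L :: "real ^ 'n \<Rightarrow> real ^ 'n" and e :: "real ^ 'n"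
  assumes e: "e \<bullet> e = 1" and S: "open S" "x0 \<in> S" and \<xi>: "smooth_on S \<xi>" and L: "bounded_linear L"
  obtains G R where "0 < R" "smooth_on (ball 0 R) G" "\<And>z. z \<in> ball 0 R \<Longrightarrow> G z \<in> S"
    "\<And>z. z \<in> ball 0 R \<Longrightarrow> dird e G z = \<xi> (G z)"
    "\<And>z. z \<in> ball 0 R \<Longrightarrow> z \<bullet> e = 0 \<Longrightarrow> G z = x0 + L z"
proof -
  note bb = bounded_bilinear_matrix_mult[where 'n='n and 'm='n and 'p='n]
  note bv = bounded_bilinear_matrix_vector_mult[where 'n='n and 'm='n]
  obtain r where r: "0 < r" "cball x0 r \<subseteq> S" using S open_contains_cball by blast
  let ?C = "cball x0 r"
  \<comment> \<open>Composition with the projection to the ball makes the right-hand side globally Lipschitz and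
    bounded; the solution does not leave the ball for small times, where \<open>\<rho>\<close> has no effect.\<close>
  define \<rho> where "\<rho> = closest_point ?C"
  have C: "closed ?C" "convex ?C" "?C \<noteq> {}" "compact ?C" using r by auto
  have \<rho>C: "\<rho> x \<in> ?C" for x unfolding \<rho>_def by (rule closest_point_in_set[OF C(1,3)])
  have \<rho>id: "\<rho> x = x" if "x \<in> ?C" for x unfolding \<rho>_def by (rule closest_point_self[OF that])
  have \<rho>lip: "norm (\<rho> x - \<rho> y) \<le> norm (x - y)" for x y
    using closest_point_lipschitz[OF C(2,1,3), of x y] by (simp add: \<rho>_def dist_norm)
  have c\<rho>: "continuous_on UNIV \<rho>" unfolding \<rho>_def by (rule continuous_on_closest_point[OF C(2,1,3)])
  have \<xi>d: "\<xi> differentiable (at x)" if "x \<in> ?C" for x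
    using smooth_on_differentiable[OF \<xi>] that r by blast
  have ckj: "ck k S (jac \<xi>)" for k
    using ck_jac[OF S(1), of k \<xi>] \<xi> unfolding smooth_on_iff_ck by blast
  have cj: "continuous_on ?C (jac \<xi>)" "continuous_on ?C \<xi>"
    using continuous_on_subset[OF ck_continuous_on[OF ckj] r(2)]
      continuous_on_subset[OF smooth_on_continuous_on[OF \<xi>] r(2)] by auto
  obtain B where B: "\<And>x. x \<in> ?C \<Longrightarrow> norm (jac \<xi> x) \<le> B"
    using compact_imp_bounded[OF compact_continuous_image[OF cj(1) C(4)]] unfolding bounded_iff by blast
  obtain M where M: "\<And>x. x \<in> ?C \<Longrightarrow> norm (\<xi> x) \<le> M"
    using compact_imp_bounded[OF compact_continuous_image[OF cj(2) C(4)]] unfolding bounded_iff by blast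
  have "\<exists>K>0. \<forall>(X :: real ^ 'n ^ 'n) y. norm (X *v y) \<le> norm X * norm y * K"
    by (rule bounded_bilinear.pos_bounded[OF bv])
  then obtain K where K': "0 < K" "\<forall>(X :: real ^ 'n ^ 'n) y. norm (X *v y) \<le> norm X * norm y * K"
    by (elim exE conjE)
  note K = K'(1) K'(2)[rule_format]
  have x0C: "x0 \<in> ?C" using r by simp
  have B0: "0 \<le> B" using order_trans[OF norm_ge_zero B[OF x0C]] .
  have M0: "0 \<le> M" using order_trans[OF norm_ge_zero M[OF x0C]] .
  define J where "J x y = integral {0..1} (\<lambda>s. jac \<xi> (\<rho> (x + s *\<^sub>R (y - x))))" for x y
  have cJ\<rho>: "continuous_on UNIV (\<lambda>x. jac \<xi> (\<rho> x))"
    by (rule continuous_on_compose2[OF cj(1) c\<rho>]) (use \<rho>C in auto)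
  have cJs: "continuous_on {0..1} (\<lambda>s. jac \<xi> (\<rho> (x + s *\<^sub>R (y - x))))" for x y
    by (rule continuous_on_compose2[OF cJ\<rho>]) (auto intro!: continuous_intros)
  have Jb: "norm (J x y) \<le> B" for x y
    using integral_bound[OF _ cJs[of x y], of B] B[OF \<rho>C] by (simp add: J_def)
  have J: "\<xi> y - \<xi> x = J x y *v (y - x)" if xy: "x \<in> ?C" "y \<in> ?C" for x y
  proof -
    have inC: "x + s *\<^sub>R (y - x) \<in> ?C" if "s \<in> {0..1}" for s
    proof -
      have "(1 - s) *\<^sub>R x + s *\<^sub>R y \<in> ?C" by (rule convexD_alt[OF C(2) xy]) (use that in auto)
      then show ?thesis by (simp add: algebra_simps)
    qed
    have "((\<lambda>s. dird (y - x) \<xi> (x + s *\<^sub>R (y - x))) has_integral \<xi> (x + (y - x)) - \<xi> x) {0..1}"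
      by (rule hadamard[OF C(2) \<xi>d]) (use xy in simp_all)
    from integral_unique[OF this]
    have 1: "integral {0..1} (\<lambda>s. dird (y - x) \<xi> (x + s *\<^sub>R (y - x))) = \<xi> y - \<xi> x" by simp
    have "((\<lambda>s. jac \<xi> (\<rho> (x + s *\<^sub>R (y - x)))) has_integral J x y) {0..1}"
      unfolding J_def by (rule integrable_integral[OF integrable_continuous_interval[OF cJs]])
    from has_integral_linear[OF this bounded_bilinear.bounded_linear_left[OF bv, of "y - x"]]
    have "((\<lambda>s. jac \<xi> (\<rho> (x + s *\<^sub>R (y - x))) *v (y - x)) has_integral J x y *v (y - x)) {0..1}" by (simp add: o_def)
    then have "integral {0..1} (\<lambda>s. jac \<xi> (\<rho> (x + s *\<^sub>R (y - x))) *v (y - x)) = J x y *v (y - x)"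
      by (rule integral_unique)
    moreover have "integral {0..1} (\<lambda>s. jac \<xi> (\<rho> (x + s *\<^sub>R (y - x))) *v (y - x))
        = integral {0..1} (\<lambda>s. dird (y - x) \<xi> (x + s *\<^sub>R (y - x)))"
      by (rule integral_cong) (simp add: \<rho>id[OF inC] jac_mult[OF \<xi>d[OF inC]])
    ultimately show ?thesis using 1 by simp
  qed
  have lip: "norm (\<xi> (\<rho> x) - \<xi> (\<rho> y)) \<le> B * K * norm (x - y)" for x y
  proof -
    have "norm (\<xi> (\<rho> x) - \<xi> (\<rho> y)) \<le> norm (J (\<rho> y) (\<rho> x)) * norm (\<rho> x - \<rho> y) * K"
      unfolding J[OF \<rho>C \<rho>C] by (rule K)
    also have "\<dots> \<le> B * norm (x - y) * K"
      using K B0 Jb \<rho>lip by (intro mult_mono mult_right_mono) auto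
    finally show ?thesis by (simp add: algebra_simps)
  qed
  have BK: "0 \<le> B * K" using B0 K by simp
  \<comment> \<open>The first bound makes the iteration a contraction, the second keeps the solution within
    \<open>r / 2\<close> of its initial value; the added 1 avoids a division by 0.\<close>
  define T0 where "T0 = min (1 / (2 * (B * K + 1))) (r / (2 * (M + 1)))"
  have T0: "0 < T0" using BK M0 r by (simp add: T0_def add_nonneg_pos)
  have half: "c / (2 * q) * q = c / 2" if "0 < q" for q c :: real using that by simp
  have "T0 * (B * K) \<le> 1 / (2 * (B * K + 1)) * (B * K + 1)"
    using BK T0 by (intro mult_mono) (simp_all add: T0_def)
  also have "\<dots> = 1/2" using half[of "B * K + 1" 1] BK by linarith
  finally have T0B: "T0 * (B * K) \<le> 1/2" .
  have "T0 * M \<le> r / (2 * (M + 1)) * (M + 1)"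
    using M0 r T0 by (intro mult_mono) (simp_all add: T0_def)
  also have "\<dots> = r / 2" using half[of "M + 1" r] M0 by linarith
  finally have T0M: "T0 * M \<le> r / 2" .
  define P where "P z = x0 + L (tslide e 0 z)" for z
  have cP: "continuous_on UNIV P"
    unfolding P_def[abs_def]
    by (intro continuous_intros linear_continuous_on bounded_linear_compose[OF L bounded_linear_tslide])
  have c\<xi>\<rho>: "continuous_on UNIV (\<lambda>x. \<xi> (\<rho> x))"
    by (rule continuous_on_compose2[OF cj(2) c\<rho>]) (use \<rho>C in auto)
  have "continuous_on UNIV (\<lambda>p. \<xi> (\<rho> (snd p)))"
    by (rule continuous_on_compose2[OF c\<xi>\<rho>]) (auto intro!: continuous_intros)
  then have cf: "continuous_on UNIV (\<lambda>(z :: real ^ 'n, y). \<xi> (\<rho> y))" by (simp add: split_beta)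
  obtain G where G: "continuous_on UNIV G" "\<And>z. \<bar>z \<bullet> e\<bar> \<le> T0 \<Longrightarrow> G z = P z + tint e (\<lambda>\<zeta>. \<xi> (\<rho> (G \<zeta>))) z"
    by (rule picard[OF e T0 BK T0B cf lip, of P M]) (use M[OF \<rho>C] cP in simp_all)
  have cG\<xi>: "continuous_on UNIV (\<lambda>z. \<xi> (\<rho> (G z)))"
    by (rule continuous_on_compose2[OF c\<xi>\<rho> G(1)]) simp
  \<comment> \<open>The parameters of the linear equation are pairs: an increment \<open>w\<close> of the initial value and
    the point \<open>z\<close> itself, with time acting on the second component only.\<close>
  define Jp where "Jp p = J (G (snd p)) (G (snd p + fst p))" for p :: "(real ^ 'n) \<times> (real ^ 'n)"
  have "continuous_on UNIV (\<lambda>p. integral (cbox 0 1)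
      (\<lambda>s. jac \<xi> (\<rho> (G (snd p) + s *\<^sub>R (G (snd p + fst p) - G (snd p :: real ^ 'n))))))"
  proof (rule integral_continuous_on_param)
    have "continuous_on (UNIV \<times> cbox 0 1) (\<lambda>q. G (snd (fst q) + fst (fst q)) :: real ^ 'n)"
      "continuous_on (UNIV \<times> cbox 0 1) (\<lambda>q. G (snd (fst q)) :: real ^ 'n)"
      for q :: "((real ^ 'n) \<times> (real ^ 'n)) \<times> real"
      by (rule continuous_on_compose2[OF G(1)]; auto intro!: continuous_intros)+
    then have "continuous_on (UNIV \<times> cbox 0 1) (\<lambda>q. G (snd (fst q)) + snd q *\<^sub>R (G (snd (fst q) + fst (fst q)) - G (snd (fst q))))"
      by (intro continuous_intros)
    from continuous_on_compose2[OF cJ\<rho> this]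
    show "continuous_on (UNIV \<times> cbox 0 1) (\<lambda>(p, s). jac \<xi> (\<rho> (G (snd p) + s *\<^sub>R (G (snd p + fst p) - G (snd p :: real ^ 'n)))))"
      by (simp add: split_beta)
  qed
  then have cJp: "continuous_on UNIV Jp" by (simp add: Jp_def[abs_def] J_def)
  let ?e = "(0, e) :: (real ^ 'n) \<times> (real ^ 'n)"
  have e': "?e \<bullet> ?e = 1" using e by simp
  have Jpb: "norm (Jp p) \<le> B" for p unfolding Jp_def by (rule Jb)
  obtain T Y2 Z2 where T: "0 < T" "T \<le> T0" and cYZ: "continuous_on UNIV Y2" "continuous_on UNIV Z2"
    and i: "\<And>z. z \<bullet> ?e = 0 \<Longrightarrow> Y2 z = mat 1 \<and> Z2 z = mat 1"
    and dY2: "\<And>z t. z \<bullet> ?e = 0 \<Longrightarrow> \<bar>t\<bar> < T \<Longrightarrow>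
       ((\<lambda>t. Y2 (z + t *\<^sub>R ?e)) has_vector_derivative Jp (z + t *\<^sub>R ?e) ** Y2 (z + t *\<^sub>R ?e)) (at t)"
    and dZ2: "\<And>z t. z \<bullet> ?e = 0 \<Longrightarrow> \<bar>t\<bar> < T \<Longrightarrow>
       ((\<lambda>t. Z2 (z + t *\<^sub>R ?e)) has_vector_derivative - (Z2 (z + t *\<^sub>R ?e) ** Jp (z + t *\<^sub>R ?e))) (at t)"
    and YZ: "\<And>z. \<bar>z \<bullet> ?e\<bar> < T \<Longrightarrow> Y2 z ** Z2 z = mat 1 \<and> Z2 z ** Y2 z = mat 1"
    by (rule linear_ode[OF e' cJp Jpb T0]) (rule that)
  define \<pi> where "\<pi> = tslide e 0"
  have \<pi>l: "bounded_linear \<pi>" unfolding \<pi>_def by (rule bounded_linear_tslide)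
  have \<pi>0: "\<pi> z \<bullet> e = 0" for z using e by (simp add: \<pi>_def tslide_inner)
  have \<pi>z: "\<pi> z + (z \<bullet> e) *\<^sub>R e = z" for z by (simp add: \<pi>_def tslide_def)
  have \<pi>o: "\<pi> w = w" if "w \<bullet> e = 0" for w using that by (simp add: \<pi>_def tslide_orth)
  have \<pi>a: "\<pi> (z + w) = \<pi> z + \<pi> w" for z w by (simp add: \<pi>_def tslide_add)
  have \<pi>s: "\<pi> (tslide e s z) = \<pi> z" for s z using e by (simp add: \<pi>_def tslide_tslide)
  \<comment> \<open>Convexity of \<open>\<Omega>\<close> allows integration over segments, and it is closed under \<open>tslide\<close>.\<close>
  define \<Omega> where "\<Omega> = {z. \<bar>z \<bullet> e\<bar> < T \<and> norm (L (\<pi> z)) < r / 2}"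
  have Lp: "bounded_linear (\<lambda>z. L (\<pi> z))" by (rule bounded_linear_compose[OF L \<pi>l])
  have o\<Omega>: "open \<Omega>" unfolding \<Omega>_def
    by (intro open_Collect_conj open_Collect_less continuous_intros linear_continuous_on Lp)
  have cv\<Omega>: "convex \<Omega>"
  proof -
    have "\<Omega> = (\<lambda>z. z \<bullet> e) -` {-T<..<T} \<inter> (\<lambda>z. L (\<pi> z)) -` ball 0 (r/2)"
      by (auto simp: \<Omega>_def abs_less_iff)
    moreover have "convex ((\<lambda>z. z \<bullet> e) -` {-T<..<T})"
      by (rule convex_linear_vimage) (simp_all add: bounded_linear.linear[OF bounded_linear_inner_left])
    moreover have "convex ((\<lambda>z. L (\<pi> z)) -` ball 0 (r/2))"
      by (rule convex_linear_vimage[OF bounded_linear.linear[OF Lp] convex_ball])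
    ultimately show ?thesis by (simp add: convex_Int)
  qed
  have \<Omega>s: "tslide e s z \<in> \<Omega>" if "z \<in> \<Omega>" "s \<in> {0..1}" for s z
  proof -
    have "\<bar>s\<bar> * \<bar>z \<bullet> e\<bar> \<le> 1 * \<bar>z \<bullet> e\<bar>" using that by (intro mult_right_mono) auto
    then show ?thesis using that e by (simp add: \<Omega>_def tslide_inner \<pi>s abs_mult)
  qed
  have \<Omega>t: "\<pi> z + t *\<^sub>R e \<in> \<Omega>" if "z \<in> \<Omega>" "\<bar>t\<bar> < T" for t z
  proof -
    have "\<pi> (\<pi> z + t *\<^sub>R e) = \<pi> z" using e \<pi>0[of z] by (simp add: \<pi>_def tslide_add tslide_time tslide_orth)
    moreover have "(\<pi> z + t *\<^sub>R e) \<bullet> e = t" using e \<pi>0[of z] by (simp add: inner_add_left)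
    ultimately show ?thesis using that by (simp add: \<Omega>_def)
  qed
  have \<Omega>T: "\<bar>z \<bullet> e\<bar> < T" if "z \<in> \<Omega>" for z using that by (simp add: \<Omega>_def)
  have GC: "G z \<in> ball x0 r" if z: "z \<in> \<Omega>" for z
  proof -
    have zT: "\<bar>z \<bullet> e\<bar> \<le> T0" using \<Omega>T[OF z] T by simp
    have "norm (tint e (\<lambda>\<zeta>. \<xi> (\<rho> (G \<zeta>))) z) \<le> \<bar>z \<bullet> e\<bar> * M" by (rule tint_bound[OF cG\<xi> M[OF \<rho>C]])
    also have "\<dots> \<le> T0 * M" using zT M0 by (rule mult_right_mono)
    also have "\<dots> \<le> r / 2" by (rule T0M)
    finally have 1: "norm (tint e (\<lambda>\<zeta>. \<xi> (\<rho> (G \<zeta>))) z) \<le> r / 2" .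
    have "G z - x0 = L (\<pi> z) + tint e (\<lambda>\<zeta>. \<xi> (\<rho> (G \<zeta>))) z"
      using G(2)[OF zT] by (simp add: P_def \<pi>_def)
    then have "norm (G z - x0) \<le> norm (L (\<pi> z)) + norm (tint e (\<lambda>\<zeta>. \<xi> (\<rho> (G \<zeta>))) z)"
      using norm_triangle_ineq by metis
    also have "\<dots> < r" using 1 z by (simp add: \<Omega>_def)
    finally show ?thesis by (simp add: dist_norm norm_minus_commute)
  qed
  have GC': "G z \<in> ?C" "G z \<in> S" "\<rho> (G z) = G z" if "z \<in> \<Omega>" for z
    using GC[OF that] \<rho>id[of "G z"] r(2) by auto
  have dG: "((\<lambda>t. G (z + t *\<^sub>R e)) has_vector_derivative \<xi> (\<rho> (G (z + t *\<^sub>R e)))) (at t)"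
    if "z \<bullet> e = 0" "\<bar>t\<bar> < T" for z t
    by (rule fixpoint_line_derivative[OF e _ cG\<xi> that(1), of T0 _ "\<lambda>x. x0 + L x"])
       (use G(2) that T in \<open>simp_all add: P_def\<close>)
  have G0: "G z = x0 + L z" if "z \<bullet> e = 0" for z
    using G(2)[of z] that T0 by (simp add: P_def tint_def tslide_orth)
  \<comment> \<open>\<open>Z2\<close> times the difference is constant in time, as \<open>Z2\<close> solves the adjoint equation.\<close>
  have key: "G (z + w) = G z + Y2 (w, z) *v L w" if w: "w \<bullet> e = 0" and z: "z \<in> \<Omega>" "z + w \<in> \<Omega>" for z w
  proof -
    let ?Q = "\<lambda>t. G (\<pi> z + w + t *\<^sub>R e) - G (\<pi> z + t *\<^sub>R e)"
    have \<pi>zw: "(\<pi> z + w) \<bullet> e = 0" using w \<pi>0 by (simp add: inner_add_left)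
    have p0: "(w, \<pi> z) \<bullet> ?e = 0" using \<pi>0 by simp
    have "\<exists>c. \<forall>t\<in>{-T<..<T}. Z2 ((w, \<pi> z) + t *\<^sub>R ?e) *v ?Q t = c"
    proof (rule has_derivative_zero_constant)
      fix t assume "t \<in> {-T<..<T}"
      then have t: "\<bar>t\<bar> < T" by auto
      have 1: "\<pi> z + t *\<^sub>R e \<in> \<Omega>" by (rule \<Omega>t[OF z(1) t])
      have "\<pi> (z + w) + t *\<^sub>R e \<in> \<Omega>" by (rule \<Omega>t[OF z(2) t])
      then have 2: "\<pi> z + w + t *\<^sub>R e \<in> \<Omega>" by (simp add: \<pi>a \<pi>o[OF w])
      let ?Z = "Z2 ((w, \<pi> z) + t *\<^sub>R ?e)"
      have J': "\<xi> (\<rho> (G (\<pi> z + w + t *\<^sub>R e))) - \<xi> (\<rho> (G (\<pi> z + t *\<^sub>R e))) = Jp ((w, \<pi> z) + t *\<^sub>R ?e) *v ?Q t"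
        using J[OF GC'(1)[OF 1] GC'(1)[OF 2]] GC'(3)[OF 1] GC'(3)[OF 2]
        by (simp add: Jp_def add_ac)
      have "((\<lambda>t. Z2 ((w, \<pi> z) + t *\<^sub>R ?e) *v ?Q t) has_vector_derivative
          ?Z *v (\<xi> (\<rho> (G (\<pi> z + w + t *\<^sub>R e))) - \<xi> (\<rho> (G (\<pi> z + t *\<^sub>R e))))
          + (- (?Z ** Jp ((w, \<pi> z) + t *\<^sub>R ?e))) *v ?Q t) (at t)"
        by (rule bounded_bilinear.has_vector_derivative[OF bv dZ2[OF p0 t]
              has_vector_derivative_diff[OF dG[OF \<pi>zw t] dG[OF \<pi>0 t]]])
      then have "((\<lambda>t. Z2 ((w, \<pi> z) + t *\<^sub>R ?e) *v ?Q t) has_vector_derivative 0) (at t)"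
        unfolding J' by (simp only: bounded_bilinear.minus_left[OF bv] matrix_vector_mul_assoc add.right_inverse)
      then show "((\<lambda>t. Z2 ((w, \<pi> z) + t *\<^sub>R ?e) *v ?Q t) has_derivative (\<lambda>h. 0)) (at t within {-T<..<T})"
        by (simp add: has_vector_derivative_def has_derivative_at_withinI)
    qed simp
    then obtain c where c: "\<And>t. t \<in> {-T<..<T} \<Longrightarrow> Z2 ((w, \<pi> z) + t *\<^sub>R ?e) *v ?Q t = c" by blast
    have ze: "(w, \<pi> z) + (z \<bullet> e) *\<^sub>R ?e = (w, z)" by (simp add: \<pi>z)
    have ze': "\<pi> z + w + (z \<bullet> e) *\<^sub>R e = z + w" by (metis \<pi>z add.assoc add.commute)
    have zT: "z \<bullet> e \<in> {-T<..<T}" using \<Omega>T[OF z(1)] by (auto simp: abs_less_iff)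
    have "Z2 (w, z) *v (G (z + w) - G z) = c"
      using c[OF zT] by (simp only: ze ze' \<pi>z)
    also have "c = Z2 (w, \<pi> z) *v (G (\<pi> z + w) - G (\<pi> z))"
      using c[of 0] T by simp
    also have "\<dots> = L w"
      using i[OF p0] by (simp add: G0[OF \<pi>zw] G0[OF \<pi>0] linear_add[OF bounded_linear.linear[OF L]])
    finally have "Y2 (w, z) *v (Z2 (w, z) *v (G (z + w) - G z)) = Y2 (w, z) *v L w" by simp
    moreover have "Y2 (w, z) ** Z2 (w, z) = mat 1" using YZ[of "(w, z)"] \<Omega>T[OF z(1)] by simp
    ultimately show ?thesis by (simp add: matrix_vector_mul_assoc algebra_simps)
  qed
  define Y where "Y z = Y2 (0, z)" for z
  define Z where "Z z = Z2 (0, z)" for z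
  define A where "A z = jac \<xi> (G z)" for z
  have JpA: "Jp (0, z) = A z" if "z \<in> \<Omega>" for z
    using GC'(3)[OF that] by (simp add: Jp_def J_def A_def)
  have cY: "continuous_on UNIV Y" and cZ: "continuous_on UNIV Z"
    unfolding Y_def[abs_def] Z_def[abs_def]
    by (rule continuous_on_compose2[OF cYZ(1)] continuous_on_compose2[OF cYZ(2)]; auto intro!: continuous_intros)+
  have dY: "((\<lambda>t. Y (\<pi> z + t *\<^sub>R e)) has_vector_derivative A (\<pi> z + t *\<^sub>R e) ** Y (\<pi> z + t *\<^sub>R e)) (at t)"
    and dZ: "((\<lambda>t. Z (\<pi> z + t *\<^sub>R e)) has_vector_derivative - (Z (\<pi> z + t *\<^sub>R e) ** A (\<pi> z + t *\<^sub>R e))) (at t)"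
    if "z \<in> \<Omega>" "\<bar>t\<bar> < T" for z t
    using dY2[of "(0, \<pi> z)" t] dZ2[of "(0, \<pi> z)" t] \<pi>0[of z] that(2) JpA[OF \<Omega>t[OF that]]
    by (simp_all add: Y_def Z_def)
  have YZ1: "Y z ** Z z = mat 1" "Z z ** Y z = mat 1" if "z \<in> \<Omega>" for z
    using YZ[of "(0, z)"] \<Omega>T[OF that] by (simp_all add: Y_def Z_def)
  have shift: "((\<lambda>t. f (z + t *\<^sub>R e)) has_vector_derivative g z) (at 0)"
    if "z \<in> \<Omega>" "\<And>t. \<bar>t\<bar> < T \<Longrightarrow> ((\<lambda>t. f (\<pi> z + t *\<^sub>R e)) has_vector_derivative g (\<pi> z + t *\<^sub>R e)) (at t)"
    for z and f g :: "real ^ 'n \<Rightarrow> 'x::real_normed_vector"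
  proof -
    have "((\<lambda>t. z \<bullet> e + t) has_vector_derivative 1) (at 0)" by (auto intro!: derivative_eq_intros)
    moreover have "((\<lambda>t. f (\<pi> z + t *\<^sub>R e)) has_vector_derivative g z) (at (z \<bullet> e + 0))"
      using that(2)[OF \<Omega>T[OF that(1)]] by (simp add: \<pi>z)
    ultimately have "((\<lambda>t. f (\<pi> z + (z \<bullet> e + t) *\<^sub>R e)) has_vector_derivative 1 *\<^sub>R g z) (at 0)"
      using vector_diff_chain_at[of "\<lambda>t. z \<bullet> e + t" 1 0 "\<lambda>t. f (\<pi> z + t *\<^sub>R e)" "g z"] by (simp add: o_def)
    moreover have "\<pi> z + (z \<bullet> e + t) *\<^sub>R e = z + t *\<^sub>R e" for t
      by (metis \<pi>z add.assoc scaleR_add_left)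
    ultimately show ?thesis by simp
  qed
  have U: "open {w. z + \<pi> w \<in> \<Omega>}" "0 \<in> {w. z + \<pi> w \<in> \<Omega>}" if "z \<in> \<Omega>" for z
  proof -
    have "continuous_on UNIV (\<lambda>w. z + \<pi> w)" by (intro continuous_intros linear_continuous_on \<pi>l)
    from open_vimage[OF o\<Omega> this] show "open {w. z + \<pi> w \<in> \<Omega>}" by (simp add: vimage_def)
    show "0 \<in> {w. z + \<pi> w \<in> \<Omega>}" using that by (simp add: \<pi>_def tslide_def)
  qed
  have \<pi>zero: "\<pi> 0 = 0" by (simp add: \<pi>_def tslide_def)
  have DG: "(G has_derivative (\<lambda>w. Y z *v L (\<pi> w) + (w \<bullet> e) *\<^sub>R \<xi> (G z))) (at z)" if z: "z \<in> \<Omega>" for z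
  proof (rule has_derivative_split[OF e o\<Omega> z, of "\<lambda>z. \<xi> (G z)"])
    show "continuous_on \<Omega> (\<lambda>z. \<xi> (G z))"
      by (rule continuous_on_compose2[OF smooth_on_continuous_on[OF \<xi>] continuous_on_subset[OF G(1)]]) (use GC' in auto)
    show "((\<lambda>t. G (\<zeta> + t *\<^sub>R e)) has_vector_derivative \<xi> (G \<zeta>)) (at 0)" if "\<zeta> \<in> \<Omega>" for \<zeta>
    proof -
      have "((\<lambda>t. G (\<zeta> + t *\<^sub>R e)) has_vector_derivative (\<lambda>z. \<xi> (\<rho> (G z))) \<zeta>) (at 0)"
        by (rule shift[OF that]) (rule dG[OF \<pi>0])
      then show ?thesis by (simp add: GC'(3)[OF that])
    qed
    have "continuous_on UNIV (\<lambda>w. Y2 (\<pi> w, z))"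
      by (rule continuous_on_compose2[OF cYZ(1)
          continuous_on_Pair[OF linear_continuous_on[OF \<pi>l] continuous_on_const]]) simp
    then have "isCont (\<lambda>w. Y2 (\<pi> w, z)) 0" by (simp add: continuous_on_eq_continuous_at)
    from has_derivative_mult_cont[OF bv Lp this]
    have "((\<lambda>w. Y2 (\<pi> w, z) *v L (\<pi> w)) has_derivative (\<lambda>w. Y z *v L (\<pi> w))) (at 0)"
      by (simp add: Y_def \<pi>zero)
    from has_derivative_add[OF has_derivative_const[of "G z"] this]
    have 1: "((\<lambda>w. G z + Y2 (\<pi> w, z) *v L (\<pi> w)) has_derivative (\<lambda>w. Y z *v L (\<pi> w))) (at 0)" by simp
    show "((\<lambda>w. G (z + tslide e 0 w)) has_derivative (\<lambda>w. Y z *v L (\<pi> w))) (at 0)"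
      unfolding \<pi>_def[symmetric]
      by (rule has_derivative_transform_within_open[OF 1 U[OF z]]) (use key[OF \<pi>0 z] in simp)
  qed
  \<comment> \<open>The same argument for \<open>Y\<close>: its increment solves an inhomogeneous linear equation, and
    variation of constants expresses it through the averages \<open>a i\<close> of the derivatives of \<open>A\<close> over
    the segment of increments.\<close>
  have DY: "(Y has_derivative (\<lambda>w. (\<Sum>i\<in>Basis. (\<pi> w \<bullet> i) *\<^sub>R (Y z ** tint e (\<lambda>\<zeta>. Z \<zeta> ** dird i A \<zeta> ** Y \<zeta>) z))
      + (w \<bullet> e) *\<^sub>R (A z ** Y z))) (at z)"
    if z: "z \<in> \<Omega>" and A: "ck 1 \<Omega> A" for z
  proof (rule has_derivative_split[OF e o\<Omega> z, of "\<lambda>z. A z ** Y z"])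
    have cA: "continuous_on \<Omega> A" and cdA: "continuous_on \<Omega> (dird i A)" for i
      using ck_continuous_on[OF A] A by simp_all
    have Ad: "A differentiable (at x)" if "x \<in> \<Omega>" for x using A that by simp
    show "continuous_on \<Omega> (\<lambda>z. A z ** Y z)"
      by (intro bounded_bilinear.continuous_on[OF bb cA] continuous_on_subset[OF cY]) simp
    show "((\<lambda>t. Y (\<zeta> + t *\<^sub>R e)) has_vector_derivative A \<zeta> ** Y \<zeta>) (at 0)" if "\<zeta> \<in> \<Omega>" for \<zeta>
      by (rule shift[OF that dY[OF that]])
    define a where "a i p = integral {0..1} (\<lambda>\<theta>. dird i A (snd p + \<theta> *\<^sub>R fst p))" for i and p :: "(real ^ 'n) \<times> (real ^ 'n)"
    let ?D = "{p :: (real ^ 'n) \<times> (real ^ 'n). snd p \<in> \<Omega> \<and> snd p + fst p \<in> \<Omega>}"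
    have seg: "x + \<theta> *\<^sub>R w \<in> \<Omega>" if "x \<in> \<Omega>" "x + w \<in> \<Omega>" "\<theta> \<in> {0..1}" for x w \<theta>
    proof -
      have "(1 - \<theta>) *\<^sub>R x + \<theta> *\<^sub>R (x + w) \<in> \<Omega>" by (rule convexD_alt[OF cv\<Omega> that(1,2)]) (use that in auto)
      then show ?thesis by (simp add: algebra_simps)
    qed
    have ca: "continuous_on ?D (a i)" for i
    proof -
      have "continuous_on ?D (\<lambda>p. integral (cbox 0 1) (\<lambda>\<theta>. dird i A (snd p + \<theta> *\<^sub>R fst p)))"
      proof (rule integral_continuous_on_param)
        have "continuous_on (?D \<times> cbox 0 1) (\<lambda>q. dird i A (snd (fst q) + snd q *\<^sub>R fst (fst q)))"
          by (rule continuous_on_compose2[OF cdA]) (use seg in \<open>auto intro!: continuous_intros\<close>)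
        then show "continuous_on (?D \<times> cbox 0 1) (\<lambda>(p, \<theta>). dird i A (snd p + \<theta> *\<^sub>R fst p))"
          by (simp add: split_beta)
      qed
      then show ?thesis by (simp add: a_def[abs_def])
    qed
    have a0: "a i (0, \<zeta>) = dird i A \<zeta>" for i \<zeta> by (simp add: a_def)
    have Aw: "A (\<zeta> + w) - A \<zeta> = (\<Sum>i\<in>Basis. (w \<bullet> i) *\<^sub>R a i (w, \<zeta>))" if "\<zeta> \<in> \<Omega>" "\<zeta> + w \<in> \<Omega>" for \<zeta> w
    proof -
      have lin: "dird w A x = (\<Sum>i\<in>Basis. (w \<bullet> i) *\<^sub>R dird i A x)" if "x \<in> \<Omega>" for x
      proof -
        have l: "linear (\<lambda>w. dird w A x)"
          using differentiable_has_derivative_dird[OF Ad[OF that]] has_derivative_linear by blast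
        show ?thesis
          using linear_sum[OF l, of "\<lambda>b. (w \<bullet> b) *\<^sub>R b" Basis] linear_cmul[OF l]
          by (simp add: euclidean_representation)
      qed
      have "((\<lambda>\<theta>. (w \<bullet> i) *\<^sub>R dird i A (\<zeta> + \<theta> *\<^sub>R w)) has_integral (w \<bullet> i) *\<^sub>R a i (w, \<zeta>)) {0..1}" for i
      proof -
        have "continuous_on {0..1} (\<lambda>\<theta>. dird i A (\<zeta> + \<theta> *\<^sub>R w))"
          by (rule continuous_on_compose2[OF cdA]) (use seg[OF that] in \<open>auto intro!: continuous_intros\<close>)
        from integrable_integral[OF integrable_continuous_interval[OF this]]
        show ?thesis by (intro has_integral_cmul) (simp add: a_def)
      qed
      then have "((\<lambda>\<theta>. \<Sum>i\<in>Basis. (w \<bullet> i) *\<^sub>R dird i A (\<zeta> + \<theta> *\<^sub>R w)) has_integral (\<Sum>i\<in>Basis. (w \<bullet> i) *\<^sub>R a i (w, \<zeta>))) {0..1}"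
        by (intro has_integral_sum) auto
      then have "((\<lambda>\<theta>. dird w A (\<zeta> + \<theta> *\<^sub>R w)) has_integral (\<Sum>i\<in>Basis. (w \<bullet> i) *\<^sub>R a i (w, \<zeta>))) {0..1}"
        by (rule has_integral_eq[rotated]) (use lin[OF seg[OF that]] in simp)
      from has_integral_unique[OF hadamard[OF cv\<Omega> Ad that] this] show ?thesis .
    qed
    define c where "c i w = Y z ** tint e (\<lambda>\<zeta>. Z \<zeta> ** a i (\<pi> w, \<zeta>) ** Y (\<zeta> + \<pi> w)) z" for i w
    let ?U = "{w. z + \<pi> w \<in> \<Omega>}"
    have zs: "tslide e s z \<in> \<Omega>" "tslide e s z + \<pi> w \<in> \<Omega>" if "w \<in> ?U" "s \<in> {0..1}" for s w
    proof -
      show "tslide e s z \<in> \<Omega>" by (rule \<Omega>s[OF z that(2)])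
      have "tslide e s (z + \<pi> w) \<in> \<Omega>" by (rule \<Omega>s) (use that in auto)
      then show "tslide e s z + \<pi> w \<in> \<Omega>" by (simp add: tslide_add tslide_orth[OF \<pi>0])
    qed
    have cc: "isCont (c i) 0" for i
    proof -
      have "continuous_on ?U (\<lambda>w. integral (cbox 0 1) (\<lambda>s. Z (tslide e s z) ** a i (\<pi> w, tslide e s z) ** Y (tslide e s z + \<pi> w)))"
      proof (rule integral_continuous_on_param)
        have c1: "continuous_on (?U \<times> cbox 0 1) (\<lambda>q. tslide e (snd q) z)" unfolding tslide_def by (intro continuous_intros)
        have c2: "continuous_on (?U \<times> cbox 0 1) (\<lambda>q. \<pi> (fst q))"
          by (rule continuous_on_compose2[OF linear_continuous_on[OF \<pi>l, of UNIV]]) (auto intro!: continuous_intros)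
        have "continuous_on (?U \<times> cbox 0 1) (\<lambda>q. Z (tslide e (snd q) z) ** a i (\<pi> (fst q), tslide e (snd q) z)
            ** Y (tslide e (snd q) z + \<pi> (fst q)))"
        proof (intro bounded_bilinear.continuous_on[OF bb])
          show "continuous_on (?U \<times> cbox 0 1) (\<lambda>q. Z (tslide e (snd q) z))"
            by (rule continuous_on_compose2[OF cZ c1]) simp
          show "continuous_on (?U \<times> cbox 0 1) (\<lambda>q. a i (\<pi> (fst q), tslide e (snd q) z))"
            by (rule continuous_on_compose2[OF ca continuous_on_Pair[OF c2 c1]]) (use zs in auto)
          show "continuous_on (?U \<times> cbox 0 1) (\<lambda>q. Y (tslide e (snd q) z + \<pi> (fst q)))"
            by (rule continuous_on_compose2[OF cY continuous_on_add[OF c1 c2]]) simp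
        qed
        then show "continuous_on (?U \<times> cbox 0 1) (\<lambda>(w, s). Z (tslide e s z) ** a i (\<pi> w, tslide e s z) ** Y (tslide e s z + \<pi> w))"
          by (simp add: split_beta)
      qed
      then have "continuous_on ?U (c i)"
        unfolding c_def[abs_def] tint_def
        by (intro bounded_bilinear.continuous_on[OF bb] continuous_on_const continuous_on_scaleR) simp
      then show ?thesis using U[OF z] by (simp add: continuous_on_eq_continuous_at)
    qed
    have Yw: "Y (z + \<pi> w) = Y z + (\<Sum>i\<in>Basis. (\<pi> w \<bullet> i) *\<^sub>R c i w)" if w: "w \<in> ?U" for w
    proof -
      let ?S = "{\<zeta> \<in> \<Omega>. \<zeta> + \<pi> w \<in> \<Omega>}"
      let ?g = "\<lambda>\<zeta>. Z \<zeta> ** (A (\<zeta> + \<pi> w) - A \<zeta>) ** Y (\<zeta> + \<pi> w)"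
      have zt: "\<pi> z + t *\<^sub>R e \<in> ?S" if "\<bar>t\<bar> < T" for t
        using \<Omega>t[OF z that] \<Omega>t[of "z + \<pi> w" t] w that by (simp add: \<pi>a \<pi>o[OF \<pi>0] add_ac)
      have "(\<lambda>\<zeta>. Z \<zeta> ** Y (\<zeta> + \<pi> w)) (\<pi> z + (z \<bullet> e) *\<^sub>R e)
          = (\<lambda>\<zeta>. Z \<zeta> ** Y (\<zeta> + \<pi> w)) (\<pi> z) + tint e ?g (\<pi> z + (z \<bullet> e) *\<^sub>R e)"
      proof (rule line_increment[OF e _ \<pi>0 zt \<Omega>T[OF z]])
        have "continuous_on ?S (\<lambda>\<zeta>. A (\<zeta> + \<pi> w))"
          by (rule continuous_on_compose2[OF cA]) (auto intro!: continuous_intros)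
        moreover have "continuous_on ?S A" by (rule continuous_on_subset[OF cA]) auto
        moreover have "continuous_on ?S (\<lambda>\<zeta>. Y (\<zeta> + \<pi> w))"
          by (rule continuous_on_compose2[OF cY]) (auto intro!: continuous_intros)
        ultimately show "continuous_on ?S ?g"
          by (intro bounded_bilinear.continuous_on[OF bb] continuous_on_diff continuous_on_subset[OF cZ]) auto
      next
        fix t assume t: "\<bar>t\<bar> < T"
        have "((\<lambda>t. Y (\<pi> (z + \<pi> w) + t *\<^sub>R e)) has_vector_derivative
            A (\<pi> (z + \<pi> w) + t *\<^sub>R e) ** Y (\<pi> (z + \<pi> w) + t *\<^sub>R e)) (at t)"
          using dY[OF _ t, of "z + \<pi> w"] w by simp
        then have 1: "((\<lambda>t. Y (\<pi> z + t *\<^sub>R e + \<pi> w)) has_vector_derivative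
            A (\<pi> z + t *\<^sub>R e + \<pi> w) ** Y (\<pi> z + t *\<^sub>R e + \<pi> w)) (at t)"
          by (simp add: \<pi>a \<pi>o[OF \<pi>0] add_ac)
        have "((\<lambda>t. Z (\<pi> z + t *\<^sub>R e) ** Y (\<pi> z + t *\<^sub>R e + \<pi> w)) has_vector_derivative
            Z (\<pi> z + t *\<^sub>R e) ** (A (\<pi> z + t *\<^sub>R e + \<pi> w) ** Y (\<pi> z + t *\<^sub>R e + \<pi> w))
            + (- (Z (\<pi> z + t *\<^sub>R e) ** A (\<pi> z + t *\<^sub>R e))) ** Y (\<pi> z + t *\<^sub>R e + \<pi> w)) (at t)"
          by (rule bounded_bilinear.has_vector_derivative[OF bb dZ[OF z t] 1])
        then show "((\<lambda>t. Z (\<pi> z + t *\<^sub>R e) ** Y (\<pi> z + t *\<^sub>R e + \<pi> w)) has_vector_derivative ?g (\<pi> z + t *\<^sub>R e)) (at t)"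
          by (simp add: bounded_bilinear.diff_right[OF bb] bounded_bilinear.diff_left[OF bb]
              bounded_bilinear.minus_left[OF bb] matrix_mul_assoc)
      qed
      moreover have "Z (\<pi> z) ** Y (\<pi> z + \<pi> w) = mat 1"
        using i[of "(0, \<pi> z)"] i[of "(0, \<pi> z + \<pi> w)"] \<pi>0 by (simp add: Y_def Z_def inner_add_left)
      ultimately have ZY: "Z z ** Y (z + \<pi> w) = mat 1 + tint e ?g z" by (simp add: \<pi>z)
      have "Y (z + \<pi> w) = (Y z ** Z z) ** Y (z + \<pi> w)" by (simp add: YZ1[OF z])
      also have "\<dots> = Y z ** (mat 1 + tint e ?g z)" by (simp only: ZY flip: matrix_mul_assoc)
      also have "\<dots> = Y z + Y z ** tint e ?g z"
        by (simp add: bounded_bilinear.add_right[OF bb])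
      also have "tint e ?g z = (\<Sum>i\<in>Basis. (\<pi> w \<bullet> i) *\<^sub>R tint e (\<lambda>\<zeta>. Z \<zeta> ** a i (\<pi> w, \<zeta>) ** Y (\<zeta> + \<pi> w)) z)"
      proof -
        let ?h = "\<lambda>i s. Z (tslide e s z) ** a i (\<pi> w, tslide e s z) ** Y (tslide e s z + \<pi> w)"
        have "?g (tslide e s z) = (\<Sum>i\<in>Basis. (\<pi> w \<bullet> i) *\<^sub>R ?h i s)" if "s \<in> {0..1}" for s
          by (simp add: Aw[OF zs[OF w that]] bounded_bilinear.sum_right[OF bb] bounded_bilinear.sum_left[OF bb]
              bounded_bilinear.scaleR_right[OF bb] bounded_bilinear.scaleR_left[OF bb])
        then have "integral {0..1} (\<lambda>s. ?g (tslide e s z)) = integral {0..1} (\<lambda>s. \<Sum>i\<in>Basis. (\<pi> w \<bullet> i) *\<^sub>R ?h i s)"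
          by (rule integral_cong)
        also have "\<dots> = (\<Sum>i\<in>Basis. (\<pi> w \<bullet> i) *\<^sub>R integral {0..1} (?h i))"
        proof -
          have "?h i integrable_on {0..1}" for i
          proof (intro integrable_continuous_interval bounded_bilinear.continuous_on[OF bb])
            have c1: "continuous_on {0..1} (\<lambda>s. tslide e s z)" unfolding tslide_def by (intro continuous_intros)
            show "continuous_on {0..1} (\<lambda>s. Z (tslide e s z))"
              by (rule continuous_on_compose2[OF cZ c1]) simp
            show "continuous_on {0..1} (\<lambda>s. a i (\<pi> w, tslide e s z))"
              by (rule continuous_on_compose2[OF ca continuous_on_Pair[OF continuous_on_const c1]]) (use zs[OF w] in auto)
            show "continuous_on {0..1} (\<lambda>s. Y (tslide e s z + \<pi> w))"
              by (rule continuous_on_compose2[OF cY continuous_on_add[OF c1 continuous_on_const]]) simp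
          qed
          then show ?thesis by (simp add: integral_sum integrable_cmul)
        qed
        finally show ?thesis by (simp add: tint_def scaleR_sum_right mult.commute)
      qed
      finally show ?thesis
        by (simp add: c_def bounded_bilinear.sum_right[OF bb] bounded_bilinear.scaleR_right[OF bb])
    qed
    have "((\<lambda>w. (\<pi> w \<bullet> i) *\<^sub>R c i w) has_derivative (\<lambda>w. (\<pi> w \<bullet> i) *\<^sub>R c i 0)) (at 0)" for i
      using has_derivative_mult_cont[OF bounded_bilinear.flip[OF bounded_bilinear_scaleR]
          bounded_linear_compose[OF bounded_linear_inner_left \<pi>l] cc] .
    then have "((\<lambda>w. Y z + (\<Sum>i\<in>Basis. (\<pi> w \<bullet> i) *\<^sub>R c i w)) has_derivative (\<lambda>w. 0 + (\<Sum>i\<in>Basis. (\<pi> w \<bullet> i) *\<^sub>R c i 0))) (at 0)"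
      by (intro has_derivative_add has_derivative_const has_derivative_sum)
    then have 1: "((\<lambda>w. Y z + (\<Sum>i\<in>Basis. (\<pi> w \<bullet> i) *\<^sub>R c i w)) has_derivative
        (\<lambda>w. \<Sum>i\<in>Basis. (\<pi> w \<bullet> i) *\<^sub>R (Y z ** tint e (\<lambda>\<zeta>. Z \<zeta> ** dird i A \<zeta> ** Y \<zeta>) z))) (at 0)"
      by (simp add: c_def \<pi>zero a0)
    show "((\<lambda>w. Y (z + tslide e 0 w)) has_derivative
        (\<lambda>w. \<Sum>i\<in>Basis. (\<pi> w \<bullet> i) *\<^sub>R (Y z ** tint e (\<lambda>\<zeta>. Z \<zeta> ** dird i A \<zeta> ** Y \<zeta>) z))) (at 0)"
      unfolding \<pi>_def[symmetric]
      by (rule has_derivative_transform_within_open[OF 1 U[OF z]]) (use Yw in simp)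
  qed
  have inv: "invertible (Y z)" "matrix_inv (Y z) = Z z" if "z \<in> \<Omega>" for z
  proof -
    show I: "invertible (Y z)" using YZ1[OF that] invertible_def by blast
    have "matrix_inv (Y z) ** (Y z ** Z z) = Z z" by (simp add: matrix_mul_assoc matrix_inv_mult[OF I])
    then show "matrix_inv (Y z) = Z z" by (simp add: YZ1[OF that])
  qed
  \<comment> \<open>The order matters: \<open>G\<close> gains a derivative first, which makes \<open>A\<close> differentiable and \<open>DY\<close>
    applicable.\<close>
  have "ck k \<Omega> G \<and> ck k \<Omega> Y" for k
  proof (induction k)
    case 0
    then show ?case using continuous_on_subset[OF G(1)] continuous_on_subset[OF cY] by simp
  next
    case (Suc k)
    then have kG: "ck k \<Omega> G" and kY: "ck k \<Omega> Y" by auto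
    have "ck k S \<xi>" using \<xi> by (simp add: smooth_on_iff_ck)
    then have k\<xi>: "ck k \<Omega> (\<lambda>z. \<xi> (G z))" by (rule ck_compose[OF o\<Omega> S(1) _ kG GC'(2)])
    have SG: "ck (Suc k) \<Omega> G"
      by (rule ck_SucI[OF o\<Omega> DG])
         (assumption | intro ck_add[OF o\<Omega>] ck_scaleR[OF o\<Omega>] ck_bilinear[OF bv o\<Omega>] ck_const[OF o\<Omega>] kY k\<xi>)+
    have SA: "ck (Suc k) \<Omega> A" unfolding A_def[abs_def]
      by (rule ck_compose[OF o\<Omega> S(1) ckj SG GC'(2)])
    have kA: "ck k \<Omega> A" "ck k \<Omega> (dird i A)" for i using SA ck_mono_Suc by auto
    have "ck (Suc j) \<Omega> A \<Longrightarrow> ck 1 \<Omega> A" for j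
    proof (induction j)
      case (Suc j)
      then show ?case using ck_mono_Suc[of "Suc j" \<Omega> A] by simp
    qed simp
    from this[OF SA] have "ck 1 \<Omega> A" .
    note DY' = DY[OF _ this]
    have kZ: "ck k \<Omega> Z"
      using ck_cong[OF o\<Omega> inv(2), where k = k] ck_matrix_inv[OF o\<Omega> kY inv(1)] by simp
    have kt: "ck k \<Omega> (tint e (\<lambda>\<zeta>. Z \<zeta> ** dird i A \<zeta> ** Y \<zeta>))" for i
      by (rule ck_tint[OF o\<Omega> \<Omega>s]) (assumption | intro ck_bilinear[OF bb o\<Omega>] kZ kA kY)+
    have "ck (Suc k) \<Omega> Y"
      by (rule ck_SucI[OF o\<Omega> DY'])
         (assumption | intro ck_add[OF o\<Omega>] ck_sum[OF o\<Omega>] ck_scaleR[OF o\<Omega>] ck_bilinear[OF bb o\<Omega>] ck_const[OF o\<Omega>] kY kt kA)+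
    with SG show ?case by blast
  qed
  then have sG: "smooth_on \<Omega> G" by (simp add: smooth_on_iff_ck)
  have "0 \<in> \<Omega>" using T r linear_0[OF bounded_linear.linear[OF L]] by (simp add: \<Omega>_def \<pi>zero)
  then obtain R where R: "0 < R" "ball 0 R \<subseteq> \<Omega>" using o\<Omega> open_contains_ball by blast
  show ?thesis
  proof (rule that[OF R(1) smooth_on_subset[OF sG R(2)]])
    fix z :: "real ^ 'n" assume "z \<in> ball 0 R"
    then have z: "z \<in> \<Omega>" using R by blast
    show "G z \<in> S" by (rule GC'(2)[OF z])
    show "dird e G z = \<xi> (G z)"
      using dird_has_derivative[OF DG[OF z], of e] e
      by (simp add: \<pi>_def tslide_def linear_0[OF bounded_linear.linear[OF L]])
    show "G z = x0 + L z" if "z \<bullet> e = 0" using G0[OF that] .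
  qed
qed

section \<open>Charts and components\<close>

lemma chart_facts:
  assumes "is_chart X c"
  shows chart_inj: "inj_on (coord c) (cdom c)" and chart_open_range: "open (crange c)"
    and chart_openin: "openin X (cdom c)"
    and chart_homeo: "homeomorphic_map (subtopology X (cdom c)) (top_of_set (crange c)) (coord c)"
proof -
  show o: "openin X (cdom c)" and "open (crange c)"
    and h: "homeomorphic_map (subtopology X (cdom c)) (top_of_set (crange c)) (coord c)"
    using assms by (auto simp: is_chart_def)
  have "topspace (subtopology X (cdom c)) = cdom c"
    using openin_subset[OF o] by auto
  then show "inj_on (coord c) (cdom c)" using homeomorphic_imp_injective_map[OF h] by simp
qed

lemma cinv_coord: "is_chart X c \<Longrightarrow> p \<in> cdom c \<Longrightarrow> cinv c (coord c p) = p"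
  by (simp add: cinv_def chart_inj)

lemma cinv_in: "x \<in> crange c \<Longrightarrow> cinv c x \<in> cdom c"
  unfolding cinv_def by (rule inv_into_into)

lemma coord_cinv: "x \<in> crange c \<Longrightarrow> coord c (cinv c x) = x"
  unfolding cinv_def by (rule f_inv_into_f)

lemma chart_open_image:
  assumes c: "is_chart X c" and U: "openin X U"
  shows "open (coord c ` (cdom c \<inter> U))"
proof -
  have "openin (subtopology X (cdom c)) (cdom c \<inter> U)"
    using openin_subtopology_Int2[OF U] by blast
  then have "openin (top_of_set (crange c)) (coord c ` (cdom c \<inter> U))"
    using homeomorphic_imp_open_map[OF chart_homeo[OF c]] unfolding open_map_def by blast
  then show ?thesis using openin_open_eq[OF chart_open_range[OF c]] by blast
qed

lemma chart_openin_vimage: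
  assumes c: "is_chart X c" and V: "open V"
  shows "openin X {p \<in> cdom c. coord c p \<in> V}"
proof -
  have "continuous_map (subtopology X (cdom c)) (top_of_set (crange c)) (coord c)"
    using homeomorphic_imp_continuous_map[OF chart_homeo[OF c]] .
  moreover have "openin (top_of_set (crange c)) (crange c \<inter> V)" using V by (simp add: openin_open_Int)
  ultimately have "openin (subtopology X (cdom c)) {p \<in> topspace (subtopology X (cdom c)). coord c p \<in> crange c \<inter> V}"
    by (rule openin_continuous_map_preimage)
  moreover have "{p \<in> topspace (subtopology X (cdom c)). coord c p \<in> crange c \<inter> V} = {p \<in> cdom c. coord c p \<in> V}"
    using openin_subset[OF chart_openin[OF c]] by auto
  ultimately have "openin (subtopology X (cdom c)) {p \<in> cdom c. coord c p \<in> V}" by (simp only:)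
  then show ?thesis using chart_openin[OF c] openin_trans_full by blast
qed

lemma transition_coord: "is_chart X c \<Longrightarrow> p \<in> cdom c \<Longrightarrow> transition c c' (coord c p) = coord c' p"
  by (simp add: transition_def cinv_coord)

lemma chart_cinv_continuous:
  assumes c: "is_chart X c"
  shows "continuous_map (top_of_set (crange c)) (subtopology X (cdom c)) (cinv c)"
proof -
  obtain g where g: "homeomorphic_maps (subtopology X (cdom c)) (top_of_set (crange c)) (coord c) g"
    using chart_homeo[OF c] homeomorphic_map_maps by blast
  then have 1: "continuous_map (top_of_set (crange c)) (subtopology X (cdom c)) g"
    by (simp add: homeomorphic_maps_def)
  have "g x = cinv c x" if "x \<in> crange c" for x
  proof -
    have "cinv c x \<in> topspace (subtopology X (cdom c))"
      using cinv_in[OF that] openin_subset[OF chart_openin[OF c]] by auto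
    then have "g (coord c (cinv c x)) = cinv c x" using g unfolding homeomorphic_maps_def by blast
    then show ?thesis by (simp add: coord_cinv[OF that])
  qed
  then show ?thesis by (intro continuous_map_eq[OF 1]) simp
qed

text \<open>New coordinates on part of a chart, given by a homeomorphism \<open>E\<close> between open sets.\<close>

lemma new_chart_is_chart:
  assumes c: "is_chart X c" and V: "open V" "V \<subseteq> crange c"
    and E: "continuous_on V E" "open (E ` V)" and Ei: "\<And>x. x \<in> V \<Longrightarrow> Ei (E x) = x" "continuous_on (E ` V) Ei"
  shows "is_chart X ({p \<in> cdom c. coord c p \<in> V}, E \<circ> coord c)" (is "is_chart X ?c")
    "crange ({p \<in> cdom c. coord c p \<in> V}, E \<circ> coord c) = E ` V"
proof -
  have im: "coord c ` {p \<in> cdom c. coord c p \<in> V} = V" using V by auto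
  show cr: "crange ?c = E ` V"
    by (simp only: fst_conv snd_conv image_comp[symmetric] im)
  have op: "openin X (cdom ?c)" using chart_openin_vimage[OF c V(1)] by simp
  have ts: "topspace (subtopology X (cdom ?c)) = cdom ?c"
    using openin_subset[OF op] by auto
  have "continuous_map (subtopology X (cdom ?c)) (top_of_set (crange c)) (coord c)"
    by (rule continuous_map_from_subtopology_mono[OF homeomorphic_imp_continuous_map[OF chart_homeo[OF c]]]) auto
  then have 1: "continuous_map (subtopology X (cdom ?c)) (top_of_set V) (coord c)"
    unfolding continuous_map_in_subtopology using ts by auto
  have 2: "continuous_map (top_of_set V) (top_of_set (E ` V)) E"
    unfolding continuous_map_in_subtopology using E(1) by auto
  have 3: "continuous_map (top_of_set (E ` V)) (top_of_set V) Ei"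
    unfolding continuous_map_in_subtopology using Ei by auto
  have "continuous_map (top_of_set V) (subtopology X (cdom c)) (cinv c)"
    by (rule continuous_map_from_subtopology_mono[OF chart_cinv_continuous[OF c] V(2)])
  then have 4: "continuous_map (top_of_set V) (subtopology X (cdom ?c)) (cinv c)"
    unfolding continuous_map_in_subtopology using V(2) cinv_in[of _ c] coord_cinv[of _ c] by auto
  have "homeomorphic_maps (subtopology X (cdom ?c)) (top_of_set (E ` V)) (E \<circ> coord c) (cinv c \<circ> Ei)"
    unfolding homeomorphic_maps_def
  proof (intro conjI)
    show "continuous_map (subtopology X (cdom ?c)) (top_of_set (E ` V)) (E \<circ> coord c)"
      by (rule continuous_map_compose[OF 1 2])
    show "continuous_map (top_of_set (E ` V)) (subtopology X (cdom ?c)) (cinv c \<circ> Ei)"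
      by (rule continuous_map_compose[OF 3 4])
    show "\<forall>x\<in>topspace (subtopology X (cdom ?c)). (cinv c \<circ> Ei) ((E \<circ> coord c) x) = x"
      unfolding ts using Ei(1) cinv_coord[OF c] by simp
    show "\<forall>y\<in>topspace (top_of_set (E ` V)). (E \<circ> coord c) ((cinv c \<circ> Ei) y) = y"
    proof
      fix y assume "y \<in> topspace (top_of_set (E ` V))"
      then obtain x where x: "x \<in> V" "y = E x" by auto
      then have "x \<in> crange c" using V(2) by blast
      then show "(E \<circ> coord c) ((cinv c \<circ> Ei) y) = y" using x by (simp add: Ei(1) coord_cinv)
    qed
  qed
  then have h: "homeomorphic_map (subtopology X (cdom ?c)) (top_of_set (E ` V)) (E \<circ> coord c)"
    by (rule homeomorphic_maps_imp_map)
  then show "is_chart X ?c"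
    unfolding is_chart_def cr unfolding snd_conv using op E(2) h by blast
qed

context
  fixes X :: "'p topology" and \<A> :: "('p, 'n::finite) chart set"
  assumes M: "smooth_manifold X \<A>"
begin

lemma atlas_chart: "c \<in> \<A> \<Longrightarrow> is_chart X c"
  using M by (simp add: smooth_manifold_def)

lemma atlas_topspace: "c \<in> \<A> \<Longrightarrow> p \<in> cdom c \<Longrightarrow> p \<in> topspace X"
  using M unfolding smooth_manifold_def by blast

lemma atlas_cover: "p \<in> topspace X \<Longrightarrow> \<exists>c\<in>\<A>. p \<in> cdom c"
  using M unfolding smooth_manifold_def by blast

lemma transition_smooth:
  "c \<in> \<A> \<Longrightarrow> c' \<in> \<A> \<Longrightarrow> smooth_on (coord c ` (cdom c \<inter> cdom c')) (transition c c')"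
  using M by (simp add: smooth_manifold_def compatible_def)

lemma overlap_open: "c \<in> \<A> \<Longrightarrow> c' \<in> \<A> \<Longrightarrow> open (coord c ` (cdom c \<inter> cdom c'))"
  using chart_open_image[OF atlas_chart chart_openin[OF atlas_chart]] .

lemma transition_derivative:
  assumes "c \<in> \<A>" "c' \<in> \<A>" "p \<in> cdom c" "p \<in> cdom c'"
  shows "(transition c c' has_derivative (\<lambda>v. dird v (transition c c') (coord c p))) (at (coord c p))"
  by (rule smooth_on_has_derivative[OF transition_smooth[OF assms(1,2)]]) (use assms in auto)

text \<open>The chain rule for the composition of two changes of charts. It makes \<open>tvec_of\<close>, the
  tangent vector with components \<open>y\<close> in the chart \<open>c\<close>, satisfy the transformation law of tangent
  vectors.\<close>

lemma transition_chain:
  assumes c: "c \<in> \<A>" "c' \<in> \<A>" "c'' \<in> \<A>" and p: "p \<in> cdom c" "p \<in> cdom c'" "p \<in> cdom c''"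
  shows "dird y (transition c c'') (coord c p)
    = dird (dird y (transition c c') (coord c p)) (transition c' c'') (coord c' p)"
proof -
  have t: "transition c c' (coord c p) = coord c' p" by (rule transition_coord[OF atlas_chart[OF c(1)] p(1)])
  have 1: "((\<lambda>x. transition c' c'' (transition c c' x)) has_derivative
     (\<lambda>y. dird (dird y (transition c c') (coord c p)) (transition c' c'') (coord c' p))) (at (coord c p))"
    using has_derivative_compose[OF transition_derivative[OF c(1,2) p(1,2)]] transition_derivative[OF c(2,3) p(2,3)] t by auto
  have o: "open (coord c ` (cdom c \<inter> (cdom c' \<inter> cdom c'')))"
    by (rule chart_open_image[OF atlas_chart[OF c(1)]])
       (intro openin_Int chart_openin[OF atlas_chart] c)
  have "(transition c c'' has_derivative
     (\<lambda>y. dird (dird y (transition c c') (coord c p)) (transition c' c'') (coord c' p))) (at (coord c p))"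
  proof (rule has_derivative_transform_within_open[OF 1 o])
    show "coord c p \<in> coord c ` (cdom c \<inter> (cdom c' \<inter> cdom c''))" using p by auto
    fix x assume "x \<in> coord c ` (cdom c \<inter> (cdom c' \<inter> cdom c''))"
    then obtain q where "x = coord c q" "q \<in> cdom c" "q \<in> cdom c'" "q \<in> cdom c''" by auto
    then show "transition c' c'' (transition c c' x) = transition c c'' x"
      using transition_coord[OF atlas_chart] c by metis
  qed
  from dird_has_derivative[OF this] show ?thesis .
qed

lemma transition_self:
  assumes "c \<in> \<A>" "p \<in> cdom c"
  shows "dird y (transition c c) (coord c p) = y"
proof -
  have "((\<lambda>x. x) has_derivative (\<lambda>v. v)) (at (coord c p))" by simp
  then have "(transition c c has_derivative (\<lambda>v. v)) (at (coord c p))"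
  proof (rule has_derivative_transform_within_open[OF _ chart_open_range[OF atlas_chart[OF assms(1)]]])
    show "coord c p \<in> crange c" using assms by simp
    fix x assume "x \<in> crange c"
    then show "x = transition c c x" by (simp add: transition_def coord_cinv)
  qed
  from dird_has_derivative[OF this] show ?thesis .
qed

lemma tvec_of_apply:
  "c' \<in> \<A> \<Longrightarrow> p \<in> cdom c' \<Longrightarrow> tvec_of \<A> c p y c' = dird y (transition c c') (coord c p)"
  by (simp add: tvec_of_def dird_def)

lemma tvec_of_self: "c \<in> \<A> \<Longrightarrow> p \<in> cdom c \<Longrightarrow> tvec_of \<A> c p y c = y"
  by (simp add: tvec_of_apply transition_self)

lemma tvec_of_tangent:
  assumes "c \<in> \<A>" "p \<in> cdom c"
  shows "tvec_of \<A> c p y \<in> tangent_space \<A> p"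
  unfolding tangent_space_def
proof (intro CollectI conjI ballI allI impI)
  fix c1 c2 assume "c1 \<in> \<A>" "c2 \<in> \<A>" "p \<in> cdom c1 \<and> p \<in> cdom c2"
  then show "tvec_of \<A> c p y c2 = frechet_derivative (transition c1 c2) (at (coord c1 p)) (tvec_of \<A> c p y c1)"
    using transition_chain[of c c1 c2 p y] assms by (simp add: tvec_of_apply dird_def[of "dird _ _ _"])
next
  fix c' assume "\<not> (c' \<in> \<A> \<and> p \<in> cdom c')"
  then show "tvec_of \<A> c p y c' = 0" by (auto simp: tvec_of_def)
qed

lemma tvec_of_component:
  assumes "c \<in> \<A>" "p \<in> cdom c" "w \<in> tangent_space \<A> p"
  shows "tvec_of \<A> c p (w c) = w"
proof
  fix c'
  show "tvec_of \<A> c p (w c) c' = w c'"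
  proof (cases "c' \<in> \<A> \<and> p \<in> cdom c'")
    case True
    then have "w c' = frechet_derivative (transition c c') (at (coord c p)) (w c)"
      using assms unfolding tangent_space_def by blast
    then show ?thesis using True by (simp only: tvec_of_def simp_thms if_True)
  next
    case False
    then have "w c' = 0" using assms(3) unfolding tangent_space_def by blast
    with False show ?thesis by (auto simp: tvec_of_def)
  qed
qed

lemma tvec_of_linear:
  assumes "c \<in> \<A>" "p \<in> cdom c"
  shows "tvec_of \<A> c p (r *\<^sub>R y + s *\<^sub>R z) = (\<lambda>c'. r *\<^sub>R tvec_of \<A> c p y c' + s *\<^sub>R tvec_of \<A> c p z c')"
proof
  fix c'
  show "tvec_of \<A> c p (r *\<^sub>R y + s *\<^sub>R z) c' = r *\<^sub>R tvec_of \<A> c p y c' + s *\<^sub>R tvec_of \<A> c p z c'"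
  proof (cases "c' \<in> \<A> \<and> p \<in> cdom c'")
    case True
    then have "linear (\<lambda>v. dird v (transition c c') (coord c p))"
      using has_derivative_linear[OF transition_derivative[OF assms(1) _ assms(2)]] by blast
    from linear_add[OF this] linear_cmul[OF this] show ?thesis using True by (simp add: tvec_of_apply)
  next
    case False then show ?thesis by (auto simp: tvec_of_def)
  qed
qed

lemma tvec_of_change:
  assumes "c \<in> \<A>" "c' \<in> \<A>" "p \<in> cdom c" "p \<in> cdom c'"
  shows "tvec_of \<A> c p y = tvec_of \<A> c' p (dird y (transition c c') (coord c p))"
  using tvec_of_component[OF assms(2,4) tvec_of_tangent[OF assms(1,3)]] assms by (simp add: tvec_of_apply)

lemma tvec_of_scale:
  assumes "c \<in> \<A>" "p \<in> cdom c"
  shows "tvec_of \<A> c p (r *\<^sub>R y) = (\<lambda>c'. r *\<^sub>R tvec_of \<A> c p y c')"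
  using tvec_of_linear[OF assms, of r y 0 0] by simp

lemma form_comp_eq:
  assumes b: "one_form X \<A> b" and c: "c \<in> \<A>" "p \<in> cdom c"
  shows "b p (tvec_of \<A> c p y) = form_comp \<A> b c (coord c p) \<bullet> y"
proof -
  have l: "linear (\<lambda>y. b p (tvec_of \<A> c p y))"
  proof (rule linearI)
    fix y z r
    have lin: "b p (tvec_of \<A> c p (r *\<^sub>R y + s *\<^sub>R z)) = r * b p (tvec_of \<A> c p y) + s * b p (tvec_of \<A> c p z)" for r s y z
      unfolding tvec_of_linear[OF c] using b atlas_topspace[OF c] tvec_of_tangent[OF c] unfolding one_form_def by blast
    show "b p (tvec_of \<A> c p (y + z)) = b p (tvec_of \<A> c p y) + b p (tvec_of \<A> c p z)" using lin[of 1 y 1 z] by simp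
    show "b p (tvec_of \<A> c p (r *\<^sub>R y)) = r *\<^sub>R b p (tvec_of \<A> c p y)" using lin[of r y 0 0] by simp
  qed
  have "b p (tvec_of \<A> c p y) = b p (tvec_of \<A> c p (\<Sum>i\<in>UNIV. (y $ i) *\<^sub>R axis i 1))"
    by (subst basis_expansion[symmetric, of y]) (simp add: scalar_mult_eq_scaleR)
  also have "\<dots> = (\<Sum>i\<in>UNIV. (y $ i) * b p (tvec_of \<A> c p (axis i 1)))"
    using linear_sum[OF l, of "\<lambda>i. (y $ i) *\<^sub>R axis i 1" UNIV] linear_cmul[OF l] by simp
  finally show ?thesis
    using c by (simp add: form_comp_def inner_vec_def cinv_coord[OF atlas_chart] mult.commute)
qed

text \<open>Bilinearity reduces the metric to its values on the coordinate vectors, so that it can be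
  handled as a matrix; the same is done for 1-forms in \<open>form_comp_eq\<close>.\<close>

lemma metric_linear:
  assumes g: "pseudo_riemannian_on \<A> U g" and c: "c \<in> \<A>" "p \<in> cdom c" "p \<in> U"
  shows "g p (tvec_of \<A> c p y) (tvec_of \<A> c p z) = y \<bullet> (metric_comp \<A> g c (coord c p) *v z)"
proof -
  let ?t = "tvec_of \<A> c p"
  have sym: "g p (?t y) (?t z) = g p (?t z) (?t y)" for y z
    using g c(3) tvec_of_tangent[OF c(1,2)] unfolding pseudo_riemannian_on_def by blast
  have lin: "g p (?t (r *\<^sub>R y + s *\<^sub>R z)) (?t x) = r * g p (?t y) (?t x) + s * g p (?t z) (?t x)" for r s x y z
    unfolding tvec_of_linear[OF c(1,2)] using g c(3) tvec_of_tangent[OF c(1,2)] unfolding pseudo_riemannian_on_def by blast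
  have l: "linear (\<lambda>y. g p (?t y) (?t x))" for x
    by (rule linearI) (use lin[of 1 _ 1 _ x] lin[of _ _ 0 0 x] in simp_all)
  have ex: "g p (?t y) (?t x) = (\<Sum>i\<in>UNIV. (y $ i) * g p (?t (axis i 1)) (?t x))" for x y
  proof -
    have "g p (?t y) (?t x) = g p (?t (\<Sum>i\<in>UNIV. (y $ i) *\<^sub>R axis i 1)) (?t x)"
      by (subst basis_expansion[symmetric, of y]) (simp add: scalar_mult_eq_scaleR)
    also have "\<dots> = (\<Sum>i\<in>UNIV. (y $ i) * g p (?t (axis i 1)) (?t x))"
      using linear_sum[OF l, of "\<lambda>i. (y $ i) *\<^sub>R axis i 1" UNIV] linear_cmul[OF l] by simp
    finally show ?thesis .
  qed
  have "g p (?t y) (?t z) = (\<Sum>i\<in>UNIV. (y $ i) * (\<Sum>j\<in>UNIV. (z $ j) * g p (?t (axis j 1)) (?t (axis i 1))))"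
    unfolding ex[of y z] sym[of "axis _ 1" z] ex[of z] ..
  then show ?thesis
    using c by (simp add: metric_comp_def inner_vec_def matrix_vector_mult_def cinv_coord[OF atlas_chart] sym[of "axis _ 1" "axis _ 1"] mult.commute)
qed

lemma metric_comp_sym:
  assumes g: "pseudo_riemannian_on \<A> U g" and c: "c \<in> \<A>" "p \<in> cdom c" "p \<in> U"
  shows "metric_comp \<A> g c (coord c p) $ i $ j = metric_comp \<A> g c (coord c p) $ j $ i"
  using g c(3) tvec_of_tangent[OF c(1,2)] cinv_coord[OF atlas_chart[OF c(1)] c(2)]
  unfolding pseudo_riemannian_on_def by (simp add: metric_comp_def)

lemma metric_comp_invertible:
  assumes g: "pseudo_riemannian_on \<A> U g" and c: "c \<in> \<A>" "p \<in> cdom c" "p \<in> U"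
  shows "invertible (metric_comp \<A> g c (coord c p))"
proof -
  let ?t = "tvec_of \<A> c p"
  have "z = 0" if z: "metric_comp \<A> g c (coord c p) *v z = 0" for z
  proof -
    have "g p (?t z) w = 0" if w: "w \<in> tangent_space \<A> p" for w
    proof -
      have "g p (?t (w c)) (?t z) = 0" using metric_linear[OF g c, of "w c" z] z by simp
      then have "g p w (?t z) = 0" by (simp add: tvec_of_component[OF c(1,2) w])
      then show ?thesis
      proof -
        have "g p (?t z) w = g p w (?t z)"
          using g c(3) tvec_of_tangent[OF c(1,2)] w unfolding pseudo_riemannian_on_def by blast
        with \<open>g p w (?t z) = 0\<close> show ?thesis by (simp only:)
      qed
    qed
    then have "?t z = (\<lambda>_. 0)"
      using g c(3) tvec_of_tangent[OF c(1,2)] unfolding pseudo_riemannian_on_def by blast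
    then show "z = 0" using tvec_of_self[OF c(1,2), of z] by simp
  qed
  then have "\<exists>B. B ** metric_comp \<A> g c (coord c p) = mat 1"
    unfolding matrix_left_invertible_ker by blast
  then show ?thesis by (simp only: invertible_left_inverse)
qed

lemma metric_comp_change:
  assumes g: "pseudo_riemannian_on \<A> U g" and c: "c \<in> \<A>" "c' \<in> \<A>" and p: "p \<in> cdom c" "p \<in> cdom c'" "p \<in> U"
  shows "y \<bullet> (metric_comp \<A> g c (coord c p) *v z)
    = dird y (transition c c') (coord c p) \<bullet> (metric_comp \<A> g c' (coord c' p) *v dird z (transition c c') (coord c p))"
  by (simp only: metric_linear[OF g c(1) p(1,3), symmetric] metric_linear[OF g c(2) p(2,3), symmetric]
      tvec_of_change[OF c p(1,2), symmetric])

lemma form_comp_change: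
  assumes b: "one_form X \<A> b" and c: "c \<in> \<A>" "c' \<in> \<A>" and p: "p \<in> cdom c" "p \<in> cdom c'"
  shows "form_comp \<A> b c (coord c p) \<bullet> y = form_comp \<A> b c' (coord c' p) \<bullet> dird y (transition c c') (coord c p)"
  by (simp only: form_comp_eq[OF b c(1) p(1), symmetric] form_comp_eq[OF b c(2) p(2), symmetric]
      tvec_of_change[OF c p, symmetric])

text \<open>Maximality of the atlas puts every smooth change of coordinates into it.\<close>

lemma new_chart:
  assumes c: "c \<in> \<A>" and V: "open V" "V \<subseteq> crange c"
    and E: "smooth_on V E" "open (E ` V)" and Ei: "\<And>x. x \<in> V \<Longrightarrow> Ei (E x) = x" "smooth_on (E ` V) Ei"
  shows "({p \<in> cdom c. coord c p \<in> V}, E \<circ> coord c) \<in> \<A>" (is "?c \<in> \<A>")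
    and "crange ({p \<in> cdom c. coord c p \<in> V}, E \<circ> coord c) = E ` V"
    and "\<And>z. z \<in> E ` V \<Longrightarrow> transition ({p \<in> cdom c. coord c p \<in> V}, E \<circ> coord c) c z = Ei z"
proof -
  note ic = atlas_chart[OF c]
  note nc = new_chart_is_chart[OF ic V smooth_on_continuous_on[OF E(1)] E(2) Ei(1) smooth_on_continuous_on[OF Ei(2)]]
  show cr: "crange ?c = E ` V" by (rule nc(2))
  have ic': "is_chart X ?c" by (rule nc(1))
  show tr: "transition ?c c z = Ei z" if z: "z \<in> E ` V" for z
  proof -
    obtain q where q: "q \<in> cdom c" "coord c q \<in> V" "z = E (coord c q)"
      using z V(2) by auto
    then have "transition ?c c (coord ?c q) = coord c q" by (intro transition_coord[OF ic']) simp
    then show ?thesis using q Ei(1) by simp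
  qed
  have "compatible ?c c'" if c': "c' \<in> \<A>" for c'
    unfolding compatible_def
  proof
    note ic2 = atlas_chart[OF c']
    let ?S = "coord ?c ` (cdom ?c \<inter> cdom c')"
    have oS: "open ?S" by (rule chart_open_image[OF ic' chart_openin[OF ic2]])
    have "smooth_on ?S (\<lambda>z. transition c c' (Ei z))"
    proof (rule smooth_on_compose[OF oS overlap_open[OF c c'] transition_smooth[OF c c']])
      show "smooth_on ?S Ei" by (rule smooth_on_subset[OF Ei(2)]) auto
      show "Ei z \<in> coord c ` (cdom c \<inter> cdom c')" if "z \<in> ?S" for z using that Ei(1) by auto
    qed
    moreover have "transition ?c c' z = transition c c' (Ei z)" if z: "z \<in> ?S" for z
    proof -
      obtain q where q: "q \<in> cdom ?c" "z = coord ?c q" using z by blast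
      then have "transition ?c c' z = coord c' q" using transition_coord[OF ic' q(1), of c'] by simp
      moreover have "Ei z = coord c q" using q Ei(1) by simp
      ultimately show ?thesis using transition_coord[OF ic, of q c'] q by simp
    qed
    then have "smooth_on ?S (transition ?c c') \<longleftrightarrow> smooth_on ?S (\<lambda>z. transition c c' (Ei z))"
      by (rule smooth_on_cong[OF oS])
    ultimately show "smooth_on ?S (transition ?c c')" by (simp only:)
    let ?R = "coord c' ` (cdom ?c \<inter> cdom c')"
    have oR: "open ?R" using chart_open_image[OF ic2 chart_openin[OF ic']] by (simp add: Int_commute)
    have "smooth_on ?R (\<lambda>z. E (transition c' c z))"
    proof (rule smooth_on_compose[OF oR V(1) E(1)])
      show "smooth_on ?R (transition c' c)" by (rule smooth_on_subset[OF transition_smooth[OF c' c]]) auto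
      show "transition c' c z \<in> V" if "z \<in> ?R" for z using that transition_coord[OF ic2, of _ c] by auto
    qed
    moreover have "transition c' ?c = (\<lambda>z. E (transition c' c z))" by (simp add: transition_def fun_eq_iff)
    ultimately show "smooth_on (coord c' ` (cdom ?c \<inter> cdom c')) (transition c' ?c)"
      by (simp only: Int_commute)
  qed
  then show "?c \<in> \<A>" using ic' M unfolding smooth_manifold_def by blast
qed

end

section \<open>Weyl connections and the affine Ricci tensor\<close>

lemma dird_component:
  assumes "f differentiable (at x)"
  shows "dird w (\<lambda>z. f z $ i) x = dird w f x $ i"
  by (rule dird_has_derivative[OF bounded_linear.has_derivative[OF bounded_linear_vec_nth
        differentiable_has_derivative_dird[OF assms]]])

lemma dird_linear:
  assumes "f differentiable (at x)"
  shows "linear (\<lambda>w. dird w f x)"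
  using differentiable_has_derivative_dird[OF assms] has_derivative_linear by blast

lemma differentiable_component:
  assumes "f differentiable (at x)"
  shows "(\<lambda>z. f z $ i) differentiable (at x)"
  using bounded_linear.has_derivative[OF bounded_linear_vec_nth differentiable_has_derivative_dird[OF assms]]
  unfolding differentiable_def by blast

lemma dird_entry:
  assumes "A differentiable (at x)"
  shows "dird w (\<lambda>z. A z $ i $ j) x = dird w A x $ i $ j"
  by (simp add: dird_component[OF differentiable_component[OF assms]] dird_component[OF assms])

lemma inner_axis_mult: "axis i 1 \<bullet> (M *v axis j 1) = (M $ i $ j :: real)"
  by (simp add: inner_axis' matrix_vector_mult_basis column_def)

lemma matrix_eq_bilinear:
  fixes M N :: "real ^ 'n ^ 'm"
  assumes "\<And>y z. y \<bullet> (M *v z) = y \<bullet> (N *v z)"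
  shows "M = N"
  using assms[of "axis _ 1" "axis _ 1"] by (simp add: inner_axis_mult vec_eq_iff)

lemma inner_transpose: "y \<bullet> (transpose M *v z) = (M *v y) \<bullet> (z :: real ^ 'n)"
  by (metis dot_lmul_matrix inner_commute transpose_matrix_vector)

lemma inner_vector_matrix: "y \<bullet> (x v* M) = (M *v y) \<bullet> (x :: real ^ 'n)"
  by (metis dot_lmul_matrix inner_commute)

lemma symmetric_inner:
  fixes A :: "real ^ 'n ^ 'n"
  assumes "transpose A = A"
  shows "y \<bullet> (A *v z) = z \<bullet> (A *v y)"
  by (metis assms inner_commute inner_transpose)

text \<open>The matrix of \<open>y \<mapsto> \<Gamma>(w, y)\<close>. Contracting one lower index with a vector turns index sums
  into matrix calculus.\<close>

definition gm :: "('n::finite \<Rightarrow> 'n \<Rightarrow> 'n \<Rightarrow> real) \<Rightarrow> real ^ 'n \<Rightarrow> real ^ 'n ^ 'n" where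
  "gm g w = (\<chi> i j. \<Sum>k\<in>UNIV. g i k j * w $ k)"

lemma gm_axis: "gm g (axis k 1) $ i $ j = g i k j"
  by (simp add: gm_def axis_def if_distrib[where f = "\<lambda>x. _ * x"] cong: if_cong)

lemma gm_apply: "(gm g w *v y) $ i = (\<Sum>k\<in>UNIV. \<Sum>j\<in>UNIV. g i k j * w $ k * y $ j)"
  by (simp add: gm_def matrix_vector_mult_def sum_distrib_right) (rule sum.swap)

lemma gm_sym:
  assumes "\<And>i j k. g i j k = g i k j"
  shows "gm g w *v y = gm g y *v w"
proof -
  have "(gm g w *v y) $ i = (gm g y *v w) $ i" for i
    unfolding gm_apply by (subst sum.swap) (simp add: assms[of i] mult_ac)
  then show ?thesis by (simp add: vec_eq_iff)
qed

text \<open>\<open>\<nabla>\<^sub>w A = \<theta>(w) A\<close> at \<open>x\<close>, for the connection with coefficients \<open>g\<close>. The Levi-Civita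
  connection is the case \<open>\<theta> = 0\<close>.\<close>

definition weyl_at :: "('n::finite \<Rightarrow> 'n \<Rightarrow> 'n \<Rightarrow> real) \<Rightarrow> (real ^ 'n \<Rightarrow> real ^ 'n ^ 'n) \<Rightarrow> (real ^ 'n \<Rightarrow> real) \<Rightarrow> real ^ 'n \<Rightarrow> bool" where
  "weyl_at g A \<theta> x \<longleftrightarrow> (\<forall>w y z. y \<bullet> (dird w A x *v z)
     = (gm g w *v y) \<bullet> (A x *v z) + y \<bullet> (A x *v (gm g w *v z)) + \<theta> w * (y \<bullet> (A x *v z)))"

lemma weyl_at_matrix:
  assumes "weyl_at g A \<theta> x"
  shows "dird w A x = transpose (gm g w) ** A x + A x ** gm g w + \<theta> w *\<^sub>R A x"
  by (rule matrix_eq_bilinear)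
     (use assms in \<open>simp add: weyl_at_def matrix_vector_mult_add_rdistrib inner_add_right
       matrix_vector_mul_assoc[symmetric] inner_transpose inner_vector_matrix scaleR_matrix_vector_assoc[symmetric]\<close>)

text \<open>Twice the Christoffel symbols of the first kind.\<close>

definition chris_first :: "(real ^ 'n \<Rightarrow> real ^ 'n ^ 'n) \<Rightarrow> real ^ 'n \<Rightarrow> 'n \<Rightarrow> 'n \<Rightarrow> 'n \<Rightarrow> real" where
  "chris_first A x l j k = partial j (\<lambda>z. A z $ l $ k) x + partial k (\<lambda>z. A z $ l $ j) x - partial l (\<lambda>z. A z $ j $ k) x"

lemma dird_sym_matrix:
  assumes S: "open S" "x \<in> S" and sym: "\<And>z. z \<in> S \<Longrightarrow> transpose (A z) = A z" and A: "A differentiable (at x)"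
  shows "transpose (dird w A x) = dird w A x"
proof -
  have "dird w (\<lambda>z. A z $ i $ j) x = dird w (\<lambda>z. A z $ j $ i) x" for i j
  proof (rule dird_cong[OF S])
    fix z assume "z \<in> S"
    from arg_cong[OF sym[OF this], of "\<lambda>M. M $ i $ j"] show "A z $ i $ j = A z $ j $ i"
      by (simp add: transpose_def)
  qed
  then show ?thesis by (simp add: dird_entry[OF A] transpose_def vec_eq_iff)
qed

text \<open>The trick of Koszul: in the cyclic combination of three instances of \<open>\<nabla> A = 0\<close>, symmetry of
  the connection cancels all terms but two equal ones.\<close>

lemma weyl_zero_imp_levi_civita:
  fixes A :: "real ^ 'n \<Rightarrow> real ^ 'n ^ 'n"
  assumes g: "\<And>i j k. g i j k = g i k j" and W: "weyl_at g A (\<lambda>_. 0) x"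
    and sym: "transpose (A x) = A x" and I: "invertible (A x)" and A: "A differentiable (at x)"
  shows "g i j k = 1/2 * (\<Sum>l\<in>UNIV. matrix_inv (A x) $ i $ l * chris_first A x l j k)"
proof -
  let ?a = "\<lambda>i. axis i 1 :: real ^ 'n"
  have d: "partial p (\<lambda>z. A z $ q $ r) x = ?a q \<bullet> (dird (?a p) A x *v ?a r)" for p q r
    by (simp add: partial_def dird_entry[OF A] inner_axis_mult)
  have c: "chris_first A x l j k = 2 * (?a l \<bullet> (A x *v (gm g (?a j) *v ?a k)))" for l
  proof -
    have W': "y \<bullet> (dird w A x *v z) = (gm g w *v y) \<bullet> (A x *v z) + y \<bullet> (A x *v (gm g w *v z))" for w y z
      using W by (simp add: weyl_at_def)
    show ?thesis
      unfolding chris_first_def d W'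
      using gm_sym[OF g, where w = "?a k" and y = "?a j"] gm_sym[OF g, where w = "?a l" and y = "?a j"] gm_sym[OF g, where w = "?a l" and y = "?a k"]
        symmetric_inner[OF sym, of "gm g (?a j) *v ?a l" "?a k"]
        symmetric_inner[OF sym, of "gm g (?a k) *v ?a l" "?a j"]
        symmetric_inner[OF sym, of "gm g (?a l) *v ?a j" "?a k"]
      by (simp add: algebra_simps inner_commute)
  qed
  have "(\<Sum>l\<in>UNIV. matrix_inv (A x) $ i $ l * chris_first A x l j k)
     = 2 * (matrix_inv (A x) *v (A x *v (gm g (?a j) *v ?a k))) $ i"
    unfolding c by (simp add: inner_axis' matrix_vector_mult_def[of "matrix_inv (A x)"] sum_distrib_left mult_ac)
  also have "\<dots> = 2 * (gm g (?a j) *v ?a k) $ i"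
    by (simp add: matrix_vector_mul_assoc matrix_mul_assoc matrix_inv_mult(2)[OF I])
  also have "(gm g (?a j) *v ?a k) $ i = g i j k"
    by (simp add: matrix_vector_mult_basis column_def gm_axis)
  finally show ?thesis by simp
qed

lemma levi_civita_imp_weyl_zero:
  fixes A :: "real ^ 'n \<Rightarrow> real ^ 'n ^ 'n"
  assumes g: "\<And>i j k. g i j k = 1/2 * (\<Sum>l\<in>UNIV. matrix_inv (A x) $ i $ l * chris_first A x l j k)"
    and sym: "transpose (A x) = A x" "\<And>w. transpose (dird w A x) = dird w A x"
    and I: "invertible (A x)" and A: "A differentiable (at x)"
  shows "weyl_at g A (\<lambda>_. 0) x" "g i j k = g i k j"
proof -
  have e: "partial p (\<lambda>z. A z $ q $ r) x = dird (axis p 1) A x $ q $ r" for p q r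
    by (simp add: partial_def dird_entry[OF A])
  have s: "dird w A x $ q $ r = dird w A x $ r $ q" for w q r
    using arg_cong[OF sym(2)[of w], of "\<lambda>M. M $ r $ q"] by (simp add: transpose_def)
  have csym: "chris_first A x l j k = chris_first A x l k j" for l j k
    unfolding chris_first_def e by (simp add: s[of _ j k])
  show "g i j k = g i k j" unfolding g[of i] by (simp add: csym[of _ j k])
  have As: "A x $ r $ q = A x $ q $ r" for q r
    using arg_cong[OF sym(1), of "\<lambda>M. M $ q $ r"] by (simp add: transpose_def)
  have low: "(A x ** gm g (axis j 1)) $ r $ k = 1/2 * chris_first A x r j k" for r j k
  proof -
    let ?C = "\<chi> l. chris_first A x l j k"
    have "(\<chi> i. g i j k) = (1/2) *\<^sub>R (matrix_inv (A x) *v ?C)"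
      by (simp add: vec_eq_iff g[of _ j k] matrix_vector_mult_def)
    then have "A x *v (\<chi> i. g i j k) = (1/2) *\<^sub>R (A x *v (matrix_inv (A x) *v ?C))"
      by (simp add: matrix_vector_mult_scaleR)
    also have "\<dots> = (1/2) *\<^sub>R ?C" by (simp add: matrix_vector_mul_assoc matrix_inv_mult(1)[OF I])
    finally have "(A x *v (\<chi> i. g i j k)) $ r = 1/2 * chris_first A x r j k" by simp
    then show ?thesis by (simp add: matrix_vector_mult_def matrix_matrix_mult_def gm_axis)
  qed
  have low': "(transpose (gm g (axis j 1)) ** A x) $ k $ r = 1/2 * chris_first A x r j k" for r j k
    using low[of j r k] by (simp add: matrix_matrix_mult_def transpose_def As[of r] mult.commute)
  have ax: "dird (axis j 1) A x = transpose (gm g (axis j 1)) ** A x + A x ** gm g (axis j 1)" for j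
  proof -
    have "dird (axis j 1) A x $ p $ q = (transpose (gm g (axis j 1)) ** A x + A x ** gm g (axis j 1)) $ p $ q" for p q
      by (simp add: low low') (simp add: chris_first_def e s[of _ q p] s[of _ p j] s[of _ q j] field_simps)
    then show ?thesis by (simp add: vec_eq_iff)
  qed
  have gml: "gm g w = (\<Sum>j\<in>UNIV. (w $ j) *\<^sub>R gm g (axis j 1))" for w
    by (simp add: vec_eq_iff gm_axis) (simp add: gm_def mult.commute)
  note bb = bounded_bilinear_matrix_mult[where 'n='n and 'm='n and 'p='n]
  have tr: "transpose (\<Sum>j\<in>UNIV. (w $ j) *\<^sub>R M j) = (\<Sum>j\<in>UNIV. (w $ j) *\<^sub>R transpose (M j))"
    for w :: "real ^ 'n" and M :: "'n \<Rightarrow> real ^ 'n ^ 'n"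
    by (simp add: vec_eq_iff transpose_def)
  have all: "dird w A x = transpose (gm g w) ** A x + A x ** gm g w" for w
  proof -
    have "dird w A x = dird (\<Sum>j\<in>UNIV. (w $ j) *\<^sub>R axis j 1) A x"
      by (subst basis_expansion[symmetric, of w]) (simp add: scalar_mult_eq_scaleR)
    also have "\<dots> = (\<Sum>j\<in>UNIV. (w $ j) *\<^sub>R dird (axis j 1) A x)"
      using linear_sum[OF dird_linear[OF A], of "\<lambda>j. (w $ j) *\<^sub>R axis j 1" UNIV] linear_cmul[OF dird_linear[OF A]] by simp
    also have "\<dots> = transpose (gm g w) ** A x + A x ** gm g w"
      unfolding gml[of w] tr ax
      by (simp add: bounded_bilinear.sum_left[OF bb] bounded_bilinear.sum_right[OF bb] scaleR_right_distrib sum.distrib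
          bounded_bilinear.scaleR_left[OF bb] bounded_bilinear.scaleR_right[OF bb])
    finally show ?thesis .
  qed
  show "weyl_at g A (\<lambda>_. 0) x"
    unfolding weyl_at_def all
    by (simp add: matrix_vector_mult_add_rdistrib inner_add_right matrix_vector_mul_assoc[symmetric] inner_transpose inner_vector_matrix)
qed

text \<open>By the symmetry of \<open>G\<close>, the quadratic terms are symmetric after contraction, and so is the
  divergence \<open>\<partial>\<^sub>i G\<^sup>i\<^sub>k\<^sub>l\<close>. Only the derivatives of the trace contribute.\<close>

lemma ricci_antisymmetric_part:
  assumes S: "open S" "x \<in> S" and sym: "\<And>z i j k. z \<in> S \<Longrightarrow> G z i j k = G z i k j"
    and d: "\<And>i j k. (\<lambda>z. G z i j k) differentiable (at x)"
  shows "affine_ricci G x l k - affine_ricci G x k l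
    = partial l (\<lambda>z. \<Sum>i\<in>UNIV. G z i i k) x - partial k (\<lambda>z. \<Sum>i\<in>UNIV. G z i i l) x"
proof -
  have s: "partial p (\<lambda>z. G z i k l) x = partial p (\<lambda>z. G z i l k) x" for p i
    unfolding partial_def by (rule dird_cong[OF S sym])
  have t: "partial k (\<lambda>z. \<Sum>i\<in>UNIV. G z i i l) x = (\<Sum>i\<in>UNIV. partial k (\<lambda>z. G z i i l) x)" for k l
    unfolding partial_def
    by (rule dird_has_derivative[OF has_derivative_sum]) (rule differentiable_has_derivative_dird[OF d])
  have q: "(\<Sum>i\<in>UNIV. \<Sum>p\<in>UNIV. G x i p l * G x p i k) = (\<Sum>i\<in>UNIV. \<Sum>p\<in>UNIV. G x i p k * G x p i l)"
    by (subst sum.swap) (simp add: mult.commute)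
  have r: "affine_ricci G x l k = (\<Sum>i\<in>UNIV. partial i (\<lambda>z. G z i k l) x) - (\<Sum>i\<in>UNIV. partial k (\<lambda>z. G z i i l) x)
     + (\<Sum>i\<in>UNIV. \<Sum>p\<in>UNIV. G x i p i * G x p k l) - (\<Sum>i\<in>UNIV. \<Sum>p\<in>UNIV. G x i p k * G x p i l)" for l k
    by (simp add: affine_ricci_def affine_curvature_def sum.distrib sum_subtractf)
  show ?thesis unfolding r t q by (simp add: s sym[OF S(2), of _ k l])
qed

lemma trace_scaleR: "trace (c *\<^sub>R (M :: real ^ 'n ^ 'n)) = c * trace M"
  by (simp add: trace_def sum_distrib_left)

lemma trace_transpose: "trace (transpose (M :: real ^ 'n ^ 'n)) = trace M"
  by (simp add: trace_def transpose_def)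

lemma bounded_linear_trace: "bounded_linear (trace :: real ^ 'n ^ 'n \<Rightarrow> real)"
proof -
  have "linear (trace :: real ^ 'n ^ 'n \<Rightarrow> real)"
    by (rule linearI) (simp_all add: trace_add trace_scaleR)
  then show ?thesis by (simp only: linear_conv_bounded_linear)
qed

text \<open>The trace of \<open>A\<^sup>-\<^sup>1 \<partial>\<^sub>w A\<close> is the derivative of \<open>ln \<bar>det A\<bar>\<close>, hence a closed form in \<open>w\<close>.
  It is enough to differentiate it directly: the derivative of \<open>A\<^sup>-\<^sup>1\<close> contributes a trace that
  is symmetric in \<open>v\<close> and \<open>w\<close>.\<close>

lemma trace_log_derivative_closed:
  fixes A :: "real ^ 'n \<Rightarrow> real ^ 'n ^ 'n"
  assumes S: "open S" "x \<in> S" and A: "smooth_on S A" and I: "\<And>z. z \<in> S \<Longrightarrow> invertible (A z)"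
  shows "dird v (\<lambda>z. trace (matrix_inv (A z) ** dird w A z)) x = dird w (\<lambda>z. trace (matrix_inv (A z) ** dird v A z)) x"
proof -
  note bb = bounded_bilinear_matrix_mult[where 'n='n and 'm='n and 'p='n]
  let ?N = "\<lambda>z. matrix_inv (A z)"
  have sN: "smooth_on S ?N" by (rule smooth_on_matrix_inv[OF S(1) A I])
  note dN = smooth_on_has_derivative[OF sN S(2)] and dA = smooth_on_has_derivative[OF A S(2)]
  have N1: "dird v ?N x = - (?N x ** dird v A x ** ?N x)" for v
  proof -
    have 1: "((\<lambda>z. ?N z ** A z) has_derivative (\<lambda>v. ?N x ** dird v A x + dird v ?N x ** A x)) (at x)"
      by (rule bounded_bilinear.FDERIV[OF bb dN dA])
    have 2: "((\<lambda>z. ?N z ** A z) has_derivative (\<lambda>v. 0)) (at x)"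
      by (rule has_derivative_transform_within_open[OF has_derivative_const S]) (simp add: matrix_inv_mult(2)[OF I])
    from fun_cong[OF has_derivative_unique[OF 1 2], of v]
    have "(?N x ** dird v A x + dird v ?N x ** A x) ** ?N x = 0" by (simp add: bounded_bilinear.zero_left[OF bb])
    then have "?N x ** dird v A x ** ?N x + dird v ?N x = 0"
      by (simp add: bounded_bilinear.add_left[OF bb] matrix_mul_assoc[symmetric] matrix_inv_mult(1)[OF I[OF S(2)]])
    then show ?thesis by (simp add: eq_neg_iff_add_eq_0 add.commute)
  qed
  have D: "dird v (\<lambda>z. trace (?N z ** dird w A z)) x
     = trace (?N x ** dird v (dird w A) x + dird v ?N x ** dird w A x)" for v w
    by (rule dird_has_derivative[OF bounded_linear.has_derivative[OF bounded_linear_trace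
          bounded_bilinear.FDERIV[OF bb dN smooth_on_has_derivative[OF smooth_on_dird[OF A] S(2)]]]])
  have c: "dird v (dird w A) x = dird w (dird v A) x"
    by (rule dird_dird_commute[OF S(1) _ S(2)]) (use A smooth_on_iff_ck in blast)
  have "trace (?N x ** dird v A x ** ?N x ** dird w A x) = trace (?N x ** dird w A x ** ?N x ** dird v A x)"
    using trace_mul_sym[of "?N x ** dird v A x" "?N x ** dird w A x"] by (simp add: matrix_mul_assoc)
  then show ?thesis
    unfolding D N1 c by (simp add: trace_sub bounded_bilinear.minus_left[OF bb])
qed

text \<open>Taking the trace of \<open>A\<^sup>-\<^sup>1\<close> times the Weyl equation shows that \<open>2 \<Gamma>\<^sup>i\<^sub>i\<^sub>k + n \<theta>\<^sub>k\<close> is the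
  closed form \<open>\<partial>\<^sub>k ln \<bar>det A\<bar>\<close>. So the exterior derivatives of the trace of \<open>\<Gamma>\<close> and of \<open>\<theta>\<close> vanish
  together.\<close>

lemma weyl_ricci_symmetric_iff:
  fixes A :: "real ^ 'n \<Rightarrow> real ^ 'n ^ 'n"
  assumes S: "open S" "x \<in> S" and A: "smooth_on S A" and I: "\<And>z. z \<in> S \<Longrightarrow> invertible (A z)"
    and G: "\<And>i j k. smooth_on S (\<lambda>z. G z i j k)" "\<And>z i j k. z \<in> S \<Longrightarrow> G z i j k = G z i k j"
    and W: "\<And>z. z \<in> S \<Longrightarrow> weyl_at (G z) A (\<theta> z) z"
    and \<theta>: "\<And>k. (\<lambda>z. \<theta> z (axis k 1)) differentiable (at x)"
  shows "affine_ricci G x l k = affine_ricci G x k l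
    \<longleftrightarrow> partial l (\<lambda>z. \<theta> z (axis k 1)) x = partial k (\<lambda>z. \<theta> z (axis l 1)) x"
proof -
  let ?a = "\<lambda>k. axis k 1 :: real ^ 'n"
  let ?t = "\<lambda>k z. \<Sum>i\<in>UNIV. G z i i k" and ?s = "\<lambda>k z. trace (matrix_inv (A z) ** dird (?a k) A z)"
  have tr: "?s k z = 2 * ?t k z + real CARD('n) * \<theta> z (?a k)" if z: "z \<in> S" for z k
  proof -
    let ?N = "matrix_inv (A z)" and ?M = "gm (G z) (?a k)"
    have "?N ** (A z ** ?M) = ?M" by (simp add: matrix_mul_assoc matrix_inv_mult(2)[OF I[OF z]])
    moreover have "trace (?N ** (transpose ?M ** A z)) = trace (transpose ?M)"
      using trace_mul_sym[of ?N "transpose ?M ** A z"] by (simp add: matrix_mul_assoc[symmetric] matrix_inv_mult(1)[OF I[OF z]])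
    moreover have "trace (?N ** A z) = real CARD('n)" by (simp add: matrix_inv_mult(2)[OF I[OF z]] trace_I)
    moreover have "trace ?M = ?t k z" by (simp add: trace_def gm_axis G(2)[OF z, of _ k])
    ultimately show ?thesis
      unfolding weyl_at_matrix[OF W[OF z]]
      by (simp add: bounded_bilinear.add_right[OF bounded_bilinear_matrix_mult]
          bounded_bilinear.scaleR_right[OF bounded_bilinear_matrix_mult] trace_add trace_scaleR trace_transpose mult.commute)
  qed
  have td: "?t k differentiable (at x)" for k
    by (rule differentiable_sum) (simp_all add: smooth_on_differentiable[OF G(1) S(2)])
  have ps: "partial l (?s k) x = 2 * partial l (?t k) x + real CARD('n) * partial l (\<lambda>z. \<theta> z (?a k)) x" for k l
  proof -
    have "partial l (?s k) x = partial l (\<lambda>z. 2 * ?t k z + real CARD('n) * \<theta> z (?a k)) x"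
      unfolding partial_def by (rule dird_cong[OF S tr])
    also have "\<dots> = 2 * partial l (?t k) x + real CARD('n) * partial l (\<lambda>z. \<theta> z (?a k)) x"
      unfolding partial_def
      by (rule dird_has_derivative[OF has_derivative_add[OF has_derivative_mult_right has_derivative_mult_right]])
         (rule differentiable_has_derivative_dird[OF td] differentiable_has_derivative_dird[OF \<theta>])+
    finally show ?thesis .
  qed
  have "partial l (?s k) x = partial k (?s l) x"
    unfolding partial_def by (rule trace_log_derivative_closed[OF S A I])
  then have "2 * (partial l (?t k) x - partial k (?t l) x)
     = real CARD('n) * (partial k (\<lambda>z. \<theta> z (?a l)) x - partial l (\<lambda>z. \<theta> z (?a k)) x)"
    unfolding ps by (simp add: algebra_simps)
  moreover have "affine_ricci G x l k - affine_ricci G x k l = partial l (?t k) x - partial k (?t l) x"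
    by (rule ricci_antisymmetric_part[OF S G(2) smooth_on_differentiable[OF G(1) S(2)]])
  ultimately have "2 * (affine_ricci G x l k - affine_ricci G x k l)
     = real CARD('n) * (partial k (\<lambda>z. \<theta> z (?a l)) x - partial l (\<lambda>z. \<theta> z (?a k)) x)"
    by (simp only:)
  moreover have "(a = b) = (d = c)" if h: "2 * (a - b) = n * (c - d)" and n: "n \<noteq> 0" for a b c d n :: real
  proof -
    have "(a = b) = (2 * (a - b) = 0)" by simp
    also have "\<dots> = (d = c)" unfolding h using n by auto
    finally show ?thesis .
  qed
  note aux = this
  ultimately have h: "2 * (affine_ricci G x l k - affine_ricci G x k l)
     = real CARD('n) * (partial k (\<lambda>z. \<theta> z (?a l)) x - partial l (\<lambda>z. \<theta> z (?a k)) x)"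
    by blast
  show ?thesis by (rule aux[OF h]) simp
qed

text \<open>The left-hand side is the Levi-Civita derivative of \<open>b\<close>, with \<open>\<xi> = - b\<^sup>\<sharp>\<close>. It differs from
  \<open>\<nabla> b = \<kappa> b \<otimes> b\<close> by a contraction of \<open>b\<close> with the difference of the two connections; for null
  \<open>b\<close> this is a multiple of \<open>b \<otimes> b\<close>.\<close>

lemma hessian_of_weyl:
  assumes g: "\<And>i j k. g i j k = g i k j" and W: "weyl_at g A (\<lambda>w. lam * \<kappa> * (b x \<bullet> w)) x"
    and sym: "transpose (A x) = A x" and \<xi>: "A x *v \<xi> = - b x" and null: "b x \<bullet> \<xi> = 0"
    and b: "\<And>w y. dird w b x \<bullet> y = b x \<bullet> (gm g w *v y) + \<kappa> * (b x \<bullet> w) * (b x \<bullet> y)"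
  shows "dird y b x \<bullet> z + 1/2 * (\<xi> \<bullet> (dird y A x *v z) + y \<bullet> (dird z A x *v \<xi>) - y \<bullet> (dird \<xi> A x *v z))
    = \<kappa> * (1 - lam) * (b x \<bullet> y) * (b x \<bullet> z)"
proof -
  have W': "y \<bullet> (dird w A x *v z) = (gm g w *v y) \<bullet> (A x *v z) + y \<bullet> (A x *v (gm g w *v z))
    + lam * \<kappa> * (b x \<bullet> w) * (y \<bullet> (A x *v z))" for w y z
    using W by (simp add: weyl_at_def)
  have \<xi>': "\<xi> \<bullet> (A x *v w) = - (b x \<bullet> w)" for w
    using symmetric_inner[OF sym, of \<xi> w] \<xi> by (simp add: inner_commute)
  show ?thesis
    unfolding W' b[of y z]
    using gm_sym[OF g, where w = \<xi> and y = y] gm_sym[OF g, where w = \<xi> and y = z] gm_sym[OF g, where w = z and y = y]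
    by (simp add: \<xi> \<xi>' null inner_commute[of _ "b x"] algebra_simps)
qed

text \<open>The same left-hand side, computed in the coordinates \<open>T\<close>, in which \<open>b\<close> is the constant form
  \<open>du\<close> and \<open>\<xi>\<close> is \<open>\<partial>\<^sub>v\<close>: as \<open>A'(\<partial>\<^sub>v, -)\<close> is constant, only the derivative of \<open>A'\<close> along \<open>\<partial>\<^sub>v\<close>
  remains of the Christoffel symbols. The terms with second derivatives of \<open>T\<close> cancel, which is
  the tensor property of the Hessian.\<close>

lemma hessian_of_coordinate:
  fixes T :: "real ^ 'n \<Rightarrow> real ^ 'n"
  assumes S: "open S" "x \<in> S" and T: "smooth_on S T" and A: "A differentiable (at x)" and A': "A' differentiable (at (T x))"
    and b: "b differentiable (at x)"
    and AT: "\<And>z y w. z \<in> S \<Longrightarrow> y \<bullet> (A z *v w) = dird y T z \<bullet> (A' (T z) *v dird w T z)"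
    and bT: "\<And>z y. z \<in> S \<Longrightarrow> b z \<bullet> y = dird y T z $ u"
    and \<xi>: "dird \<xi> T x = axis v 1"
    and S': "open S'" "T x \<in> S'" and sym: "\<And>z. z \<in> S' \<Longrightarrow> transpose (A' z) = A' z"
    and Av: "\<And>z. z \<in> S' \<Longrightarrow> A' z *v axis v 1 = - axis u 1"
  shows "dird y b x \<bullet> z + 1/2 * (\<xi> \<bullet> (dird y A x *v z) + y \<bullet> (dird z A x *v \<xi>) - y \<bullet> (dird \<xi> A x *v z))
    = - 1/2 * (dird y T x \<bullet> (dird (axis v 1) A' (T x) *v dird z T x))"
proof -
  note bv = bounded_bilinear_matrix_vector_mult[where 'n='n and 'm='n]
  let ?D2 = "\<lambda>w y. dird w (dird y T) x"
  have T2: "(dird y T has_derivative (\<lambda>w. ?D2 w y)) (at x)" for y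
    by (rule smooth_on_has_derivative[OF smooth_on_dird[OF T] S(2)])
  have comm: "?D2 w y = ?D2 y w" for w y
    by (rule dird_dird_commute[OF S(1) _ S(2)]) (use T smooth_on_iff_ck in blast)
  note T1 = smooth_on_has_derivative[OF T S(2)]
  have DA: "y \<bullet> (dird w A x *v z) = dird y T x \<bullet> (A' (T x) *v ?D2 w z) + dird y T x \<bullet> (dird (dird w T x) A' (T x) *v dird z T x)
     + ?D2 w y \<bullet> (A' (T x) *v dird z T x)" for w y z
  proof -
    have c: "((\<lambda>z. z) has_derivative (\<lambda>w. w)) (at x)" by simp
    have "((\<lambda>p. y \<bullet> (A p *v z)) has_derivative (\<lambda>w. y \<bullet> (dird w A x *v z))) (at x)"
      by (rule bounded_linear.has_derivative[OF bounded_linear_inner_right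
            bounded_linear.has_derivative[OF bounded_bilinear.bounded_linear_left[OF bv] differentiable_has_derivative_dird[OF A]]])
    then have 1: "((\<lambda>p. dird y T p \<bullet> (A' (T p) *v dird z T p)) has_derivative (\<lambda>w. y \<bullet> (dird w A x *v z))) (at x)"
      by (rule has_derivative_transform_within_open[OF _ S]) (rule AT)
    have 2: "((\<lambda>p. dird y T p \<bullet> (A' (T p) *v dird z T p)) has_derivative
       (\<lambda>w. dird y T x \<bullet> (A' (T x) *v ?D2 w z + dird (dird w T x) A' (T x) *v dird z T x) + ?D2 w y \<bullet> (A' (T x) *v dird z T x))) (at x)"
      by (rule bounded_bilinear.FDERIV[OF bounded_bilinear_inner T2
            bounded_bilinear.FDERIV[OF bv has_derivative_compose[OF T1 differentiable_has_derivative_dird[OF A']] T2]])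
    from fun_cong[OF has_derivative_unique[OF 1 2], of w] show ?thesis by (simp add: inner_add_right)
  qed
  have Db: "dird y b x \<bullet> z = ?D2 y z $ u" for y z
  proof -
    have "((\<lambda>p. b p \<bullet> z) has_derivative (\<lambda>y. dird y b x \<bullet> z)) (at x)"
      by (rule bounded_linear.has_derivative[OF bounded_linear_inner_left differentiable_has_derivative_dird[OF b]])
    then have 1: "((\<lambda>p. dird z T p $ u) has_derivative (\<lambda>y. dird y b x \<bullet> z)) (at x)"
      by (rule has_derivative_transform_within_open[OF _ S]) (rule bT)
    have 2: "((\<lambda>p. dird z T p $ u) has_derivative (\<lambda>y. ?D2 y z $ u)) (at x)"
      by (rule bounded_linear.has_derivative[OF bounded_linear_vec_nth T2])
    from fun_cong[OF has_derivative_unique[OF 1 2], of y] show ?thesis .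
  qed
  have dAv: "dird w A' (T x) *v axis v 1 = 0" for w
  proof -
    have "((\<lambda>z. A' z *v axis v 1) has_derivative (\<lambda>w. dird w A' (T x) *v axis v 1)) (at (T x))"
      by (rule bounded_linear.has_derivative[OF bounded_bilinear.bounded_linear_left[OF bv] differentiable_has_derivative_dird[OF A']])
    moreover have "((\<lambda>z. A' z *v axis v 1) has_derivative (\<lambda>w. 0)) (at (T x))"
      by (rule has_derivative_transform_within_open[OF has_derivative_const[of "- axis u 1"] S']) (simp add: Av)
    ultimately show ?thesis using has_derivative_unique by metis
  qed
  have dAv': "axis v 1 \<bullet> (dird w A' (T x) *v z) = 0" for w z
    using symmetric_inner[OF dird_sym_matrix[OF S' sym A'], of "axis v 1" w z] by (simp add: dAv)
  have Av': "axis v 1 \<bullet> (A' (T x) *v z) = - z $ u" for z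
    using symmetric_inner[OF sym[OF S'(2)], of "axis v 1" z] by (simp add: Av[OF S'(2)] inner_axis)
  show ?thesis
    unfolding DA Db \<xi>
    by (simp add: dAv dAv' Av[OF S'(2)] Av' comm[of \<xi>] comm[of z y] inner_axis algebra_simps)
qed

section \<open>Berwald connections preserve the Finsler metric\<close>

lemma linear_basis_sum:
  fixes g :: "'a::euclidean_space \<Rightarrow> 'b::real_vector"
  assumes "linear g"
  shows "g w = (\<Sum>b\<in>Basis. (w \<bullet> b) *\<^sub>R g b)"
  using linear_sum[OF assms, of "\<lambda>b. (w \<bullet> b) *\<^sub>R b" Basis] linear_cmul[OF assms]
  by (simp add: euclidean_representation)

text \<open>A derivative of \<open>L\<close> in a direction \<open>l z\<close> that moves with the point has an extra term from
  the motion.\<close>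

lemma dird_of_dird:
  fixes L :: "'a::euclidean_space \<Rightarrow> real"
  assumes S: "open S" "z \<in> S" and L: "smooth_on S L" and l: "(l has_derivative l') (at z)"
  shows "((\<lambda>z. dird (l z) L z) has_derivative (\<lambda>p. dird p (dird (l z) L) z + dird (l' p) L z)) (at z)"
proof -
  have lin: "linear (\<lambda>w. dird w L y)" if "y \<in> S" for y
    by (rule dird_linear[OF smooth_on_differentiable[OF L that]])
  have d2: "linear (\<lambda>w. dird p (dird w L) z)" for p
  proof -
    have "dird p (dird w L) z = dird w (dird p L) z" for w
      by (rule dird_dird_commute[OF S(1) _ S(2)]) (use L smooth_on_iff_ck in blast)
    then show ?thesis
      using dird_linear[OF smooth_on_differentiable[OF smooth_on_dird[OF L] S(2)], of p] by simp
  qed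
  have l1: "((\<lambda>z. l z \<bullet> b) has_derivative (\<lambda>p. l' p \<bullet> b)) (at z)" for b
    by (rule bounded_linear.has_derivative[OF bounded_linear_inner_left l])
  have "((\<lambda>z. \<Sum>b\<in>Basis. (l z \<bullet> b) * dird b L z) has_derivative
      (\<lambda>p. \<Sum>b\<in>Basis. (l z \<bullet> b) * dird p (dird b L) z + (l' p \<bullet> b) * dird b L z)) (at z)"
    by (intro has_derivative_sum has_derivative_mult[OF l1] smooth_on_has_derivative[OF smooth_on_dird[OF L] S(2)])
  then have "((\<lambda>z. dird (l z) L z) has_derivative
      (\<lambda>p. \<Sum>b\<in>Basis. (l z \<bullet> b) * dird p (dird b L) z + (l' p \<bullet> b) * dird b L z)) (at z)"
    by (rule has_derivative_transform_within_open[OF _ S])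
       (simp add: linear_basis_sum[OF lin, of _ "l _"])
  moreover have "(\<Sum>b\<in>Basis. (l z \<bullet> b) * dird p (dird b L) z + (l' p \<bullet> b) * dird b L z)
      = dird p (dird (l z) L) z + dird (l' p) L z" for p
    by (simp add: sum.distrib linear_basis_sum[OF lin[OF S(2)], of "l' p"] linear_basis_sum[OF d2, of _ "l z"])
  ultimately show ?thesis by simp
qed

lemma smooth_on_entries:
  fixes A :: "'a::euclidean_space \<Rightarrow> real ^ 'n ^ 'm"
  assumes "open S" "\<And>i j. smooth_on S (\<lambda>x. A x $ i $ j)"
  shows "smooth_on S A"
  by (intro smooth_on_vec[OF assms(1)] assms(2))

lemma linear_snd_expand:
  fixes g :: "(real ^ 'n) \<times> (real ^ 'n) \<Rightarrow> real"
  assumes "linear g"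
  shows "g (0, v) = (\<Sum>i\<in>UNIV. v $ i * g (0, axis i 1))"
proof -
  have "(0, v) = (\<Sum>i\<in>UNIV. (v $ i) *\<^sub>R ((0, axis i 1) :: (real ^ 'n) \<times> (real ^ 'n)))"
    by (rule prod_eqI) (simp_all add: fst_sum snd_sum basis_expansion[of v, unfolded scalar_mult_eq_scaleR])
  then have "g (0, v) = g (\<Sum>i\<in>UNIV. (v $ i) *\<^sub>R (0, axis i 1))" by (rule arg_cong)
  also have "\<dots> = (\<Sum>i\<in>UNIV. g ((v $ i) *\<^sub>R (0, axis i 1)))" by (rule linear_sum[OF assms])
  finally show ?thesis by (simp only: linear_cmul[OF assms] real_scaleR_def)
qed

lemma linear_fst_expand:
  fixes g :: "(real ^ 'n) \<times> (real ^ 'n) \<Rightarrow> real"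
  assumes "linear g"
  shows "g (v, 0) = (\<Sum>i\<in>UNIV. v $ i * g (axis i 1, 0))"
proof -
  have "(v, 0) = (\<Sum>i\<in>UNIV. (v $ i) *\<^sub>R ((axis i 1, 0) :: (real ^ 'n) \<times> (real ^ 'n)))"
    by (rule prod_eqI) (simp_all add: fst_sum snd_sum basis_expansion[of v, unfolded scalar_mult_eq_scaleR])
  then have "g (v, 0) = g (\<Sum>i\<in>UNIV. (v $ i) *\<^sub>R (axis i 1, 0))" by (rule arg_cong)
  also have "\<dots> = (\<Sum>i\<in>UNIV. g ((v $ i) *\<^sub>R (axis i 1, 0)))" by (rule linear_sum[OF assms])
  finally show ?thesis by (simp only: linear_cmul[OF assms] real_scaleR_def)
qed

lemma fundamental_tensor_entry:
  fixes f :: "(real ^ 'n) \<times> (real ^ 'n) \<Rightarrow> real"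
  assumes S: "open S" and L: "smooth_on S (\<lambda>z. (f z)\<^sup>2)" and z: "z \<in> S"
  shows "fundamental_tensor f z $ i $ j = 1/2 * dird (0, axis i 1) (dird (0, axis j 1) (\<lambda>z. (f z)\<^sup>2)) z"
proof -
  let ?L = "\<lambda>z. (f z)\<^sup>2"
  let ?e = "\<lambda>k. (0, axis k 1) :: (real ^ 'n) \<times> (real ^ 'n)"
  have half: "dird p (\<lambda>z. 1/2 * ?L z) z = 1/2 * dird p ?L z" if "z \<in> S" for p z
    by (rule dird_has_derivative[OF has_derivative_mult_right[OF smooth_on_has_derivative[OF L that]]])
  have "fundamental_tensor f z $ i $ j = dird (?e i) (dird (?e j) (\<lambda>z. 1/2 * ?L z)) z"
    by (simp add: fundamental_tensor_def partial_y_def)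
  also have "\<dots> = dird (?e i) (\<lambda>z. 1/2 * dird (?e j) ?L z) z"
    by (rule dird_cong[OF S z half])
  also have "\<dots> = 1/2 * dird (?e i) (dird (?e j) ?L) z"
    by (rule dird_has_derivative[OF has_derivative_mult_right[OF smooth_on_has_derivative[OF smooth_on_dird[OF L] z]]])
  finally show ?thesis .
qed

lemma fundamental_tensor_bilinear:
  fixes f :: "(real ^ 'n) \<times> (real ^ 'n) \<Rightarrow> real"
  assumes S: "open S" and L: "smooth_on S (\<lambda>z. (f z)\<^sup>2)" and z: "z \<in> S"
  shows "v \<bullet> (fundamental_tensor f z *v w) = 1/2 * dird (0, v) (dird (0, w) (\<lambda>z. (f z)\<^sup>2)) z"
proof -
  let ?L = "\<lambda>z. (f z)\<^sup>2"
  have comm: "dird p (dird q ?L) z = dird q (dird p ?L) z" for p q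
    by (rule dird_dird_commute[OF S _ z]) (use L smooth_on_iff_ck in blast)
  have lin2: "linear (\<lambda>p. dird p (dird q ?L) z)" for q
    by (rule dird_linear[OF smooth_on_differentiable[OF smooth_on_dird[OF L] z]])
  have lin3: "linear (\<lambda>q. dird p (dird q ?L) z)" for p
    using lin2[of p] by (simp add: comm[of p])
  show ?thesis
    by (simp add: linear_snd_expand[OF lin2, of v] linear_snd_expand[OF lin3, of _ w] inner_vec_def
        matrix_vector_mult_def fundamental_tensor_entry[OF S L z] sum_distrib_left mult_ac) (rule sum.swap)
qed

text \<open>Let \<open>sp\<close> be the spray, so that \<open>1/2 \<partial>\<^sub>v \<partial>\<^sub>s\<^sub>p L = y\<^sup>l \<partial>\<^sub>l \<partial>\<^sub>v L - \<partial>\<^sub>x\<^sub>,\<^sub>v L\<close> for all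
  vertical \<open>v\<close>. For \<open>v = y\<close> the Euler identity turns this into \<open>1/2 \<partial>\<^sub>s\<^sub>p L = y\<^sup>l \<partial>\<^sub>l L\<close>. The
  vertical derivative of the latter, compared with the former, leaves
  \<open>1/2 dL(\<partial>\<^sub>v sp) = 2 \<partial>\<^sub>x\<^sub>,\<^sub>v L\<close>, and \<open>\<partial>\<^sub>v sp\<close> is four times the non-linear connection applied to
  \<open>v\<close>. The coefficients are symmetric because they are second vertical derivatives of \<open>sp / 4\<close>.\<close>

lemma berwald_horizontal:
  fixes f :: "(real ^ 'n) \<times> (real ^ 'n) \<Rightarrow> real" and G :: "real ^ 'n \<Rightarrow> 'n \<Rightarrow> 'n \<Rightarrow> 'n \<Rightarrow> real"
  defines "L \<equiv> \<lambda>z. (f z)\<^sup>2"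
  assumes S: "open S" and L: "smooth_on S L"
    and euler: "\<And>z. z \<in> S \<Longrightarrow> dird (0, snd z) L z = 2 * L z"
    and inv: "\<And>z. z \<in> S \<Longrightarrow> invertible (fundamental_tensor f z)"
    and N: "\<And>x y i j. (x, y) \<in> S \<Longrightarrow> cartan_N f i j (x, y) = (\<Sum>k\<in>UNIV. G x i j k * y $ k)"
    and z: "(x, y) \<in> S"
  shows "dird (w, 0) L (x, y) = dird (0, gm (G x) w *v y) L (x, y)"
    and "G x i j k = G x i k j"
proof -
  let ?e = "\<lambda>k. (0, axis k 1) :: (real ^ 'n) \<times> (real ^ 'n)"
  let ?x = "\<lambda>k. (axis k 1, 0) :: (real ^ 'n) \<times> (real ^ 'n)"
  note sd = smooth_on_dird[OF L]
  have comm: "dird p (dird q L) z = dird q (dird p L) z" if "z \<in> S" for p q z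
    by (rule dird_dird_commute[OF S _ that]) (use L smooth_on_iff_ck in blast)
  have lin1: "linear (\<lambda>p. dird p L z)" and lin2: "linear (\<lambda>p. dird p (dird q L) z)" if "z \<in> S" for z q
    by (rule dird_linear[OF smooth_on_differentiable[OF L that]])
       (rule dird_linear[OF smooth_on_differentiable[OF sd that]])
  have lin3: "linear (\<lambda>q. dird p (dird q L) z)" if "z \<in> S" for z p
    using lin2[OF that, of p] by (simp add: comm[OF that, of p])
  note ft = fundamental_tensor_entry[OF S L[unfolded L_def], folded L_def]
  define R where "R k z = (\<Sum>l\<in>UNIV. snd z $ l * dird (?x l) (dird (?e k) L) z) - dird (?x k) L z" for k z
  have spray: "spray f i z = (\<Sum>k\<in>UNIV. matrix_inv (fundamental_tensor f z) $ i $ k * R k z)" for i z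
    by (simp add: spray_def R_def partial_x_def partial_y_def L_def)
  define sp where "sp z = (\<chi> i. spray f i z)" for z
  have sn: "smooth_on S (\<lambda>z. snd z $ l)" for l
    by (rule smooth_on_bounded_linear[OF S bounded_linear_compose[OF bounded_linear_vec_nth bounded_linear_snd]])
  have sR: "smooth_on S (R k)" for k
    unfolding R_def[abs_def]
    by (intro smooth_on_diff[OF S] smooth_on_sum[OF S] smooth_on_mult[OF S] sn smooth_on_dird L)
  have sft: "smooth_on S (\<lambda>z. fundamental_tensor f z $ i $ j)" for i j
    by (subst smooth_on_cong[OF S ft])
       (assumption | intro smooth_on_mult[OF S] smooth_on_const[OF S] smooth_on_dird L)+
  have sFi: "smooth_on S (\<lambda>z. matrix_inv (fundamental_tensor f z))"
    by (rule smooth_on_matrix_inv[OF S smooth_on_entries[OF S sft] inv])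
  have ssp: "smooth_on S sp"
    unfolding sp_def spray
  proof (rule smooth_on_vec[OF S], simp)
    fix i
    show "smooth_on S (\<lambda>z. \<Sum>k\<in>UNIV. matrix_inv (fundamental_tensor f z) $ i $ k * R k z)"
      by (intro smooth_on_sum[OF S] smooth_on_mult[OF S] smooth_on_vec_nth[OF S] sFi sR)
  qed
  have gsp: "fundamental_tensor f z *v sp z = (\<chi> k. R k z)" if "z \<in> S" for z
  proof -
    have "sp z = matrix_inv (fundamental_tensor f z) *v (\<chi> k. R k z)"
      by (simp add: sp_def spray matrix_vector_mult_def)
    then show ?thesis by (simp add: matrix_vector_mul_assoc matrix_inv_mult(1)[OF inv[OF that]])
  qed
  note expand = linear_snd_expand and expandx = linear_fst_expand
  have E: "1/2 * dird (0, v) (dird (0, sp z) L) z = dird (snd z, 0) (dird (0, v) L) z - dird (v, 0) L z" if "z \<in> S" for z v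
  proof -
    have "1/2 * dird (?e k) (dird (0, sp z) L) z = R k z" for k
      using arg_cong[OF gsp[OF that], of "\<lambda>u. u $ k"]
      by (simp add: expand[OF lin3[OF that], of _ "sp z"] matrix_vector_mult_def ft[OF that] sum_distrib_left mult_ac)
    then have "1/2 * dird (0, v) (dird (0, sp z) L) z = (\<Sum>k\<in>UNIV. v $ k * R k z)"
      by (simp add: expand[OF lin2[OF that], of v] sum_distrib_left mult.left_commute)
    also have "\<dots> = (\<Sum>k\<in>UNIV. v $ k * dird (snd z, 0) (dird (?e k) L) z) - (\<Sum>k\<in>UNIV. v $ k * dird (?x k) L z)"
      by (simp add: R_def expandx[OF lin2[OF that], of "snd z"] algebra_simps sum_subtractf)
    finally show ?thesis
      by (simp add: expand[OF lin3[OF that], of _ v] expandx[OF lin1[OF that], of v])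
  qed
  have dsnd: "((\<lambda>z. (0, snd z)) has_derivative (\<lambda>p. (0, snd p))) (at z)"
    and dsnd': "((\<lambda>z. (snd z, 0)) has_derivative (\<lambda>p. (snd p, 0))) (at z)" for z :: "(real ^ 'n) \<times> (real ^ 'n)"
    by (auto intro!: derivative_eq_intros)
  \<comment> \<open>The derivative of the Euler identity in the direction \<open>p\<close>.\<close>
  have eu: "dird p (dird (0, snd z) L) z + dird (0, snd p) L z = 2 * dird p L z" if "z \<in> S" for z p
  proof -
    have 1: "((\<lambda>z. 2 * L z) has_derivative (\<lambda>p. dird p (dird (0, snd z) L) z + dird (0, snd p) L z)) (at z)"
      by (rule has_derivative_transform_within_open[OF dird_of_dird[OF S that L dsnd] S that euler])
    from fun_cong[OF has_derivative_unique[OF 1 has_derivative_mult_right[OF smooth_on_has_derivative[OF L that]]], of p]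
    show ?thesis .
  qed
  have star: "1/2 * dird (0, sp z) L z = dird (snd z, 0) L z" if "z \<in> S" for z
    using E[OF that, of "snd z"] eu[OF that, of "(0, sp z)"] eu[OF that, of "(snd z, 0)"]
      comm[OF that, of "(0, snd z)" "(0, sp z)"]
    by (simp add: linear_0[OF lin1[OF that]] zero_prod_def[symmetric])
  have key: "1/2 * dird (0, dird (0, v) sp z) L z = 2 * dird (v, 0) L z" if "z \<in> S" for z v
  proof -
    have "((\<lambda>z. (0, sp z)) has_derivative (\<lambda>p. (0, dird p sp z))) (at z)"
      by (rule has_derivative_Pair[OF has_derivative_const smooth_on_has_derivative[OF ssp that]])
    from has_derivative_mult_right[OF dird_of_dird[OF S that L this], of "1/2"]
    have "((\<lambda>z. dird (snd z, 0) L z) has_derivative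
        (\<lambda>p. 1/2 * (dird p (dird (0, sp z) L) z + dird (0, dird p sp z) L z))) (at z)"
      by (rule has_derivative_transform_within_open[OF _ S that star])
    from fun_cong[OF has_derivative_unique[OF this dird_of_dird[OF S that L dsnd']], of "(0, v)"]
    have "1/2 * dird (0, v) (dird (0, sp z) L) z + 1/2 * dird (0, dird (0, v) sp z) L z
        = dird (0, v) (dird (snd z, 0) L) z + dird (v, 0) L z" by (simp add: algebra_simps)
    then show ?thesis
      using E[OF that, of v] comm[OF that, of "(0, v)" "(snd z, 0)"] by linarith
  qed
  have sp_entry: "dird (?e j) (\<lambda>z. sp z $ i) (x', y') = 4 * (\<Sum>k\<in>UNIV. G x' i j k * y' $ k)" if "(x', y') \<in> S" for x' y' i j
    using N[OF that, of i j] by (simp add: cartan_N_def partial_y_def sp_def[abs_def])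
  have dsp: "dird (0, v) sp (x, y) = 4 *\<^sub>R (gm (G x) v *v y)" for v
  proof -
    have "dird (0, v) (\<lambda>z. sp z $ i) (x, y) = 4 * (gm (G x) v *v y) $ i" for i
    proof -
      have "linear (\<lambda>p. dird p (\<lambda>z. sp z $ i) (x, y))"
        by (rule dird_linear[OF differentiable_component[OF smooth_on_differentiable[OF ssp z]]])
      from expand[OF this, of v] show ?thesis
        by (simp add: sp_entry[OF z] gm_apply sum_distrib_left mult_ac)
    qed
    then show ?thesis by (simp add: vec_eq_iff dird_component[OF smooth_on_differentiable[OF ssp z]])
  qed
  show "dird (w, 0) L (x, y) = dird (0, gm (G x) w *v y) L (x, y)"
  proof -
    have "dird (0, dird (0, w) sp (x, y)) L (x, y) = 4 * dird (0, gm (G x) w *v y) L (x, y)"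
      using linear_cmul[OF lin1[OF z], of 4 "(0, gm (G x) w *v y)"] by (simp add: dsp)
    then show ?thesis using key[OF z, of w] by simp
  qed
  show "G x i j k = G x i k j"
  proof -
    have si: "smooth_on S (\<lambda>z. sp z $ i)" by (rule smooth_on_vec_nth[OF S ssp])
    have d: "dird (?e k) (dird (?e j) (\<lambda>z. sp z $ i)) (x, y) = 4 * G x i j k" for j k
    proof -
      let ?h = "dird (?e j) (\<lambda>z. sp z $ i)"
      have line: "((\<lambda>t. (x, y) + t *\<^sub>R ?e k) has_derivative (\<lambda>t. t *\<^sub>R ?e k)) (at 0)"
        by (auto intro!: derivative_eq_intros)
      have dh: "(?h has_derivative (\<lambda>p. dird p ?h (x, y))) (at ((x, y) + 0 *\<^sub>R ?e k))"
        using smooth_on_has_derivative[OF smooth_on_dird[OF si] z] by simp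
      from has_derivative_compose[OF line dh]
      have 1: "((\<lambda>t. ?h ((x, y) + t *\<^sub>R ?e k)) has_derivative (\<lambda>t. dird (t *\<^sub>R ?e k) ?h (x, y))) (at 0)" .
      let ?T = "(\<lambda>t. (x, y) + t *\<^sub>R ?e k) -` S"
      have oT: "open ?T" by (intro open_vimage S continuous_intros)
      have 2: "((\<lambda>t. ?h ((x, y) + t *\<^sub>R ?e k)) has_derivative (\<lambda>t. 4 * (t * G x i j k))) (at 0)"
      proof (rule has_derivative_transform_within_open[OF _ oT])
        show "((\<lambda>t. 4 * (\<Sum>l\<in>UNIV. G x i j l * y $ l) + 4 * (t * G x i j k)) has_derivative (\<lambda>t. 4 * (t * G x i j k))) (at 0)"
          by (auto intro!: derivative_eq_intros)
        show "0 \<in> ?T" using z by simp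
        fix t assume "t \<in> ?T"
        then have "(x, y + t *\<^sub>R axis k 1) \<in> S" by simp
        from sp_entry[OF this, of j i]
        show "4 * (\<Sum>l\<in>UNIV. G x i j l * y $ l) + 4 * (t * G x i j k) = ?h ((x, y) + t *\<^sub>R ?e k)"
          by (simp add: algebra_simps sum.distrib sum_distrib_left axis_def if_distrib[where f = "\<lambda>u. _ * u"] cong: if_cong)
      qed
      from fun_cong[OF has_derivative_unique[OF 1 2], of 1] show ?thesis by simp
    qed
    have "dird (?e k) (dird (?e j) (\<lambda>z. sp z $ i)) (x, y) = dird (?e j) (dird (?e k) (\<lambda>z. sp z $ i)) (x, y)"
      by (rule dird_dird_commute[OF S _ z]) (use si smooth_on_iff_ck in blast)
    then show ?thesis unfolding d by simp
  qed
qed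

section \<open>The polynomial identity of a Kropina metric\<close>

lemma cubic_zero:
  fixes c0 c1 c2 c3 :: real
  assumes "0 < d" "\<And>t. \<bar>t\<bar> < d \<Longrightarrow> c0 + t * (c1 + t * (c2 + t * c3)) = 0"
  shows "c0 + t * (c1 + t * (c2 + t * c3)) = 0"
proof -
  let ?p = "[:c0, c1, c2, c3:]"
  have "{-d<..<d} \<subseteq> {t. poly ?p t = 0}" using assms(2) by (auto simp: abs_less_iff)
  moreover have "infinite {-d<..<d}" using assms(1) by (simp add: infinite_Ioo)
  ultimately have "infinite {t. poly ?p t = 0}" using infinite_super by blast
  then have "?p = 0" using poly_roots_finite by blast
  then show ?thesis by simp
qed

text \<open>If the kernel of \<open>b\<close> were totally isotropic, \<open>M\<close> would map it to the multiples of \<open>b\<close>; as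
  \<open>M\<close> is invertible, its dimension \<open>n - 1\<close> would be at most 1.\<close>

lemma null_kernel_not_isotropic:
  fixes M :: "real ^ 'n ^ 'n"
  assumes n: "CARD('n) > 2" and sym: "transpose M = M" and I: "invertible M" and b: "b \<noteq> 0"
  obtains z where "b \<bullet> z = 0" "z \<bullet> (M *v z) \<noteq> 0"
proof (rule ccontr)
  note ob = that
  assume neg: "\<not> thesis"
  have q: "z \<bullet> (M *v z) = 0" if bz: "b \<bullet> z = 0" for z
  proof (rule ccontr)
    assume "z \<bullet> (M *v z) \<noteq> 0"
    from neg ob[OF bz this] show False by (rule notE)
  qed
  note s = symmetric_inner[OF sym]
  have bil: "y \<bullet> (M *v z) = 0" if "b \<bullet> y = 0" "b \<bullet> z = 0" for y z
  proof -
    have "b \<bullet> (y + z) = 0" using that by (simp add: inner_add_right)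
    from q[OF this] q[OF that(1)] q[OF that(2)] s[of z y] show ?thesis
      by (simp add: matrix_vector_right_distrib inner_add_left inner_add_right)
  qed
  have Mb: "M *v y = ((b \<bullet> (M *v y)) / (b \<bullet> b)) *\<^sub>R b" if y: "b \<bullet> y = 0" for y
  proof -
    let ?u = "M *v y - ((b \<bullet> (M *v y)) / (b \<bullet> b)) *\<^sub>R b"
    have bu: "b \<bullet> ?u = 0" using b by (simp add: inner_diff_right)
    have "?u \<bullet> ?u = ?u \<bullet> (M *v y) - ((b \<bullet> (M *v y)) / (b \<bullet> b)) * (?u \<bullet> b)"
      by (simp only: inner_diff_right inner_scaleR_right)
    also have "\<dots> = 0" using bil[OF bu y] bu inner_commute[of ?u b] by (simp only: mult_zero_right diff_self)
    finally show ?thesis by (simp only: inner_eq_zero_iff right_minus_eq)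
  qed
  have "{y. b \<bullet> y = 0} \<subseteq> span {matrix_inv M *v b}"
  proof
    fix y assume "y \<in> {y. b \<bullet> y = 0}"
    then have "matrix_inv M *v (M *v y) = matrix_inv M *v (((b \<bullet> (M *v y)) / (b \<bullet> b)) *\<^sub>R b)"
      using Mb[of y] by simp
    then have "y = ((b \<bullet> (M *v y)) / (b \<bullet> b)) *\<^sub>R (matrix_inv M *v b)"
      by (simp add: matrix_vector_mul_assoc matrix_inv_mult(2)[OF I] matrix_vector_mult_scaleR)
    then show "y \<in> span {matrix_inv M *v b}" by (metis insertI1 span_base span_mul)
  qed
  then have "dim {y. b \<bullet> y = 0} \<le> dim (span {matrix_inv M *v b})" by (rule dim_subset)
  also have "\<dots> \<le> 1" using dim_le_card[of "{matrix_inv M *v b}" "{matrix_inv M *v b}"] by (simp add: span_base dim_span)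
  finally show False using dim_hyperplane[OF b] n by simp
qed

text \<open>The identity of cubic polynomials extends from \<open>V\<close> to all \<open>y\<close>. On the kernel of \<open>b\<close> it says
  that \<open>e\<close> vanishes at every vector that is not isotropic for \<open>M\<close>; these exist and generate the
  kernel, so \<open>e\<close> is a multiple of \<open>b\<close>. Division by \<open>b \<bullet> y\<close> then shows that \<open>q\<close> and the multiple
  of \<open>M\<close> agree off the kernel of \<open>b\<close>, hence everywhere.\<close>

lemma proportional_of_cubic_identity:
  fixes M q :: "real ^ 'n ^ 'n"
  assumes n: "CARD('n) > 2" and sym: "transpose M = M" "transpose q = q" and I: "invertible M" and b: "b \<noteq> 0"
    and V: "open V" "V \<noteq> {}" and mu: "mu \<noteq> 0" and nu: "nu \<noteq> 0"
    and eq: "\<And>y. y \<in> V \<Longrightarrow> mu * (b \<bullet> y) * (y \<bullet> (q *v y)) = nu * (y \<bullet> (M *v y)) * (e \<bullet> y)"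
  obtains c where "e = c *\<^sub>R b" "q = (nu * c / mu) *\<^sub>R M"
proof -
  have all: "mu * (b \<bullet> y) * (y \<bullet> (q *v y)) = nu * (y \<bullet> (M *v y)) * (e \<bullet> y)" for y
  proof -
    obtain y0 d where y0: "0 < d" "ball y0 d \<subseteq> V" using V open_contains_ball by blast
    define w where "w = y - y0"
    let ?d = "d / (norm w + 1)"
    have d: "0 < ?d" using y0 by (simp add: add_nonneg_pos)
    let ?c0 = "mu * (b \<bullet> y0) * (y0 \<bullet> (q *v y0)) - nu * (y0 \<bullet> (M *v y0)) * (e \<bullet> y0)"
    let ?c1 = "mu * ((b \<bullet> w) * (y0 \<bullet> (q *v y0)) + (b \<bullet> y0) * (2 * (y0 \<bullet> (q *v w))))
      - nu * ((2 * (y0 \<bullet> (M *v w))) * (e \<bullet> y0) + (y0 \<bullet> (M *v y0)) * (e \<bullet> w))"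
    let ?c2 = "mu * ((b \<bullet> w) * (2 * (y0 \<bullet> (q *v w))) + (b \<bullet> y0) * (w \<bullet> (q *v w)))
      - nu * ((w \<bullet> (M *v w)) * (e \<bullet> y0) + (2 * (y0 \<bullet> (M *v w))) * (e \<bullet> w))"
    let ?c3 = "mu * (b \<bullet> w) * (w \<bullet> (q *v w)) - nu * (w \<bullet> (M *v w)) * (e \<bullet> w)"
    have quad: "(y0 + t *\<^sub>R w) \<bullet> (N *v (y0 + t *\<^sub>R w)) = y0 \<bullet> (N *v y0) + t * (2 * (y0 \<bullet> (N *v w))) + t * t * (w \<bullet> (N *v w))"
      if "transpose N = N" for N :: "real ^ 'n ^ 'n" and t
      using symmetric_inner[OF that, of w y0]
      by (simp add: matrix_vector_right_distrib matrix_vector_mult_scaleR inner_add_left inner_add_right algebra_simps)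
    have ex: "mu * (b \<bullet> (y0 + t *\<^sub>R w)) * ((y0 + t *\<^sub>R w) \<bullet> (q *v (y0 + t *\<^sub>R w)))
       - nu * ((y0 + t *\<^sub>R w) \<bullet> (M *v (y0 + t *\<^sub>R w))) * (e \<bullet> (y0 + t *\<^sub>R w))
       = ?c0 + t * (?c1 + t * (?c2 + t * ?c3))" for t
      unfolding quad[OF sym(1)] quad[OF sym(2)] inner_add_right inner_scaleR_right by algebra
    have "?c0 + t * (?c1 + t * (?c2 + t * ?c3)) = 0" if t: "\<bar>t\<bar> < ?d" for t
    proof -
      have "norm (t *\<^sub>R w) \<le> \<bar>t\<bar> * (norm w + 1)" by (simp add: algebra_simps)
      also have "\<dots> < ?d * (norm w + 1)" using t by (intro mult_strict_right_mono) (simp_all add: add_nonneg_pos)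
      also have "\<dots> = d"
      proof -
        have "norm w + 1 > 0" by (simp add: add_nonneg_pos)
        then show ?thesis by simp
      qed
      finally have "y0 + t *\<^sub>R w \<in> ball y0 d" by (simp add: dist_norm)
      then have "y0 + t *\<^sub>R w \<in> V" using y0 by blast
      from eq[OF this] show ?thesis unfolding ex[symmetric] by simp
    qed
    from cubic_zero[OF d this, of 1] ex[of 1] show ?thesis by (simp add: w_def)
  qed
  obtain z where z: "b \<bullet> z = 0" "z \<bullet> (M *v z) \<noteq> 0" by (rule null_kernel_not_isotropic[OF n sym(1) I b])
  have ez: "e \<bullet> z = 0" using all[of z] z nu by simp
  have ek: "e \<bullet> y = 0" if y: "b \<bullet> y = 0" for y
  proof -
    have h: "(y + t *\<^sub>R z) \<bullet> (M *v (y + t *\<^sub>R z)) = 0 \<or> e \<bullet> y = 0" for t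
      using all[of "y + t *\<^sub>R z"] y z(1) ez nu by (simp add: inner_add_right)
    have q: "(y + t *\<^sub>R z) \<bullet> (M *v (y + t *\<^sub>R z)) = y \<bullet> (M *v y) + t * (2 * (y \<bullet> (M *v z))) + t * t * (z \<bullet> (M *v z))" for t
      using symmetric_inner[OF sym(1), of z y]
      by (simp add: matrix_vector_right_distrib matrix_vector_mult_scaleR inner_add_left inner_add_right algebra_simps)
    show ?thesis using h[of 0] h[of 1] h[of "-1"] z(2) unfolding q by auto
  qed
  define c where "c = (e \<bullet> b) / (b \<bullet> b)"
  have bb: "b \<bullet> b \<noteq> 0" using b by simp
  have e: "e = c *\<^sub>R b"
  proof -
    let ?u = "e - c *\<^sub>R b"
    have bu: "b \<bullet> ?u = 0" using bb by (simp add: c_def inner_diff_right inner_commute)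
    have "?u \<bullet> ?u = e \<bullet> ?u - c * (b \<bullet> ?u)" by (simp add: inner_diff_left inner_diff_right inner_commute[of e b])
    also have "\<dots> = 0" using ek[OF bu] bu by simp
    finally show ?thesis by (simp only: inner_eq_zero_iff right_minus_eq)
  qed
  define r where "r = q - (nu * c / mu) *\<^sub>R M"
  have rs: "transpose r = r" using sym by (simp add: r_def transpose_def vec_eq_iff)
  have rq: "y \<bullet> (r *v y) = y \<bullet> (q *v y) - (nu * c / mu) * (y \<bullet> (M *v y))" for y
    by (simp add: r_def matrix_vector_mult_diff_rdistrib inner_diff_right scaleR_matrix_vector_assoc[symmetric])
  have r0: "y \<bullet> (r *v y) = 0" if "b \<bullet> y \<noteq> 0" for y
  proof -
    have "(b \<bullet> y) * (mu * (y \<bullet> (q *v y)) - nu * c * (y \<bullet> (M *v y))) = 0"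
      using all[of y] by (simp add: e algebra_simps)
    then have "mu * (y \<bullet> (q *v y)) - nu * c * (y \<bullet> (M *v y)) = 0" using that by simp
    then show ?thesis unfolding rq using mu by (simp add: field_simps)
  qed
  have q2: "(y + t *\<^sub>R z) \<bullet> (r *v (y + t *\<^sub>R z)) = y \<bullet> (r *v y) + t * (2 * (y \<bullet> (r *v z))) + t * t * (z \<bullet> (r *v z))" for t y z
    using symmetric_inner[OF rs, of z y]
    by (simp add: matrix_vector_right_distrib matrix_vector_mult_scaleR inner_add_left inner_add_right algebra_simps)
  have r1: "y \<bullet> (r *v y) = 0" for y
  proof (cases "b \<bullet> y = 0")
    case True
    \<comment> \<open>A quadratic polynomial in \<open>t\<close> with zeros at 1, -1 and 2 vanishes at 0.\<close>
    have "(y + t *\<^sub>R b) \<bullet> (r *v (y + t *\<^sub>R b)) = 0" if "t \<noteq> 0" for t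
      using r0[of "y + t *\<^sub>R b"] True bb that by (simp add: inner_add_right)
    from this[of 1] this[of "-1"] this[of 2] show ?thesis unfolding q2 by simp
  qed (rule r0)
  have "y \<bullet> (r *v z) = y \<bullet> (0 *v z)" for y z
    using q2[of y 1 z] r1[of "y + 1 *\<^sub>R z"] r1[of y] r1[of z] by simp
  then have "r = 0" by (rule matrix_eq_bilinear)
  then show ?thesis using that[OF e] by (simp add: r_def)
qed

text \<open>Squaring removes the sign of the base, which may be negative for an integer exponent.\<close>

lemma rpow_square:
  assumes "x \<noteq> 0" "rpow_defined x r"
  shows "(rpow x r)\<^sup>2 = x\<^sup>2 powr r"
proof (cases "r \<in> \<int>")
  case True
  then obtain k where k: "r = of_int k" by (elim Ints_cases)
  have "(rpow x r)\<^sup>2 = x\<^sup>2 powi k"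
    using True by (simp add: rpow_def k power2_eq_square power_int_mult_distrib)
  also have "\<dots> = x\<^sup>2 powr r" using assms(1) by (simp add: k powr_real_of_int')
  finally show ?thesis .
next
  case False
  then have "x > 0" using assms by (auto simp: rpow_defined_def)
  then show ?thesis using False by (simp add: rpow_def power2_eq_square powr_mult)
qed

lemma ball_line:
  fixes y w :: "'a::real_normed_vector"
  assumes "open V" "y \<in> V"
  obtains d where "0 < d" "\<And>t. \<bar>t\<bar> < d \<Longrightarrow> y + t *\<^sub>R w \<in> V"
proof -
  obtain e where e: "0 < e" "ball y e \<subseteq> V" using assms open_contains_ball by blast
  have p: "norm w + 1 > 0" by (simp add: add_nonneg_pos)
  show ?thesis
  proof (rule that[of "e / (norm w + 1)"])
    show "0 < e / (norm w + 1)" using e p by simp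
    fix t assume t: "\<bar>t\<bar> < e / (norm w + 1)"
    have "norm (t *\<^sub>R w) \<le> \<bar>t\<bar> * (norm w + 1)" by (simp add: algebra_simps)
    also have "\<dots> < e" using t p by (simp add: pos_less_divide_eq)
    finally have "y + t *\<^sub>R w \<in> ball y e" by (simp add: dist_norm)
    then show "y + t *\<^sub>R w \<in> V" using e by blast
  qed
qed

lemma quadratic_line:
  fixes N :: "real ^ 'n ^ 'n"
  assumes "transpose N = N"
  shows "(y + t *\<^sub>R w) \<bullet> (N *v (y + t *\<^sub>R w)) = y \<bullet> (N *v y) + t * (2 * (w \<bullet> (N *v y))) + t * t * (w \<bullet> (N *v w))"
  using symmetric_inner[OF assms, of w y]
  by (simp add: matrix_vector_right_distrib matrix_vector_mult_scaleR inner_add_left inner_add_right algebra_simps)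

text \<open>A zero of the quadratic form in the open set would be a minimum, hence a critical point,
  which an invertible \<open>N\<close> has only at 0.\<close>

lemma positive_on_open_of_nonneg:
  fixes N :: "real ^ 'n ^ 'n"
  assumes sym: "transpose N = N" and I: "invertible N" and V: "open V" "y \<in> V" and y: "y \<noteq> 0"
    and nn: "\<And>y. y \<in> V \<Longrightarrow> 0 \<le> y \<bullet> (N *v y)"
  shows "0 < y \<bullet> (N *v y)"
proof (rule ccontr)
  assume "\<not> 0 < y \<bullet> (N *v y)"
  then have 0: "y \<bullet> (N *v y) = 0" using nn[OF V(2)] by simp
  let ?w = "- (N *v y)"
  define P where "P = (N *v y) \<bullet> (N *v y)"
  define q where "q = ?w \<bullet> (N *v ?w)"
  have "N *v y \<noteq> 0"
  proof
    assume "N *v y = 0"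
    then have "matrix_inv N *v (N *v y) = 0" by simp
    then show False using y by (simp add: matrix_vector_mul_assoc matrix_inv_mult(2)[OF I])
  qed
  then have P: "0 < P" by (simp add: P_def)
  obtain d where d: "0 < d" "\<And>t. \<bar>t\<bar> < d \<Longrightarrow> y + t *\<^sub>R ?w \<in> V" using ball_line[OF V] by blast
  \<comment> \<open>A step along the negative gradient that is so short that the linear term dominates the
    quadratic one.\<close>
  define t where "t = min (d / 2) (P / (\<bar>q\<bar> + 1))"
  have t: "0 < t" "\<bar>t\<bar> < d" using d P by (auto simp: t_def add_nonneg_pos)
  have "0 \<le> t * (2 * (- P)) + t * t * q"
    using nn[OF d(2)[OF t(2)]] unfolding quadratic_line[OF sym] 0 by (simp add: P_def q_def)
  then have "0 \<le> t * (t * q - 2 * P)" by (simp add: algebra_simps)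
  then have "2 * P \<le> t * q" using t by (simp add: zero_le_mult_iff)
  also have "\<dots> \<le> t * (\<bar>q\<bar> + 1)" using t by (intro mult_left_mono) auto
  also have "\<dots> \<le> P / (\<bar>q\<bar> + 1) * (\<bar>q\<bar> + 1)" by (intro mult_right_mono) (simp_all add: t_def)
  also have "\<dots> = P"
  proof -
    have "\<bar>q\<bar> + 1 > 0" by simp
    then show ?thesis by simp
  qed
  finally show False using P by simp
qed

text \<open>On the set where \<open>\<beta> \<noteq> 0\<close>, the logarithmic derivative of \<open>L = F\<^sup>2\<close> in the direction \<open>p\<close> is
  \<open>P z p = (1 + m) dA(p) / A - 2 m d\<beta>(p) / \<beta>\<close>. That it vanishes in horizontal directions is the
  cubic identity for \<open>q = \<nabla>\<^sub>w a\<close> and \<open>e = \<nabla>\<^sub>w b\<close>. The resulting factor \<open>c w\<close> is a multiple of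
  \<open>b(w)\<close> because \<open>\<nabla> b\<close> is symmetric for closed \<open>b\<close> and symmetric \<open>\<nabla>\<close>.\<close>

lemma kropina_chart:
  fixes M :: "real ^ 'n \<Rightarrow> real ^ 'n ^ 'n" and b :: "real ^ 'n \<Rightarrow> real ^ 'n"
    and f :: "(real ^ 'n) \<times> (real ^ 'n) \<Rightarrow> real" and G :: "real ^ 'n \<Rightarrow> 'n \<Rightarrow> 'n \<Rightarrow> 'n \<Rightarrow> real"
  assumes n: "CARD('n) > 2" and D: "open D" and sM: "smooth_on D M" and sb: "smooth_on D b"
    and sym: "\<And>x. x \<in> D \<Longrightarrow> transpose (M x) = M x" and I: "\<And>x. x \<in> D \<Longrightarrow> invertible (M x)"
    and b0: "\<And>x. x \<in> D \<Longrightarrow> b x \<noteq> 0" and null: "\<And>x. x \<in> D \<Longrightarrow> b x \<bullet> (matrix_inv (M x) *v b x) = 0"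
    and closed: "\<And>x w y. x \<in> D \<Longrightarrow> dird w b x \<bullet> y = dird y b x \<bullet> w"
    and K: "open K" and sf: "smooth_on K f"
    and Kx: "\<And>x y. (x, y) \<in> K \<Longrightarrow> x \<in> D \<and> y \<noteq> 0 \<and> 0 \<le> y \<bullet> (M x *v y)"
    and f: "\<And>x y. (x, y) \<in> K \<Longrightarrow> rpow_defined (sqrt (y \<bullet> (M x *v y))) (1 + m) \<and> rpow_defined (b x \<bullet> y) (- m)
       \<and> f (x, y) = rpow (sqrt (y \<bullet> (M x *v y))) (1 + m) * rpow (b x \<bullet> y) (- m)"
    and inv: "\<And>z. z \<in> K \<Longrightarrow> invertible (fundamental_tensor f z)"
    and N: "\<And>x y i j. (x, y) \<in> K \<Longrightarrow> cartan_N f i j (x, y) = (\<Sum>k\<in>UNIV. G x i j k * y $ k)"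
    and z0: "(x0, y0) \<in> K" and m: "m \<noteq> 0"
  shows "m \<noteq> 1 \<and> m \<noteq> -1 \<and> (\<forall>i j k. G x0 i j k = G x0 i k j) \<and>
    (\<exists>\<kappa>. weyl_at (G x0) M (\<lambda>w. 2 * m / (1 + m) * \<kappa> * (b x0 \<bullet> w)) x0 \<and>
       (\<forall>w y. dird w b x0 \<bullet> y = b x0 \<bullet> (gm (G x0) w *v y) + \<kappa> * (b x0 \<bullet> w) * (b x0 \<bullet> y)))"
proof -
  note bv = bounded_bilinear_matrix_vector_mult[where 'n='n and 'm='n]
  define A where "A z = snd z \<bullet> (M (fst z) *v snd z)" for z
  define \<beta> where "\<beta> z = b (fst z) \<bullet> snd z" for z
  define L where "L z = (f z)\<^sup>2" for z
  have KO: "fst z \<in> D" if "z \<in> K" for z using Kx[of "fst z" "snd z"] that by simp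
  have oKx: "open {y. (x, y) \<in> K}" for x
  proof -
    have "open ((\<lambda>y. (x, y)) -` K)" by (intro open_vimage K continuous_intros)
    then show ?thesis by (simp add: vimage_def)
  qed
  have Apos: "0 < A z" if "z \<in> K" for z
  proof -
    have zK: "(fst z, snd z) \<in> K" using that by simp
    show ?thesis unfolding A_def
    proof (rule positive_on_open_of_nonneg[OF sym[OF KO[OF that]] I[OF KO[OF that]] oKx[of "fst z"]])
      show "snd z \<in> {y. (fst z, y) \<in> K}" "snd z \<noteq> 0" using zK Kx[OF zK] by blast+
      show "0 \<le> y \<bullet> (M (fst z) *v y)" if "y \<in> {y. (fst z, y) \<in> K}" for y using that Kx by blast
    qed
  qed
  have sfst: "smooth_on K fst" and ssnd: "smooth_on K snd"
    by (rule smooth_on_bounded_linear[OF K bounded_linear_fst])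
       (rule smooth_on_bounded_linear[OF K bounded_linear_snd])
  have sMf: "smooth_on K (\<lambda>z. M (fst z))" by (rule smooth_on_compose[OF K D sM sfst KO])
  have sbf: "smooth_on K (\<lambda>z. b (fst z))" by (rule smooth_on_compose[OF K D sb sfst KO])
  have c\<beta>: "continuous_on K \<beta>" unfolding \<beta>_def[abs_def]
    by (rule smooth_on_continuous_on[OF smooth_on_inner[OF K sbf ssnd]])
  define S where "S = {z \<in> K. \<beta> z \<noteq> 0}"
  have S: "open S"
  proof -
    have "open (K \<inter> \<beta> -` (- {0}))" by (rule continuous_open_preimage[OF c\<beta> K]) auto
    moreover have "K \<inter> \<beta> -` (- {0}) = S" by (auto simp: S_def)
    ultimately show ?thesis by simp
  qed
  have SK: "S \<subseteq> K" by (auto simp: S_def)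
  have \<beta>0: "\<beta> z \<noteq> 0" and A0: "0 < A z" if "z \<in> S" for z using that Apos by (auto simp: S_def)
  have Leq: "exp ((1 + m) * ln (A z) - m * ln ((\<beta> z)\<^sup>2)) = L z" if z: "z \<in> S" for z
  proof -
    have zK: "(fst z, snd z) \<in> K" using z SK by auto
    have "L z = (rpow (sqrt (A z)) (1 + m))\<^sup>2 * (rpow (\<beta> z) (- m))\<^sup>2"
      using f[OF zK] by (simp add: L_def A_def \<beta>_def power_mult_distrib)
    also have "(rpow (sqrt (A z)) (1 + m))\<^sup>2 = A z powr (1 + m)"
      using rpow_square[of "sqrt (A z)" "1 + m"] f[OF zK] A0[OF z] by (simp add: A_def)
    also have "(rpow (\<beta> z) (- m))\<^sup>2 = (\<beta> z)\<^sup>2 powr (- m)"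
      using rpow_square[of "\<beta> z" "- m"] f[OF zK] \<beta>0[OF z] by (simp add: \<beta>_def)
    finally show ?thesis using A0[OF z] \<beta>0[OF z] by (simp add: powr_def exp_add[symmetric])
  qed
  have Lpos: "0 < L z" if "z \<in> S" for z using Leq[OF that] by (metis exp_gt_zero)
  define A' where "A' z p = 2 * (snd p \<bullet> (M (fst z) *v snd z)) + snd z \<bullet> (dird (fst p) M (fst z) *v snd z)" for z p
  define \<beta>' where "\<beta>' z p = b (fst z) \<bullet> snd p + dird (fst p) b (fst z) \<bullet> snd z" for z p
  have dfst: "(fst has_derivative fst) (at z)" and dsnd: "(snd has_derivative snd) (at z)"
    for z :: "(real ^ 'n) \<times> (real ^ 'n)"
    by (rule has_derivative_fst[OF has_derivative_ident]) (rule has_derivative_snd[OF has_derivative_ident])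
  have dM: "((\<lambda>z. M (fst z)) has_derivative (\<lambda>p. dird (fst p) M (fst z))) (at z)"
    and db: "((\<lambda>z. b (fst z)) has_derivative (\<lambda>p. dird (fst p) b (fst z))) (at z)" if "z \<in> S" for z
  proof -
    have zD: "fst z \<in> D" using KO SK that by blast
    show "((\<lambda>z. M (fst z)) has_derivative (\<lambda>p. dird (fst p) M (fst z))) (at z)"
      by (rule has_derivative_compose[OF dfst smooth_on_has_derivative[OF sM zD]])
    show "((\<lambda>z. b (fst z)) has_derivative (\<lambda>p. dird (fst p) b (fst z))) (at z)"
      by (rule has_derivative_compose[OF dfst smooth_on_has_derivative[OF sb zD]])
  qed
  have dMs: "((\<lambda>z. M (fst z) *v snd z) has_derivative (\<lambda>p. M (fst z) *v snd p + dird (fst p) M (fst z) *v snd z)) (at z)"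
    if "z \<in> S" for z
    by (rule bounded_bilinear.FDERIV[OF bv dM[OF that] dsnd])
  have dA: "(A has_derivative A' z) (at z)" if z: "z \<in> S" for z
  proof -
    have "(A has_derivative (\<lambda>p. snd z \<bullet> (M (fst z) *v snd p + dird (fst p) M (fst z) *v snd z) + snd p \<bullet> (M (fst z) *v snd z))) (at z)"
      unfolding A_def[abs_def] by (rule bounded_bilinear.FDERIV[OF bounded_bilinear_inner dsnd dMs[OF z]])
    moreover have "snd z \<bullet> (M (fst z) *v snd p + dird (fst p) M (fst z) *v snd z) + snd p \<bullet> (M (fst z) *v snd z) = A' z p" for p
      using symmetric_inner[OF sym[OF KO], of z "snd z" "snd p"] z SK by (auto simp: A'_def inner_add_right)
    ultimately show ?thesis by simp
  qed
  have d\<beta>: "(\<beta> has_derivative \<beta>' z) (at z)" if z: "z \<in> S" for z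
    unfolding \<beta>_def[abs_def] \<beta>'_def by (rule bounded_bilinear.FDERIV[OF bounded_bilinear_inner db[OF z] dsnd])
  define P where "P z p = (1 + m) * (A' z p / A z) - 2 * m * (\<beta>' z p / \<beta> z)" for z p
  have dL: "(L has_derivative (\<lambda>p. L z * P z p)) (at z)" if z: "z \<in> S" for z
  proof -
    have "((\<lambda>z. exp ((1 + m) * ln (A z) - m * ln ((\<beta> z)\<^sup>2))) has_derivative (\<lambda>p. L z * P z p)) (at z)"
    proof -
      have b2: "0 < \<beta> z * \<beta> z" using \<beta>0[OF z] not_real_square_gt_zero by blast
      note 1 = has_derivative_mult_right[OF DERIV_compose_FDERIV[OF DERIV_ln_divide[OF A0[OF z]] dA[OF z]], of "1 + m"]
      note 2 = has_derivative_mult_right[OF DERIV_compose_FDERIV[OF DERIV_ln_divide[OF b2]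
          has_derivative_mult[OF d\<beta>[OF z] d\<beta>[OF z]]], of m]
      note 3 = DERIV_compose_FDERIV[OF DERIV_exp has_derivative_diff[OF 1 2]]
      have eqv: "(1 + m) * (p * (1 / A z)) - m * ((\<beta> z * q + q * \<beta> z) * (1 / (\<beta> z * \<beta> z)))
          = (1 + m) * (p / A z) - 2 * m * (q / \<beta> z)" for p q
        using \<beta>0[OF z] by (simp add: field_simps)
      show ?thesis
        using 3 unfolding eqv power2_eq_square Leq[OF z, unfolded power2_eq_square] P_def
        by (simp only: mult.commute[of _ "L z"])
    qed
    then show ?thesis by (rule has_derivative_transform_within_open[OF _ S z]) (rule Leq)
  qed
  have dirL: "dird p L z = L z * P z p" if "z \<in> S" for z p
    by (rule dird_has_derivative[OF dL[OF that]])
  have sL: "smooth_on S L"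
    unfolding L_def[abs_def] power2_eq_square
    by (intro smooth_on_mult[OF S] smooth_on_subset[OF sf SK])
  have lin0: "dird 0 M x = 0" "dird 0 b x = 0" if "x \<in> D" for x
    using linear_0[OF dird_linear[OF smooth_on_differentiable[OF sM that]]]
      linear_0[OF dird_linear[OF smooth_on_differentiable[OF sb that]]] by auto
  have A'0: "A' z (0, v) = 2 * (v \<bullet> (M (fst z) *v snd z))" and \<beta>'0: "\<beta>' z (0, v) = b (fst z) \<bullet> v" if "z \<in> S" for z v
  proof -
    have zD: "fst z \<in> D" using KO SK that by blast
    show "A' z (0, v) = 2 * (v \<bullet> (M (fst z) *v snd z))" "\<beta>' z (0, v) = b (fst z) \<bullet> v"
      by (simp_all add: A'_def \<beta>'_def lin0[OF zD])
  qed
  have euler: "dird (0, snd z) L z = 2 * L z" if z: "z \<in> S" for z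
  proof -
    have "A' z (0, snd z) = 2 * A z" "\<beta>' z (0, snd z) = \<beta> z"
      unfolding A'0[OF z] \<beta>'0[OF z] by (simp_all add: A_def \<beta>_def)
    then show ?thesis using A0[OF z] \<beta>0[OF z] by (simp add: dirL[OF z] P_def)
  qed
  have x0: "x0 \<in> D" using Kx[OF z0] by simp
  let ?b = "b x0" and ?M = "M x0"
  \<comment> \<open>If \<open>m < 0\<close>, the given \<open>y0\<close> may lie in the kernel of \<open>b\<close>; a small shift along \<open>b\<close> leaves it.\<close>
  obtain y1 where y1: "(x0, y1) \<in> S"
  proof (cases "?b \<bullet> y0 = 0")
    case True
    obtain d where d: "0 < d" "\<And>t. \<bar>t\<bar> < d \<Longrightarrow> y0 + t *\<^sub>R ?b \<in> {y. (x0, y) \<in> K}"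
      using ball_line[OF oKx[of x0], of y0 ?b] z0 by blast
    have "(x0, y0 + (d/2) *\<^sub>R ?b) \<in> S"
      using d(2)[of "d/2"] d(1) True b0[OF x0] by (simp add: S_def \<beta>_def inner_add_right)
    then show ?thesis by (rule that)
  next
    case False
    then show ?thesis using z0 that[of y0] by (simp add: S_def \<beta>_def)
  qed
  have hor: "dird (w, 0) L (x0, y) = dird (0, gm (G x0) w *v y) L (x0, y)" and Gs: "G x0 i j k = G x0 i k j"
    if "(x0, y) \<in> S" for y w i j k
  proof -
    have invS: "invertible (fundamental_tensor f z)" if "z \<in> S" for z using inv SK that by blast
    have NS: "cartan_N f i j (x, y) = (\<Sum>k\<in>UNIV. G x i j k * y $ k)" if "(x, y) \<in> S" for x y i j
      using N SK that by blast
    note bh = berwald_horizontal[OF S sL[unfolded L_def[abs_def]] euler[unfolded L_def[abs_def]] invS NS that]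
    show "dird (w, 0) L (x0, y) = dird (0, gm (G x0) w *v y) L (x0, y)"
      unfolding L_def[abs_def] by (rule bh(1))
    show "G x0 i j k = G x0 i k j" by (rule bh(2))
  qed
  let ?\<xi> = "matrix_inv ?M *v ?b"
  have M\<xi>: "?M *v ?\<xi> = ?b" by (simp add: matrix_vector_mul_assoc matrix_inv_mult(1)[OF I[OF x0]])
  have b\<xi>: "?b \<bullet> ?\<xi> = 0" by (rule null[OF x0])
  have mm: "m \<noteq> 1 \<and> m \<noteq> -1"
  proof (rule ccontr)
    assume "\<not> (m \<noteq> 1 \<and> m \<noteq> -1)"
    then have mm: "(1 + m) * (1 - m) = 0" by auto
    let ?z = "(x0, y1)"
    define \<alpha> where "\<alpha> = A ?z"
    define be where "be = \<beta> ?z"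
    have ab: "0 < \<alpha>" "be \<noteq> 0" using A0[OF y1] \<beta>0[OF y1] by (auto simp: \<alpha>_def be_def)
    \<comment> \<open>The Hessian of \<open>L\<close> annihilates this \<open>w\<close> if \<open>m = 1\<close> or \<open>m = -1\<close>: up to a factor, the first
      derivative of \<open>L\<close> along \<open>w\<close> vanishes for every \<open>m\<close> (\<open>s1\<close>), the second one is a multiple of
      \<open>(1 + m) (1 - m)\<close> (\<open>s2\<close>).\<close>
    define w where "w = ?\<xi> - ((1 + m) * be / \<alpha>) *\<^sub>R y1"
    have bw: "?b \<bullet> w = - ((1 + m) * be * be / \<alpha>)"
      by (simp add: w_def inner_diff_right b\<xi> be_def \<beta>_def)
    have Mw: "?M *v w = ?b - ((1 + m) * be / \<alpha>) *\<^sub>R (?M *v y1)"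
      by (simp add: w_def matrix_vector_mult_diff_distrib M\<xi> matrix_vector_mult_scaleR)
    have wM: "w \<bullet> (?M *v v) = ?b \<bullet> v - ((1 + m) * be / \<alpha>) * (v \<bullet> (?M *v y1))" for v
      using symmetric_inner[OF sym[OF x0], of w v] by (simp add: Mw inner_diff_right inner_commute[of v ?b])
    have wMy: "w \<bullet> (?M *v y1) = - m * be"
    proof -
      have "((1 + m) * be / \<alpha>) * \<alpha> = (1 + m) * be" using ab by simp
      moreover have "w \<bullet> (?M *v y1) = be - ((1 + m) * be / \<alpha>) * \<alpha>"
        unfolding wM by (simp add: be_def \<beta>_def \<alpha>_def A_def)
      ultimately show ?thesis by (simp add: algebra_simps)
    qed
    have D2: "dird (0, v) (dird (0, w) L) ?z = 0" for v
    proof -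
      have e1: "L z * ((1 + m) * (2 * (w \<bullet> (M (fst z) *v snd z)) / A z) - 2 * m * (b (fst z) \<bullet> w / \<beta> z)) = dird (0, w) L z"
        if "z \<in> S" for z
        unfolding dirL[OF that] P_def A'0[OF that] \<beta>'0[OF that] ..
      have dw: "((\<lambda>z. w \<bullet> (M (fst z) *v snd z)) has_derivative
          (\<lambda>p. w \<bullet> (M (fst ?z) *v snd p + dird (fst p) M (fst ?z) *v snd ?z))) (at ?z)"
        by (rule bounded_linear.has_derivative[OF bounded_linear_inner_right dMs[OF y1]])
      have dbw: "((\<lambda>z. b (fst z) \<bullet> w) has_derivative (\<lambda>p. dird (fst p) b (fst ?z) \<bullet> w)) (at ?z)"
        by (rule bounded_linear.has_derivative[OF bounded_linear_inner_left db[OF y1]])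
      have q: "((\<lambda>z. g z / h z) has_derivative (\<lambda>p. (g' p * h ?z - g ?z * h' p) / (h ?z * h ?z))) (at ?z)"
        if "(g has_derivative g') (at ?z)" "(h has_derivative h') (at ?z)" "h ?z \<noteq> 0"
        for g h g' h' :: "(real ^ 'n) \<times> (real ^ 'n) \<Rightarrow> real"
        by (rule has_derivative_divide'[OF that])
      have An: "A ?z \<noteq> 0" using A0[OF y1] by simp
      note d1 = has_derivative_mult_right[OF q[OF has_derivative_mult_right[OF dw, of 2] dA[OF y1] An], of "1 + m"]
      note d2 = has_derivative_mult_right[OF q[OF dbw d\<beta>[OF y1] \<beta>0[OF y1]], of "2 * m"]
      note d3 = has_derivative_mult[OF dL[OF y1] has_derivative_diff[OF d1 d2]]
      have d4: "(dird (0, w) L has_derivative (\<lambda>p.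
          L ?z * ((1 + m) * ((2 * (w \<bullet> (M (fst ?z) *v snd p + dird (fst p) M (fst ?z) *v snd ?z)) * A ?z
             - 2 * (w \<bullet> (M (fst ?z) *v snd ?z)) * A' ?z p) / (A ?z * A ?z))
           - 2 * m * ((dird (fst p) b (fst ?z) \<bullet> w * \<beta> ?z - b (fst ?z) \<bullet> w * \<beta>' ?z p) / (\<beta> ?z * \<beta> ?z)))
         + L ?z * P ?z p * ((1 + m) * (2 * (w \<bullet> (M (fst ?z) *v snd ?z)) / A ?z) - 2 * m * (b (fst ?z) \<bullet> w / \<beta> ?z)))) (at ?z)"
        by (rule has_derivative_transform_within_open[OF d3 S y1 e1])
      have s1: "2 * (w \<bullet> (?M *v y1)) / \<alpha> * (1 + m) - 2 * m * (?b \<bullet> w / be) = 0"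
        unfolding wMy bw using ab by (simp add: field_simps)
      have s2: "(1 + m) * ((2 * (w \<bullet> (?M *v v)) * \<alpha> - 2 * (w \<bullet> (?M *v y1)) * (2 * (v \<bullet> (?M *v y1)))) / (\<alpha> * \<alpha>))
         + 2 * m * ((?b \<bullet> w) * (?b \<bullet> v) / (be * be)) = 0"
      proof -
        define X where "X = ?b \<bullet> v"
        define Y where "Y = v \<bullet> (?M *v y1)"
        have "(1 + m) * ((2 * (X - ((1 + m) * be / \<alpha>) * Y) * \<alpha> - 2 * (- m * be) * (2 * Y)) / (\<alpha> * \<alpha>))
           + 2 * m * ((- ((1 + m) * be * be / \<alpha>)) * X / (be * be))
           = 2 * ((1 + m) * (1 - m)) * (X * \<alpha> - be * Y) / (\<alpha> * \<alpha>)"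
          using ab by (simp add: field_simps power2_eq_square)
        then show ?thesis unfolding wM[of v] wMy bw X_def[symmetric] Y_def[symmetric] mm by simp
      qed
      have "dird (0, v) (dird (0, w) L) ?z = L ?z * ((1 + m) * ((2 * (w \<bullet> (?M *v v)) * \<alpha> - 2 * (w \<bullet> (?M *v y1)) * (2 * (v \<bullet> (?M *v y1)))) / (\<alpha> * \<alpha>))
         + 2 * m * ((?b \<bullet> w) * (?b \<bullet> v) / (be * be)))
         + L ?z * P ?z (0, v) * (2 * (w \<bullet> (?M *v y1)) / \<alpha> * (1 + m) - 2 * m * (?b \<bullet> w / be))"
        using dird_has_derivative[OF d4, of "(0, v)"] A'0[OF y1, of v] \<beta>'0[OF y1, of v]
        by (simp add: lin0[OF x0] \<alpha>_def be_def algebra_simps)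
      then show ?thesis unfolding s1 s2 by simp
    qed
    have "fundamental_tensor f ?z *v w = 0"
    proof -
      have "v \<bullet> (fundamental_tensor f ?z *v w) = 0" for v
        using fundamental_tensor_bilinear[OF S sL[unfolded L_def[abs_def]] y1, of v w] D2[of v] by (simp add: L_def[abs_def])
      then show ?thesis using inner_eq_zero_iff by blast
    qed
    then have "matrix_inv (fundamental_tensor f ?z) *v (fundamental_tensor f ?z *v w) = 0" by simp
    then have w0: "w = 0"
      using inv[of ?z] y1 SK by (auto simp: matrix_vector_mul_assoc matrix_inv_mult(2))
    then have "(1 + m) * be * be / \<alpha> = 0" using bw by simp
    then have "1 + m = 0" using ab by simp
    then have "?\<xi> = 0" using w0 by (simp add: w_def)
    then show False using M\<xi> b0[OF x0] by simp
  qed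
  let ?V = "{y. (x0, y) \<in> S}"
  have oV: "open ?V"
  proof -
    have "open ((\<lambda>y. (x0, y)) -` S)" by (intro open_vimage S continuous_intros)
    then show ?thesis by (simp add: vimage_def)
  qed
  have "\<exists>c. dird w b x0 - transpose (gm (G x0) w) *v ?b = c *\<^sub>R ?b \<and>
      dird w M x0 - (transpose (gm (G x0) w) ** ?M + ?M ** gm (G x0) w) = (2 * m * c / (1 + m)) *\<^sub>R ?M" for w
  proof -
    let ?\<Gamma> = "gm (G x0) w"
    let ?e = "dird w b x0 - transpose ?\<Gamma> *v ?b" and ?q = "dird w M x0 - (transpose ?\<Gamma> ** ?M + ?M ** ?\<Gamma>)"
    have sq: "transpose ?q = ?q"
    proof -
      have "transpose (X - (Y + Z)) = transpose X - (transpose Y + transpose Z)" for X Y Z :: "real ^ 'n ^ 'n"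
        by (simp add: transpose_def vec_eq_iff)
      then show ?thesis
        using dird_sym_matrix[OF D x0 sym smooth_on_differentiable[OF sM x0], of w]
        by (simp add: matrix_transpose_mul sym[OF x0] add.commute)
    qed
    have "(1 + m) * (?b \<bullet> y) * (y \<bullet> (?q *v y)) = (2 * m) * (y \<bullet> (?M *v y)) * (?e \<bullet> y)" if "y \<in> ?V" for y
    proof -
      have y: "(x0, y) \<in> S" using that by simp
      let ?z = "(x0, y)"
      define \<alpha> where "\<alpha> = A ?z"
      define be where "be = \<beta> ?z"
      have ab: "0 < \<alpha>" "be \<noteq> 0" using A0[OF y] \<beta>0[OF y] by (auto simp: \<alpha>_def be_def)
      have "L ?z * P ?z (w, 0) = L ?z * P ?z (0, ?\<Gamma> *v y)" using hor[OF y, of w] unfolding dirL[OF y] .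
      then have "P ?z (w, 0) = P ?z (0, ?\<Gamma> *v y)" using Lpos[OF y] by simp
      then have "(1 + m) * (y \<bullet> (dird w M x0 *v y) / \<alpha>) - 2 * m * (dird w b x0 \<bullet> y / be)
          = (1 + m) * (2 * ((?\<Gamma> *v y) \<bullet> (?M *v y)) / \<alpha>) - 2 * m * (?b \<bullet> (?\<Gamma> *v y) / be)"
        unfolding P_def A'0[OF y] \<beta>'0[OF y] by (simp add: A'_def \<beta>'_def \<alpha>_def be_def)
      then have "(1 + m) * ((y \<bullet> (dird w M x0 *v y) - 2 * ((?\<Gamma> *v y) \<bullet> (?M *v y))) / \<alpha>)
          = 2 * m * ((dird w b x0 \<bullet> y - ?b \<bullet> (?\<Gamma> *v y)) / be)"
        by (simp add: diff_divide_distrib algebra_simps)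
      then have h: "(1 + m) * be * (y \<bullet> (dird w M x0 *v y) - 2 * ((?\<Gamma> *v y) \<bullet> (?M *v y)))
          = 2 * m * \<alpha> * (dird w b x0 \<bullet> y - ?b \<bullet> (?\<Gamma> *v y))"
        using ab by (simp add: field_simps)
      have "y \<bullet> (?q *v y) = y \<bullet> (dird w M x0 *v y) - 2 * ((?\<Gamma> *v y) \<bullet> (?M *v y))"
      proof -
        have "y \<bullet> (?M *v (?\<Gamma> *v y)) = (?\<Gamma> *v y) \<bullet> (?M *v y)" by (rule symmetric_inner[OF sym[OF x0]])
        moreover have "y \<bullet> ((transpose ?\<Gamma> ** ?M) *v y) = (?\<Gamma> *v y) \<bullet> (?M *v y)"
          by (simp only: matrix_vector_mul_assoc[symmetric] inner_transpose)
        moreover have "y \<bullet> ((?M ** ?\<Gamma>) *v y) = y \<bullet> (?M *v (?\<Gamma> *v y))"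
          by (simp only: matrix_vector_mul_assoc[symmetric])
        ultimately show ?thesis
          by (simp only: matrix_vector_mult_diff_rdistrib matrix_vector_mult_add_rdistrib inner_diff_right inner_add_right)
      qed
      moreover have "?e \<bullet> y = dird w b x0 \<bullet> y - ?b \<bullet> (?\<Gamma> *v y)"
      proof -
        have "(transpose ?\<Gamma> *v ?b) \<bullet> y = ?b \<bullet> (?\<Gamma> *v y)"
          using inner_transpose[of y ?\<Gamma> ?b] by (simp only: inner_commute)
        then show ?thesis by (simp only: inner_diff_left)
      qed
      ultimately show ?thesis using h by (simp add: \<alpha>_def be_def A_def \<beta>_def)
    qed
    note id = this
    have ne: "?V \<noteq> {}" "1 + m \<noteq> 0" "2 * m \<noteq> 0" using y1 mm m by auto
    obtain c where "?e = c *\<^sub>R ?b" "?q = (2 * m * c / (1 + m)) *\<^sub>R ?M"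
      by (rule proportional_of_cubic_identity[OF n sym[OF x0] sq I[OF x0] b0[OF x0] oV ne id])
    then show ?thesis by blast
  qed
  then obtain c where c1: "\<And>w. dird w b x0 - transpose (gm (G x0) w) *v ?b = c w *\<^sub>R ?b"
    and c2: "\<And>w. dird w M x0 - (transpose (gm (G x0) w) ** ?M + ?M ** gm (G x0) w) = (2 * m * c w / (1 + m)) *\<^sub>R ?M"
    by metis
  have c1': "dird w b x0 \<bullet> y = ?b \<bullet> (gm (G x0) w *v y) + c w * (?b \<bullet> y)" for w y
  proof -
    have "(transpose (gm (G x0) w) *v ?b) \<bullet> y = ?b \<bullet> (gm (G x0) w *v y)"
      using inner_transpose[of y "gm (G x0) w" ?b] by (simp only: inner_commute)
    then show ?thesis
      using arg_cong[OF c1[of w], of "\<lambda>u. u \<bullet> y"] by (simp only: inner_diff_left inner_scaleR_left diff_eq_eq add.commute)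
  qed
  \<comment> \<open>Symmetry gives \<open>c w (b \<bullet> y) = c y (b \<bullet> w)\<close>; take \<open>y = b\<close>, for which \<open>b \<bullet> y \<noteq> 0\<close>.\<close>
  define \<kappa> where "\<kappa> = c ?b / (?b \<bullet> ?b)"
  have cw: "c w = \<kappa> * (?b \<bullet> w)" for w
  proof -
    have "c w * (?b \<bullet> ?b) = c ?b * (?b \<bullet> w)"
    proof -
      have "?b \<bullet> (gm (G x0) w *v ?b) = ?b \<bullet> (gm (G x0) ?b *v w)"
        by (simp only: gm_sym[OF Gs[OF y1], where w = w and y = ?b])
      then show ?thesis using closed[OF x0, of w ?b] unfolding c1' by linarith
    qed
    then show ?thesis using b0[OF x0] by (simp add: \<kappa>_def field_simps)
  qed
  have "weyl_at (G x0) M (\<lambda>w. 2 * m / (1 + m) * \<kappa> * (?b \<bullet> w)) x0"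
    unfolding weyl_at_def
  proof (intro allI)
    fix w y z
    have "dird w M x0 = transpose (gm (G x0) w) ** ?M + ?M ** gm (G x0) w + (2 * m * c w / (1 + m)) *\<^sub>R ?M"
      using c2[of w] by (simp only: diff_eq_eq add.commute)
    moreover have "y \<bullet> ((transpose (gm (G x0) w) ** ?M) *v z) = (gm (G x0) w *v y) \<bullet> (?M *v z)"
      by (simp only: matrix_vector_mul_assoc[symmetric] inner_transpose)
    ultimately show "y \<bullet> (dird w M x0 *v z) = (gm (G x0) w *v y) \<bullet> (?M *v z) + y \<bullet> (?M *v (gm (G x0) w *v z))
        + 2 * m / (1 + m) * \<kappa> * (?b \<bullet> w) * (y \<bullet> (?M *v z))"
      by (simp add: matrix_vector_mult_add_rdistrib inner_add_right matrix_vector_mul_assoc scaleR_matrix_vector_assoc[symmetric] cw del: transpose_matrix_vector)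
  qed
  then show ?thesis
    using mm Gs[OF y1] c1' cw by (auto simp: mult.assoc)
qed

section \<open>Rectifying a closed null form\<close>

lemma dird_expand:
  fixes f :: "real ^ 'n \<Rightarrow> 'b::real_normed_vector"
  assumes d: "f differentiable (at x)"
  shows "dird w f x = (\<Sum>i\<in>UNIV. (w $ i) *\<^sub>R dird (axis i 1) f x)"
proof -
  have "dird w f x = dird (\<Sum>i\<in>UNIV. (w $ i) *\<^sub>R axis i 1) f x"
    by (simp add: basis_expansion[of w, unfolded scalar_mult_eq_scaleR])
  also have "\<dots> = (\<Sum>i\<in>UNIV. (w $ i) *\<^sub>R dird (axis i 1) f x)"
    using linear_sum[OF dird_linear[OF d], of "\<lambda>i. (w $ i) *\<^sub>R axis i 1" UNIV] linear_cmul[OF dird_linear[OF d]] by simp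
  finally show ?thesis .
qed

lemma closed_form_vector:
  fixes b :: "real ^ 'n \<Rightarrow> real ^ 'n"
  assumes d: "b differentiable (at x)" and c: "\<And>i j. partial i (\<lambda>z. b z $ j) x = partial j (\<lambda>z. b z $ i) x"
  shows "dird w b x \<bullet> y = dird y b x \<bullet> w"
proof -
  have e: "dird (axis i 1) b x $ j = dird (axis j 1) b x $ i" for i j
    using c[of i j] by (simp add: partial_def dird_component[OF d])
  have ex: "dird w b x = (\<Sum>i\<in>UNIV. (w $ i) *\<^sub>R dird (axis i 1) b x)" for w
  proof -
    have "dird w b x = dird (\<Sum>i\<in>UNIV. (w $ i) *\<^sub>R axis i 1) b x"
      by (simp add: basis_expansion[of w, unfolded scalar_mult_eq_scaleR])
    also have "\<dots> = (\<Sum>i\<in>UNIV. (w $ i) *\<^sub>R dird (axis i 1) b x)"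
      using linear_sum[OF dird_linear[OF d], of "\<lambda>i. (w $ i) *\<^sub>R axis i 1" UNIV] linear_cmul[OF dird_linear[OF d]] by simp
    finally show ?thesis .
  qed
  have s: "dird w b x \<bullet> y = (\<Sum>j\<in>UNIV. \<Sum>i\<in>UNIV. w $ i * y $ j * dird (axis i 1) b x $ j)" for w y
    by (subst ex) (simp add: inner_vec_def sum_distrib_left mult_ac)
  show ?thesis unfolding s by (subst sum.swap) (simp add: e mult_ac)
qed

lemma open_coordinate_image:
  fixes U :: "(real ^ 'n) set"
  assumes "open U"
  shows "open ((\<lambda>x. x $ u) ` U)"
proof (rule open_surjective_linear_image[OF assms])
  show "linear (\<lambda>x :: real ^ 'n. x $ u)" by (rule bounded_linear.linear[OF bounded_linear_vec_nth])
  show "surj (\<lambda>x :: real ^ 'n. x $ u)"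
  proof (rule surjI)
    fix t show "(t *\<^sub>R axis u 1 :: real ^ 'n) $ u = t" by simp
  qed
qed

text \<open>The matrix of the adapted form of the metric, entry by entry. Extending \<open>W\<close> and \<open>h\<close> by zero
  avoids a case distinction over the position of the indices.\<close>

lemma adapted_matrix_entry:
  fixes h :: "'n::finite \<Rightarrow> 'n \<Rightarrow> real" and W :: "'n \<Rightarrow> real" and u v :: 'n
  defines "W' \<equiv> \<lambda>q. if q \<in> {u, v} then 0 else W q"
    and "h' \<equiv> \<lambda>p q. if p \<in> {u, v} \<or> q \<in> {u, v} then 0 else h p q"
  shows "((- 2) *\<^sub>R sym_prod (axis u 1) (axis v 1) + H *\<^sub>R sym_prod (axis u 1) (axis u 1)
      + (\<Sum>i\<in>- {u, v}. W i *\<^sub>R sym_prod (axis u 1) (axis i 1))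
      + (\<Sum>i\<in>- {u, v}. \<Sum>j\<in>- {u, v}. h i j *\<^sub>R sym_prod (axis i 1) (axis j 1)) :: real ^ 'n ^ 'n) $ p $ q
    = - (of_bool (p = u \<and> q = v) + of_bool (p = v \<and> q = u)) + H * of_bool (p = u \<and> q = u)
      + 1/2 * (of_bool (p = u) * W' q + of_bool (q = u) * W' p) + 1/2 * (h' p q + h' q p)"
proof -
  have s: "(sym_prod e f :: real ^ 'n ^ 'n) $ p $ q = 1/2 * (e $ p * f $ q + f $ p * e $ q)" for e f
    by (simp add: sym_prod_def)
  have a: "(axis i 1 :: real ^ 'n) $ p = of_bool (p = i)" for i p by (simp add: axis_def)
  have d: "(\<Sum>i\<in>- {u, v}. f i * of_bool (r = i)) = (if r \<in> {u, v} then 0 else f r)" for f :: "'n \<Rightarrow> real" and r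
  proof -
    have "(\<Sum>i\<in>- {u, v}. f i * of_bool (r = i)) = (\<Sum>i\<in>- {u, v}. if r = i then f i else 0)"
      by (rule sum.cong) auto
    then show ?thesis by simp
  qed
  have w: "(\<Sum>i\<in>- {u, v}. W i *\<^sub>R sym_prod (axis u 1) (axis i 1) :: real ^ 'n ^ 'n) $ p $ q
      = 1/2 * (of_bool (p = u) * W' q + of_bool (q = u) * W' p)"
  proof -
    have "(\<Sum>i\<in>- {u, v}. W i *\<^sub>R sym_prod (axis u 1) (axis i 1) :: real ^ 'n ^ 'n) $ p $ q
      = (\<Sum>i\<in>- {u, v}. 1/2 * (of_bool (p = u) * (W i * of_bool (q = i)) + of_bool (q = u) * (W i * of_bool (p = i))))"
      unfolding sum_component vector_scaleR_component s a by (rule sum.cong[OF refl]) (simp only: real_scaleR_def, algebra)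
    also have "\<dots> = 1/2 * (of_bool (p = u) * (\<Sum>i\<in>- {u, v}. W i * of_bool (q = i)) + of_bool (q = u) * (\<Sum>i\<in>- {u, v}. W i * of_bool (p = i)))"
      by (simp only: sum_distrib_left[symmetric] sum.distrib)
    finally have "(\<Sum>i\<in>- {u, v}. W i *\<^sub>R sym_prod (axis u 1) (axis i 1) :: real ^ 'n ^ 'n) $ p $ q
      = 1/2 * (of_bool (p = u) * (\<Sum>i\<in>- {u, v}. W i * of_bool (q = i)) + of_bool (q = u) * (\<Sum>i\<in>- {u, v}. W i * of_bool (p = i)))" .
    then show ?thesis by (simp only: d W'_def)
  qed
  have h: "(\<Sum>i\<in>- {u, v}. \<Sum>j\<in>- {u, v}. h i j *\<^sub>R sym_prod (axis i 1) (axis j 1) :: real ^ 'n ^ 'n) $ p $ q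
      = 1/2 * (h' p q + h' q p)"
  proof -
    have "(\<Sum>i\<in>- {u, v}. \<Sum>j\<in>- {u, v}. h i j *\<^sub>R sym_prod (axis i 1) (axis j 1) :: real ^ 'n ^ 'n) $ p $ q
      = (\<Sum>i\<in>- {u, v}. \<Sum>j\<in>- {u, v}. 1/2 * ((h i j * of_bool (q = j)) * of_bool (p = i) + (h i j * of_bool (p = j)) * of_bool (q = i)))"
      unfolding sum_component vector_scaleR_component s a
      by (intro sum.cong[OF refl]) (simp only: real_scaleR_def, algebra)
    also have "\<dots> = 1/2 * ((\<Sum>i\<in>- {u, v}. (\<Sum>j\<in>- {u, v}. h i j * of_bool (q = j)) * of_bool (p = i))
        + (\<Sum>i\<in>- {u, v}. (\<Sum>j\<in>- {u, v}. h i j * of_bool (p = j)) * of_bool (q = i)))"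
      by (simp only: sum_distrib_left[symmetric] sum_distrib_right[symmetric] sum.distrib)
    also have "\<dots> = 1/2 * (h' p q + h' q p)"
      unfolding d h'_def by auto
    finally show ?thesis .
  qed
  show ?thesis
    unfolding vector_add_component w h by (simp add: s a)
qed

text \<open>A factor \<open>E\<close> with logarithmic derivative \<open>\<eta>\<close> adds \<open>\<eta>\<close> to the Weyl form.\<close>

lemma weyl_rescaled:
  assumes W: "weyl_at g M (\<lambda>w. - \<eta> w) x" and A: "dird w A x = E *\<^sub>R dird w M x + (E * \<eta> w) *\<^sub>R M x" "A x = E *\<^sub>R M x"
  shows "y \<bullet> (dird w A x *v z) = (gm g w *v y) \<bullet> (A x *v z) + y \<bullet> (A x *v (gm g w *v z)) + 0 * (y \<bullet> (A x *v z))"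
proof -
  have "y \<bullet> (dird w M x *v z) = (gm g w *v y) \<bullet> (M x *v z) + y \<bullet> (M x *v (gm g w *v z)) - \<eta> w * (y \<bullet> (M x *v z))"
    using W by (simp add: weyl_at_def)
  note D = this
  show ?thesis unfolding A
    by (simp add: matrix_vector_mult_add_rdistrib scaleR_matrix_vector_assoc[symmetric] matrix_vector_mult_scaleR inner_add_right D)
       (simp add: algebra_simps)
qed

lemma transition_surj:
  assumes mf: "smooth_manifold X \<A>" and c: "c \<in> \<A>" "c' \<in> \<A>" and p: "p \<in> cdom c" "p \<in> cdom c'"
  shows "\<exists>y. dird y (transition c c') (coord c p) = w"
  using transition_chain[OF mf c(2,1,2) p(2,1,2), of w] transition_self[OF mf c(2) p(2), of w] by metis

text \<open>A potential \<open>f\<close> of \<open>b\<close> replaces a coordinate \<open>j\<close> with \<open>b\<^sub>j \<noteq> 0\<close>, which keeps the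
  coordinates independent. If \<open>j \<noteq> u\<close>, the old coordinate \<open>u\<close> moves to the position \<open>j\<close>, as \<open>f\<close>
  takes the position \<open>u\<close>.\<close>

lemma chart_with_exact_form:
  fixes \<A> :: "('p, 'n::finite) chart set"
  assumes mf: "smooth_manifold X \<A>" and ob: "one_form X \<A> b" and c: "c \<in> \<A>" and p: "p \<in> cdom c"
    and sb: "smooth_on (crange c) (form_comp \<A> b c)"
    and cl: "\<And>x v w. x \<in> crange c \<Longrightarrow> dird v (form_comp \<A> b c) x \<bullet> w = dird w (form_comp \<A> b c) x \<bullet> v"
    and nz: "form_comp \<A> b c (coord c p) \<noteq> 0"
  obtains c1 where "c1 \<in> \<A>" "p \<in> cdom c1" "\<And>z. z \<in> crange c1 \<Longrightarrow> form_comp \<A> b c1 z = axis u 1"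
proof -
  let ?x = "coord c p"
  have xr: "?x \<in> crange c" using p by simp
  obtain r where r: "0 < r" "ball ?x r \<subseteq> crange c"
    using chart_open_range[OF atlas_chart[OF mf c]] xr open_contains_ball by blast
  let ?B = "ball ?x r"
  obtain f where f: "smooth_on ?B f" "\<And>x v. x \<in> ?B \<Longrightarrow> (f has_derivative (\<lambda>v. form_comp \<A> b c x \<bullet> v)) (at x)"
    by (rule closed_form_potential[OF r(1) smooth_on_subset[OF sb r(2)]]) (use cl r(2) in blast)+
  obtain j where j: "form_comp \<A> b c ?x $ j \<noteq> 0" using nz by (auto simp: vec_eq_iff)
  define E where "E x = (\<chi> i. if i = u then f x else if i = j then x $ u else x $ i)" for x
  have sE: "smooth_on ?B E"
  proof (rule smooth_on_vec[OF open_ball])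
    fix i
    have n: "smooth_on ?B (\<lambda>x. x $ k)" for k
      by (rule smooth_on_bounded_linear[OF open_ball bounded_linear_vec_nth])
    show "smooth_on ?B (\<lambda>x. E x $ i)" by (cases "i = u"; cases "i = j") (simp_all add: E_def f(1) n)
  qed
  have DE: "dird w E x $ i = (if i = u then form_comp \<A> b c x \<bullet> w else if i = j then w $ u else w $ i)" if x: "x \<in> ?B" for x w i
  proof -
    have "dird w E x $ i = dird w (\<lambda>x. E x $ i) x"
      by (rule dird_component[OF smooth_on_differentiable[OF sE x], symmetric])
    also have "\<dots> = (if i = u then form_comp \<A> b c x \<bullet> w else if i = j then w $ u else w $ i)"
      using dird_has_derivative[OF f(2)[OF x], of w]
        dird_has_derivative[OF bounded_linear_imp_has_derivative[OF bounded_linear_vec_nth], of w _ x]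
      by (simp add: E_def)
    finally show ?thesis .
  qed
  have xB: "?x \<in> ?B" using r(1) by simp
  have inj: "w = 0" if "dird w E ?x = 0" for w
  proof -
    have z: "(if i = u then form_comp \<A> b c ?x \<bullet> w else if i = j then w $ u else w $ i) = 0" for i
      using DE[OF xB, of w i] that by simp
    have other: "w $ i = 0" if "i \<noteq> j" for i
    proof (cases "i = u")
      case True then show ?thesis using z[of j] that by simp
    next
      case False then show ?thesis using z[of i] that by simp
    qed
    have "form_comp \<A> b c ?x \<bullet> w = (\<Sum>i\<in>UNIV. if i = j then form_comp \<A> b c ?x $ j * w $ j else 0)"
      unfolding inner_vec_def by (rule sum.cong) (auto simp: other)
    then have "form_comp \<A> b c ?x $ j * w $ j = 0" using z[of u] by simp
    then have "w $ j = 0" using j by simp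
    then show ?thesis using other by (metis vec_eq_iff zero_index)
  qed
  obtain U V g where g: "open U" "?x \<in> U" "U \<subseteq> ?B" "open V" "E ` U = V"
    "\<And>x. x \<in> U \<Longrightarrow> g (E x) = x" "\<And>y. y \<in> V \<Longrightarrow> g y \<in> U \<and> E (g y) = y" "smooth_on V g"
    by (rule smooth_local_inverse[OF open_ball xB sE inj]) (assumption | rule that)+
  let ?c = "({p \<in> cdom c. coord c p \<in> U}, E \<circ> coord c)"
  note nc = new_chart[OF mf c g(1) order_trans[OF g(3) r(2)] smooth_on_subset[OF sE g(3)]
      g(4)[folded g(5)] g(6) g(8)[folded g(5)]]
  show ?thesis
  proof (rule that[of ?c])
    show "?c \<in> \<A>" by (rule nc(1))
    show "p \<in> cdom ?c" using p g(2) by simp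
    fix z assume "z \<in> crange ?c"
    then obtain q where q: "q \<in> cdom c" "coord c q \<in> U" "z = E (coord c q)" by auto
    have q': "q \<in> cdom ?c" "coord ?c q = z" using q by simp_all
    have tE: "dird y (transition c ?c) (coord c q) = dird y E (coord c q)" for y
    proof (rule dird_cong[OF g(1) q(2)])
      fix x assume "x \<in> U"
      then have "x \<in> crange c" using g(3) r(2) by blast
      then show "transition c ?c x = E x" by (simp add: transition_def coord_cinv)
    qed
    have "form_comp \<A> b ?c z \<bullet> w = axis u 1 \<bullet> w" for w
    proof -
      obtain y where y: "dird y (transition c ?c) (coord c q) = w"
        using transition_surj[OF mf c nc(1) q(1) q'(1)] by blast
      have "form_comp \<A> b c (coord c q) \<bullet> y = form_comp \<A> b ?c z \<bullet> w"
        using form_comp_change[OF mf ob c nc(1) q(1) q'(1), of y] unfolding y q'(2) .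
      moreover have "w $ u = form_comp \<A> b c (coord c q) \<bullet> y"
        using DE[of "coord c q" y u] q(2) g(3) y unfolding tE by auto
      ultimately show ?thesis by (simp add: inner_axis')
    qed
    then show "form_comp \<A> b ?c z = axis u 1" by (rule vector_eq_rdot[THEN iffD1, OF allI])
  qed
qed

text \<open>The new coordinates follow the flow of \<open>\<xi> = - b\<^sup>\<sharp>\<close>, with \<open>v\<close> as time. As \<open>b\<close> is null, the
  flow preserves the coordinate \<open>u\<close>, so that \<open>b\<close> remains \<open>du\<close> (up to a shift of \<open>u\<close>), and
  \<open>a(\<xi>, -) = - b\<close> becomes the statement on the column \<open>v\<close> of the metric.\<close>

lemma chart_along_flow:
  fixes \<A> :: "('p, 'n::finite) chart set"
  assumes mf: "smooth_manifold X \<A>" and ob: "one_form X \<A> b" and pa: "pseudo_riemannian_on \<A> (topspace X) a"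
    and c: "c \<in> \<A>" and p: "p \<in> cdom c" and uv: "u \<noteq> v"
    and sM: "smooth_on (crange c) (metric_comp \<A> a c)"
    and I: "\<And>x. x \<in> crange c \<Longrightarrow> invertible (metric_comp \<A> a c x)"
    and bu: "\<And>x. x \<in> crange c \<Longrightarrow> form_comp \<A> b c x = axis u 1"
    and null: "\<And>x. x \<in> crange c \<Longrightarrow> form_comp \<A> b c x \<bullet> (matrix_inv (metric_comp \<A> a c x) *v form_comp \<A> b c x) = 0"
  obtains c1 r where "c1 \<in> \<A>" "p \<in> cdom c1" "0 < r" "crange c1 = ball 0 r"
    "\<And>z. z \<in> ball 0 r \<Longrightarrow> form_comp \<A> b c1 z = axis u 1"
    "\<And>z. z \<in> ball 0 r \<Longrightarrow> metric_comp \<A> a c1 z *v axis v 1 = - axis u 1"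
proof -
  let ?x = "coord c p" and ?S = "crange c" and ?e = "axis v 1 :: real ^ 'n"
  have S: "open ?S" by (rule chart_open_range[OF atlas_chart[OF mf c]])
  have xS: "?x \<in> ?S" using p by simp
  define \<xi> where "\<xi> x = - (matrix_inv (metric_comp \<A> a c x) *v axis u 1)" for x
  have s\<xi>: "smooth_on ?S \<xi>" unfolding \<xi>_def[abs_def]
    by (intro smooth_on_uminus[OF S] smooth_on_bilinear[OF S bounded_bilinear_matrix_vector_mult]
        smooth_on_matrix_inv[OF S sM I] smooth_on_const[OF S])
  have M\<xi>: "metric_comp \<A> a c x *v \<xi> x = - axis u 1" if "x \<in> ?S" for x
    unfolding \<xi>_def using matrix_inv_mult(1)[OF I[OF that]]
    by (simp add: matrix_vector_mul_assoc bounded_bilinear.minus_right[OF bounded_bilinear_matrix_vector_mult])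
  have \<xi>u: "\<xi> x $ u = 0" if "x \<in> ?S" for x
    using null[OF that] by (simp add: bu[OF that] \<xi>_def inner_axis')
  have "\<xi> ?x \<noteq> 0" using M\<xi>[OF xS] by (auto simp: axis_eq_0_iff)
  then obtain j where j: "\<xi> ?x $ j \<noteq> 0" by (auto simp: vec_eq_iff)
  have ju: "j \<noteq> u" using j \<xi>u[OF xS] by auto
  \<comment> \<open>The initial values form the coordinate hyperplane through the point that omits a direction
    \<open>j\<close> with \<open>\<xi>\<^sub>j \<noteq> 0\<close> and is therefore transverse to \<open>\<xi>\<close>. The name \<open>j\<close> of the unused coordinate
    takes the value of the old coordinate \<open>v\<close>, since \<open>v\<close> is now the time. Note that \<open>j \<noteq> u\<close>, so
    \<open>u\<close> is kept.\<close>
  define L where "L z = (\<chi> i. if i = j then 0 else if i = v then z $ j else z $ i)" for z :: "real ^ 'n"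
  have "linear L" by (rule linearI) (simp_all add: L_def vec_eq_iff)
  then have L: "bounded_linear L" by (simp only: linear_conv_bounded_linear)
  have e: "?e \<bullet> ?e = 1" by (simp add: inner_axis_axis)
  obtain G R where R: "0 < R" and sG: "smooth_on (ball 0 R) G" and GS: "\<And>z. z \<in> ball 0 R \<Longrightarrow> G z \<in> ?S"
    and G\<xi>: "\<And>z. z \<in> ball 0 R \<Longrightarrow> dird ?e G z = \<xi> (G z)"
    and G0: "\<And>z. z \<in> ball 0 R \<Longrightarrow> z \<bullet> ?e = 0 \<Longrightarrow> G z = ?x + L z"
    by (rule flow[OF e S xS s\<xi> L]) (rule that)
  have B0: "0 \<in> ball 0 R" using R by simp
  have L0: "L 0 = 0" by (simp add: L_def vec_eq_iff)
  have G00: "G 0 = ?x" using G0[OF B0] by (simp add: L0)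
  note dG = smooth_on_differentiable[OF sG]
  have DG0: "dird w G 0 = L w" if w: "w \<bullet> ?e = 0" for w
  proof -
    have line: "((\<lambda>t. t *\<^sub>R w) has_derivative (\<lambda>t. t *\<^sub>R w)) (at 0)"
      by (auto intro!: derivative_eq_intros)
    have "(G has_derivative (\<lambda>w. dird w G 0)) (at (0 *\<^sub>R w))"
      using differentiable_has_derivative_dird[OF dG[OF B0]] by simp
    from has_derivative_compose[OF line this]
    have 1: "((\<lambda>t. G (t *\<^sub>R w)) has_derivative (\<lambda>t. dird (t *\<^sub>R w) G 0)) (at 0)" .
    let ?T = "(\<lambda>t. t *\<^sub>R w) -` ball 0 R"
    have oT: "open ?T" by (intro open_vimage open_ball continuous_intros)
    have "((\<lambda>t. ?x + t *\<^sub>R L w) has_derivative (\<lambda>t. t *\<^sub>R L w)) (at 0)"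
      by (auto intro!: derivative_eq_intros)
    then have 2: "((\<lambda>t. G (t *\<^sub>R w)) has_derivative (\<lambda>t. t *\<^sub>R L w)) (at 0)"
    proof (rule has_derivative_transform_within_open[OF _ oT])
      show "0 \<in> ?T" using R by simp
      fix t assume "t \<in> ?T"
      then have "t *\<^sub>R w \<in> ball 0 R" by simp
      from G0[OF this] w show "?x + t *\<^sub>R L w = G (t *\<^sub>R w)"
        by (simp add: linear_cmul[OF \<open>linear L\<close>])
    qed
    from fun_cong[OF has_derivative_unique[OF 1 2], of 1] show ?thesis by simp
  qed
  have inj: "w = 0" if w0: "dird w G 0 = 0" for w
  proof -
    let ?w' = "w - (w $ v) *\<^sub>R ?e"
    have w': "?w' \<bullet> ?e = 0" by (simp add: inner_diff_left inner_axis_axis inner_axis)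
    note lin = dird_linear[OF dG[OF B0]]
    have "dird w G 0 = dird ?w' G 0 + (w $ v) *\<^sub>R dird ?e G 0"
      using linear_add[OF lin, of ?w' "(w $ v) *\<^sub>R ?e"] linear_cmul[OF lin, of "w $ v" ?e] by simp
    then have eq: "L ?w' + (w $ v) *\<^sub>R \<xi> ?x = 0" using w0 DG0[OF w'] G\<xi>[OF B0] G00 by simp
    have "(L ?w' + (w $ v) *\<^sub>R \<xi> ?x) $ j = w $ v * \<xi> ?x $ j" by (simp add: L_def)
    then have wv: "w $ v = 0" using eq j by simp
    then have "L w = 0" using eq by simp
    then have Lw: "(if i = j then 0 else if i = v then w $ j else w $ i) = 0" for i
      unfolding vec_eq_iff by (simp add: L_def)
    have "w $ i = 0" for i
    proof (cases "i = v")
      case False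
      show ?thesis
      proof (cases "i = j")
        case True then show ?thesis using Lw[of v] False by simp
      next
        case False': False
        then show ?thesis using Lw[of i] False by simp
      qed
    qed (use wv in simp)
    then show ?thesis by (simp add: vec_eq_iff)
  qed
  obtain U V g where g: "open U" "0 \<in> U" "U \<subseteq> ball 0 R" "open V" "G ` U = V"
    "\<And>x. x \<in> U \<Longrightarrow> g (G x) = x" "\<And>y. y \<in> V \<Longrightarrow> g y \<in> U \<and> G (g y) = y" "smooth_on V g"
    by (rule smooth_local_inverse[OF open_ball B0 sG inj]) (assumption | rule that)+
  obtain r where r: "0 < r" "ball 0 r \<subseteq> U" using g(1,2) open_contains_ball by blast
  let ?B = "ball 0 r :: (real ^ 'n) set"
  let ?V = "G ` ?B"
  have BR: "?B \<subseteq> ball 0 R" using r(2) g(3) by blast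
  have oV: "open ?V"
  proof -
    have "?V = V \<inter> g -` ?B"
    proof (intro equalityI subsetI)
      fix y assume "y \<in> ?V"
      then obtain x where x: "x \<in> ?B" "y = G x" by blast
      then have "x \<in> U" using r(2) by blast
      then show "y \<in> V \<inter> g -` ?B" using x g(5,6) by auto
    next
      fix y assume y: "y \<in> V \<inter> g -` ?B"
      then have "G (g y) = y" using g(7) by blast
      then show "y \<in> ?V" using y by (metis IntD2 image_eqI vimageE)
    qed
    then show ?thesis using continuous_open_preimage[OF smooth_on_continuous_on[OF g(8)] g(4) open_ball] by simp
  qed
  have VS: "?V \<subseteq> ?S" using GS BR by blast
  have gV: "g ` ?V = ?B"
  proof -
    have "g ` ?V = (\<lambda>x. g (G x)) ` ?B" by (simp add: image_image)
    also have "\<dots> = id ` ?B" by (rule image_cong[OF refl]) (use r(2) g(6) in auto)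
    finally show ?thesis by simp
  qed
  have VV: "?V \<subseteq> V" using r(2) g(5) by blast
  have Gg: "G (g y) = y" if "y \<in> ?V" for y using g(7) VV that by blast
  let ?c = "({p \<in> cdom c. coord c p \<in> ?V}, g \<circ> coord c)"
  have oB: "open (g ` ?V)" unfolding gV by (rule open_ball)
  have sG': "smooth_on (g ` ?V) G" unfolding gV by (rule smooth_on_subset[OF sG BR])
  note nc = new_chart[OF mf c oV VS smooth_on_subset[OF g(8) VV] oB Gg sG']
  define C where "C = ?c"
  have CA: "C \<in> \<A>" unfolding C_def by (rule nc(1))
  have crC: "crange C = ?B" unfolding C_def by (rule trans[OF nc(2) gV])
  have trC: "transition C c z = G z" if "z \<in> ?B" for z
    unfolding C_def by (rule nc(3)[unfolded gV, OF _ that])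
  have Cc: "q \<in> cdom c" if "q \<in> cdom C" for q using that by (simp add: C_def)
  have pC: "p \<in> cdom C" using p G00 r(1) by (auto simp: C_def intro!: image_eqI[of _ _ 0])
  have tG: "dird y (transition C c) z = dird y G z" if "z \<in> ?B" for y z
    by (rule dird_cong[OF open_ball that trC])
  have Gu: "G z $ u = z $ u + ?x $ u" if z: "z \<in> ?B" for z
  proof -
    let ?z' = "z - (z $ v) *\<^sub>R ?e"
    have lin': "?z' + s *\<^sub>R ((z $ v) *\<^sub>R ?e) \<in> ball 0 R" if s: "s \<in> {0..1}" for s
    proof -
      have "norm (?z' + s *\<^sub>R ((z $ v) *\<^sub>R ?e)) \<le> norm z"
      proof (rule norm_le_componentwise_cart)
        fix i
        have "\<bar>s\<bar> * \<bar>z $ v\<bar> \<le> 1 * \<bar>z $ v\<bar>" using s by (intro mult_right_mono) auto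
        then show "norm ((?z' + s *\<^sub>R ((z $ v) *\<^sub>R ?e)) $ i) \<le> norm (z $ i)"
          by (cases "i = v") (simp_all add: axis_def abs_mult)
      qed
      then show ?thesis using z BR by auto
    qed
    let ?h = "\<lambda>x. G x $ u"
    have hd: "?h differentiable (at x)" if "x \<in> ball 0 R" for x by (rule differentiable_component[OF dG[OF that]])
    have zr: "?z' \<in> ball 0 R" "?z' + (z $ v) *\<^sub>R ?e \<in> ball 0 R" using lin'[of 0] lin'[of 1] by simp_all
    have "((\<lambda>s. dird ((z $ v) *\<^sub>R ?e) ?h (?z' + s *\<^sub>R ((z $ v) *\<^sub>R ?e))) has_integral ?h (?z' + (z $ v) *\<^sub>R ?e) - ?h ?z') {0..1}"
      by (rule hadamard[OF convex_ball hd zr])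
    then have "((\<lambda>s. 0) has_integral ?h (?z' + (z $ v) *\<^sub>R ?e) - ?h ?z') {0..1::real}"
    proof (rule has_integral_eq[rotated])
      fix s :: real assume s: "s \<in> {0..1}"
      note q = lin'[OF s]
      have "dird ((z $ v) *\<^sub>R ?e) ?h (?z' + s *\<^sub>R ((z $ v) *\<^sub>R ?e)) = z $ v * \<xi> (G (?z' + s *\<^sub>R ((z $ v) *\<^sub>R ?e))) $ u"
        unfolding dird_component[OF dG[OF q]] linear_cmul[OF dird_linear[OF dG[OF q]]] G\<xi>[OF q] by simp
      then show "dird ((z $ v) *\<^sub>R ?e) ?h (?z' + s *\<^sub>R ((z $ v) *\<^sub>R ?e)) = 0"
        using \<xi>u[OF GS[OF q]] by simp
    qed
    then have "?h z = ?h ?z'" using has_integral_unique[OF has_integral_0] by fastforce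
    also have "\<dots> = z $ u + ?x $ u"
    proof -
      have "?z' \<bullet> ?e = 0" by (simp add: inner_diff_left inner_axis_axis inner_axis)
      from G0[OF zr(1) this] have "G ?z' = ?x + L ?z'" .
      moreover have "L ?z' $ u = z $ u" using uv ju by (simp add: L_def axis_def)
      ultimately show ?thesis by simp
    qed
    finally show ?thesis .
  qed
  have DGu: "dird w G z $ u = w $ u" if z: "z \<in> ?B" for w z
  proof -
    have "dird w G z $ u = dird w (\<lambda>x. G x $ u) z"
      by (rule dird_component[OF dG, symmetric]) (use z BR in blast)
    also have "\<dots> = dird w (\<lambda>x. x $ u + ?x $ u) z" by (rule dird_cong[OF open_ball z Gu])
    also have "\<dots> = w $ u"
      by (rule dird_has_derivative) (auto intro!: derivative_eq_intros bounded_linear_imp_has_derivative bounded_linear_vec_nth)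
    finally show ?thesis .
  qed
  have pt: "cinv C z \<in> cdom C \<and> coord C (cinv C z) = z \<and> cinv C z \<in> cdom c \<and> coord c (cinv C z) = G z
      \<and> cinv C z \<in> topspace X" if z: "z \<in> ?B" for z
  proof -
    have zr: "z \<in> crange C" using z by (simp only: crC)
    have q: "cinv C z \<in> cdom C" "coord C (cinv C z) = z" by (rule cinv_in[OF zr] coord_cinv[OF zr])+
    have "coord c (cinv C z) = transition C c z" by (simp add: transition_def)
    also have "\<dots> = G z" by (rule trC[OF z])
    finally show ?thesis using q Cc atlas_topspace[OF mf CA q(1)] by blast
  qed
  show ?thesis
  proof (rule that[OF CA pC r(1) crC])
    fix z :: "real ^ 'n" assume z: "z \<in> ball 0 r"
    from pt[OF z] have P: "cinv C z \<in> cdom C" "coord C (cinv C z) = z" "cinv C z \<in> cdom c"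
      "coord c (cinv C z) = G z" "cinv C z \<in> topspace X" by blast+
    have Gz: "G z \<in> ?S" using GS z BR by blast
    have "form_comp \<A> b C z \<bullet> w = axis u 1 \<bullet> w" for w
    proof -
      have "form_comp \<A> b C z \<bullet> w = form_comp \<A> b c (G z) \<bullet> dird w G z"
        using form_comp_change[OF mf ob CA c P(1,3), of w] unfolding P tG[OF z] .
      then show ?thesis by (simp add: bu[OF Gz] inner_axis' DGu[OF z])
    qed
    then show "form_comp \<A> b C z = axis u 1" by (rule vector_eq_rdot[THEN iffD1, OF allI])
    have "y \<bullet> (metric_comp \<A> a C z *v ?e) = y \<bullet> (- axis u 1)" for y
    proof -
      have "y \<bullet> (metric_comp \<A> a C z *v ?e) = dird y G z \<bullet> (metric_comp \<A> a c (G z) *v dird ?e G z)"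
        using metric_comp_change[OF mf pa CA c P(1,3,5), of y ?e] unfolding P tG[OF z] .
      also have "dird ?e G z = \<xi> (G z)" by (rule G\<xi>) (use z BR in blast)
      also have "dird y G z \<bullet> (metric_comp \<A> a c (G z) *v \<xi> (G z)) = - dird y G z $ u"
        unfolding M\<xi>[OF Gz] by (simp add: inner_axis)
      finally show ?thesis by (simp add: DGu[OF z] inner_axis)
    qed
    then show "metric_comp \<A> a C z *v ?e = - axis u 1" by (rule vector_eq_ldot[THEN iffD1, OF allI])
  qed
qed

section \<open>Berwald spaces of Kropina type with a closed null form\<close>

context
  fixes X :: "'p topology" and \<A> :: "('p, 'n::finite) chart set"
    and a :: "('p, 'n) metric" and b :: "('p, 'n) form" and m :: real
    and K :: "('p \<times> ('p, 'n) tvec) set" and F :: "'p \<times> ('p, 'n) tvec \<Rightarrow> real"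
    and \<Gamma> :: "('p, 'n) connection"
  assumes mf: "smooth_manifold X \<A>" and n: "CARD('n) > 2"
    and pa: "pseudo_riemannian_on \<A> (topspace X) a"
    and ob: "one_form X \<A> b" and nv: "nowhere_vanishing X \<A> b"
    and m0: "m \<noteq> 0"
    and kr: "kropina_space X \<A> a b m K F"
    and cl: "closed_form \<A> b" and nl: "null_form \<A> a b"
    and as: "associated_connection \<A> K F \<Gamma>"
begin

abbreviation "Mc c \<equiv> metric_comp \<A> a c"
abbreviation "bc c \<equiv> form_comp \<A> b c"

lemma dom_top: "c \<in> \<A> \<Longrightarrow> cdom c \<inter> topspace X = cdom c"
  using atlas_topspace[OF mf] by blast

lemma cr: "c \<in> \<A> \<Longrightarrow> x \<in> crange c \<Longrightarrow> cinv c x \<in> cdom c \<and> coord c (cinv c x) = x \<and> cinv c x \<in> topspace X"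
  using cinv_in[of x c] coord_cinv[of x c] atlas_topspace[OF mf] by blast

lemma metric_smooth:
  assumes "c \<in> \<A>"
  shows "smooth_on (crange c) (Mc c)"
proof (rule smooth_on_entries[OF chart_open_range[OF atlas_chart[OF mf assms]]])
  fix i j
  have "smooth_on (coord c ` (cdom c \<inter> topspace X)) (\<lambda>x. Mc c x $ i $ j)"
    using pa assms unfolding pseudo_riemannian_on_def by blast
  then show "smooth_on (crange c) (\<lambda>x. Mc c x $ i $ j)" by (simp only: dom_top[OF assms])
qed

lemma form_smooth:
  assumes "c \<in> \<A>"
  shows "smooth_on (crange c) (bc c)"
proof (rule smooth_on_vec[OF chart_open_range[OF atlas_chart[OF mf assms]]])
  fix i
  show "smooth_on (crange c) (\<lambda>x. bc c x $ i)" using ob assms unfolding one_form_def by blast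
qed

lemma metric_sym:
  assumes "c \<in> \<A>" "x \<in> crange c"
  shows "transpose (Mc c x) = Mc c x"
  using metric_comp_sym[OF mf pa assms(1), of "cinv c x"] cr[OF assms] by (simp add: transpose_def vec_eq_iff)

lemma metric_inv:
  assumes "c \<in> \<A>" "x \<in> crange c"
  shows "invertible (Mc c x)"
  using metric_comp_invertible[OF mf pa assms(1), of "cinv c x"] cr[OF assms] by simp

lemma form_nz:
  assumes "c \<in> \<A>" "x \<in> crange c"
  shows "bc c x \<noteq> 0"
proof -
  obtain w where w: "w \<in> tangent_space \<A> (cinv c x)" "b (cinv c x) w \<noteq> 0"
    using nv cr[OF assms] unfolding nowhere_vanishing_def by blast
  have "b (cinv c x) w = bc c x \<bullet> w c"
    using form_comp_eq[OF mf ob assms(1), of "cinv c x" "w c"] tvec_of_component[OF mf assms(1) _ w(1)] cr[OF assms] by simp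
  then show ?thesis using w(2) by auto
qed

lemma form_null:
  assumes "c \<in> \<A>" "x \<in> crange c"
  shows "bc c x \<bullet> (matrix_inv (Mc c x) *v bc c x) = 0"
proof -
  let ?b' = "matrix_inv (Mc c x) *v bc c x"
  have "(\<Sum>i\<in>UNIV. \<Sum>j\<in>UNIV. Mc c x $ i $ j * ?b' $ i * ?b' $ j) = 0"
    using nl assms unfolding null_form_def Let_def by blast
  then have "?b' \<bullet> (Mc c x *v ?b') = 0"
    by (simp add: inner_vec_def matrix_vector_mult_def[of "Mc c x"] sum_distrib_left mult_ac)
  moreover have "Mc c x *v ?b' = bc c x"
    by (simp add: matrix_vector_mul_assoc matrix_inv_mult(1)[OF metric_inv[OF assms]])
  ultimately show ?thesis by (simp add: inner_commute)
qed

lemma form_closed: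
  assumes "c \<in> \<A>" "x \<in> crange c"
  shows "dird w (bc c) x \<bullet> y = dird y (bc c) x \<bullet> w"
  by (rule closed_form_vector[OF smooth_on_differentiable[OF form_smooth[OF assms(1)] assms(2)]])
     (use cl assms in \<open>unfold closed_form_def, blast\<close>)

lemma connection_smooth: "c \<in> \<A> \<Longrightarrow> smooth_on (crange c) (\<lambda>x. \<Gamma> c x i j k)"
  using as unfolding associated_connection_def by blast

lemma finsler: "finsler_space X \<A> K F"
  using kr by (simp add: kropina_space_def)

text \<open>The identity at a point needs a direction over this point in which \<open>F\<close> is given by the
  formula; there is one because the conic subbundle has non-empty fibers.\<close>

lemma chart_weyl:
  assumes c: "c \<in> \<A>" and x: "x \<in> crange c"
  shows "m \<noteq> 1 \<and> m \<noteq> -1 \<and> (\<forall>i j k. \<Gamma> c x i j k = \<Gamma> c x i k j) \<and>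
    (\<exists>\<kappa>. weyl_at (\<Gamma> c x) (Mc c) (\<lambda>w. 2 * m / (1 + m) * \<kappa> * (bc c x \<bullet> w)) x \<and>
       (\<forall>w y. dird w (bc c) x \<bullet> y = bc c x \<bullet> (gm (\<Gamma> c x) w *v y) + \<kappa> * (bc c x \<bullet> w) * (bc c x \<bullet> y)))"
proof -
  have Ksub: "K \<subseteq> slit_tangent_bundle X \<A>" and Kopen: "open (tset_in \<A> K c)"
    using finsler c unfolding finsler_space_def conic_subbundle_def by blast+
  obtain w where w: "(cinv c x, w) \<in> K"
    using finsler cr[OF c x] unfolding finsler_space_def by blast
  have wt: "w \<in> tangent_space \<A> (cinv c x)"
    using subsetD[OF Ksub w] by (simp add: slit_tangent_bundle_def)
  have z0: "(x, w c) \<in> tset_in \<A> K c"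
    using w x tvec_of_component[OF mf c _ wt] cr[OF c x] by (simp add: tset_in_def tpoint_def)
  have pt: "x \<in> crange c" "(cinv c x, tvec_of \<A> c (cinv c x) y) \<in> K"
     "a (cinv c x) (tvec_of \<A> c (cinv c x) y) (tvec_of \<A> c (cinv c x) y) = y \<bullet> (Mc c x *v y)"
     "b (cinv c x) (tvec_of \<A> c (cinv c x) y) = bc c x \<bullet> y" if "(x, y) \<in> tset_in \<A> K c" for x y
  proof -
    show x: "x \<in> crange c" and "(cinv c x, tvec_of \<A> c (cinv c x) y) \<in> K"
      using that unfolding tset_in_def tpoint_def by auto
    show "a (cinv c x) (tvec_of \<A> c (cinv c x) y) (tvec_of \<A> c (cinv c x) y) = y \<bullet> (Mc c x *v y)"
      using metric_linear[OF mf pa c, of "cinv c x" y y] cr[OF c x] by simp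
    show "b (cinv c x) (tvec_of \<A> c (cinv c x) y) = bc c x \<bullet> y"
      using form_comp_eq[OF mf ob c, of "cinv c x" y] cr[OF c x] by simp
  qed
  have krp: "0 \<le> a p w w \<and> rpow_defined (sqrt (a p w w)) (1 + m) \<and> rpow_defined (b p w) (- m)
      \<and> F (p, w) = rpow (sqrt (a p w w)) (1 + m) * rpow (b p w) (- m)" if "(p, w) \<in> K" for p w
    using kr that by (auto simp: kropina_space_def Let_def)
  show ?thesis
  proof (rule kropina_chart[where K = "tset_in \<A> K c" and f = "F \<circ> tpoint \<A> c" and D = "crange c"])
    show "CARD('n) > 2" by (rule n)
    show "open (crange c)" by (rule chart_open_range[OF atlas_chart[OF mf c]])
    show "smooth_on (crange c) (Mc c)" "smooth_on (crange c) (bc c)" by (rule metric_smooth[OF c] form_smooth[OF c])+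
    show "transpose (Mc c x) = Mc c x" "invertible (Mc c x)" "bc c x \<noteq> 0"
      "bc c x \<bullet> (matrix_inv (Mc c x) *v bc c x) = 0" if "x \<in> crange c" for x
      using metric_sym[OF c that] metric_inv[OF c that] form_nz[OF c that] form_null[OF c that] by blast+
    show "dird w (bc c) x \<bullet> y = dird y (bc c) x \<bullet> w" if "x \<in> crange c" for x w y
      by (rule form_closed[OF c that])
    show "open (tset_in \<A> K c)" by (rule Kopen)
    show "smooth_on (tset_in \<A> K c) (F \<circ> tpoint \<A> c)"
      using finsler c unfolding finsler_space_def by blast
    show "invertible (fundamental_tensor (F \<circ> tpoint \<A> c) z)" if "z \<in> tset_in \<A> K c" for z
      using finsler c that unfolding finsler_space_def by blast
    show "x \<in> crange c \<and> y \<noteq> 0 \<and> 0 \<le> y \<bullet> (Mc c x *v y)" if "(x, y) \<in> tset_in \<A> K c" for x y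
    proof -
      note p = pt[OF that]
      have "tvec_of \<A> c (cinv c x) y \<noteq> (\<lambda>_. 0)" using subsetD[OF Ksub p(2)] by (simp add: slit_tangent_bundle_def)
      then have "y \<noteq> 0" using tvec_of_scale[OF mf c, of "cinv c x" 0 y] cr[OF c p(1)] by auto
      then show ?thesis using p(1) krp[OF p(2)] p(3) by simp
    qed
    show "rpow_defined (sqrt (y \<bullet> (Mc c x *v y))) (1 + m) \<and> rpow_defined (bc c x \<bullet> y) (- m)
       \<and> (F \<circ> tpoint \<A> c) (x, y) = rpow (sqrt (y \<bullet> (Mc c x *v y))) (1 + m) * rpow (bc c x \<bullet> y) (- m)"
      if "(x, y) \<in> tset_in \<A> K c" for x y
      using krp[OF pt(2)[OF that]] unfolding pt(3,4)[OF that] by (simp add: tpoint_def)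
    show "cartan_N (F \<circ> tpoint \<A> c) i j (x, y) = (\<Sum>k\<in>UNIV. \<Gamma> c x i j k * y $ k)"
      if "(x, y) \<in> tset_in \<A> K c" for x y i j
      using as c that unfolding associated_connection_def by blast
    show "(x, w c) \<in> tset_in \<A> K c" by (rule z0)
    show "m \<noteq> 0" by (rule m0)
  qed
qed

lemma connection_sym: "c \<in> \<A> \<Longrightarrow> x \<in> crange c \<Longrightarrow> \<Gamma> c x i j k = \<Gamma> c x i k j"
  using chart_weyl by blast

lemma locally_metrizable_imp_ricci_symmetric:
  assumes lm: "locally_metrizable X \<A> \<Gamma>"
  shows "ricci_symmetric \<A> \<Gamma>"
  unfolding ricci_symmetric_def
proof (intro ballI allI)
  fix c x i j assume c: "c \<in> \<A>" and x: "x \<in> crange c"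
  obtain U g where U: "openin X U" "cinv c x \<in> U" and g: "metrizable_by_on \<A> U g \<Gamma>"
    using lm cr[OF c x] unfolding locally_metrizable_def by blast
  have pg: "pseudo_riemannian_on \<A> U g" and lc: "levi_civita_on \<A> U g \<Gamma>"
    using g unfolding metrizable_by_on_def by auto
  let ?S = "coord c ` (cdom c \<inter> U)" and ?g = "metric_comp \<A> g c"
  have S: "open ?S" by (rule chart_open_image[OF atlas_chart[OF mf c] U(1)])
  have xS: "x \<in> ?S" using cr[OF c x] U(2) by force
  have SR: "?S \<subseteq> crange c" by blast
  have sg: "smooth_on ?S ?g"
    by (rule smooth_on_entries[OF S]) (use pg c in \<open>unfold pseudo_riemannian_on_def, blast\<close>)
  have sym: "transpose (?g z) = ?g z" and inv: "invertible (?g z)" if "z \<in> ?S" for z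
    using metric_comp_sym[OF mf pg c] metric_comp_invertible[OF mf pg c] that by (auto simp: transpose_def vec_eq_iff)
  have W: "weyl_at (\<Gamma> c z) ?g (\<lambda>_. 0) z" and Gs: "\<Gamma> c z i j k = \<Gamma> c z i k j" if z: "z \<in> ?S" for z i j k
  proof -
    have f: "\<Gamma> c z i j k = 1/2 * (\<Sum>l\<in>UNIV. matrix_inv (?g z) $ i $ l * chris_first ?g z l j k)" for i j k
      using lc c z unfolding levi_civita_on_def chris_first_def by blast
    note d = smooth_on_differentiable[OF sg z]
    note L = levi_civita_imp_weyl_zero[OF f sym[OF z] dird_sym_matrix[OF S z sym d] inv[OF z] d]
    show "weyl_at (\<Gamma> c z) ?g (\<lambda>_. 0) z" by (rule L(1))
    show "\<Gamma> c z i j k = \<Gamma> c z i k j" by (rule L(2))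
  qed
  have "affine_ricci (\<Gamma> c) x i j = affine_ricci (\<Gamma> c) x j i
    \<longleftrightarrow> partial i (\<lambda>z. 0) x = partial j (\<lambda>z. 0) x"
    by (rule weyl_ricci_symmetric_iff[OF S xS sg inv smooth_on_subset[OF connection_smooth[OF c] SR] Gs W]) simp_all
  moreover have "partial k (\<lambda>z. 0 :: real) x = 0" for k
    unfolding partial_def by (rule dird_has_derivative[OF has_derivative_const])
  ultimately show "affine_ricci (\<Gamma> c) x i j = affine_ricci (\<Gamma> c) x j i" by simp
qed

text \<open>All that the equivalence needs to know about an adapted chart: \<open>\<partial>\<^sub>v = - b\<^sup>\<sharp>\<close>, and
  \<open>\<partial>\<^sub>v a = \<phi>(u) du\<^sup>2\<close>.\<close>

lemma adapted_facts:
  assumes ad: "adapted_chart \<A> a b u v c \<phi>" and uv: "u \<noteq> v" and x: "x \<in> crange c"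
  shows "Mc c x *v axis v 1 = - axis u 1" "bc c x = axis u 1"
    "y \<bullet> (dird (axis v 1) (Mc c) x *v z) = \<phi> (x $ u) * y $ u * z $ u"
proof -
  have c: "c \<in> \<A>" using ad by (simp add: adapted_chart_def)
  obtain H W h where iH: "independent_of v (crange c) H"
    and W: "\<forall>i\<in>- {u, v}. smooth_on (crange c) (\<lambda>x. W x i) \<and> independent_of v (crange c) (\<lambda>x. W x i)"
    and h: "\<forall>i\<in>- {u, v}. \<forall>j\<in>- {u, v}. smooth_on (crange c) (\<lambda>x. h x i j) \<and> independent_of v (crange c) (\<lambda>x. h x i j)"
    and M: "\<forall>x\<in>crange c.
           (\<forall>i\<in>- {u, v}. \<forall>j\<in>- {u, v}. h x i j = h x j i) \<and>
           (\<forall>y :: 'n \<Rightarrow> real. (\<forall>i\<in>- {u, v}. (\<Sum>j\<in>- {u, v}. h x i j * y j) = 0) \<longrightarrow> (\<forall>j\<in>- {u, v}. y j = 0)) \<and>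
           metric_comp \<A> a c x =
                (- 2) *\<^sub>R sym_prod (axis u 1) (axis v 1)
                + (H x + \<phi> (x $ u) * x $ v) *\<^sub>R sym_prod (axis u 1) (axis u 1)
                + (\<Sum>i\<in>- {u, v}. W x i *\<^sub>R sym_prod (axis u 1) (axis i 1))
                + (\<Sum>i\<in>- {u, v}. \<Sum>j\<in>- {u, v}. h x i j *\<^sub>R sym_prod (axis i 1) (axis j 1)) \<and>
              form_comp \<A> b c x = axis u 1"
    using ad unfolding adapted_chart_def Let_def by (elim conjE exE) (rule that)
  have iW: "independent_of v (crange c) (\<lambda>x. W x i)" if "i \<in> - {u, v}" for i using W that by blast
  have ih: "independent_of v (crange c) (\<lambda>x. h x i j)" if "i \<in> - {u, v}" "j \<in> - {u, v}" for i j using h that by blast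
  have f: "metric_comp \<A> a c x =
                (- 2) *\<^sub>R sym_prod (axis u 1) (axis v 1)
                + (H x + \<phi> (x $ u) * x $ v) *\<^sub>R sym_prod (axis u 1) (axis u 1)
                + (\<Sum>i\<in>- {u, v}. W x i *\<^sub>R sym_prod (axis u 1) (axis i 1))
                + (\<Sum>i\<in>- {u, v}. \<Sum>j\<in>- {u, v}. h x i j *\<^sub>R sym_prod (axis i 1) (axis j 1)) \<and>
              form_comp \<A> b c x = axis u 1" if "x \<in> crange c" for x
    using M that by blast
  define W' where "W' x q = (if q \<in> {u, v} then 0 else W x q)" for x q
  define h' where "h' x p q = (if p \<in> {u, v} \<or> q \<in> {u, v} then 0 else h x p q)" for x p q
  have e: "Mc c x $ p $ q = - (of_bool (p = u \<and> q = v) + of_bool (p = v \<and> q = u))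
      + (H x + \<phi> (x $ u) * x $ v) * of_bool (p = u \<and> q = u)
      + 1/2 * (of_bool (p = u) * W' x q + of_bool (q = u) * W' x p) + 1/2 * (h' x p q + h' x q p)"
    if "x \<in> crange c" for x p q
    unfolding conjunct1[OF f[OF that]] adapted_matrix_entry W'_def h'_def ..
  show "bc c x = axis u 1" using f[OF x] by simp
  have "(Mc c x *v axis v 1) $ p = - axis u 1 $ p" for p
  proof -
    have "(Mc c x *v axis v 1) $ p = Mc c x $ p $ v" by (simp add: matrix_vector_mult_basis column_def)
    then show ?thesis unfolding e[OF x] using uv by (auto simp: W'_def h'_def axis_def)
  qed
  then show "Mc c x *v axis v 1 = - axis u 1" by (simp add: vec_eq_iff)
  have ent: "dird (axis v 1) (Mc c) x $ p $ q = \<phi> (x $ u) * of_bool (p = u \<and> q = u)" for p q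
  proof -
    note o = chart_open_range[OF atlas_chart[OF mf c]]
    note d = smooth_on_differentiable[OF metric_smooth[OF c] x]
    let ?T = "(\<lambda>t. x + t *\<^sub>R axis v 1) -` crange c"
    have oT: "open ?T" by (intro open_vimage o continuous_intros)
    have agree: "(x + t *\<^sub>R axis v 1) $ i = x $ i" if "i \<noteq> v" for t i using that by (simp add: axis_def)
    have "((\<lambda>t. x + t *\<^sub>R axis v 1) has_derivative (\<lambda>t. t *\<^sub>R axis v 1)) (at 0)"
      by (auto intro!: derivative_eq_intros)
    moreover have "((\<lambda>z. Mc c z $ p $ q) has_derivative (\<lambda>w. dird w (Mc c) x $ p $ q)) (at (x + 0 *\<^sub>R axis v 1))"
      using bounded_linear.has_derivative[OF bounded_linear_vec_nth
          bounded_linear.has_derivative[OF bounded_linear_vec_nth differentiable_has_derivative_dird[OF d]]] by simp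
    ultimately have 1: "((\<lambda>t. Mc c (x + t *\<^sub>R axis v 1) $ p $ q) has_derivative (\<lambda>t. dird (t *\<^sub>R axis v 1) (Mc c) x $ p $ q)) (at 0)"
      by (rule has_derivative_compose)
    have 2: "((\<lambda>t. Mc c (x + t *\<^sub>R axis v 1) $ p $ q) has_derivative (\<lambda>t. t * (\<phi> (x $ u) * of_bool (p = u \<and> q = u)))) (at 0)"
    proof (rule has_derivative_transform_within_open[OF _ oT])
      show "((\<lambda>t. Mc c x $ p $ q + t * (\<phi> (x $ u) * of_bool (p = u \<and> q = u))) has_derivative (\<lambda>t. t * (\<phi> (x $ u) * of_bool (p = u \<and> q = u)))) (at 0)"
        by (auto intro!: derivative_eq_intros)
      show "0 \<in> ?T" using x by simp
      fix t assume "t \<in> ?T"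
      then have t: "x + t *\<^sub>R axis v 1 \<in> crange c" by simp
      have ind: "k (x + t *\<^sub>R axis v 1) = k x" if "independent_of v (crange c) k" for k :: "real ^ 'n \<Rightarrow> real"
        using that t x agree unfolding independent_of_def by blast
      have "H (x + t *\<^sub>R axis v 1) = H x" by (rule ind[OF iH])
      moreover have "W' (x + t *\<^sub>R axis v 1) r = W' x r" for r
      proof (cases "r \<in> {u, v}")
        case False
        then have "W (x + t *\<^sub>R axis v 1) r = W x r" by (intro ind[OF iW]) blast
        then show ?thesis by (simp only: W'_def)
      qed (simp only: W'_def if_True)
      moreover have "h' (x + t *\<^sub>R axis v 1) r s = h' x r s" for r s
      proof (cases "r \<in> {u, v} \<or> s \<in> {u, v}")
        case False
        then have "h (x + t *\<^sub>R axis v 1) r s = h x r s" by (intro ind[OF ih]) blast+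
        then show ?thesis by (simp only: h'_def)
      qed (simp only: h'_def if_True)
      ultimately show "Mc c x $ p $ q + t * (\<phi> (x $ u) * of_bool (p = u \<and> q = u)) = Mc c (x + t *\<^sub>R axis v 1) $ p $ q"
        unfolding e[OF x] e[OF t] agree[OF uv] by (simp add: algebra_simps)
    qed
    from fun_cong[OF has_derivative_unique[OF 1 2], of 1] show ?thesis by simp
  qed
  have row: "(dird (axis v 1) (Mc c) x *v z) $ p = (if p = u then \<phi> (x $ u) * z $ u else 0)" for p
  proof -
    have "(dird (axis v 1) (Mc c) x *v z) $ p = (\<Sum>q\<in>UNIV. if q = u then (if p = u then \<phi> (x $ u) * z $ u else 0) else 0)"
      by (simp only: matrix_vector_mult_def vec_lambda_beta ent) (rule sum.cong, auto)
    then show ?thesis by simp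
  qed
  have "y \<bullet> (dird (axis v 1) (Mc c) x *v z) = (\<Sum>p\<in>UNIV. if p = u then y $ u * (\<phi> (x $ u) * z $ u) else 0)"
    unfolding inner_vec_def row by (rule sum.cong) auto
  then show "y \<bullet> (dird (axis v 1) (Mc c) x *v z) = \<phi> (x $ u) * y $ u * z $ u" by simp
qed

text \<open>The connection has to be compared with the Levi-Civita connection in all charts \<open>c'\<close> of the
  atlas. Computing the Hessian of \<open>u\<close> in \<open>c'\<close> in two ways determines \<open>\<kappa>\<close> in terms of \<open>\<phi>\<close>, and the
  conformal factor is chosen to remove the Weyl form. An open \<open>U\<close> inside the chart is admitted
  because an antiderivative of \<open>\<phi>\<close> is in general only at hand locally.\<close>

lemma adapted_metrizable:
  assumes ad: "adapted_chart \<A> a b u v c \<phi>" and uv: "u \<noteq> v"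
    and U: "openin X U" "U \<subseteq> cdom c"
    and \<Phi>: "\<And>p. p \<in> U \<Longrightarrow> (\<Phi> has_real_derivative \<phi> (coord c p $ u)) (at (coord c p $ u))"
  shows "metrizable_by_on \<A> U (\<lambda>p w w'. exp (m / (1 - m) * \<Phi> (coord c p $ u)) * a p w w') \<Gamma>"
proof -
  define g where "g = (\<lambda>p w w'. exp (m / (1 - m) * \<Phi> (coord c p $ u)) * a p w w')"
  have c: "c \<in> \<A>" and s\<phi>: "smooth_on ((\<lambda>x. x $ u) ` crange c) \<phi>" using ad by (auto simp: adapted_chart_def)
  have UX: "U \<subseteq> topspace X" using U(1) openin_subset by blast
  let ?Q = "(\<lambda>x. x $ u) ` (coord c ` (cdom c \<inter> U))"
  have oQ: "open ?Q" by (rule open_coordinate_image[OF chart_open_image[OF atlas_chart[OF mf c] U(1)]])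
  have dQ: "(\<Phi> has_derivative (\<lambda>h. \<phi> t * h)) (at t)" if "t \<in> ?Q" for t
    using \<Phi> that by (auto simp: has_field_derivative_def)
  have s\<Phi>: "smooth_on ?Q \<Phi>"
  proof -
    have "ck k ?Q \<Phi>" for k
    proof (cases k)
      case 0
      then show ?thesis
        using continuous_at_imp_continuous_on[of ?Q \<Phi>] has_derivative_continuous[OF dQ] by simp
    next
      case (Suc j)
      have "smooth_on ?Q \<phi>" by (rule smooth_on_subset[OF s\<phi>]) blast
      then have "ck j ?Q (\<lambda>t. \<phi> t * h)" for h
        by (intro ck_mult[OF oQ] ck_const[OF oQ]) (simp add: smooth_on_iff_ck)
      then show ?thesis unfolding Suc by (intro ck_SucI[OF oQ dQ])
    qed
    then show ?thesis by (simp add: smooth_on_iff_ck)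
  qed
  define E where "E c' x = exp (m / (1 - m) * \<Phi> (transition c' c x $ u))" for c' x
  have gE: "metric_comp \<A> g c' z = E c' z *\<^sub>R Mc c' z" for c' z
    by (simp add: metric_comp_def g_def E_def transition_def vec_eq_iff)
  have tr: "transition c' c z = coord c (cinv c' z)" for c' z by (simp add: transition_def)
  have oS: "open (coord c' ` (cdom c' \<inter> U))" if "c' \<in> \<A>" for c'
    by (rule chart_open_image[OF atlas_chart[OF mf that] U(1)])
  have inS: "cinv c' z \<in> U \<and> cinv c' z \<in> cdom c' \<and> cinv c' z \<in> cdom c \<and> coord c' (cinv c' z) = z \<and> z \<in> crange c'"
    if c': "c' \<in> \<A>" and z: "z \<in> coord c' ` (cdom c' \<inter> U)" for c' z
  proof -
    obtain q where q: "z = coord c' q" "q \<in> cdom c'" "q \<in> U" using z by blast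
    then have "cinv c' z = q" using cinv_coord[OF atlas_chart[OF mf c']] by simp
    then show ?thesis using q U(2) by auto
  qed
  have sT: "smooth_on (coord c' ` (cdom c' \<inter> U)) (transition c' c)" if "c' \<in> \<A>" for c'
    by (rule smooth_on_subset[OF transition_smooth[OF mf that c]]) (use U(2) in blast)
  have sE: "smooth_on (coord c' ` (cdom c' \<inter> U)) (E c')" if c': "c' \<in> \<A>" for c'
  proof -
    note o = oS[OF c']
    have "smooth_on (coord c' ` (cdom c' \<inter> U)) (\<lambda>x. \<Phi> (transition c' c x $ u))"
    proof (rule smooth_on_compose[OF o oQ s\<Phi> smooth_on_vec_nth[OF o sT[OF c']]])
      fix x assume "x \<in> coord c' ` (cdom c' \<inter> U)"
      from inS[OF c' this] show "transition c' c x $ u \<in> ?Q" unfolding tr by blast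
    qed
    then show ?thesis unfolding E_def[abs_def]
      by (intro smooth_on_exp[OF o] smooth_on_mult[OF o] smooth_on_const[OF o])
  qed
  have pg: "pseudo_riemannian_on \<A> U g"
    unfolding pseudo_riemannian_on_def
  proof (intro conjI ballI allI impI)
    fix p w1 w2 assume p: "p \<in> U" and w: "w1 \<in> tangent_space \<A> p" "w2 \<in> tangent_space \<A> p"
    have pX: "p \<in> topspace X" using p UX by blast
    show "g p w1 w2 = g p w2 w1" using pa pX w unfolding pseudo_riemannian_on_def g_def by simp
    fix w3 r s assume w3: "w3 \<in> tangent_space \<A> p"
    have "a p (\<lambda>c. r *\<^sub>R w1 c + s *\<^sub>R w2 c) w3 = r * a p w1 w3 + s * a p w2 w3"
      using pa pX w w3 unfolding pseudo_riemannian_on_def by blast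
    then show "g p (\<lambda>c. r *\<^sub>R w1 c + s *\<^sub>R w2 c) w3 = r * g p w1 w3 + s * g p w2 w3"
      by (simp add: g_def algebra_simps)
  next
    fix p w1 assume p: "p \<in> U" and w: "w1 \<in> tangent_space \<A> p" and z: "\<forall>w2\<in>tangent_space \<A> p. g p w1 w2 = 0"
    have pX: "p \<in> topspace X" using p UX by blast
    have "\<forall>w2\<in>tangent_space \<A> p. a p w1 w2 = 0" using z by (simp add: g_def)
    then show "w1 = (\<lambda>_. 0)" using pa pX w unfolding pseudo_riemannian_on_def by blast
  next
    fix c' i j assume c': "c' \<in> \<A>"
    have "smooth_on (coord c' ` (cdom c' \<inter> U)) (\<lambda>x. E c' x * Mc c' x $ i $ j)"
    proof (intro smooth_on_mult[OF oS[OF c']] sE[OF c'])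
      have "smooth_on (coord c' ` (cdom c' \<inter> U)) (Mc c')" by (rule smooth_on_subset[OF metric_smooth[OF c']]) blast
      then show "smooth_on (coord c' ` (cdom c' \<inter> U)) (\<lambda>x. Mc c' x $ i $ j)"
        by (intro smooth_on_vec_nth[OF oS[OF c']])
    qed
    then show "smooth_on (coord c' ` (cdom c' \<inter> U)) (\<lambda>x. metric_comp \<A> g c' x $ i $ j)" by (simp add: gE)
  qed
  have "levi_civita_on \<A> U g \<Gamma>"
    unfolding levi_civita_on_def
  proof (intro ballI allI)
    fix c' x i j k assume c': "c' \<in> \<A>" and x: "x \<in> coord c' ` (cdom c' \<inter> U)"
    let ?S = "coord c' ` (cdom c' \<inter> U)" and ?T = "transition c' c" and ?p = "cinv c' x"
    note o = oS[OF c'] and p = inS[OF c' x]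
    have xr: "x \<in> crange c'" using p by blast
    have Tx: "?T x = coord c ?p" by (rule tr)
    have Txr: "?T x \<in> crange c" using p unfolding tr by blast
    \<comment> \<open>The vector \<open>\<partial>\<^sub>v\<close> of the adapted chart, expressed in the chart \<open>c'\<close>.\<close>
    define \<xi> where "\<xi> = dird (axis v 1) (transition c c') (coord c ?p)"
    have \<xi>: "dird \<xi> ?T x = axis v 1"
      using transition_chain[OF mf c c' c, of ?p "axis v 1"] transition_self[OF mf c, of ?p "axis v 1"] p
      by (simp add: \<xi>_def)
    have AT: "y \<bullet> (Mc c' z *v w) = dird y ?T z \<bullet> (Mc c (?T z) *v dird w ?T z)" if "z \<in> ?S" for z y w
      using metric_comp_change[OF mf pa c' c, of "cinv c' z" y w] inS[OF c' that] UX unfolding tr by auto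
    have bT: "bc c' z \<bullet> y = dird y ?T z $ u" if z: "z \<in> ?S" for z y
    proof -
      have "?T z \<in> crange c" using inS[OF c' z] unfolding tr by blast
      then have "bc c (?T z) = axis u 1" by (rule adapted_facts(2)[OF ad uv])
      then show ?thesis
        using form_comp_change[OF mf ob c' c, of "cinv c' z" y] inS[OF c' z] unfolding tr by (simp add: inner_axis')
    qed
    note dM = smooth_on_differentiable[OF metric_smooth[OF c'] xr] and db = smooth_on_differentiable[OF form_smooth[OF c'] xr]
    have hess1: "dird y (bc c') x \<bullet> z + 1/2 * (\<xi> \<bullet> (dird y (Mc c') x *v z) + y \<bullet> (dird z (Mc c') x *v \<xi>) - y \<bullet> (dird \<xi> (Mc c') x *v z))
      = - 1/2 * (dird y ?T x \<bullet> (dird (axis v 1) (Mc c) (?T x) *v dird z ?T x))" for y z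
      by (rule hessian_of_coordinate[OF o x sT[OF c'] dM smooth_on_differentiable[OF metric_smooth[OF c] Txr] db AT bT \<xi>
            chart_open_range[OF atlas_chart[OF mf c]] Txr metric_sym[OF c] adapted_facts(1)[OF ad uv]])
    obtain \<kappa> where W: "weyl_at (\<Gamma> c' x) (Mc c') (\<lambda>w. 2 * m / (1 + m) * \<kappa> * (bc c' x \<bullet> w)) x"
      and Db: "\<And>w y. dird w (bc c') x \<bullet> y = bc c' x \<bullet> (gm (\<Gamma> c' x) w *v y) + \<kappa> * (bc c' x \<bullet> w) * (bc c' x \<bullet> y)"
      and mm: "m \<noteq> 1" "m \<noteq> -1"
      using chart_weyl[OF c' xr] by blast
    have bx: "bc c' x \<bullet> \<xi> = 0" using bT[OF x, of \<xi>] uv by (simp add: \<xi> axis_def)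
    have M\<xi>: "Mc c' x *v \<xi> = - bc c' x"
    proof -
      have "y \<bullet> (Mc c' x *v \<xi>) = y \<bullet> (- bc c' x)" for y
        unfolding AT[OF x] \<xi> adapted_facts(1)[OF ad uv Txr] using bT[OF x, of y]
        by (simp add: inner_axis inner_commute[of y])
      then show ?thesis by (metis vector_eq_ldot)
    qed
    note h2 = hessian_of_weyl[where g = "\<Gamma> c' x" and A = "Mc c'" and b = "bc c'" and x = x,
        OF connection_sym[OF c' xr] W metric_sym[OF c' xr] M\<xi> bx Db]
    let ?f = "\<phi> (?T x $ u)" and ?b = "bc c' x"
    \<comment> \<open>Both expressions are multiples of \<open>b \<otimes> b\<close>; evaluating at \<open>b\<close> itself compares the factors.\<close>
    have "\<kappa> * (1 - 2 * m / (1 + m)) * (?b \<bullet> ?b) * (?b \<bullet> ?b) = - 1/2 * (?f * (?b \<bullet> ?b) * (?b \<bullet> ?b))"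
      using hess1[of ?b ?b] h2[of ?b ?b] unfolding adapted_facts(3)[OF ad uv Txr] bT[OF x, symmetric] by simp
    then have "(\<kappa> * (1 - 2 * m / (1 + m)) + 1/2 * ?f) * ((?b \<bullet> ?b) * (?b \<bullet> ?b)) = 0" by (simp add: algebra_simps)
    then have k0: "\<kappa> * (1 - 2 * m / (1 + m)) + 1/2 * ?f = 0" using form_nz[OF c' xr] by simp
    have k: "m / (1 - m) * ?f = - (2 * m / (1 + m) * \<kappa>)"
    proof -
      have m1: "1 + m \<noteq> 0" "1 - m \<noteq> 0" using mm by auto
      have "?f = - 2 * (\<kappa> * (1 - 2 * m / (1 + m)))" using k0 by linarith
      also have "1 - 2 * m / (1 + m) = (1 - m) / (1 + m)" using m1 by (simp add: field_simps)
      finally show ?thesis using m1 by simp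
    qed
    let ?\<eta> = "\<lambda>w. m / (1 - m) * ?f * (?b \<bullet> w)"
    have W': "weyl_at (\<Gamma> c' x) (Mc c') (\<lambda>w. - ?\<eta> w) x" using W unfolding k by simp
    have dE: "(E c' has_derivative (\<lambda>w. E c' x * ?\<eta> w)) (at x)"
    proof -
      have 1: "((\<lambda>z. ?T z $ u) has_derivative (\<lambda>w. dird w ?T x $ u)) (at x)"
        by (rule bounded_linear.has_derivative[OF bounded_linear_vec_nth smooth_on_has_derivative[OF sT[OF c'] x]])
      have 2: "(\<Phi> has_real_derivative ?f) (at (?T x $ u))" using \<Phi>[of ?p] p unfolding tr by blast
      note 3 = has_derivative_mult_right[OF DERIV_compose_FDERIV[OF 2 1], of "m / (1 - m)"]
      have 4: "(E c' has_derivative (\<lambda>w. m / (1 - m) * (dird w ?T x $ u * ?f) * exp (m / (1 - m) * \<Phi> (?T x $ u)))) (at x)"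
        unfolding E_def[abs_def] by (rule DERIV_compose_FDERIV[OF DERIV_exp 3])
      show ?thesis
        by (rule has_derivative_eq_rhs[OF 4]) (simp add: fun_eq_iff E_def bT[OF x] mult_ac)
    qed
    let ?g = "metric_comp \<A> g c'"
    have gd: "(?g has_derivative (\<lambda>w. E c' x *\<^sub>R dird w (Mc c') x + (E c' x * ?\<eta> w) *\<^sub>R Mc c' x)) (at x)"
      unfolding gE[abs_def] by (rule has_derivative_scaleR[OF dE differentiable_has_derivative_dird[OF dM]])
    have Wg: "weyl_at (\<Gamma> c' x) ?g (\<lambda>_. 0) x"
      unfolding weyl_at_def
      by (intro allI weyl_rescaled[OF W' dird_has_derivative[OF gd] gE])
    have "?g differentiable (at x)" using gd unfolding differentiable_def by blast
    moreover have "transpose (?g x) = ?g x"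
      using metric_comp_sym[OF mf pg c', of ?p] p by (simp add: transpose_def vec_eq_iff)
    moreover have "invertible (?g x)" using metric_comp_invertible[OF mf pg c', of ?p] p by simp
    ultimately show "\<Gamma> c' x i j k = 1/2 * (\<Sum>l\<in>UNIV. matrix_inv (metric_comp \<A> g c' x) $ i $ l *
          (partial j (\<lambda>z. metric_comp \<A> g c' z $ l $ k) x
           + partial k (\<lambda>z. metric_comp \<A> g c' z $ l $ j) x
           - partial l (\<lambda>z. metric_comp \<A> g c' z $ j $ k) x))"
      using weyl_zero_imp_levi_civita[where g = "\<Gamma> c' x" and A = ?g and x = x, OF connection_sym[OF c' xr] Wg]
      unfolding chris_first_def by blast
  qed
  with pg show ?thesis unfolding metrizable_by_on_def g_def[symmetric] by blast
qed

lemma adapted_imp_locally_metrizable: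
  assumes ac: "\<And>p. p \<in> topspace X \<Longrightarrow> \<exists>c \<phi>. p \<in> cdom c \<and> adapted_chart \<A> a b u v c \<phi>" and uv: "u \<noteq> v"
  shows "locally_metrizable X \<A> \<Gamma>"
  unfolding locally_metrizable_def
proof
  fix p assume "p \<in> topspace X"
  then obtain c \<phi> where p: "p \<in> cdom c" and ad: "adapted_chart \<A> a b u v c \<phi>" using ac by blast
  have c: "c \<in> \<A>" and s\<phi>: "smooth_on ((\<lambda>x. x $ u) ` crange c) \<phi>" using ad by (auto simp: adapted_chart_def)
  define x where "x = coord c p"
  have x: "x \<in> crange c" using p by (simp add: x_def)
  obtain r where r: "0 < r" "ball x r \<subseteq> crange c"
    using chart_open_range[OF atlas_chart[OF mf c]] x open_contains_ball by blast
  let ?I = "{x $ u - r/2..x $ u + r/2}"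
  have I: "?I \<subseteq> (\<lambda>x. x $ u) ` crange c"
  proof
    fix t assume t: "t \<in> ?I"
    let ?y = "x + (t - x $ u) *\<^sub>R axis u 1"
    have "norm ((t - x $ u) *\<^sub>R axis u 1 :: real ^ 'n) < r" using t r(1) by (auto simp: abs_le_iff)
    then have "?y \<in> ball x r" by (simp add: dist_norm)
    moreover have "t = ?y $ u" by simp
    ultimately show "t \<in> (\<lambda>x. x $ u) ` crange c" using r(2) by blast
  qed
  have "continuous_on ?I \<phi>" by (rule continuous_on_subset[OF smooth_on_continuous_on[OF s\<phi>] I])
  then obtain \<Phi> where \<Phi>: "\<And>t. t \<in> ?I \<Longrightarrow> (\<Phi> has_vector_derivative \<phi> t) (at t within ?I)"
    using antiderivative_continuous by blast
  define U where "U = {q \<in> cdom c. coord c q \<in> ball x (r/2)}"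
  have U: "openin X U" unfolding U_def by (rule chart_openin_vimage[OF atlas_chart[OF mf c] open_ball])
  have UI: "coord c q $ u \<in> interior ?I" if "q \<in> U" for q
  proof -
    have "norm (coord c q - x) < r/2" using that by (simp add: U_def dist_norm norm_minus_commute)
    then have "\<bar>(coord c q - x) $ u\<bar> < r/2" using component_le_norm_cart[of "coord c q - x" u] by simp
    then have "x $ u - r/2 < coord c q $ u" "coord c q $ u < x $ u + r/2"
      unfolding vector_minus_component by linarith+
    then show ?thesis by simp
  qed
  have "(\<Phi> has_real_derivative \<phi> (coord c q $ u)) (at (coord c q $ u))" if "q \<in> U" for q
    using \<Phi>[OF subsetD[OF interior_subset UI[OF that]]]
    unfolding at_within_interior[OF UI[OF that]] has_real_derivative_iff_has_vector_derivative .
  from adapted_metrizable[OF ad uv U _ this]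
  have "metrizable_by_on \<A> U (\<lambda>p w w'. exp (m / (1 - m) * \<Phi> (coord c p $ u)) * a p w w') \<Gamma>"
    by (auto simp: U_def)
  moreover have "p \<in> U" using p r(1) by (simp add: U_def x_def)
  ultimately show "\<exists>U g. openin X U \<and> p \<in> U \<and> metrizable_by_on \<A> U g \<Gamma>" using U by blast
qed

text \<open>In the coordinates along the flow, \<open>\<partial>\<^sub>v a = - 2 (1 - \<lambda>) \<kappa> du\<^sup>2\<close> for any Ricci tensor. Its
  symmetry makes \<open>\<kappa>\<close> a function of \<open>u\<close> alone on the ball of coordinates, and then \<open>a\<close> is affine
  in \<open>v\<close> in the entry \<open>(u, u)\<close> and independent of \<open>v\<close> in all others.\<close>

lemma ricci_symmetric_imp_adapted:
  assumes rs: "ricci_symmetric \<A> \<Gamma>" and uv: "u \<noteq> v" and p: "p \<in> topspace X"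
  shows "\<exists>c \<phi>. p \<in> cdom c \<and> adapted_chart \<A> a b u v c \<phi>"
proof -
  let ?u = "axis u 1 :: real ^ 'n" and ?v = "axis v 1 :: real ^ 'n"
  obtain c0 where c0: "c0 \<in> \<A>" "p \<in> cdom c0" using atlas_cover[OF mf p] by blast
  have "coord c0 p \<in> crange c0" using c0 by simp
  then obtain c1 where c1: "c1 \<in> \<A>" "p \<in> cdom c1" and f1: "\<And>z. z \<in> crange c1 \<Longrightarrow> bc c1 z = ?u"
    using chart_with_exact_form[OF mf ob c0 form_smooth[OF c0(1)] form_closed[OF c0(1)] form_nz[OF c0(1)]] by metis
  obtain c r where c: "c \<in> \<A>" "p \<in> cdom c" and r: "0 < r" and cr: "crange c = ball 0 r"
    and bu: "\<And>z. z \<in> ball 0 r \<Longrightarrow> bc c z = ?u"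
    and Mv: "\<And>z. z \<in> ball 0 r \<Longrightarrow> Mc c z *v ?v = - ?u"
    by (rule chart_along_flow[OF mf ob pa c1 uv metric_smooth[OF c1(1)] metric_inv[OF c1(1)] f1 form_null[OF c1(1)]])
       (assumption | rule that)+
  let ?B = "ball 0 r :: (real ^ 'n) set"
  let ?M = "Mc c" and ?lam = "2 * m / (1 + m)"
  note sM = metric_smooth[OF c(1), unfolded cr] and symM = metric_sym[OF c(1), unfolded cr]
    and invM = metric_inv[OF c(1), unfolded cr] and sb = form_smooth[OF c(1), unfolded cr]
    and sG = connection_smooth[OF c(1), unfolded cr] and Gs = connection_sym[OF c(1), unfolded cr]
  note dM = smooth_on_differentiable[OF sM]
  \<comment> \<open>As \<open>b = du\<close> has constant components, \<open>\<nabla> b = \<kappa> b \<otimes> b\<close> can be solved for \<open>\<kappa>\<close>, which shows its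
    smoothness.\<close>
  define \<kappa> where "\<kappa> z = - \<Gamma> c z u u u" for z
  have s\<kappa>: "smooth_on ?B \<kappa>" unfolding \<kappa>_def[abs_def] by (rule smooth_on_uminus[OF open_ball sG])
  have db: "dird w (bc c) z = 0" if "z \<in> ?B" for w z
  proof -
    have "dird w (bc c) z = dird w (\<lambda>_. ?u) z" by (rule dird_cong[OF open_ball that bu])
    also have "\<dots> = 0" by (rule dird_has_derivative[OF has_derivative_const])
    finally show ?thesis .
  qed
  have W: "weyl_at (\<Gamma> c z) ?M (\<lambda>w. ?lam * \<kappa> z * (bc c z \<bullet> w)) z"
    and Db: "dird w (bc c) z \<bullet> y = bc c z \<bullet> (gm (\<Gamma> c z) w *v y) + \<kappa> z * (bc c z \<bullet> w) * (bc c z \<bullet> y)"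
    and mm: "m \<noteq> 1 \<and> m \<noteq> -1" if z: "z \<in> ?B" for z w y
  proof -
    have zr: "z \<in> crange c" using z by (simp only: cr)
    obtain k where k: "weyl_at (\<Gamma> c z) ?M (\<lambda>w. ?lam * k * (bc c z \<bullet> w)) z"
      "\<And>w y. dird w (bc c) z \<bullet> y = bc c z \<bullet> (gm (\<Gamma> c z) w *v y) + k * (bc c z \<bullet> w) * (bc c z \<bullet> y)"
      using chart_weyl[OF c(1) zr] by blast
    have "(gm (\<Gamma> c z) ?u *v ?u) $ u = \<Gamma> c z u u u" by (simp add: matrix_vector_mult_basis column_def gm_axis)
    then have "k = \<kappa> z"
      using k(2)[of ?u ?u] unfolding db[OF z] bu[OF z] by (simp add: inner_axis' inner_axis_axis \<kappa>_def)
    with k show "weyl_at (\<Gamma> c z) ?M (\<lambda>w. ?lam * \<kappa> z * (bc c z \<bullet> w)) z"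
      "dird w (bc c) z \<bullet> y = bc c z \<bullet> (gm (\<Gamma> c z) w *v y) + \<kappa> z * (bc c z \<bullet> w) * (bc c z \<bullet> y)" by simp_all
    show "m \<noteq> 1 \<and> m \<noteq> -1" using chart_weyl[OF c(1) zr] by blast
  qed
  have B0: "0 \<in> ?B" using r by simp
  have m1: "m \<noteq> 1" "1 + m \<noteq> 0" using mm[OF B0] by auto
  have dk: "dird (axis l 1) \<kappa> z = 0" if z: "z \<in> ?B" and l: "l \<noteq> u" for z l
  proof -
    have W': "weyl_at (\<Gamma> c z) ?M (\<lambda>w. ?lam * \<kappa> z * (?u \<bullet> w)) z" if "z \<in> ?B" for z
      using W[OF that] by (simp only: bu[OF that])
    note d\<kappa> = smooth_on_differentiable[OF s\<kappa> z]
    have th: "(\<lambda>z. ?lam * \<kappa> z * (?u \<bullet> axis k 1)) differentiable (at z)" for k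
      by (intro differentiable_mult differentiable_const d\<kappa>)
    have "(affine_ricci (\<Gamma> c) z l u = affine_ricci (\<Gamma> c) z u l)
        = (partial l (\<lambda>z. ?lam * \<kappa> z * (?u \<bullet> axis u 1)) z = partial u (\<lambda>z. ?lam * \<kappa> z * (?u \<bullet> axis l 1)) z)"
      by (rule weyl_ricci_symmetric_iff[OF open_ball z sM invM sG Gs W' th])
    moreover have "affine_ricci (\<Gamma> c) z l u = affine_ricci (\<Gamma> c) z u l"
      using rs c(1) z unfolding ricci_symmetric_def cr[symmetric] by blast
    ultimately have "partial l (\<lambda>z. ?lam * \<kappa> z * (?u \<bullet> axis u 1)) z = partial u (\<lambda>z. ?lam * \<kappa> z * (?u \<bullet> axis l 1)) z"
      by (rule iffD1)
    moreover have "partial l (\<lambda>z. ?lam * \<kappa> z * (?u \<bullet> axis u 1)) z = ?lam * dird (axis l 1) \<kappa> z"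
      unfolding partial_def inner_axis_axis
      using dird_has_derivative[OF has_derivative_mult_right[OF differentiable_has_derivative_dird[OF d\<kappa>], of ?lam]] by simp
    moreover have "partial u (\<lambda>z. ?lam * \<kappa> z * (?u \<bullet> axis l 1)) z = 0"
      unfolding partial_def using l
      by (simp add: inner_axis_axis dird_has_derivative[OF has_derivative_const])
    ultimately show ?thesis using m0 m1 by simp
  qed
  have k_const: "\<kappa> z = \<kappa> z'" if z: "z \<in> ?B" "z' \<in> ?B" "z $ u = z' $ u" for z z'
  proof -
    have seg: "z + s *\<^sub>R (z' - z) \<in> ?B" if "s \<in> {0..1}" for s
    proof -
      have "(1 - s) *\<^sub>R z + s *\<^sub>R z' \<in> ?B" by (rule convexD_alt[OF convex_ball z(1,2)]) (use that in auto)
      then show ?thesis by (simp add: algebra_simps)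
    qed
    have zz: "z + (z' - z) \<in> ?B" using z(2) by simp
    have "((\<lambda>s. dird (z' - z) \<kappa> (z + s *\<^sub>R (z' - z))) has_integral \<kappa> (z + (z' - z)) - \<kappa> z) {0..1}"
      by (rule hadamard[OF convex_ball smooth_on_differentiable[OF s\<kappa>] z(1) zz])
    then have "((\<lambda>s. 0) has_integral \<kappa> (z + (z' - z)) - \<kappa> z) {0..1::real}"
    proof (rule has_integral_eq[rotated])
      fix s :: real assume s: "s \<in> {0..1}"
      show "dird (z' - z) \<kappa> (z + s *\<^sub>R (z' - z)) = 0"
      proof (subst dird_expand[OF smooth_on_differentiable[OF s\<kappa> seg[OF s]]], rule sum.neutral, rule ballI)
        fix i
        show "((z' - z) $ i) *\<^sub>R dird (axis i 1) \<kappa> (z + s *\<^sub>R (z' - z)) = 0"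
          using dk[OF seg[OF s], of i] z(3) by (cases "i = u") simp_all
      qed
    qed
    then have "\<kappa> (z + (z' - z)) - \<kappa> z = 0" using has_integral_unique[OF _ has_integral_0] by blast
    then show ?thesis by simp
  qed
  \<comment> \<open>The ball contains the point on the axis \<open>u\<close> with the same coordinate \<open>u\<close> as any of its
    points.\<close>
  define \<phi> where "\<phi> t = - 2 * (1 - ?lam) * \<kappa> (t *\<^sub>R ?u)" for t
  have uB: "(z $ u) *\<^sub>R ?u \<in> ?B" if "z \<in> ?B" for z
    using that component_le_norm_cart[of z u] by simp
  have \<phi>: "\<phi> (z $ u) = - 2 * (1 - ?lam) * \<kappa> z" if z: "z \<in> ?B" for z
    using k_const[OF uB[OF z] z] by (simp add: \<phi>_def)
  let ?Q = "(\<lambda>x. x $ u) ` ?B"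
  have oQ: "open ?Q" by (rule open_coordinate_image[OF open_ball])
  have s\<phi>: "smooth_on ?Q \<phi>"
  proof -
    have "smooth_on ?Q (\<lambda>t. \<kappa> (t *\<^sub>R ?u))"
      by (rule smooth_on_compose[OF oQ open_ball s\<kappa> smooth_on_bounded_linear[OF oQ bounded_linear_scaleR_left]])
         (use uB in blast)
    then show ?thesis unfolding \<phi>_def[abs_def]
      by (intro smooth_on_mult[OF oQ] smooth_on_const[OF oQ])
  qed
  have Dv: "y \<bullet> (dird ?v ?M z *v w) = \<phi> (z $ u) * y $ u * w $ u" if z: "z \<in> ?B" for y z w
  proof -
    have M\<xi>: "?M z *v ?v = - bc c z" by (simp only: Mv[OF z] bu[OF z])
    have n0: "bc c z \<bullet> ?v = 0" using uv by (simp add: bu[OF z] inner_axis_axis)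
    have dv0: "dird q ?M z *v ?v = 0" for q
    proof -
      have 1: "((\<lambda>z. ?M z *v ?v) has_derivative (\<lambda>q. dird q ?M z *v ?v)) (at z)"
        by (rule bounded_linear.has_derivative[OF bounded_bilinear.bounded_linear_left[OF bounded_bilinear_matrix_vector_mult]
              differentiable_has_derivative_dird[OF dM[OF z]]])
      have 2: "((\<lambda>z. ?M z *v ?v) has_derivative (\<lambda>q. 0)) (at z)"
        by (rule has_derivative_transform_within_open[OF has_derivative_const[of "- ?u"] open_ball z]) (simp only: Mv)
      from fun_cong[OF has_derivative_unique[OF 1 2], of q] show ?thesis .
    qed
    have dv1: "?v \<bullet> (dird q ?M z *v w) = 0" for q w
      using symmetric_inner[OF dird_sym_matrix[OF open_ball z symM dM[OF z]], of ?v q w] by (simp add: dv0)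
    have dv2: "(dird q ?M z *v w) $ v = 0" for q w
      using dv1[of q w] by (simp add: inner_axis')
    note h = hessian_of_weyl[where g = "\<Gamma> c z" and A = ?M and b = "bc c" and x = z,
        OF Gs[OF z] W[OF z] symM[OF z] M\<xi> n0 Db[OF z], of y w]
    have half: "d = - 2 * t" if "- (1/2 * d) = t" for d t :: real using that by simp
    have "- (1/2 * (y \<bullet> (dird ?v ?M z *v w))) = \<kappa> z * (1 - ?lam) * y $ u * w $ u"
      using h by (simp add: db[OF z] dv0 dv1 dv2 bu[OF z] inner_axis')
    then have "y \<bullet> (dird ?v ?M z *v w) = - 2 * (\<kappa> z * (1 - ?lam) * y $ u * w $ u)"
      by (rule half)
    also have "\<dots> = - 2 * (1 - ?lam) * \<kappa> z * y $ u * w $ u" by algebra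
    finally show ?thesis unfolding \<phi>[OF z] .
  qed
  have Dve: "dird ?v ?M z $ i $ j = \<phi> (z $ u) * of_bool (i = u \<and> j = u)" if "z \<in> ?B" for z i j
  proof -
    have "axis i 1 \<bullet> (dird ?v ?M z *v axis j 1) = dird ?v ?M z $ i $ j"
      by (rule inner_axis_mult)
    moreover have "(axis i 1 :: real ^ 'n) $ u = of_bool (i = u)" "(axis j 1 :: real ^ 'n) $ u = of_bool (j = u)"
      by (simp_all add: axis_def)
    ultimately show ?thesis using Dv[OF that, of "axis i 1" "axis j 1"] by (cases "i = u"; cases "j = u"; simp)
  qed
  have inc: "?M x' $ i $ j - ?M x $ i $ j = (x' $ v - x $ v) * (\<phi> (x $ u) * of_bool (i = u \<and> j = u))"
    if x: "x \<in> ?B" "x' \<in> ?B" and ag: "\<And>i. i \<noteq> v \<Longrightarrow> x $ i = x' $ i" for x x' i j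
  proof -
    define t where "t = x' $ v - x $ v"
    have x': "x' = x + t *\<^sub>R ?v"
      using ag by (simp add: vec_eq_iff t_def axis_def)
    have seg: "x + s *\<^sub>R (t *\<^sub>R ?v) \<in> ?B" if "s \<in> {0..1}" for s
    proof -
      have "(1 - s) *\<^sub>R x + s *\<^sub>R x' \<in> ?B" by (rule convexD_alt[OF convex_ball x]) (use that in auto)
      then show ?thesis by (simp add: x' algebra_simps)
    qed
    have ed: "(\<lambda>z. ?M z $ i $ j) differentiable (at z)" if "z \<in> ?B" for z
      by (rule differentiable_component[OF differentiable_component[OF dM[OF that]]])
    have "((\<lambda>s. dird (t *\<^sub>R ?v) (\<lambda>z. ?M z $ i $ j) (x + s *\<^sub>R (t *\<^sub>R ?v))) has_integral ?M (x + t *\<^sub>R ?v) $ i $ j - ?M x $ i $ j) {0..1}"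
      by (rule hadamard[OF convex_ball ed x(1)]) (use x(2) x' in simp_all)
    then have "((\<lambda>s. t * (\<phi> (x $ u) * of_bool (i = u \<and> j = u))) has_integral ?M (x + t *\<^sub>R ?v) $ i $ j - ?M x $ i $ j) {0..1::real}"
    proof (rule has_integral_eq[rotated])
      fix s :: real assume s: "s \<in> {0..1}"
      have "dird (t *\<^sub>R ?v) (\<lambda>z. ?M z $ i $ j) (x + s *\<^sub>R (t *\<^sub>R ?v)) = t * dird ?v ?M (x + s *\<^sub>R (t *\<^sub>R ?v)) $ i $ j"
        unfolding dird_entry[OF dM[OF seg[OF s]]] linear_cmul[OF dird_linear[OF dM[OF seg[OF s]]]] by simp
      also have "\<dots> = t * (\<phi> (x $ u) * of_bool (i = u \<and> j = u))"
        unfolding Dve[OF seg[OF s]] using uv by (simp add: axis_def)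
      finally show "dird (t *\<^sub>R ?v) (\<lambda>z. ?M z $ i $ j) (x + s *\<^sub>R (t *\<^sub>R ?v)) = t * (\<phi> (x $ u) * of_bool (i = u \<and> j = u))" .
    qed
    from has_integral_unique[OF this has_integral_const_real[of "t * (\<phi> (x $ u) * of_bool (i = u \<and> j = u))" 0 1]]
    have "?M (x + t *\<^sub>R ?v) $ i $ j - ?M x $ i $ j = t * (\<phi> (x $ u) * of_bool (i = u \<and> j = u))" by simp
    then show ?thesis by (simp only: x'[symmetric] t_def[symmetric])
  qed
  have Ment: "?M x $ i $ v = - of_bool (i = u)" "?M x $ v $ i = - of_bool (i = u)" if x: "x \<in> ?B" for x i
  proof -
    have "(?M x *v ?v) $ i = ?M x $ i $ v" by (simp add: matrix_vector_mult_basis column_def)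
    moreover have "(- ?u) $ i = - of_bool (i = u)" by (simp add: axis_def)
    ultimately show 1: "?M x $ i $ v = - of_bool (i = u)" unfolding Mv[OF x] by simp
    have "?M x $ v $ i = ?M x $ i $ v"
      using arg_cong[OF symM[OF x], of "\<lambda>N. N $ i $ v"] by (simp add: transpose_def)
    then show "?M x $ v $ i = - of_bool (i = u)" using 1 by simp
  qed
  have Msym: "?M x $ i $ j = ?M x $ j $ i" if "x \<in> ?B" for x i j
    using arg_cong[OF symM[OF that], of "\<lambda>N. N $ j $ i"] by (simp add: transpose_def)
  define H where "H x = ?M x $ u $ u - \<phi> (x $ u) * x $ v" for x
  \<comment> \<open>The symmetrized products \<open>du dx\<^sup>i\<close> contribute one half of \<open>W\<close> to each of two entries.\<close>
  define W where "W x i = 2 * ?M x $ u $ i" for x i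
  define h where "h x i j = ?M x $ i $ j" for x i j
  have sx: "smooth_on ?B (\<lambda>x. x $ k)" for k
    by (rule smooth_on_bounded_linear[OF open_ball bounded_linear_vec_nth])
  have sMe: "smooth_on ?B (\<lambda>x. ?M x $ i $ j)" for i j
    by (intro smooth_on_vec_nth[OF open_ball] sM)
  have sH: "smooth_on ?B H" unfolding H_def[abs_def]
    by (intro smooth_on_diff[OF open_ball] smooth_on_mult[OF open_ball] sMe sx smooth_on_compose[OF open_ball oQ s\<phi> sx]) blast
  have iH: "independent_of v ?B H"
    unfolding independent_of_def
  proof (intro ballI impI)
    fix x x' assume x: "x \<in> ?B" "x' \<in> ?B" and ag: "\<forall>i. i \<noteq> v \<longrightarrow> x $ i = x' $ i"
    have "?M x' $ u $ u - ?M x $ u $ u = (x' $ v - x $ v) * \<phi> (x $ u)"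
      using inc[OF x, of u u] ag by simp
    moreover have "x $ u = x' $ u" using ag uv by blast
    ultimately show "H x = H x'" by (simp add: H_def algebra_simps)
  qed
  have iM: "independent_of v ?B (\<lambda>x. ?M x $ i $ j)" if "\<not> (i = u \<and> j = u)" for i j
    unfolding independent_of_def
  proof (intro ballI impI)
    fix x x' assume x: "x \<in> ?B" "x' \<in> ?B" and ag: "\<forall>i. i \<noteq> v \<longrightarrow> x $ i = x' $ i"
    have "?M x' $ i $ j - ?M x $ i $ j = 0" using inc[OF x, of i j] ag that by auto
    then show "?M x $ i $ j = ?M x' $ i $ j" by simp
  qed
  have iW: "independent_of v ?B (\<lambda>x. W x i)" if "i \<in> - {u, v}" for i
    unfolding independent_of_def
  proof (intro ballI impI)
    fix x x' assume x: "x \<in> ?B" "x' \<in> ?B" and ag: "\<forall>i. i \<noteq> v \<longrightarrow> x $ i = x' $ i"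
    have "\<not> (u = u \<and> i = u)" using that by simp
    from iM[OF this] x ag have "?M x $ u $ i = ?M x' $ u $ i" unfolding independent_of_def by blast
    then show "W x i = W x' i" by (simp only: W_def)
  qed
  have nd: "y j = 0" if x: "x \<in> ?B" and z: "\<And>i. i \<in> - {u, v} \<Longrightarrow> (\<Sum>j\<in>- {u, v}. h x i j * y j) = 0"
    and j: "j \<in> - {u, v}" for x j and y :: "'n \<Rightarrow> real"
  proof -
    define s where "s = (\<Sum>j\<in>- {u, v}. ?M x $ u $ j * y j)"
    define Y where "Y = (\<chi> k. if k = u then 0 else if k = v then s else y k)"
    have split: "(?M x *v Y) $ i = ?M x $ i $ v * s + (\<Sum>j\<in>- {u, v}. ?M x $ i $ j * y j)" for i
    proof -
      have U: "(UNIV :: 'n set) = insert u (insert v (- {u, v}))" by auto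
      have "(?M x *v Y) $ i = (\<Sum>k\<in>insert u (insert v (- {u, v})). ?M x $ i $ k * Y $ k)"
        unfolding matrix_vector_mult_def by (simp only: vec_lambda_beta U[symmetric])
      also have "\<dots> = ?M x $ i $ u * Y $ u + (?M x $ i $ v * Y $ v + (\<Sum>k\<in>- {u, v}. ?M x $ i $ k * Y $ k))"
        using uv by (subst sum.insert, simp, simp, subst sum.insert) simp_all
      also have "(\<Sum>k\<in>- {u, v}. ?M x $ i $ k * Y $ k) = (\<Sum>j\<in>- {u, v}. ?M x $ i $ j * y j)"
        by (rule sum.cong) (auto simp: Y_def)
      finally show ?thesis using uv by (simp add: Y_def)
    qed
    have "(?M x *v Y) $ i = 0" for i
    proof (cases "i = u \<or> i = v")
      case True
      then show ?thesis
      proof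
        assume "i = u"
        then show ?thesis unfolding split by (simp add: Ment[OF x] s_def)
      next
        assume iv: "i = v"
        have "(\<Sum>j\<in>- {u, v}. ?M x $ v $ j * y j) = 0"
          by (rule sum.neutral) (simp add: Ment[OF x])
        then show ?thesis unfolding split iv using uv by (simp add: Ment[OF x])
      qed
    next
      case False
      then show ?thesis using z[of i] unfolding split h_def by (simp add: Ment[OF x])
    qed
    then have "?M x *v Y = 0" by (simp add: vec_eq_iff)
    then have "matrix_inv (?M x) *v (?M x *v Y) = 0" by simp
    then have "Y = 0" by (simp add: matrix_vector_mul_assoc matrix_inv_mult(2)[OF invM[OF x]])
    from arg_cong[OF this, of "\<lambda>Y. Y $ j"] show "y j = 0" using j by (simp add: Y_def)
  qed
  have form: "?M x = (- 2) *\<^sub>R sym_prod ?u ?v + (H x + \<phi> (x $ u) * x $ v) *\<^sub>R sym_prod ?u ?u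
      + (\<Sum>i\<in>- {u, v}. W x i *\<^sub>R sym_prod ?u (axis i 1))
      + (\<Sum>i\<in>- {u, v}. \<Sum>j\<in>- {u, v}. h x i j *\<^sub>R sym_prod (axis i 1) (axis j 1))" (is "_ = ?R")
    if x: "x \<in> ?B" for x
  proof -
    have "?M x $ p $ q = ?R $ p $ q" for p q
    proof -
      consider "p = v" | "q = v" "p \<noteq> v" | "p = u" "q = u" "p \<noteq> v" | "p = u" "q \<noteq> u" "q \<noteq> v" | "p \<noteq> u" "p \<noteq> v" "q = u"
        | "p \<noteq> u" "p \<noteq> v" "q \<noteq> u" "q \<noteq> v" by blast
      then show ?thesis
      proof cases
        case 1 then show ?thesis unfolding adapted_matrix_entry using uv by (simp add: Ment[OF x])
      next
        case 2 then show ?thesis unfolding adapted_matrix_entry using uv by (simp add: Ment[OF x])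
      next
        case 3 then show ?thesis unfolding adapted_matrix_entry using uv by (simp add: H_def)
      next
        case 4 then show ?thesis unfolding adapted_matrix_entry using uv by (simp add: W_def)
      next
        case 5 then show ?thesis unfolding adapted_matrix_entry using uv Msym[OF x, of p u] by (simp add: W_def)
      next
        case 6 then show ?thesis unfolding adapted_matrix_entry using Msym[OF x, of p q] by (simp add: h_def)
      qed
    qed
    then show ?thesis by (simp add: vec_eq_iff)
  qed
  have "adapted_chart \<A> a b u v c \<phi>"
    unfolding adapted_chart_def cr Let_def
  proof (intro conjI exI[of _ H] exI[of _ W] exI[of _ h])
    show "\<forall>i\<in>- {u, v}. smooth_on ?B (\<lambda>x. W x i) \<and> independent_of v ?B (\<lambda>x. W x i)"
      using iW unfolding W_def by (auto intro!: smooth_on_mult[OF open_ball] smooth_on_const[OF open_ball] sMe)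
    show "\<forall>i\<in>- {u, v}. \<forall>j\<in>- {u, v}. smooth_on ?B (\<lambda>x. h x i j) \<and> independent_of v ?B (\<lambda>x. h x i j)"
      using iM sMe unfolding h_def by auto
    show "\<forall>x\<in>?B. (\<forall>i\<in>- {u, v}. \<forall>j\<in>- {u, v}. h x i j = h x j i) \<and>
       (\<forall>y. (\<forall>i\<in>- {u, v}. (\<Sum>j\<in>- {u, v}. h x i j * y j) = 0) \<longrightarrow> (\<forall>j\<in>- {u, v}. y j = 0)) \<and>
       ?M x = (- 2) *\<^sub>R sym_prod ?u ?v + (H x + \<phi> (x $ u) * x $ v) *\<^sub>R sym_prod ?u ?u
        + (\<Sum>i\<in>- {u, v}. W x i *\<^sub>R sym_prod ?u (axis i 1))
        + (\<Sum>i\<in>- {u, v}. \<Sum>j\<in>- {u, v}. h x i j *\<^sub>R sym_prod (axis i 1) (axis j 1)) \<and> bc c x = ?u"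
    proof (intro ballI conjI allI impI)
      fix x assume x: "x \<in> ?B"
      show "h x i j = h x j i" for i j unfolding h_def by (rule Msym[OF x])
      show "?M x = (- 2) *\<^sub>R sym_prod ?u ?v + (H x + \<phi> (x $ u) * x $ v) *\<^sub>R sym_prod ?u ?u
        + (\<Sum>i\<in>- {u, v}. W x i *\<^sub>R sym_prod ?u (axis i 1))
        + (\<Sum>i\<in>- {u, v}. \<Sum>j\<in>- {u, v}. h x i j *\<^sub>R sym_prod (axis i 1) (axis j 1))" by (rule form[OF x])
      show "bc c x = ?u" by (rule bu[OF x])
      fix y :: "'n \<Rightarrow> real" and j
      assume z: "\<forall>i\<in>- {u, v}. (\<Sum>j\<in>- {u, v}. h x i j * y j) = 0" and j: "j \<in> - {u, v}"
      show "y j = 0" by (rule nd[OF x bspec[OF z] j])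
    qed
  qed (rule c(1) s\<phi> sH iH)+
  with c(2) show ?thesis by blast
qed

end

theorem theorem5:
  fixes X :: "'p topology" and \<A> :: "('p, 'n::finite) chart set"
    and a :: "('p, 'n) metric" and b :: "('p, 'n) form" and m :: real
    and K :: "('p \<times> ('p, 'n) tvec) set" and F :: "'p \<times> ('p, 'n) tvec \<Rightarrow> real"
    and \<Gamma> :: "('p, 'n) connection" and u v :: 'n
  assumes "smooth_manifold X \<A>" and "CARD('n) > 2"
    and "pseudo_riemannian_on \<A> (topspace X) a"
    and "one_form X \<A> b" and "nowhere_vanishing X \<A> b"
    and "m \<noteq> 0"
    and "kropina_space X \<A> a b m K F" and "berwald_type \<A> K F"
    and "closed_form \<A> b" and "null_form \<A> a b"
    and "associated_connection \<A> K F \<Gamma>"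
    and "u \<noteq> v"
  shows
    "(locally_metrizable X \<A> \<Gamma> \<longleftrightarrow> ricci_symmetric \<A> \<Gamma>) \<and>
     (ricci_symmetric \<A> \<Gamma> \<longleftrightarrow>
        (\<forall>p\<in>topspace X. \<exists>c \<phi>. p \<in> cdom c \<and> adapted_chart \<A> a b u v c \<phi>)) \<and>
     ((\<forall>p\<in>topspace X. \<exists>c \<phi>. p \<in> cdom c \<and> adapted_chart \<A> a b u v c \<phi>) \<longrightarrow>
        (\<forall>c \<phi> \<Phi>. adapted_chart \<A> a b u v c \<phi> \<and>
           (\<forall>t\<in>(\<lambda>x. x $ u) ` crange c. (\<Phi> has_real_derivative \<phi> t) (at t)) \<longrightarrow>
           metrizable_by_on \<A> (cdom c)
             (\<lambda>p w w'. exp (m / (1 - m) * \<Phi> (coord c p $ u)) * a p w w') \<Gamma>))"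
proof -
  note setting = assms(1-7,9-11)
  let ?ad = "\<forall>p\<in>topspace X. \<exists>c \<phi>. p \<in> cdom c \<and> adapted_chart \<A> a b u v c \<phi>"
  have 1: "locally_metrizable X \<A> \<Gamma> \<Longrightarrow> ricci_symmetric \<A> \<Gamma>"
    by (rule locally_metrizable_imp_ricci_symmetric[OF setting])
  have 2: "ricci_symmetric \<A> \<Gamma> \<Longrightarrow> ?ad"
    using ricci_symmetric_imp_adapted[OF setting _ assms(12)] by blast
  have 3: "?ad \<Longrightarrow> locally_metrizable X \<A> \<Gamma>"
    using adapted_imp_locally_metrizable[OF setting _ assms(12)] by blast
  have 4: "metrizable_by_on \<A> (cdom c) (\<lambda>p w w'. exp (m / (1 - m) * \<Phi> (coord c p $ u)) * a p w w') \<Gamma>"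
    if ad: "adapted_chart \<A> a b u v c \<phi>"
      and \<Phi>: "\<forall>t\<in>(\<lambda>x. x $ u) ` crange c. (\<Phi> has_real_derivative \<phi> t) (at t)" for c \<phi> \<Phi>
  proof (rule adapted_metrizable[OF setting ad assms(12)])
    have "c \<in> \<A>" using ad by (simp add: adapted_chart_def)
    then show "openin X (cdom c)" by (intro chart_openin atlas_chart[OF assms(1)])
    show "(\<Phi> has_real_derivative \<phi> (coord c p $ u)) (at (coord c p $ u))" if "p \<in> cdom c" for p
      using \<Phi> that by blast
  qed simp
  show ?thesis using 1 2 3 4 by blast
qed

end
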